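(* Let $d\ge 3$, let $E\subset[1,2]$ be nonempty, and let $\beta=\dim_{\mathrm M}E$ be its upper Minkowski dimension. Let $\Delta_\beta\subset[0,1]^2$ be the closed triangle with vertices $$P_1=(0,0),\quad P_{2,\beta}=\Big(\tfrac{d-1}{d-1+\beta},\tfrac{d-1}{d-1+\beta}\Big),\quad P^{\mathrm{rad}}_{3,\beta}=\Big(\tfrac{d(d-1)}{d^2-1+\beta},\tfrac{d-1}{d^2-1+\beta}\Big).$$ Then $\overline{\mathcal T_E^{\mathrm{rad}}}=\Delta_\beta$. More precisely: (i) If $\beta<1$ and $\sup_{0<\delta<1}\delta^\beta N(E,\delta)<\infty$, then $\mathcal T_E^{\mathrm{rad}}=\Delta_\beta$. (ii) If $\beta<1$ and $\sup_{0<\delta<1}\delta^\beta N(E,\delta)=\infty$, then $\mathcal T_E^{\mathrm{rad}}=\Delta_\beta\setminus[P_{2,\beta},P^{\mathrm{rad}}_{3,\beta}]$, where $[P_{2,\beta},P^{\mathrm{rad}}_{3,\beta}]$ is the closed line segment joining the two points. (iii) If $\beta=1$, then $$\mathcal T_E^{\mathrm{rad}}=\Big\{(\tfrac1p,\tfrac1q)\in\Delta_1:\ \tfrac1p<\tfrac{d-1}{d}\ \text{ or }\ \sup_{\delta\in(0,1)}\delta\,(\log\tfrac1\delta)^{\frac qd}N(E,\delta)<\infty\Big\}.$$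
   Context: For $f\in L^1_{\mathrm{loc}}(\mathbb R^d)$ and $t>0$, $A_tf(x)$ is the average of $f$ over the sphere of radius $t$ centered at $x$ (with respect to normalized surface measure). For $E\subset[1,2]$, $M_Ef(x)=\sup_{t\in E}|A_tf(x)|$. $L^p_{\mathrm{rad}}\subset L^p(\mathbb R^d)$ is the space of radial $L^p$ functions, $f(x)=f_0(|x|)$. "$M_E:L^p_{\mathrm{rad}}\to L^q$" means there is $C<\infty$ with $\|M_Ef\|_{L^q(\mathbb R^d)}\le C\|f\|_{L^p(\mathbb R^d)}$ for all $f\in L^p_{\mathrm{rad}}$. The radial type set is $\mathcal T_E^{\mathrm{rad}}=\{(\frac1p,\frac1q)\in[0,1]^2: M_E:L^p_{\mathrm{rad}}\to L^q\}$, and the bar denotes closure. For $\delta\in(0,1)$, $N(E,\delta)$ is the minimum number of intervals of length $\delta$ required to cover $E$, and $\dim_{\mathrm M}E=\limsup_{\delta\to0}\frac{\log N(E,\delta)}{\log(1/\delta)}$. *)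

theory Defs
  imports "HOL-Analysis.Analysis" "HOL-Probability.Essential_Supremum"
begin

text \<open>The normalized surface measure on the unit sphere, defined through polar coordinates:
  the measure of a Borel set \<open>A\<close> is the proportion of the unit ball occupied by the points whose
  radial projection lies in \<open>A\<close>. The value \<open>sgn 0 = 0\<close> is immaterial, as the origin is a null set.\<close>

definition sphere_measure :: "'a::euclidean_space measure" where
  "sphere_measure = distr (uniform_measure lborel (cball 0 1)) borel sgn"

definition sphere_avg :: "real \<Rightarrow> ('a::euclidean_space \<Rightarrow> complex) \<Rightarrow> 'a \<Rightarrow> complex" where
  "sphere_avg t f x = (\<integral>y. f (x + t *\<^sub>R y) \<partial>sphere_measure)"

text \<open>A sphere over which \<open>f\<close> is not absolutely integrable contributes \<open>\<infinity>\<close> to the supremum, and not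
  the default value \<open>0\<close> of the Bochner integral. For \<open>f \<ge> 0\<close> this is the value of the average
  in \<open>[0,\<infinity>]\<close>.\<close>

definition maximal_fun :: "real set \<Rightarrow> ('a::euclidean_space \<Rightarrow> complex) \<Rightarrow> 'a \<Rightarrow> ennreal" where
  "maximal_fun E f x =
     (SUP t\<in>E. if integrable sphere_measure (\<lambda>y. f (x + t *\<^sub>R y))
               then ennreal (norm (sphere_avg t f x)) else \<infinity>)"

definition ennreal_powr :: "ennreal \<Rightarrow> real \<Rightarrow> ennreal" where
  "ennreal_powr x a = (if x = \<infinity> then \<infinity> else ennreal (enn2real x powr a))"

text \<open>The extended-valued \<open>L\<^sup>p\<close> norm, \<open>1 \<le> p \<le> \<infinity>\<close>. As for \<^const>\<open>esssup\<close>, it is \<open>\<infinity>\<close> on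
  functions that are not measurable.\<close>

definition Lp_norm :: "ennreal \<Rightarrow> ('a::euclidean_space \<Rightarrow> ennreal) \<Rightarrow> ennreal" where
  "Lp_norm p g =
     (if g \<notin> borel_measurable lebesgue then \<infinity>
      else if p = \<infinity> then esssup lebesgue g
      else ennreal_powr (\<integral>\<^sup>+x. ennreal_powr (g x) (enn2real p) \<partial>lebesgue) (1 / enn2real p))"

text \<open>Elements of \<open>L\<^sup>p\<close> are represented by Borel functions that are radial everywhere. In
  dimension at least \<open>2\<close>, changing such a representative on a null set changes none of its spherical
  averages centred at \<open>x \<noteq> 0\<close>, hence the maximal function does not depend on this choice off the
  origin.\<close>

definition radial_Lp :: "ennreal \<Rightarrow> ('a::euclidean_space \<Rightarrow> complex) set" where
  "radial_Lp p = {f \<in> borel_measurable borel.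
     (\<exists>f0. \<forall>x. f x = f0 (norm x)) \<and> Lp_norm p (\<lambda>x. ennreal (norm (f x))) < \<infinity>}"

definition maximal_bounded ::
    "'a::euclidean_space itself \<Rightarrow> real set \<Rightarrow> ennreal \<Rightarrow> ennreal \<Rightarrow> bool" where
  "maximal_bounded _ E p q \<longleftrightarrow>
     (\<exists>C::real. \<forall>f \<in> (radial_Lp p :: ('a \<Rightarrow> complex) set).
        Lp_norm q (maximal_fun E f) \<le> ennreal C * Lp_norm p (\<lambda>x. ennreal (norm (f x))))"

text \<open>The exponents range over \<open>[1,\<infinity>]\<close>, so that \<open>(1/p, 1/q)\<close> ranges over \<open>[0,1]\<^sup>2\<close>,
  with \<open>1/\<infinity> = 0\<close>.\<close>

definition radial_type_set :: "'a::euclidean_space itself \<Rightarrow> real set \<Rightarrow> (real \<times> real) set" where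
  "radial_type_set T E =
     {(enn2real (inverse p), enn2real (inverse q)) | p q.
        1 \<le> p \<and> 1 \<le> q \<and> maximal_bounded T E p q}"

text \<open>The intervals may be taken closed: passing to the closure does not change the length.\<close>

definition covering_number :: "real set \<Rightarrow> real \<Rightarrow> nat" where
  "covering_number E \<delta> =
     (LEAST n. \<exists>A. finite A \<and> card A = n \<and> E \<subseteq> (\<Union>a\<in>A. {a..a + \<delta>}))"

text \<open>For nonempty bounded \<open>E\<close> the upper limit lies in \<open>[0,1]\<close>, so the conversion to a real number
  loses nothing.\<close>

definition upper_minkowski_dim :: "real set \<Rightarrow> real" where
  "upper_minkowski_dim E =
     real_of_ereal (Limsup (at_right 0)
       (\<lambda>\<delta>. ereal (ln (real (covering_number E \<delta>)) / ln (1 / \<delta>))))"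

definition vertex_P2 :: "nat \<Rightarrow> real \<Rightarrow> real \<times> real" where
  "vertex_P2 d \<beta> = ((real d - 1) / (real d - 1 + \<beta>), (real d - 1) / (real d - 1 + \<beta>))"

definition vertex_P3_rad :: "nat \<Rightarrow> real \<Rightarrow> real \<times> real" where
  "vertex_P3_rad d \<beta> =
     (real d * (real d - 1) / ((real d)\<^sup>2 - 1 + \<beta>), (real d - 1) / ((real d)\<^sup>2 - 1 + \<beta>))"

definition type_triangle :: "nat \<Rightarrow> real \<Rightarrow> (real \<times> real) set" where
  "type_triangle d \<beta> = convex hull {(0, 0), vertex_P2 d \<beta>, vertex_P3_rad d \<beta>}"

end

theory Submission
  imports Defs "HOL-Probability.Probability_Measure" "HOL-Real_Asymp.Real_Asymp"
begin

text \<open>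
  For radial \<open>f(x) = f\<^sub>0(|x|)\<close> and \<open>r = |x|\<close>, the average \<open>A\<^sub>t f(x)\<close> is an integral of \<open>f\<^sub>0\<close> over
  \<open>|r - t| < s < r + t\<close> against an explicit kernel. For \<open>r \<le> 1/2\<close> it is dominated by the mean of
  \<open>|f\<^sub>0|\<close> over an interval of length comparable to \<open>r\<close>, which maps \<open>L\<^sup>p\<close> to \<open>L\<^sup>q\<close> exactly when
  \<open>q \<le> d p\<close>; for \<open>r \<ge> 4\<close> it is a local average, for which \<open>p \<le> q\<close> is needed. For \<open>r\<close> of size one the
  supremum over \<open>t \<in> E\<close> is comparable to \<open>\<integral> f\<^sub>0(s) s\<^sup>d\<^sup>-\<^sup>2 ds\<close> over \<open>s > dist(r, E)\<close>, a Hardy operator,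
  and as \<open>{r. dist(r, E) < \<delta>}\<close> has measure comparable to \<open>\<delta> N(E, \<delta>)\<close>, Muckenhoupt's condition
  becomes the condition on the covering numbers: a power of \<open>\<delta>\<close> when \<open>1/p > (d - 1)/d\<close>, a power of
  \<open>log (1/\<delta>)\<close> when \<open>1/p = (d - 1)/d\<close>, and nothing when \<open>1/p < (d - 1)/d\<close>. Testing on indicators of
  balls and thin shells, and on \<open>|x|\<^sup>1\<^sup>-\<^sup>d\<close> in the critical case, shows that these conditions are necessary.
\<close>

section \<open>Isometries and polar coordinates\<close>

text \<open>Boundary points of the triangle count, so every range of the radius is estimated
  directly at the given exponents and never by interpolating from interior points. In the middle
  range everything depends on the integrability at 0 of the dual weight s^(d-1-p'), with p' the
  conjugate exponent: p' = d is the threshold 1/p = (d-1)/d. The assumption d \<ge> 3 keeps the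
  exponent d-3 of the kernel nonnegative, hence the kernel is at most s/(rt).

  As E is arbitrary, the supremum is uncountable, and a non-measurable function has infinite norm by
  convention; measurability is therefore part of the claim. Continuity of an average in r is
  delicate only when the sphere passes through the origin, that is for r in E. Either a covering
  bound makes the closure of E null, or the exponent is subcritical and these spheres are harmless.

  With a = 1/p and b = 1/q the covering condition has exponent (1-d+da)/b. It equals 1-\<beta>
  exactly on the line through P2 and P3: off this side the dimension decides alone, on it the finer
  hypothesis decides for the whole segment at once. For p = 1 the bound N \<ge> 1 forces q =
  1.\<close>

lemma nn_integral_lborel_translate:
  fixes h :: "'a::euclidean_space \<Rightarrow> ennreal"
  assumes [measurable]: "h \<in> borel_measurable borel"
  shows "(\<integral>\<^sup>+x. h (x + c) \<partial>lborel) = (\<integral>\<^sup>+x. h x \<partial>lborel)"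
proof -
  have "(\<integral>\<^sup>+x. h x \<partial>lborel) = (\<integral>\<^sup>+x. h x \<partial>distr lborel borel ((+) c))"
    by (simp add: lborel_distr_plus)
  also have "\<dots> = (\<integral>\<^sup>+x. h (x + c) \<partial>lborel)"
    by (subst nn_integral_distr) (auto simp: add.commute)
  finally show ?thesis ..
qed

lemma nn_integral_lborel_reflect:
  fixes h :: "'a::euclidean_space \<Rightarrow> ennreal"
  assumes [measurable]: "h \<in> borel_measurable borel"
  shows "(\<integral>\<^sup>+x. h (c - x) \<partial>lborel) = (\<integral>\<^sup>+x. h x \<partial>lborel)"
proof -
  have "(\<integral>\<^sup>+x. h x \<partial>lborel) = (\<integral>\<^sup>+x. h x \<partial>density (distr lborel borel (\<lambda>x. c + (-1) *\<^sub>R x)) (\<lambda>_. \<bar>-1::real\<bar>^DIM('a)))"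
    by (subst lborel_affine[of "-1" c]) auto
  also have "\<dots> = (\<integral>\<^sup>+x. h (c - x) \<partial>lborel)"
    by (simp add: nn_integral_distr nn_integral_density density_1)
  finally show ?thesis ..
qed

text \<open>Uniqueness of the translation-invariant measure, with the unit ball as reference set.\<close>

lemma lborel_distr_linear_isometry:
  fixes T :: "'a::euclidean_space \<Rightarrow> 'a"
  assumes T: "linear T" and iso: "\<And>x. norm (T x) = norm x"
  shows "distr lborel borel T = lborel"
proof (rule measure_eqI)
  fix A assume "A \<in> sets (distr lborel borel T)"
  hence A[measurable]: "A \<in> sets borel" by simp
  have cT: "continuous_on UNIV T" using T by (simp add: linear_continuous_on linear_linear)
  have [measurable]: "T \<in> borel_measurable borel"
    using cT by (rule borel_measurable_continuous_onI)
  have "inj T"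
    using iso linear_injective_0[OF T] by (metis norm_eq_zero)
  hence surj: "surj T" using linear_inj_imp_surj[OF T] by blast
  define B where "B = (cball 0 1 :: 'a set)"
  have [measurable]: "B \<in> sets borel" by (simp add: B_def)
  have Bpos: "emeasure lborel B \<noteq> 0" "emeasure lborel B \<noteq> \<infinity>"
    unfolding B_def by (simp_all add: emeasure_cball less_imp_neq[symmetric])
  have TB: "(indicator B (T z) :: ennreal) = indicator B z" for z
    by (simp add: B_def iso indicator_def)
  have "emeasure (distr lborel borel T) A = (\<integral>\<^sup>+z. indicator A z \<partial>distr lborel borel T)"
    by simp
  also have "\<dots> = (\<integral>\<^sup>+z. indicator A (T z) \<partial>lborel)"
    by (rule nn_integral_distr) auto
  finally have "emeasure (distr lborel borel T) A * emeasure lborel B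
      = (\<integral>\<^sup>+z. indicator A (T z) * (\<integral>\<^sup>+y. indicator B (y + T z) \<partial>lborel) \<partial>lborel)"
    by (subst nn_integral_lborel_translate) (simp_all add: nn_integral_multc)
  also have "\<dots> = (\<integral>\<^sup>+z. \<integral>\<^sup>+y. indicator A (T z) * indicator B (y + T z) \<partial>lborel \<partial>lborel)"
    by (simp add: nn_integral_cmult)
  also have "\<dots> = (\<integral>\<^sup>+y. \<integral>\<^sup>+z. indicator A (T z) * indicator B (y + T z) \<partial>lborel \<partial>lborel)"
    by (rule lborel_pair.Fubini') measurable
  \<comment> \<open>Replacing z by z + w with \<open>T w = y\<close> moves the shift from the ball
    to A. Integrating over y first then yields the measure of A by reflection, whatever z
    is.\<close>
  also have "\<dots> = (\<integral>\<^sup>+y. \<integral>\<^sup>+z. indicator A (T z - y) * indicator B (T z) \<partial>lborel \<partial>lborel)"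
  proof (rule nn_integral_cong)
    fix y :: 'a
    obtain w where w: "T w = y" using surj by (metis surjD)
    have "(\<integral>\<^sup>+z. (indicator A (T z - y) * indicator B (T z) :: ennreal) \<partial>lborel)
      = (\<integral>\<^sup>+z. (indicator A (T (z + w) - y) * indicator B (T (z + w)) :: ennreal) \<partial>lborel)"
      by (rule nn_integral_lborel_translate[symmetric]) measurable
    also have "\<dots> = (\<integral>\<^sup>+z. indicator A (T z) * indicator B (y + T z) \<partial>lborel)"
      by (simp add: linear_add[OF T] w add.commute)
    finally show "(\<integral>\<^sup>+z. (indicator A (T z) * indicator B (y + T z) :: ennreal) \<partial>lborel)
       = (\<integral>\<^sup>+z. (indicator A (T z - y) * indicator B (T z) :: ennreal) \<partial>lborel)" ..
  qed
  also have "\<dots> = (\<integral>\<^sup>+z. \<integral>\<^sup>+y. indicator A (T z - y) * indicator B (T z) \<partial>lborel \<partial>lborel)"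
    by (rule lborel_pair.Fubini') measurable
  also have "\<dots> = (\<integral>\<^sup>+z. (\<integral>\<^sup>+y. indicator A (T z - y) \<partial>lborel) * indicator B (T z) \<partial>lborel)"
    by (simp add: nn_integral_multc)
  also have "\<dots> = emeasure lborel A * (\<integral>\<^sup>+z. indicator B z \<partial>lborel)"
    by (subst nn_integral_lborel_reflect) (simp_all add: nn_integral_cmult TB)
  also have "\<dots> = emeasure lborel A * emeasure lborel B" by simp
  finally show "emeasure (distr lborel borel T) A = emeasure lborel A"
    using Bpos by (metis mult_divide_eq_ennreal infinity_ennreal_def)
qed simp

text \<open>The reflection in the hyperplane orthogonal to b - e exchanges the two unit vectors; if
  they coincide, the identity serves.\<close>

lemma exists_linear_isometry:
  fixes b e :: "'a::euclidean_space"
  assumes "norm b = 1" "norm e = 1"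
  obtains T :: "'a \<Rightarrow> 'a" where "linear T" "\<And>x y. T x \<bullet> T y = x \<bullet> y" "T b = e"
proof (cases "b = e")
  case True
  show ?thesis by (rule that[of id]) (auto simp: True linear_id)
next
  case False
  define w where "w = b - e"
  define T where "T = (\<lambda>x. x - (2 * (x \<bullet> w) / (w \<bullet> w)) *\<^sub>R w)"
  have ww: "w \<bullet> w \<noteq> 0" using False by (simp add: w_def)
  have "b \<bullet> b = 1" "e \<bullet> e = 1" using assms by (simp_all add: norm_eq_1)
  hence bw: "2 * (b \<bullet> w) = w \<bullet> w"
    by (simp add: w_def inner_diff_left inner_diff_right inner_commute)
  show ?thesis
  proof (rule that[of T])
    show "linear T"
      by (rule linearI) (simp_all add: T_def inner_add_left algebra_simps add_divide_distrib scaleR_add_left)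
    show "T x \<bullet> T y = x \<bullet> y" for x y
    proof -
      have "T x \<bullet> T y = x \<bullet> y - 2 * (y \<bullet> w) / (w \<bullet> w) * (x \<bullet> w) - 2 * (x \<bullet> w) / (w \<bullet> w) * (y \<bullet> w)
         + (2 * (x \<bullet> w) / (w \<bullet> w)) * (2 * (y \<bullet> w) / (w \<bullet> w)) * (w \<bullet> w)"
        by (simp add: T_def inner_diff_left inner_diff_right inner_commute algebra_simps)
      thus ?thesis using ww by (simp add: field_simps)
    qed
    show "T b = e" using ww bw by (simp add: T_def w_def)
  qed
qed

text \<open>The law of a radius is determined by the volumes of its sublevel sets, since half-lines
  form an intersection-stable generator. It is applied to the norm on the whole space and to the
  distance from a coordinate axis.\<close>

lemma distr_eq_density_power:
  fixes \<phi> :: "'b \<Rightarrow> real" and c :: real and n :: nat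
  assumes [measurable]: "\<phi> \<in> borel_measurable M"
    and nonneg: "\<And>x. x \<in> space M \<Longrightarrow> 0 \<le> \<phi> x" and c: "0 \<le> c" and n: "0 < n"
    and vol: "\<And>r. 0 < r \<Longrightarrow> emeasure M {x \<in> space M. \<phi> x \<le> r} = ennreal (c * r ^ n)"
  shows "distr M borel \<phi> = density lborel (\<lambda>r. ennreal (c * n * r ^ (n - 1)) * indicator {0<..} r)"
    (is "?L = ?R")
proof -
  have vol0: "emeasure M {x \<in> space M. \<phi> x \<le> r} = ennreal (c * (max 0 r) ^ n)" for r
  proof (cases "r > 0")
    case True thus ?thesis using vol by simp
  next
    case False
    \<comment> \<open>The volume is prescribed for positive radii only. For r \<le> 0 the sublevel
      set lies in those of all small s > 0, whose measures tend to 0.\<close>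
    have "emeasure M {x \<in> space M. \<phi> x \<le> r} \<le> ennreal (c * s)" if "0 < s" "s \<le> 1" for s
    proof -
      have "emeasure M {x \<in> space M. \<phi> x \<le> r} \<le> emeasure M {x \<in> space M. \<phi> x \<le> s}"
        using that False by (intro emeasure_mono) auto
      also have "\<dots> = ennreal (c * s ^ n)" using vol that by simp
      also have "\<dots> \<le> ennreal (c * s)" using that c n
        by (intro ennreal_leI mult_left_mono) (auto simp: power_le_one_iff intro: power_decreasing[of 1 n s, simplified])
      finally show ?thesis .
    qed
    hence "\<forall>\<^sub>F s in at_right 0. emeasure M {x \<in> space M. \<phi> x \<le> r} \<le> ennreal (c * s)"
      by (intro eventually_at_right_less eventually_at_rightI[of 0 1]) auto
    moreover have "((\<lambda>s. ennreal (c * s)) \<longlongrightarrow> ennreal (c * 0)) (at_right 0)"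
      by (intro tendsto_intros)
    ultimately have "emeasure M {x \<in> space M. \<phi> x \<le> r} \<le> ennreal (c * 0)"
      by (intro tendsto_lowerbound[where F = "at_right (0::real)"]) auto
    thus ?thesis using False n by (simp add: max_def zero_power)
  qed
  have dens: "emeasure ?R {..r} = ennreal (c * (max 0 r) ^ n)" for r
  proof (cases "r > 0")
    case True
    have "emeasure ?R {..r} = (\<integral>\<^sup>+x. ennreal (c * n * x ^ (n - 1)) * indicator {0<..} x * indicator {..r} x \<partial>lborel)"
      by (subst emeasure_density) auto
    also have "\<dots> = (\<integral>\<^sup>+x. ennreal (c * n * x ^ (n - 1)) * indicator {0..r} x \<partial>lborel)"
      by (intro nn_integral_cong_AE AE_I[of _ _ "{0}"]) (auto simp: indicator_def)
    also have "\<dots> = ennreal (c * r ^ n - c * 0 ^ n)"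
      using True c by (intro nn_integral_FTC_Icc) (auto intro!: derivative_eq_intros)
    finally show ?thesis using True n by (simp add: zero_power)
  next
    case False
    have "emeasure ?R {..r} = (\<integral>\<^sup>+x. ennreal (c * n * x ^ (n - 1)) * indicator {0<..} x * indicator {..r} x \<partial>lborel)"
      by (subst emeasure_density) auto
    also have "\<dots> = (\<integral>\<^sup>+(x::real). 0 \<partial>lborel)"
      using False by (intro nn_integral_cong) (auto simp: indicator_def)
    finally show ?thesis using False n by (simp add: max_def zero_power)
  qed
  show ?thesis
  proof (rule measure_eqI_generator_eq[where E = "range (\<lambda>a. {..a})" and \<Omega> = UNIV and A = "\<lambda>i. {..real i}"])
    show "Int_stable (range (\<lambda>a::real. {..a}))"
      by (auto simp: Int_stable_def)
    show "emeasure ?L X = emeasure ?R X" if X: "X \<in> range (\<lambda>a. {..a})" for X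
    proof -
      from X obtain r where [simp]: "X = {..r}" by auto
      have "emeasure ?L X = emeasure M {x \<in> space M. \<phi> x \<le> r}"
        by (subst emeasure_distr) (auto intro!: arg_cong[where f = "emeasure M"])
      thus ?thesis using vol0 dens by simp
    qed
    show "(\<Union>i. {..real i}) = UNIV" by (auto intro: real_arch_simple)
    show "sets ?L = sigma_sets UNIV (range (\<lambda>a. {..a}))" "sets ?R = sigma_sets UNIV (range (\<lambda>a. {..a}))"
      by (simp_all add: borel_eq_atMost)
    show "emeasure ?L {..real i} \<noteq> \<infinity>" for i
    proof -
      have "emeasure ?L {..real i} = emeasure M {x \<in> space M. \<phi> x \<le> real i}"
        by (subst emeasure_distr) (auto intro!: arg_cong[where f = "emeasure M"])
      thus ?thesis using vol0 by simp
    qed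
  qed auto
qed

text \<open>Polar coordinates for radial functions; the constant, dimension times volume of the unit
  ball, is the area of the unit sphere.\<close>

lemma nn_integral_norm:
  fixes g :: "real \<Rightarrow> ennreal"
  assumes [measurable]: "g \<in> borel_measurable borel"
  shows "(\<integral>\<^sup>+x. g (norm (x::'a::euclidean_space)) \<partial>lborel) =
     ennreal (DIM('a) * unit_ball_vol DIM('a)) * (\<integral>\<^sup>+r. g r * ennreal (r ^ (DIM('a) - 1)) * indicator {0<..} r \<partial>lborel)"
proof -
  let ?c = "unit_ball_vol DIM('a)"
  have "distr (lborel :: 'a measure) borel norm
      = density lborel (\<lambda>r. ennreal (?c * DIM('a) * r ^ (DIM('a) - 1)) * indicator {0<..} r)"
  proof (rule distr_eq_density_power)
    fix r :: real assume "r > 0"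
    have "{x \<in> space lborel. norm (x::'a) \<le> r} = cball 0 r" by (auto simp: dist_norm)
    thus "emeasure lborel {x \<in> space lborel. norm (x::'a) \<le> r} = ennreal (?c * r ^ DIM('a))"
      using \<open>r > 0\<close> by (simp add: emeasure_cball)
  qed auto
  hence "(\<integral>\<^sup>+x. g (norm (x::'a)) \<partial>lborel) =
     (\<integral>\<^sup>+r. g r \<partial>density lborel (\<lambda>r. ennreal (?c * DIM('a) * r ^ (DIM('a) - 1)) * indicator {0<..} r))"
    by (subst nn_integral_distr[symmetric, of norm lborel borel]) auto
  also have "\<dots> = (\<integral>\<^sup>+r. ennreal (?c * DIM('a)) * (g r * ennreal (r ^ (DIM('a) - 1)) * indicator {0<..} r) \<partial>lborel)"
    by (subst nn_integral_density) (auto intro!: nn_integral_cong simp: indicator_def ennreal_mult' mult_ac)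
  finally show ?thesis by (simp add: nn_integral_cmult mult.commute)
qed

text \<open>Cylindrical coordinates: apart from the coordinate along b, the remaining m coordinates
  enter only through their Euclidean norm, whose law is again given by ball volumes, now in
  dimension m.\<close>

lemma nn_integral_cylinder:
  fixes H :: "real \<Rightarrow> real \<Rightarrow> ennreal" and b :: "'a::euclidean_space"
  assumes [measurable]: "case_prod H \<in> borel_measurable (borel \<Otimes>\<^sub>M borel)"
    and b: "b \<in> Basis" and m: "m = DIM('a) - 1" "0 < m"
  shows "(\<integral>\<^sup>+z. H (z \<bullet> b) (norm (z - (z \<bullet> b) *\<^sub>R b)) \<partial>lborel) =
    (\<integral>\<^sup>+y. \<integral>\<^sup>+\<rho>. H y \<rho> * (ennreal (unit_ball_vol m * m * \<rho> ^ (m - 1)) * indicator {0<..} \<rho>) \<partial>lborel \<partial>lborel)"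
proof -
  interpret product_sigma_finite "\<lambda>_::'a. lborel :: real measure" by standard
  define A where "A = Basis - {b}"
  have A: "finite A" "b \<notin> A" "insert b A = Basis" "card A = m"
    using b m by (auto simp: A_def)
  define \<phi> where "\<phi> = (\<lambda>f::'a\<Rightarrow>real. sqrt (\<Sum>i\<in>A. (f i)\<^sup>2))"
  have [measurable]: "\<phi> \<in> borel_measurable (Pi\<^sub>M A (\<lambda>_. lborel))"
    unfolding \<phi>_def by measurable
  have [measurable]: "\<phi> \<in> borel_measurable (Pi\<^sub>M Basis (\<lambda>_. lborel))"
    unfolding \<phi>_def A_def by measurable
  have inner_b: "(\<Sum>i\<in>Basis. f i *\<^sub>R i) \<bullet> b = f b" for f :: "'a \<Rightarrow> real"
    using b by simp
  have norm_b: "norm ((\<Sum>i\<in>Basis. f i *\<^sub>R i) - f b *\<^sub>R b) = \<phi> f" for f :: "'a \<Rightarrow> real"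
  proof -
    have "(\<Sum>i\<in>Basis. f i *\<^sub>R i) - f b *\<^sub>R b = (\<Sum>i\<in>A. f i *\<^sub>R i)"
      using b by (simp add: A_def sum_diff1)
    hence "(norm ((\<Sum>i\<in>Basis. f i *\<^sub>R i) - f b *\<^sub>R b))\<^sup>2 = (\<Sum>i\<in>A. (\<Sum>j\<in>A. f i * (f j * (j \<bullet> i))))"
      by (simp add: power2_norm_eq_inner inner_sum_left inner_sum_right sum_distrib_left)
    also have "\<dots> = (\<Sum>i\<in>A. (\<Sum>j\<in>A. if j = i then (f i)\<^sup>2 else 0))"
      by (intro sum.cong) (auto simp: A_def inner_Basis power2_eq_square)
    also have "\<dots> = (\<Sum>i\<in>A. (f i)\<^sup>2)" using A(1) by simp
    finally show ?thesis unfolding \<phi>_def by (metis norm_ge_zero real_sqrt_unique)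
  qed
  have law: "distr (Pi\<^sub>M A (\<lambda>_. lborel)) borel \<phi>
      = density lborel (\<lambda>r. ennreal (unit_ball_vol m * m * r ^ (m - 1)) * indicator {0<..} r)"
  proof (rule distr_eq_density_power)
    fix r :: real assume "r > 0"
    have "{x \<in> space (Pi\<^sub>M A (\<lambda>_. lborel)). \<phi> x \<le> r} = {f. sqrt (\<Sum>i\<in>A. (f i)\<^sup>2) \<le> r} \<inter> space (Pi\<^sub>M A (\<lambda>_. lborel))"
      by (auto simp: \<phi>_def)
    thus "emeasure (Pi\<^sub>M A (\<lambda>_. lborel)) {x \<in> space (Pi\<^sub>M A (\<lambda>_. lborel)). \<phi> x \<le> r} = ennreal (unit_ball_vol m * r ^ m)"
      using emeasure_cball_aux[OF A(1) \<open>r > 0\<close>] A(4) by simp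
  qed (use m in \<open>auto simp: \<phi>_def sum_nonneg\<close>)
  have "(\<integral>\<^sup>+z. H (z \<bullet> b) (norm (z - (z \<bullet> b) *\<^sub>R b)) \<partial>lborel)
     = (\<integral>\<^sup>+f. H (f b) (\<phi> f) \<partial>Pi\<^sub>M Basis (\<lambda>_. lborel))"
    by (subst lborel_eq, subst nn_integral_distr) (simp_all add: inner_b norm_b)
  also have "\<dots> = (\<integral>\<^sup>+y. \<integral>\<^sup>+f. H ((f(b := y)) b) (\<phi> (f(b := y))) \<partial>Pi\<^sub>M A (\<lambda>_. lborel) \<partial>lborel)"
    unfolding A(3)[symmetric] using A b
    by (subst product_nn_integral_insert_rev) auto
  also have "\<dots> = (\<integral>\<^sup>+y. \<integral>\<^sup>+f. H y (\<phi> f) \<partial>Pi\<^sub>M A (\<lambda>_. lborel) \<partial>lborel)"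
  proof -
    have "\<phi> (f(b := y)) = \<phi> f" for f y
      unfolding \<phi>_def using A by (intro arg_cong[where f = sqrt] sum.cong) auto
    thus ?thesis by simp
  qed
  also have "\<dots> = (\<integral>\<^sup>+y. \<integral>\<^sup>+\<rho>. H y \<rho> \<partial>distr (Pi\<^sub>M A (\<lambda>_. lborel)) borel \<phi> \<partial>lborel)"
    by (subst nn_integral_distr) auto
  also have "\<dots> = (\<integral>\<^sup>+y. \<integral>\<^sup>+\<rho>. H y \<rho> * (ennreal (unit_ball_vol m * m * \<rho> ^ (m - 1)) * indicator {0<..} \<rho>) \<partial>lborel \<partial>lborel)"
    unfolding law by (subst nn_integral_density) (auto simp: mult_ac)
  finally show ?thesis .
qed

section \<open>The surface measure and the law of its projection to an axis\<close>

lemma sets_sphere_measure [simp, measurable_cong]: "sets sphere_measure = sets borel"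
  by (simp add: sphere_measure_def)

lemma space_sphere_measure [simp]: "space sphere_measure = UNIV"
  by (simp add: sphere_measure_def)

lemma measurable_sgn [measurable]: "(sgn :: 'a::euclidean_space \<Rightarrow> 'a) \<in> borel_measurable borel"
  unfolding sgn_div_norm[abs_def] by measurable

lemma nn_integral_sphere_measure:
  fixes h :: "'a::euclidean_space \<Rightarrow> ennreal"
  assumes [measurable]: "h \<in> borel_measurable borel"
  shows "(\<integral>\<^sup>+y. h y \<partial>sphere_measure) =
    (\<integral>\<^sup>+z. h (sgn z) * indicator (cball 0 1) z \<partial>lborel) / ennreal (unit_ball_vol DIM('a))"
  unfolding sphere_measure_def
  by (subst nn_integral_distr) (auto simp: nn_integral_uniform_measure emeasure_cball)

lemma prob_space_sphere_measure: "prob_space (sphere_measure :: 'a::euclidean_space measure)"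
proof -
  interpret prob_space "uniform_measure lborel (cball 0 1 :: 'a set)"
    by (rule prob_space_uniform_measure) (auto simp: emeasure_cball ennreal_eq_0_iff not_le)
  show ?thesis unfolding sphere_measure_def by (rule prob_space_distr) simp
qed

text \<open>A linear isometry carries e to a basis vector, and the ball is described by cylindrical
  coordinates y, \<rho>. The projection of the point depends only on v = y / \<rho>, so after this
  substitution the variable \<rho> integrates out: the ball becomes \<rho> \<le> 1 / sqrt (1 + v^2),
  and integrating \<rho>^(d-1) produces the d-th power.\<close>

lemma nn_integral_sphere_projection:
  fixes g :: "real \<Rightarrow> ennreal" and e :: "'a::euclidean_space"
  assumes [measurable]: "g \<in> borel_measurable borel" and e: "norm e = 1" and d: "2 \<le> DIM('a)"
  shows "(\<integral>\<^sup>+y. g (e \<bullet> y) \<partial>sphere_measure) =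
    ennreal (unit_ball_vol (DIM('a) - 1) * (DIM('a) - 1) / (DIM('a) * unit_ball_vol DIM('a))) *
    (\<integral>\<^sup>+v. g (v / sqrt (1 + v\<^sup>2)) * ennreal ((1 / sqrt (1 + v\<^sup>2)) ^ DIM('a)) \<partial>lborel)"
proof -
  obtain b :: 'a where b: "b \<in> Basis" using nonempty_Basis by blast
  obtain T :: "'a \<Rightarrow> 'a" where T: "linear T" "\<And>x y. T x \<bullet> T y = x \<bullet> y" "T b = e"
    using exists_linear_isometry[of b e] b e by (metis norm_Basis)
  have normT: "norm (T x) = norm x" for x by (simp add: norm_eq_sqrt_inner T(2))
  have [measurable]: "T \<in> borel_measurable borel"
    using T(1) by (intro borel_measurable_continuous_onI) (simp add: linear_continuous_on linear_linear)
  have [measurable]: "cball (0::'a) 1 \<in> sets borel" by simp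
  have [measurable]: "Measurable.pred (borel \<Otimes>\<^sub>M borel) (\<lambda>x::real \<times> real. snd x \<in> {0..1 / sqrt (1 + (fst x)\<^sup>2)})"
    "Measurable.pred (borel \<Otimes>\<^sub>M borel) (\<lambda>x::real \<times> real. fst x \<in> {0..1 / sqrt (1 + (snd x)\<^sup>2)})"
    unfolding atLeastAtMost_iff by measurable
  define m where "m = DIM('a) - 1"
  have m: "0 < m" "m = DIM('a) - 1" "real m = real DIM('a) - 1" "Suc m = DIM('a)" using d by (auto simp: m_def)
  have sgnT: "sgn (T z) = T (sgn z)" for z
    by (simp add: sgn_div_norm normT linear_scale[OF T(1)])
  have "(\<integral>\<^sup>+z. g (e \<bullet> sgn z) * indicator (cball 0 1) z \<partial>lborel)
      = (\<integral>\<^sup>+z. g (e \<bullet> sgn z) * indicator (cball 0 1) z \<partial>distr lborel borel T)"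
    by (simp add: lborel_distr_linear_isometry[OF T(1) normT])
  also have "\<dots> = (\<integral>\<^sup>+z. g (T b \<bullet> sgn (T z)) * indicator (cball 0 1) (T z) \<partial>lborel)"
    unfolding T(3) by (rule nn_integral_distr) measurable
  also have "\<dots> = (\<integral>\<^sup>+z. g (b \<bullet> sgn z) * indicator (cball 0 1) z \<partial>lborel)"
    by (intro nn_integral_cong) (simp add: sgnT T(2) normT indicator_def)
  also have "\<dots> = (\<integral>\<^sup>+z. g ((z \<bullet> b) / sqrt ((z \<bullet> b)\<^sup>2 + (norm (z - (z \<bullet> b) *\<^sub>R b))\<^sup>2)) *
       indicator {..1} ((z \<bullet> b)\<^sup>2 + (norm (z - (z \<bullet> b) *\<^sub>R b))\<^sup>2) \<partial>lborel)"
  proof (rule nn_integral_cong)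
    fix z :: 'a
    have bb: "b \<bullet> b = 1" using b by simp
    have "(norm (z - (z \<bullet> b) *\<^sub>R b))\<^sup>2 = (z - (z \<bullet> b) *\<^sub>R b) \<bullet> (z - (z \<bullet> b) *\<^sub>R b)"
      by (rule power2_norm_eq_inner)
    also have "\<dots> = (norm z)\<^sup>2 - (z \<bullet> b)\<^sup>2"
      unfolding power2_norm_eq_inner
      by (simp add: inner_diff_left inner_diff_right bb inner_commute[of b z] power2_eq_square)
    finally have "(z \<bullet> b)\<^sup>2 + (norm (z - (z \<bullet> b) *\<^sub>R b))\<^sup>2 = (norm z)\<^sup>2"
      by simp
    thus "g (b \<bullet> sgn z) * indicator (cball 0 1) z = g ((z \<bullet> b) / sqrt ((z \<bullet> b)\<^sup>2 + (norm (z - (z \<bullet> b) *\<^sub>R b))\<^sup>2)) *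
       indicator {..1} ((z \<bullet> b)\<^sup>2 + (norm (z - (z \<bullet> b) *\<^sub>R b))\<^sup>2)"
      by (simp add: sgn_div_norm indicator_def inner_commute field_simps abs_square_le_1 power_le_one_iff)
  qed
  also have "\<dots> = (\<integral>\<^sup>+y. \<integral>\<^sup>+\<rho>. g (y / sqrt (y\<^sup>2 + \<rho>\<^sup>2)) * indicator {..1} (y\<^sup>2 + \<rho>\<^sup>2) *
       (ennreal (unit_ball_vol m * m * \<rho> ^ (m - 1)) * indicator {0<..} \<rho>) \<partial>lborel \<partial>lborel)"
    by (rule nn_integral_cylinder[where H = "\<lambda>y \<rho>. g (y / sqrt (y\<^sup>2 + \<rho>\<^sup>2)) * indicator {..1} (y\<^sup>2 + \<rho>\<^sup>2)", OF _ b m(2,1)]) measurable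
  \<comment> \<open>The order is exchanged so that y can be rescaled by a fixed \<rho>; after the
    substitution it is exchanged back.\<close>
  also have "\<dots> = (\<integral>\<^sup>+\<rho>. \<integral>\<^sup>+y. g (y / sqrt (y\<^sup>2 + \<rho>\<^sup>2)) * indicator {..1} (y\<^sup>2 + \<rho>\<^sup>2) *
       (ennreal (unit_ball_vol m * m * \<rho> ^ (m - 1)) * indicator {0<..} \<rho>) \<partial>lborel \<partial>lborel)"
    by (rule lborel_pair.Fubini') measurable
  also have "\<dots> = (\<integral>\<^sup>+\<rho>. \<integral>\<^sup>+v. g (v / sqrt (1 + v\<^sup>2)) *
       (ennreal (unit_ball_vol m * m * \<rho> ^ m) * indicator {0..1 / sqrt (1 + v\<^sup>2)} \<rho>) \<partial>lborel \<partial>lborel)"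
  proof (rule nn_integral_cong)
    fix \<rho> :: real
    show "(\<integral>\<^sup>+y. g (y / sqrt (y\<^sup>2 + \<rho>\<^sup>2)) * indicator {..1} (y\<^sup>2 + \<rho>\<^sup>2) *
       (ennreal (unit_ball_vol m * m * \<rho> ^ (m - 1)) * indicator {0<..} \<rho>) \<partial>lborel) =
      (\<integral>\<^sup>+v. g (v / sqrt (1 + v\<^sup>2)) *
       (ennreal (unit_ball_vol m * m * \<rho> ^ m) * indicator {0..1 / sqrt (1 + v\<^sup>2)} \<rho>) \<partial>lborel)"
    proof (cases "\<rho> > 0")
      case True
      have eq: "g (\<rho> * v / sqrt ((\<rho> * v)\<^sup>2 + \<rho>\<^sup>2)) * indicator {..1} ((\<rho> * v)\<^sup>2 + \<rho>\<^sup>2) *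
        (ennreal (unit_ball_vol m * m * \<rho> ^ (m - 1)) * indicator {0<..} \<rho>) * ennreal \<rho> =
        g (v / sqrt (1 + v\<^sup>2)) * (ennreal (unit_ball_vol m * m * \<rho> ^ m) * indicator {0..1 / sqrt (1 + v\<^sup>2)} \<rho>)" for v
      proof -
        have s: "sqrt ((\<rho> * v)\<^sup>2 + \<rho>\<^sup>2) = \<rho> * sqrt (1 + v\<^sup>2)"
        proof -
          have "(\<rho> * v)\<^sup>2 + \<rho>\<^sup>2 = \<rho>\<^sup>2 * (1 + v\<^sup>2)" by (simp add: power_mult_distrib algebra_simps)
          thus ?thesis using True by (simp add: real_sqrt_mult)
        qed
        have pos: "sqrt (1 + v\<^sup>2) > 0" by (simp add: add_pos_nonneg)
        have "(\<rho> * v)\<^sup>2 + \<rho>\<^sup>2 \<le> 1 \<longleftrightarrow> \<rho> * sqrt (1 + v\<^sup>2) \<le> 1"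
          using s by (metis real_sqrt_le_1_iff)
        also have "\<dots> \<longleftrightarrow> \<rho> \<le> 1 / sqrt (1 + v\<^sup>2)" using pos by (simp add: field_simps)
        finally have i: "indicator {..1} ((\<rho> * v)\<^sup>2 + \<rho>\<^sup>2) = (indicator {0..1 / sqrt (1 + v\<^sup>2)} \<rho> :: ennreal)"
          using True by (simp add: indicator_def)
        have q: "\<rho> * v / (\<rho> * sqrt (1 + v\<^sup>2)) = v / sqrt (1 + v\<^sup>2)" using True by simp
        have "unit_ball_vol m * m * \<rho> ^ m = unit_ball_vol m * m * \<rho> ^ (m - 1) * \<rho>"
          using m(1) by (cases m) auto
        hence "ennreal (unit_ball_vol m * m * \<rho> ^ m) = ennreal (unit_ball_vol m * m * \<rho> ^ (m - 1)) * ennreal \<rho>"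
          using True by (metis ennreal_mult'' less_imp_le)
        thus ?thesis using True by (simp add: s i q mult_ac)
      qed
      define F where "F = (\<lambda>y. g (y / sqrt (y\<^sup>2 + \<rho>\<^sup>2)) * indicator {..1} (y\<^sup>2 + \<rho>\<^sup>2) *
        (ennreal (unit_ball_vol m * m * \<rho> ^ (m - 1)) * indicator {0<..} \<rho>))"
      have [measurable]: "F \<in> borel_measurable borel" unfolding F_def by measurable
      have "(\<integral>\<^sup>+y. F y \<partial>lborel) = ennreal \<rho> * (\<integral>\<^sup>+v. F (\<rho> * v) \<partial>lborel)"
        using True by (subst nn_integral_real_affine[of F \<rho> 0]) auto
      also have "\<dots> = (\<integral>\<^sup>+v. F (\<rho> * v) * ennreal \<rho> \<partial>lborel)"
        by (subst nn_integral_multc) (auto simp: mult.commute)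
      finally show ?thesis unfolding F_def eq .
    next
      case False
      have "g (v / sqrt (1 + v\<^sup>2)) *
       (ennreal (unit_ball_vol m * m * \<rho> ^ m) * indicator {0..1 / sqrt (1 + v\<^sup>2)} \<rho>) = 0" for v
        using False m(1) by (cases "\<rho> = 0") (auto simp: indicator_def zero_power)
      hence "(\<integral>\<^sup>+v. g (v / sqrt (1 + v\<^sup>2)) *
       (ennreal (unit_ball_vol m * m * \<rho> ^ m) * indicator {0..1 / sqrt (1 + v\<^sup>2)} \<rho>) \<partial>lborel) = 0"
        by (simp only: nn_integral_0_iff_AE nn_integral_const) simp
      thus ?thesis using False by (simp add: indicator_def)
    qed
  qed
  also have "\<dots> = (\<integral>\<^sup>+v. \<integral>\<^sup>+\<rho>. g (v / sqrt (1 + v\<^sup>2)) *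
       (ennreal (unit_ball_vol m * m * \<rho> ^ m) * indicator {0..1 / sqrt (1 + v\<^sup>2)} \<rho>) \<partial>lborel \<partial>lborel)"
    by (rule lborel_pair.Fubini') measurable
  also have "\<dots> = (\<integral>\<^sup>+v. g (v / sqrt (1 + v\<^sup>2)) * ennreal (unit_ball_vol m * m / DIM('a) * (1 / sqrt (1 + v\<^sup>2)) ^ DIM('a)) \<partial>lborel)"
  proof (rule nn_integral_cong)
    fix v :: real
    have der: "((\<lambda>\<rho>. c / Suc m * \<rho> ^ Suc m) has_real_derivative c * \<rho> ^ m) (at \<rho>)" for c \<rho> :: real
      by (rule derivative_eq_intros refl)+ (simp del: of_nat_Suc)
    have "(\<integral>\<^sup>+\<rho>. ennreal (unit_ball_vol m * m * \<rho> ^ m) * indicator {0..1 / sqrt (1 + v\<^sup>2)} \<rho> \<partial>lborel)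
      = ennreal (unit_ball_vol m * m / Suc m * (1 / sqrt (1 + v\<^sup>2)) ^ Suc m - unit_ball_vol m * m / Suc m * 0 ^ Suc m)"
      by (rule nn_integral_FTC_Icc) (use der in \<open>auto simp del: of_nat_Suc power_Suc\<close>)
    thus "(\<integral>\<^sup>+\<rho>. g (v / sqrt (1 + v\<^sup>2)) * (ennreal (unit_ball_vol m * m * \<rho> ^ m) * indicator {0..1 / sqrt (1 + v\<^sup>2)} \<rho>) \<partial>lborel)
      = g (v / sqrt (1 + v\<^sup>2)) * ennreal (unit_ball_vol m * m / DIM('a) * (1 / sqrt (1 + v\<^sup>2)) ^ DIM('a))"
      unfolding m(4) by (simp add: nn_integral_cmult zero_power)
  qed
  also have "\<dots> = ennreal (unit_ball_vol m * m / DIM('a)) *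
     (\<integral>\<^sup>+v. g (v / sqrt (1 + v\<^sup>2)) * ennreal ((1 / sqrt (1 + v\<^sup>2)) ^ DIM('a)) \<partial>lborel)"
  proof (subst nn_integral_cmult[symmetric])
    have "ennreal (unit_ball_vol m * m / DIM('a) * (1 / sqrt (1 + v\<^sup>2)) ^ DIM('a))
      = ennreal (unit_ball_vol m * m / DIM('a)) * ennreal ((1 / sqrt (1 + v\<^sup>2)) ^ DIM('a))" for v :: real
      by (rule ennreal_mult') auto
    thus "(\<integral>\<^sup>+v. g (v / sqrt (1 + v\<^sup>2)) * ennreal (unit_ball_vol m * m / DIM('a) * (1 / sqrt (1 + v\<^sup>2)) ^ DIM('a)) \<partial>lborel)
      = (\<integral>\<^sup>+v. ennreal (unit_ball_vol m * m / DIM('a)) * (g (v / sqrt (1 + v\<^sup>2)) * ennreal ((1 / sqrt (1 + v\<^sup>2)) ^ DIM('a))) \<partial>lborel)"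
      by (simp only: mult.left_commute)
  qed measurable
  finally have "(\<integral>\<^sup>+y. g (e \<bullet> y) \<partial>sphere_measure) = ennreal (unit_ball_vol m * m / DIM('a)) *
     (\<integral>\<^sup>+v. g (v / sqrt (1 + v\<^sup>2)) * ennreal ((1 / sqrt (1 + v\<^sup>2)) ^ DIM('a)) \<partial>lborel) / ennreal (unit_ball_vol DIM('a))"
    by (subst nn_integral_sphere_measure) auto
  also have "\<dots> = ennreal (unit_ball_vol m * m / DIM('a)) / ennreal (unit_ball_vol DIM('a)) *
     (\<integral>\<^sup>+v. g (v / sqrt (1 + v\<^sup>2)) * ennreal ((1 / sqrt (1 + v\<^sup>2)) ^ DIM('a)) \<partial>lborel)"
    by (simp only: divide_ennreal_def mult_ac)
  also have "ennreal (unit_ball_vol m * m / DIM('a)) / ennreal (unit_ball_vol DIM('a))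
     = ennreal (unit_ball_vol m * m / (DIM('a) * unit_ball_vol DIM('a)))"
    by (subst divide_ennreal) auto
  finally show ?thesis unfolding m(3) by simp
qed

section \<open>Averages of radial functions over spheres\<close>

lemma AE_sphere_measure_norm: "AE y in (sphere_measure :: 'a::euclidean_space measure). norm y = 1"
proof -
  have "AE z::'a in uniform_measure lborel (cball 0 1). norm (sgn z) = 1"
    by (rule AE_uniform_measureI)
       (auto simp: norm_sgn intro!: AE_I[of _ _ "{0}"])
  thus ?thesis unfolding sphere_measure_def by (subst AE_distr_iff) auto
qed

text \<open>With s^2 = r^2 + t^2 + 2 r t u, the inner quotient is u, the cosine from the law of
  cosines up to sign. The first factor is du/ds, and the second is (1 - u^2)^((d-3)/2), the
  unnormalized density of one coordinate of a uniform point of the sphere.\<close>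

definition radial_kernel :: "nat \<Rightarrow> real \<Rightarrow> real \<Rightarrow> real \<Rightarrow> real" where
  "radial_kernel d r t s = s / (r * t) * sqrt (1 - ((s\<^sup>2 - r\<^sup>2 - t\<^sup>2) / (2 * r * t))\<^sup>2) ^ (d - 3)"

text \<open>The area of the unit sphere of dimension d - 2 divided by that of the unit sphere of
  dimension d - 1.\<close>

definition sphere_const :: "nat \<Rightarrow> real" where
  "sphere_const d = unit_ball_vol (real d - 1) * (real d - 1) / (real d * unit_ball_vol (real d))"

lemma sphere_const_pos: "2 \<le> d \<Longrightarrow> 0 < sphere_const d"
  by (simp add: sphere_const_def)

lemma radial_kernel_measurable [measurable]: "radial_kernel d r t \<in> borel_measurable borel"
  unfolding radial_kernel_def[abs_def] by measurable

text \<open>The hypotheses say that r, t, s are the sides of a nondegenerate triangle, so the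
  quotient is the cosine of a proper angle up to sign.\<close>

lemma projection_less_one:
  fixes r t s :: real
  assumes r: "0 < r" and t: "0 < t" and s: "\<bar>r - t\<bar> < s" "s < r + t"
  shows "\<bar>(s\<^sup>2 - r\<^sup>2 - t\<^sup>2) / (2 * r * t)\<bar> < 1"
proof -
  have "\<bar>r - t\<bar>\<^sup>2 < s\<^sup>2" "s\<^sup>2 < (r + t)\<^sup>2"
    using s power_strict_mono[of "\<bar>r - t\<bar>" s 2] power_strict_mono[of s "r + t" 2] by auto
  hence "\<bar>s\<^sup>2 - r\<^sup>2 - t\<^sup>2\<bar> < 2 * r * t" by (simp add: power2_diff power2_sum abs_less_iff)
  thus ?thesis using r t by (simp add: abs_mult)
qed

text \<open>The variable \<open>v\<close> parametrizes the projection \<open>u = v / \<surd>(1 + v\<^sup>2)\<close> of a point of the unit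
  sphere to the axis, and \<open>s\<close> is the distance \<open>\<surd>(r\<^sup>2 + t\<^sup>2 + 2 r t u)\<close> to the origin.\<close>

lemma nn_integral_projection_substitution:
  fixes g :: "real \<Rightarrow> ennreal"
  assumes [measurable]: "g \<in> borel_measurable borel" and r: "0 < r" and t: "0 < t" and d: "3 \<le> d"
  shows "(\<integral>\<^sup>+v. g (sqrt (r\<^sup>2 + t\<^sup>2 + 2 * r * t * (v / sqrt (1 + v\<^sup>2)))) * ennreal ((1 / sqrt (1 + v\<^sup>2)) ^ d) \<partial>lborel) =
    (\<integral>\<^sup>+s. g s * (ennreal (radial_kernel d r t s) * indicator {\<bar>r - t\<bar><..<r + t} s) \<partial>lborel)"
proof -
  define w where "w = (\<lambda>v::real. 1 / sqrt (1 + v\<^sup>2))"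
  define S where "S = (\<lambda>v. sqrt (r\<^sup>2 + t\<^sup>2 + 2 * r * t * (v / sqrt (1 + v\<^sup>2))))"
  define S' where "S' = (\<lambda>v. r * t * w v ^ 3 / S v)"
  define J where "J = {\<bar>r - t\<bar><..<r + t}"
  have pos: "1 + v\<^sup>2 > 0" for v :: real by (simp add: add_pos_nonneg)
  have wpos: "w v > 0" for v by (simp add: w_def pos)
  have u2: "1 - (v / sqrt (1 + v\<^sup>2))\<^sup>2 = (w v)\<^sup>2" for v
    using pos[of v] by (simp add: w_def power_divide field_simps)
  have u1: "\<bar>v / sqrt (1 + v\<^sup>2)\<bar> < 1" for v
  proof -
    have "(w v)\<^sup>2 > 0" using wpos[of v] by simp
    hence "(v / sqrt (1 + v\<^sup>2))\<^sup>2 < 1" using u2[of v] by linarith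
    thus ?thesis using abs_square_less_1 by blast
  qed
  have Sarg: "(r - t)\<^sup>2 < r\<^sup>2 + t\<^sup>2 + 2 * r * t * (v / sqrt (1 + v\<^sup>2))"
             "r\<^sup>2 + t\<^sup>2 + 2 * r * t * (v / sqrt (1 + v\<^sup>2)) < (r + t)\<^sup>2" for v
  proof -
    have a: "-1 < v / sqrt (1 + v\<^sup>2)" "v / sqrt (1 + v\<^sup>2) < 1" using u1[of v] by linarith+
    have "2 * r * t * (-1) < 2 * r * t * (v / sqrt (1 + v\<^sup>2))"
      using r t a(1) by (intro mult_strict_left_mono) auto
    thus "(r - t)\<^sup>2 < r\<^sup>2 + t\<^sup>2 + 2 * r * t * (v / sqrt (1 + v\<^sup>2))" by (simp add: power2_diff)
    have "2 * r * t * (v / sqrt (1 + v\<^sup>2)) < 2 * r * t * 1"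
      using r t a(2) by (intro mult_strict_left_mono) auto
    thus "r\<^sup>2 + t\<^sup>2 + 2 * r * t * (v / sqrt (1 + v\<^sup>2)) < (r + t)\<^sup>2" by (simp add: power2_sum)
  qed
  have S2: "(S v)\<^sup>2 = r\<^sup>2 + t\<^sup>2 + 2 * r * t * (v / sqrt (1 + v\<^sup>2))" for v
    unfolding S_def using Sarg(1)[of v] by (intro real_sqrt_pow2) (meson less_le order_trans zero_le_power2)
  have SJ: "S v \<in> J" for v
  proof -
    have a: "\<bar>r - t\<bar>\<^sup>2 < (S v)\<^sup>2" "(S v)\<^sup>2 < (r + t)\<^sup>2" using Sarg[of v] S2[of v] by simp_all
    have "0 \<le> r\<^sup>2 + t\<^sup>2 + 2 * r * t * (v / sqrt (1 + v\<^sup>2))"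
      using Sarg(1)[of v] by (rule order_trans[OF zero_le_power2 less_imp_le])
    hence "0 \<le> S v" unfolding S_def by (rule real_sqrt_ge_zero)
    hence "\<bar>r - t\<bar> < S v" "S v < r + t"
      using power2_less_imp_less[OF a(1)] power2_less_imp_less[OF a(2)] r t by simp_all
    thus ?thesis by (simp add: J_def)
  qed
  have Spos: "S v > 0" for v
    using SJ[of v] abs_ge_zero[of "r - t"] unfolding J_def greaterThanLessThan_iff by linarith
  have cS: "continuous_on A S" for A
    unfolding S_def using pos by (auto intro!: continuous_intros simp: less_imp_neq[symmetric])
  have [measurable]: "S \<in> borel_measurable borel"
    using cS by (rule borel_measurable_continuous_onI)
  have [measurable]: "w \<in> borel_measurable borel" unfolding w_def by measurable
  \<comment> \<open>The Jacobian identity: the kernel contributes d - 3 factors \<open>w v\<close>,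
    the derivative of S the remaining three, and the factors \<open>S v / (r * t)\<close>
    cancel.\<close>
  have kS: "radial_kernel d r t (S v) * S' v = w v ^ d" for v
  proof -
    have "((S v)\<^sup>2 - r\<^sup>2 - t\<^sup>2) / (2 * r * t) = v / sqrt (1 + v\<^sup>2)" using r t by (simp add: S2)
    hence "radial_kernel d r t (S v) = S v / (r * t) * sqrt (1 - (v / sqrt (1 + v\<^sup>2))\<^sup>2) ^ (d - 3)"
      unfolding radial_kernel_def by metis
    also have "\<dots> = S v / (r * t) * w v ^ (d - 3)" unfolding u2 using wpos[of v] by simp
    finally have "radial_kernel d r t (S v) * S' v = w v ^ (d - 3) * w v ^ 3"
      using r t Spos[of v] by (simp add: S'_def)
    also have "\<dots> = w v ^ d" using d by (simp flip: power_add)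
    finally show ?thesis .
  qed
  have dS: "(S has_real_derivative S' v) (at v)" for v
  proof -
    have sq: "(sqrt (1 + v\<^sup>2))\<^sup>2 = 1 + v\<^sup>2" using pos[of v] by simp
    have d1: "((\<lambda>v. v / sqrt (1 + v\<^sup>2)) has_real_derivative (w v ^ 3)) (at v)"
      using pos[of v] sq
      by (auto intro!: derivative_eq_intros simp: w_def field_simps power2_eq_square power3_eq_cube)
    have "((\<lambda>v. r\<^sup>2 + t\<^sup>2 + 2 * r * t * (v / sqrt (1 + v\<^sup>2))) has_real_derivative 2 * r * t * w v ^ 3) (at v)"
      by (rule derivative_eq_intros d1 refl)+ simp
    moreover have "0 < r\<^sup>2 + t\<^sup>2 + 2 * r * t * (v / sqrt (1 + v\<^sup>2))"
      using Sarg(1)[of v] by (rule le_less_trans[OF zero_le_power2])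
    ultimately have "(S has_real_derivative (inverse (S v) / 2 * (2 * r * t * w v ^ 3))) (at v)"
      unfolding S_def by (intro DERIV_chain2[OF DERIV_real_sqrt])
    thus ?thesis by (simp add: S'_def field_simps)
  qed
  have cS': "continuous_on A S'" for A
    unfolding S'_def w_def using Spos pos
    by (auto intro!: continuous_intros cS simp: less_imp_neq[symmetric])
  have S'nn: "S' v \<ge> 0" for v using r t Spos[of v] wpos[of v] by (simp add: S'_def)
  have monoS: "S a \<le> S b" if "a \<le> b" for a b
    by (rule deriv_nonneg_imp_mono[of a b S S']) (use dS S'nn that in auto)
  have [measurable]: "J \<in> sets borel" by (simp add: J_def)
  have UJ: "(\<Union>n::nat. {S (- real n)..S (real n)}) = J"
  proof (intro equalityI subsetI)
    fix s assume "s \<in> (\<Union>n::nat. {S (- real n)..S (real n)})"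
    then obtain n :: nat where "S (- real n) \<le> s" "s \<le> S (real n)" by auto
    thus "s \<in> J" using SJ[of "- real n"] SJ[of "real n"] unfolding J_def by auto
  next
    fix s assume s: "s \<in> J"
    define u where "u = (s\<^sup>2 - r\<^sup>2 - t\<^sup>2) / (2 * r * t)"
    have "\<bar>u\<bar> < 1" unfolding u_def using s r t by (intro projection_less_one) (auto simp: J_def)
    hence u: "u\<^sup>2 < 1" using abs_square_less_1 by blast
    define v where "v = u / sqrt (1 - u\<^sup>2)"
    have "1 + v\<^sup>2 = 1 / (1 - u\<^sup>2)" using u by (simp add: v_def power_divide field_simps)
    hence "v / sqrt (1 + v\<^sup>2) = u" using u by (simp add: v_def real_sqrt_divide)
    hence "(S v)\<^sup>2 = s\<^sup>2" using r t by (simp add: S2 u_def)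
    hence Sv: "S v = s" using Spos[of v] s unfolding J_def by (auto simp: power2_eq_iff)
    obtain n :: nat where n: "\<bar>v\<bar> \<le> real n" using real_arch_simple by blast
    hence "S (- real n) \<le> s" "s \<le> S (real n)" using monoS Sv by (auto simp: abs_le_iff)
    thus "s \<in> (\<Union>n::nat. {S (- real n)..S (real n)})" by auto
  qed
  have "distr (density lborel (\<lambda>v. ennreal (w v ^ d))) borel S
      = density lborel (\<lambda>s. ennreal (radial_kernel d r t s) * indicator J s)" (is "?L = ?R")
  proof (rule measure_eqI)
    fix A assume "A \<in> sets ?L"
    hence A[measurable]: "A \<in> sets borel" by simp
    have UI: "(\<Union>n::nat. {- real n..real n}) = UNIV"
    proof -
      have "\<exists>n::nat. - real n \<le> x \<and> x \<le> real n" for x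
        proof -
        obtain n :: nat where "\<bar>x\<bar> \<le> real n" using real_arch_simple by blast
        thus ?thesis by (intro exI[of _ n]) (simp add: abs_le_iff)
      qed
      thus ?thesis by auto
    qed
    have JJ: "s \<in> J" if "S (- real n) \<le> s" "s \<le> S (real n)" for s and n :: nat
      using that UJ by auto
    \<comment> \<open>Substitution is available on compact intervals. The two measures are therefore
      compared on the images of [-n, n] under the increasing map S, and these exhaust J.\<close>
    have *: "emeasure (density lborel (\<lambda>s. ennreal (radial_kernel d r t s) * indicator J s)) (A \<inter> {S (- real n)..S (real n)})
        = emeasure (density lborel (\<lambda>v. ennreal (w v ^ d))) (S -` A \<inter> {- real n..real n})" for n
    proof -
      have "emeasure ?R (A \<inter> {S (- real n)..S (real n)}) =
         (\<integral>\<^sup>+s. ennreal ((radial_kernel d r t s * indicator A s) * indicator {S (- real n)..S (real n)} s) \<partial>lborel)"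
        using JJ by (subst emeasure_density) (auto intro!: nn_integral_cong simp: indicator_def)
      also have "\<dots> = (\<integral>\<^sup>+v. ennreal ((radial_kernel d r t (S v) * indicator A (S v)) * S' v * indicator {- real n..real n} v) \<partial>lborel)"
        by (rule nn_integral_substitution) (auto simp: dS cS' S'nn set_borel_measurable_def)
      also have "\<dots> = emeasure (density lborel (\<lambda>v. ennreal (w v ^ d))) (S -` A \<inter> {- real n..real n})"
        by (subst emeasure_density) (auto intro!: nn_integral_cong simp: indicator_def kS)
      finally show ?thesis .
    qed
    have i1: "incseq (\<lambda>n. A \<inter> {S (- real n)..S (real n)})"
    proof (rule incseq_SucI)
      fix n show "A \<inter> {S (- real n)..S (real n)} \<le> A \<inter> {S (- real (Suc n))..S (real (Suc n))}"
        using monoS[of "- real (Suc n)" "- real n"] monoS[of "real n" "real (Suc n)"] by auto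
    qed
    have i2: "incseq (\<lambda>n. S -` A \<inter> {- real n..real n})" by (rule incseq_SucI) auto
    have "emeasure ?L A = emeasure (density lborel (\<lambda>v. ennreal (w v ^ d))) (S -` A \<inter> (\<Union>n. {- real n..real n}))"
      by (subst emeasure_distr) (auto simp: UI)
    also have "\<dots> = (SUP n. emeasure (density lborel (\<lambda>v. ennreal (w v ^ d))) (S -` A \<inter> {- real n..real n}))"
    proof -
      have "range (\<lambda>n. S -` A \<inter> {- real n..real n}) \<subseteq> sets borel"
        using measurable_sets_borel[of S borel A] by auto
      thus ?thesis
        using SUP_emeasure_incseq[OF _ i2, of "density lborel (\<lambda>v. ennreal (w v ^ d))"]
        by (simp only: Int_UN_distrib sets_density sets_lborel)
    qed
    also have "\<dots> = (SUP n. emeasure ?R (A \<inter> {S (- real n)..S (real n)}))"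
      by (simp add: *)
    also have "\<dots> = emeasure ?R (A \<inter> J)"
    proof -
      have "range (\<lambda>n. A \<inter> {S (- real n)..S (real n)}) \<subseteq> sets borel" by auto
      thus ?thesis
        using SUP_emeasure_incseq[OF _ i1, of ?R]
        by (simp only: UJ[symmetric] Int_UN_distrib sets_density sets_lborel)
    qed
    also have "\<dots> = emeasure ?R A"
      by (subst (1 2) emeasure_density) (auto intro!: nn_integral_cong simp: indicator_def J_def)
    finally show "emeasure ?L A = emeasure ?R A" .
  qed simp
  hence "integral\<^sup>N ?L g = integral\<^sup>N ?R g" by (rule arg_cong)
  moreover have "integral\<^sup>N ?L g = (\<integral>\<^sup>+v. g (S v) * ennreal (w v ^ d) \<partial>lborel)"
    by (subst nn_integral_distr) (auto simp: nn_integral_density mult.commute)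
  moreover have "integral\<^sup>N ?R g = (\<integral>\<^sup>+s. g s * (ennreal (radial_kernel d r t s) * indicator J s) \<partial>lborel)"
    by (subst nn_integral_density) (auto simp: J_def mult_ac)
  ultimately show ?thesis unfolding S_def w_def J_def by simp
qed

text \<open>On the unit sphere |x + t y|^2 depends on y only through the projection of y to the
  direction of x, so the average becomes one-dimensional.\<close>

theorem nn_integral_sphere_radial:
  fixes g :: "real \<Rightarrow> ennreal" and x :: "'a::euclidean_space"
  assumes [measurable]: "g \<in> borel_measurable borel" and x: "x \<noteq> 0" and t: "0 < t" and d: "3 \<le> DIM('a)"
  shows "(\<integral>\<^sup>+y. g (norm (x + t *\<^sub>R y)) \<partial>sphere_measure) = ennreal (sphere_const DIM('a)) *
    (\<integral>\<^sup>+s. g s * (ennreal (radial_kernel DIM('a) (norm x) t s) * indicator {\<bar>norm x - t\<bar><..<norm x + t} s) \<partial>lborel)"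
proof -
  define e where "e = x /\<^sub>R norm x"
  have e: "norm e = 1" using x by (simp add: e_def)
  have xe: "x = norm x *\<^sub>R e" using x by (simp add: e_def)
  have "(\<integral>\<^sup>+y. g (norm (x + t *\<^sub>R y)) \<partial>sphere_measure)
     = (\<integral>\<^sup>+y. g (sqrt ((norm x)\<^sup>2 + t\<^sup>2 + 2 * norm x * t * (e \<bullet> y))) \<partial>sphere_measure)"
  proof (rule nn_integral_cong_AE)
    show "AE y in sphere_measure. g (norm (x + t *\<^sub>R y)) = g (sqrt ((norm x)\<^sup>2 + t\<^sup>2 + 2 * norm x * t * (e \<bullet> y)))"
      using AE_sphere_measure_norm
    proof eventually_elim
      case (elim y)
      hence yy: "y \<bullet> y = 1" by (simp add: norm_eq_1)
      have "(norm (x + t *\<^sub>R y))\<^sup>2 = x \<bullet> x + t\<^sup>2 * (y \<bullet> y) + 2 * t * (x \<bullet> y)"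
        by (simp only: power2_norm_eq_inner) (simp add: inner_add_left inner_add_right inner_commute power2_eq_square)
      also have "x \<bullet> y = norm x * (e \<bullet> y)" by (subst xe) simp
      finally have "(norm (x + t *\<^sub>R y))\<^sup>2 = (norm x)\<^sup>2 + t\<^sup>2 + 2 * norm x * t * (e \<bullet> y)"
        by (simp add: yy power2_norm_eq_inner)
      thus ?case by (metis norm_ge_zero real_sqrt_unique)
    qed
  qed
  also have "\<dots> = ennreal (sphere_const DIM('a)) *
    (\<integral>\<^sup>+v. g (sqrt ((norm x)\<^sup>2 + t\<^sup>2 + 2 * norm x * t * (v / sqrt (1 + v\<^sup>2)))) * ennreal ((1 / sqrt (1 + v\<^sup>2)) ^ DIM('a)) \<partial>lborel)"
    using d e by (subst nn_integral_sphere_projection) (auto simp: sphere_const_def)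
  also have "(\<integral>\<^sup>+v. g (sqrt ((norm x)\<^sup>2 + t\<^sup>2 + 2 * norm x * t * (v / sqrt (1 + v\<^sup>2)))) * ennreal ((1 / sqrt (1 + v\<^sup>2)) ^ DIM('a)) \<partial>lborel)
    = (\<integral>\<^sup>+s. g s * (ennreal (radial_kernel DIM('a) (norm x) t s) * indicator {\<bar>norm x - t\<bar><..<norm x + t} s) \<partial>lborel)"
    using x t d by (intro nn_integral_projection_substitution) auto
  finally show ?thesis .
qed

section \<open>Powers and integral inequalities in the extended half-line\<close>

lemma ennreal_powr_ennreal [simp]: "0 \<le> x \<Longrightarrow> ennreal_powr (ennreal x) a = ennreal (x powr a)"
  by (simp add: ennreal_powr_def)

lemma ennreal_powr_zero [simp]: "ennreal_powr 0 a = 0"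
  by (simp add: ennreal_powr_def)

lemma ennreal_powr_top [simp]: "ennreal_powr top a = top"
  by (simp add: ennreal_powr_def)

lemma ennreal_powr_one [simp]: "ennreal_powr x 1 = x"
  by (cases x) auto

lemma ennreal_powr_one_left [simp]: "ennreal_powr 1 a = 1"
  using ennreal_powr_ennreal[of 1 a] by simp

lemma ennreal_powr_mono: "x \<le> y \<Longrightarrow> 0 \<le> a \<Longrightarrow> ennreal_powr x a \<le> ennreal_powr y a"
  by (cases x; cases y) (auto intro!: ennreal_leI powr_mono2 simp: top_unique)

lemma ennreal_powr_mult: "0 < a \<Longrightarrow> ennreal_powr (x * y) a = ennreal_powr x a * ennreal_powr y a"
proof (cases "x = top \<or> y = top")
  case True
  assume a: "0 < a"
  have pos: "ennreal_powr z a \<noteq> 0" if "z \<noteq> 0" for z using that by (cases z) (auto simp: ennreal_eq_0_iff)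
  show ?thesis
  proof (cases "x = 0 \<or> y = 0")
    case False
    thus ?thesis using True pos[of x] pos[of y] by (auto simp: ennreal_mult_eq_top_iff ennreal_top_mult ennreal_mult_top)
  qed auto
next
  case False
  thus "0 < a \<Longrightarrow> ?thesis"
    by (cases x; cases y) (auto simp: powr_mult simp flip: ennreal_mult)
qed

lemma ennreal_powr_add: "0 < a \<Longrightarrow> 0 \<le> b \<Longrightarrow> ennreal_powr x (a + b) = ennreal_powr x a * ennreal_powr x b"
  by (cases x) (auto simp: powr_add ennreal_mult_top simp flip: ennreal_mult)

lemma ennreal_powr_powr: "ennreal_powr (ennreal_powr x a) b = ennreal_powr x (a * b)"
  by (cases x) (auto simp: powr_powr)

lemma ennreal_powr_measurable [measurable]:
  assumes [measurable]: "f \<in> borel_measurable M"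
  shows "(\<lambda>x. ennreal_powr (f x) a) \<in> borel_measurable M"
  unfolding ennreal_powr_def by measurable

text \<open>Young's inequality for x / A and y / B, multiplied by A B. The weights are arranged so
  that integral bounds \<open>A powr p\<close> and \<open>B powr p'\<close> add up to A B (1/p +
  1/p') = A B.\<close>

lemma Young_ennreal:
  fixes x y :: ennreal
  assumes p: "1 < p" and p': "p' = p / (p - 1)" and A: "0 < A" and B: "0 < B"
  shows "x * y \<le> ennreal (A * B / p / A powr p) * ennreal_powr x p +
      ennreal (A * B / p' / B powr p') * ennreal_powr y p'"
proof -
  have p'1: "1 < p'" using p by (simp add: p' field_simps)
  have c: "ennreal (A * B / p / A powr p) \<noteq> 0" "ennreal (A * B / p' / B powr p') \<noteq> 0"
    using p p'1 A B by (simp_all add: ennreal_eq_0_iff not_le)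
  show ?thesis
  proof (cases "x = top \<or> y = top")
    case True
    thus ?thesis using c by (auto simp: ennreal_mult_top)
  next
    case False
    then obtain a b where ab: "x = ennreal a" "0 \<le> a" "y = ennreal b" "0 \<le> b"
      by (cases x; cases y) auto
    have "(a / A) * (b / B) \<le> (a / A) powr p / p + (b / B) powr p' / p'"
      using ab p p'1 A B by (intro Youngs_inequality) (auto simp: p' field_simps)
    hence "(A * B) * ((a / A) * (b / B)) \<le> (A * B) * ((a / A) powr p / p + (b / B) powr p' / p')"
      using A B by (intro mult_left_mono) auto
    hence "a * b \<le> A * B / p / A powr p * a powr p + A * B / p' / B powr p' * b powr p'"
      using A B ab by (simp add: powr_divide field_simps)
    thus ?thesis using ab A B p p'1
      by (simp add: ennreal_mult'[symmetric] ennreal_plus[symmetric] del: ennreal_plus)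
  qed
qed

text \<open>A and B are positive bounds for the two norms and not the norms themselves, so a
  vanishing norm needs no separate treatment.\<close>

lemma nn_integral_Hoelder:
  fixes F H :: "'b \<Rightarrow> ennreal"
  assumes [measurable]: "F \<in> borel_measurable M" "H \<in> borel_measurable M"
    and p: "1 < p" and p': "p' = p / (p - 1)" and A: "0 < A" and B: "0 < B"
    and F: "(\<integral>\<^sup>+x. ennreal_powr (F x) p \<partial>M) \<le> ennreal (A powr p)"
    and H: "(\<integral>\<^sup>+x. ennreal_powr (H x) p' \<partial>M) \<le> ennreal (B powr p')"
  shows "(\<integral>\<^sup>+x. F x * H x \<partial>M) \<le> ennreal (A * B)"
proof -
  have p'1: "1 < p'" using p by (simp add: p' field_simps)
  have "(\<integral>\<^sup>+x. F x * H x \<partial>M) \<le> (\<integral>\<^sup>+x. ennreal (A * B / p / A powr p) * ennreal_powr (F x) p +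
      ennreal (A * B / p' / B powr p') * ennreal_powr (H x) p' \<partial>M)"
    by (intro nn_integral_mono Young_ennreal[OF p p' A B])
  also have "\<dots> = ennreal (A * B / p / A powr p) * (\<integral>\<^sup>+x. ennreal_powr (F x) p \<partial>M) +
      ennreal (A * B / p' / B powr p') * (\<integral>\<^sup>+x. ennreal_powr (H x) p' \<partial>M)"
    by (simp add: nn_integral_add nn_integral_cmult)
  also have "\<dots> \<le> ennreal (A * B / p / A powr p) * ennreal (A powr p) +
      ennreal (A * B / p' / B powr p') * ennreal (B powr p')"
    by (intro add_mono mult_left_mono F H) auto
  also have "\<dots> = ennreal (A * B / p + A * B / p')"
    using p p'1 A B by (simp add: ennreal_mult'[symmetric] ennreal_plus[symmetric] del: ennreal_plus)
  also have "A * B / p + A * B / p' = A * B" using p by (simp add: p' field_simps)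
  finally show ?thesis .
qed

text \<open>Three cases for the integral of F^p: if it is infinite there is nothing to show; if it
  is 0, then F vanishes almost everywhere; otherwise its p-th root serves as A.\<close>

lemma nn_integral_Hoelder_powr:
  fixes F H :: "'b \<Rightarrow> ennreal"
  assumes [measurable]: "F \<in> borel_measurable M" "H \<in> borel_measurable M"
    and p: "1 < p" and p': "p' = p / (p - 1)" and B: "0 < B"
    and H: "(\<integral>\<^sup>+x. ennreal_powr (H x) p' \<partial>M) \<le> ennreal (B powr p')"
  shows "ennreal_powr (\<integral>\<^sup>+x. F x * H x \<partial>M) p \<le> ennreal (B powr p) * (\<integral>\<^sup>+x. ennreal_powr (F x) p \<partial>M)"
proof (cases "\<integral>\<^sup>+x. ennreal_powr (F x) p \<partial>M")
  case top
  thus ?thesis using B by (simp add: ennreal_mult_top)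
next
  case (real a)
  have "ennreal_powr (\<integral>\<^sup>+x. F x * H x \<partial>M) p \<le> ennreal (B powr p) * ennreal a"
  proof (cases "a = 0")
    case True
    have "AE x in M. ennreal_powr (F x) p = 0"
      using real True nn_integral_0_iff_AE[of "\<lambda>x. ennreal_powr (F x) p" M] by simp
    hence "AE x in M. F x = 0"
    proof eventually_elim
      case (elim x)
      thus ?case by (cases "F x") (auto simp: ennreal_eq_0_iff)
    qed
    hence "(\<integral>\<^sup>+x. F x * H x \<partial>M) = (\<integral>\<^sup>+x. 0 \<partial>M)"
      by (intro nn_integral_cong_AE) (auto elim: eventually_mono)
    thus ?thesis by simp
  next
    case False
    with real have a: "a > 0" by simp
    have "(\<integral>\<^sup>+x. F x * H x \<partial>M) \<le> ennreal (a powr (1 / p) * B)"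
      by (rule nn_integral_Hoelder[OF _ _ p p' _ B _ H]) (use a p real in \<open>auto simp: powr_powr\<close>)
    hence "ennreal_powr (\<integral>\<^sup>+x. F x * H x \<partial>M) p \<le> ennreal_powr (ennreal (a powr (1 / p) * B)) p"
      using p by (intro ennreal_powr_mono) auto
    also have "\<dots> = ennreal (B powr p) * ennreal a"
      using a p B by (simp add: powr_mult powr_powr ennreal_mult'[symmetric] mult.commute)
    finally show ?thesis .
  qed
  thus ?thesis using real by simp
qed

text \<open>The integrand may be singular at 0, so (0, s] is exhausted by [1/(n+1), s]. The
  nonnegative boundary term at the left end is simply dropped, hence an inequality.\<close>

lemma nn_integral_FTC_from_0_le:
  fixes f F :: "real \<Rightarrow> real"
  assumes [measurable]: "f \<in> borel_measurable borel"
    and der: "\<And>x. 0 < x \<Longrightarrow> x \<le> s \<Longrightarrow> (F has_real_derivative f x) (at x)"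
    and f: "\<And>x. 0 < x \<Longrightarrow> x \<le> s \<Longrightarrow> 0 \<le> f x"
    and F: "\<And>x. 0 < x \<Longrightarrow> x \<le> s \<Longrightarrow> 0 \<le> F x"
  shows "(\<integral>\<^sup>+x. ennreal (f x) * indicator {0<..s} x \<partial>lborel) \<le> ennreal (F s)"
proof -
  define A where "A = (\<lambda>n. {1 / real (Suc n)..s})"
  have UA: "(\<Union>n. A n) = {0<..s}"
  proof (intro equalityI subsetI)
    fix x assume "x \<in> {0<..s}"
    moreover from this obtain n where "inverse (real (Suc n)) < x"
      using reals_Archimedean by auto
    ultimately show "x \<in> (\<Union>n. A n)" by (auto simp: A_def inverse_eq_divide intro!: exI[of _ n])
  qed (auto simp: A_def intro: less_le_trans[rotated])
  have inc: "incseq A"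
  proof (rule incseq_SucI)
    fix n
    have "1 / real (Suc (Suc n)) \<le> 1 / real (Suc n)" by (intro divide_left_mono) auto
    thus "A n \<le> A (Suc n)" by (auto simp: A_def)
  qed
  let ?M = "density lborel (\<lambda>x. ennreal (f x))"
  have "(\<integral>\<^sup>+x. ennreal (f x) * indicator {0<..s} x \<partial>lborel) = emeasure ?M (\<Union>n. A n)"
    unfolding UA by (subst emeasure_density) auto
  also have "\<dots> = (SUP n. emeasure ?M (A n))"
    by (rule SUP_emeasure_incseq[symmetric]) (use inc in \<open>auto simp: A_def[abs_def]\<close>)
  also have "\<dots> \<le> ennreal (F s)"
  proof (rule SUP_least)
    fix n
    show "emeasure ?M (A n) \<le> ennreal (F s)"
    proof (cases "1 / real (Suc n) \<le> s")
      case True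
      have pos: "0 < 1 / real (Suc n)" by simp
      have "emeasure ?M (A n) = (\<integral>\<^sup>+x. ennreal (f x) * indicator {1 / real (Suc n)..s} x \<partial>lborel)"
        by (subst emeasure_density) (auto simp: A_def)
      also have "\<dots> = ennreal (F s - F (1 / real (Suc n)))"
        using True less_le_trans[OF pos] by (intro nn_integral_FTC_Icc der f) auto
      also have "\<dots> \<le> ennreal (F s)" using F[OF pos True] by (intro ennreal_leI) simp
      finally show ?thesis .
    qed (simp add: A_def)
  qed
  finally show ?thesis .
qed

lemma nn_integral_powr_from_0:
  fixes a c :: real
  assumes "-1 < a" "0 \<le> c"
  shows "(\<integral>\<^sup>+x. ennreal (x powr a) * indicator {0..c} x \<partial>lborel) = ennreal (c powr (a + 1) / (a + 1))"
proof -
  have "(\<integral>\<^sup>+x. ennreal (indicator {0..c} x * x powr a) \<partial>lborel) = ennreal (c powr (a + 1) / (a + 1))"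
    by (rule nn_integral_has_integral_lebesgue[OF _ has_integral_powr_from_0[OF assms]]) auto
  thus ?thesis by (simp add: ennreal_mult' ennreal_indicator mult.commute)
qed

text \<open>For finite y this is the integral of p l^(p-1) from 0 to y. For infinite y the integral
  exceeds every integer n, because n \<le> n^p.\<close>

lemma ennreal_powr_le_layer_cake:
  assumes p: "1 \<le> p"
  shows "ennreal_powr y p \<le> (\<integral>\<^sup>+l. ennreal (p * l powr (p - 1)) * indicator {l. 0 < l \<and> ennreal l < y} l \<partial>lborel)"
    (is "_ \<le> ?I y")
proof -
  have eq: "?I (ennreal c) = ennreal (c powr p)" if "0 \<le> c" for c
  proof -
    have "?I (ennreal c) = (\<integral>\<^sup>+l. ennreal p * (ennreal (l powr (p - 1)) * indicator {0..c} l) \<partial>lborel)"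
      using p that
      by (intro nn_integral_cong_AE AE_I[of _ _ "{0, c}"])
         (auto simp: indicator_def ennreal_mult' ennreal_less_iff emeasure_lborel_countable)
    also have "\<dots> = ennreal p * ennreal (c powr (p - 1 + 1) / (p - 1 + 1))"
      using p that by (subst nn_integral_cmult) (auto simp: nn_integral_powr_from_0)
    also have "\<dots> = ennreal (c powr p)" using p by (simp add: ennreal_mult'[symmetric])
    finally show ?thesis .
  qed
  show ?thesis
  proof (cases y)
    case (real c)
    thus ?thesis using eq[of c] by simp
  next
    case top
    have "ennreal (real n) \<le> ?I y" for n
    proof (cases "n = 0")
      case False
      have "real n \<le> real n powr p" using powr_mono[of 1 p "real n"] p False by simp
      hence "ennreal (real n) \<le> ?I (ennreal (real n))" by (subst eq) (auto intro: ennreal_leI)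
      also have "\<dots> \<le> ?I y" using top
        by (intro nn_integral_mono mult_left_mono) (auto simp: indicator_def)
      finally show ?thesis .
    qed simp
    hence "?I y = top"
      by (metis ennreal_Ex_less_of_nat ennreal_of_nat_eq_real_of_nat linorder_not_less top.not_eq_extremum)
    thus ?thesis by simp
  qed
qed

section \<open>Kernel estimates and the weak-type inequality\<close>

text \<open>Heron's formula: the left side is the squared sine of the angle between the sides r and
  t, the numerator on the right is 16 times the squared area.\<close>

lemma radial_kernel_arg:
  fixes r t s :: real
  assumes r: "0 < r" and t: "0 < t"
  shows "1 - ((s\<^sup>2 - r\<^sup>2 - t\<^sup>2) / (2 * r * t))\<^sup>2 = ((r + t)\<^sup>2 - s\<^sup>2) * (s\<^sup>2 - (r - t)\<^sup>2) / (2 * r * t)\<^sup>2"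
proof -
  have "(2 * r * t)\<^sup>2 - (s\<^sup>2 - r\<^sup>2 - t\<^sup>2)\<^sup>2 = ((r + t)\<^sup>2 - s\<^sup>2) * (s\<^sup>2 - (r - t)\<^sup>2)"
    by (simp add: power2_eq_square algebra_simps)
  moreover have "2 * r * t \<noteq> 0" using r t by simp
  ultimately show ?thesis by (simp add: power_divide diff_divide_distrib[symmetric] field_simps)
qed

lemma radial_kernel_bounds:
  assumes r: "0 < r" and t: "0 < t" and s: "\<bar>r - t\<bar> < s" "s < r + t"
  shows "0 \<le> radial_kernel d r t s" and "radial_kernel d r t s \<le> s / (r * t)"
proof -
  define X where "X = 1 - ((s\<^sup>2 - r\<^sup>2 - t\<^sup>2) / (2 * r * t))\<^sup>2"
  have X: "0 \<le> X" "X \<le> 1"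
    using projection_less_one[OF r t s] abs_square_le_1[of "(s\<^sup>2 - r\<^sup>2 - t\<^sup>2) / (2 * r * t)"] by (simp_all add: X_def)
  have s0: "0 < s" using s abs_ge_zero[of "r - t"] by linarith
  have k: "radial_kernel d r t s = s / (r * t) * sqrt X ^ (d - 3)" by (simp add: radial_kernel_def X_def)
  show "0 \<le> radial_kernel d r t s" using k X s0 r t by simp
  have "sqrt X ^ (d - 3) \<le> 1" using X by (intro power_le_one) auto
  hence "s / (r * t) * sqrt X ^ (d - 3) \<le> s / (r * t) * 1"
    using s0 r t by (intro mult_left_mono) auto
  thus "radial_kernel d r t s \<le> s / (r * t)" using k by simp
qed

text \<open>For r of size one the sine is at most 6 s: the area formula has a factor at most s^2,
  while r + t \<le> 6 and 2 r t \<ge> 1. Its power d - 3 and the factor s / (r t) \<le> 2 s make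
  s^(d-2).\<close>

lemma radial_kernel_le_power:
  assumes r: "1 / 2 \<le> r" "r \<le> 4" and t: "1 \<le> t" "t \<le> 2" and s: "\<bar>r - t\<bar> < s" "s < r + t" and d: "3 \<le> d"
  shows "radial_kernel d r t s \<le> 2 * 6 ^ (d - 3) * s ^ (d - 2)"
proof -
  define X where "X = 1 - ((s\<^sup>2 - r\<^sup>2 - t\<^sup>2) / (2 * r * t))\<^sup>2"
  have rt: "0 < r" "0 < t" using r t by auto
  have s0: "0 < s" using s abs_ge_zero[of "r - t"] by linarith
  have rt1: "1 \<le> 2 * (r * t)"
    using mult_mono[of "1/2" r 1 t] r t by simp
  have X0: "0 \<le> X"
    using projection_less_one[OF rt s] abs_square_le_1[of "(s\<^sup>2 - r\<^sup>2 - t\<^sup>2) / (2 * r * t)"] by (simp add: X_def)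
  have sub: "0 \<le> s\<^sup>2 - (r - t)\<^sup>2" using power_mono[of "\<bar>r - t\<bar>" s 2] s by simp
  have "X = ((r + t)\<^sup>2 - s\<^sup>2) * (s\<^sup>2 - (r - t)\<^sup>2) / (2 * r * t)\<^sup>2"
    unfolding X_def by (rule radial_kernel_arg[OF rt])
  also have "\<dots> \<le> ((r + t)\<^sup>2 - s\<^sup>2) * (s\<^sup>2 - (r - t)\<^sup>2) / 1"
  proof (rule divide_left_mono)
    show "1 \<le> (2 * r * t)\<^sup>2" using power_mono[OF rt1, of 2] by (simp add: mult.assoc)
    have "s\<^sup>2 \<le> (r + t)\<^sup>2" using s s0 by (intro power_mono) auto
    thus "0 \<le> ((r + t)\<^sup>2 - s\<^sup>2) * (s\<^sup>2 - (r - t)\<^sup>2)" using sub by simp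
    show "0 < (2 * r * t)\<^sup>2 * 1" using rt by simp
  qed
  also have "\<dots> \<le> 6\<^sup>2 * s\<^sup>2"
  proof -
    have "(r + t)\<^sup>2 \<le> 6\<^sup>2" using rt r t by (intro power_mono) auto
    hence "((r + t)\<^sup>2 - s\<^sup>2) * (s\<^sup>2 - (r - t)\<^sup>2) \<le> 6\<^sup>2 * s\<^sup>2"
      using sub by (intro mult_mono) (auto intro: order_trans[of _ "(r + t)\<^sup>2"])
    thus ?thesis by simp
  qed
  finally have "X \<le> (6 * s)\<^sup>2" by (simp add: power_mult_distrib)
  hence X6: "sqrt X \<le> 6 * s" using s0 by (intro real_le_lsqrt) auto
  have "radial_kernel d r t s = s / (r * t) * sqrt X ^ (d - 3)" by (simp add: radial_kernel_def X_def)
  also have "\<dots> \<le> (s * 2) * (6 * s) ^ (d - 3)"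
  proof (intro mult_mono power_mono X6)
    show "s / (r * t) \<le> s * 2" using rt1 s0 rt by (simp add: field_simps)
  qed (use s0 X0 in auto)
  also have "\<dots> = 2 * 6 ^ (d - 3) * s ^ Suc (d - 3)"
    by (simp add: power_mult_distrib)
  also have "Suc (d - 3) = d - 2" using d by simp
  finally show ?thesis .
qed

text \<open>The upper bound is attained up to a constant away from both ends of the support: s \<ge>
  2 |r - t| leaves 3/4 of s^2 in one factor, s \<le> 1/2 leaves 2 in the other. With 2 r t \<le> 12
  the squared sine is at least s^2/96, whence the 10.\<close>

lemma radial_kernel_ge_power:
  assumes r: "1 / 2 \<le> r" "r \<le> 3" and t: "1 \<le> t" "t \<le> 2" and s: "2 * \<bar>r - t\<bar> \<le> s" "0 < s" "s \<le> 1 / 2" and d: "3 \<le> d"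
  shows "s ^ (d - 2) / (6 * 10 ^ (d - 3)) \<le> radial_kernel d r t s" and "\<bar>r - t\<bar> < s" and "s < r + t"
proof -
  define X where "X = 1 - ((s\<^sup>2 - r\<^sup>2 - t\<^sup>2) / (2 * r * t))\<^sup>2"
  have rt: "0 < r" "0 < t" using r t by auto
  have rt6: "r * t \<le> 6" using mult_mono[of r 3 t 2] r t by simp
  show "\<bar>r - t\<bar> < s" "s < r + t" using s r t by auto
  have "(s / 10)\<^sup>2 \<le> 2 * (3 / 4 * s\<^sup>2) / 12\<^sup>2" by (simp add: power2_eq_square)
  also have "\<dots> \<le> ((r + t)\<^sup>2 - s\<^sup>2) * (s\<^sup>2 - (r - t)\<^sup>2) / (2 * r * t)\<^sup>2"
  proof (intro frac_le mult_mono)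
    have "(3 / 2)\<^sup>2 \<le> (r + t)\<^sup>2" "s\<^sup>2 \<le> (1 / 2)\<^sup>2" using r t s by (intro power_mono; simp)+
    thus b1: "2 \<le> (r + t)\<^sup>2 - s\<^sup>2" by (simp add: power2_eq_square)
    have "\<bar>r - t\<bar>\<^sup>2 \<le> (s / 2)\<^sup>2" using s by (intro power_mono) auto
    thus b2: "3 / 4 * s\<^sup>2 \<le> s\<^sup>2 - (r - t)\<^sup>2" by (simp add: power_divide)
    show "(2 * r * t)\<^sup>2 \<le> 12\<^sup>2" using rt rt6 by (intro power_mono) auto
    show "0 \<le> (r + t)\<^sup>2 - s\<^sup>2" using b1 by simp
    have "0 \<le> s\<^sup>2 - (r - t)\<^sup>2" using b2 by (rule order_trans[rotated]) simp
    thus "0 \<le> ((r + t)\<^sup>2 - s\<^sup>2) * (s\<^sup>2 - (r - t)\<^sup>2)" using b1 by simp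
  qed (use rt in auto)
  also have "\<dots> = X" unfolding X_def by (rule radial_kernel_arg[OF rt, symmetric])
  finally have "s / 10 \<le> sqrt X" using s by (intro real_le_rsqrt)
  hence "s / 6 * (s / 10) ^ (d - 3) \<le> s / (r * t) * sqrt X ^ (d - 3)"
    using s rt rt6 by (intro mult_mono power_mono divide_left_mono) auto
  moreover have "s ^ (d - 2) = s * s ^ (d - 3)"
    using d by (metis Suc_diff_le power_Suc numeral_eq_Suc pred_numeral_simps(3) diff_Suc_Suc BitM.simps(1) numeral_One One_nat_def Suc_1)
  ultimately show "s ^ (d - 2) / (6 * 10 ^ (d - 3)) \<le> radial_kernel d r t s"
    by (simp add: radial_kernel_def X_def power_divide field_simps)
qed

text \<open>The part of \<open>G\<close> below \<open>l / B\<close> does not produce values of \<open>M\<close> above \<open>l\<close>, as in the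
  Marcinkiewicz interpolation theorem.\<close>

lemma nn_integral_weak_type_powr_le:
  fixes M :: "real \<Rightarrow> ennreal" and G :: "real \<Rightarrow> real"
  assumes [measurable]: "M \<in> borel_measurable borel" "G \<in> borel_measurable borel" and I[measurable]: "I \<in> sets borel"
    and G: "\<And>s. 0 \<le> G s" and p: "1 < p" and A: "0 \<le> A" and B: "0 < B"
    and I0: "\<And>r. r \<in> I \<Longrightarrow> 0 < r"
    and weak: "\<And>r l. r \<in> I \<Longrightarrow> 0 < l \<Longrightarrow> ennreal l < M r \<Longrightarrow>
       ennreal (l * r) \<le> ennreal A * (\<integral>\<^sup>+s. ennreal (G s) * indicator {s. l < B * G s} s \<partial>lborel)"
  shows "(\<integral>\<^sup>+r. ennreal_powr (M r) p * indicator I r \<partial>lborel) \<le>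
     ennreal (A * p * B powr (p - 1) / (p - 1)) * (\<integral>\<^sup>+s. ennreal (G s powr p) \<partial>lborel)"
proof -
  define \<Phi> where "\<Phi> = (\<lambda>l. \<integral>\<^sup>+s. ennreal (G s) * indicator {s. l < B * G s} s \<partial>lborel)"
  have [measurable]: "\<Phi> \<in> borel_measurable borel" unfolding \<Phi>_def indicator_def by measurable
  have "(\<integral>\<^sup>+r. ennreal_powr (M r) p * indicator I r \<partial>lborel)
     \<le> (\<integral>\<^sup>+r. (\<integral>\<^sup>+l. ennreal (p * l powr (p - 1)) * (if 0 < l \<and> ennreal l < M r then 1 else 0) * indicator I r \<partial>lborel) \<partial>lborel)"
  proof (rule nn_integral_mono)
    fix r :: real
    have "ennreal_powr (M r) p \<le> (\<integral>\<^sup>+l. ennreal (p * l powr (p - 1)) * indicator {l. 0 < l \<and> ennreal l < M r} l \<partial>lborel)"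
      using p by (intro ennreal_powr_le_layer_cake) simp
    also have "\<dots> = (\<integral>\<^sup>+l. ennreal (p * l powr (p - 1)) * (if 0 < l \<and> ennreal l < M r then 1 else 0) \<partial>lborel)"
      by (intro nn_integral_cong) (simp add: indicator_def)
    finally show "ennreal_powr (M r) p * indicator I r \<le> (\<integral>\<^sup>+l. ennreal (p * l powr (p - 1)) * (if 0 < l \<and> ennreal l < M r then 1 else 0) * indicator I r \<partial>lborel)"
      by (simp add: nn_integral_multc mult_right_mono)
  qed
  also have "\<dots> = (\<integral>\<^sup>+l. (\<integral>\<^sup>+r. ennreal (p * l powr (p - 1)) * (if 0 < l \<and> ennreal l < M r then 1 else 0) * indicator I r \<partial>lborel) \<partial>lborel)"
    by (rule lborel_pair.Fubini') measurable
  also have "\<dots> \<le> (\<integral>\<^sup>+l. ennreal (A * p * l powr (p - 2)) * indicator {0<..} l * \<Phi> l \<partial>lborel)"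
  proof (rule nn_integral_mono)
    fix l :: real
    show "(\<integral>\<^sup>+r. ennreal (p * l powr (p - 1)) * (if 0 < l \<and> ennreal l < M r then 1 else 0) * indicator I r \<partial>lborel)
      \<le> ennreal (A * p * l powr (p - 2)) * indicator {0<..} l * \<Phi> l"
    proof (cases "0 < l")
      case l: True
      define S where "S = {r \<in> I. ennreal l < M r}"
      have [measurable]: "S \<in> sets borel" unfolding S_def by measurable
      have "emeasure lborel S \<le> ennreal (A / l) * \<Phi> l"
      proof (cases "ennreal A * \<Phi> l")
        case top
        hence "ennreal (A / l) * \<Phi> l = top"
          using l A by (auto simp: ennreal_mult_eq_top_iff ennreal_eq_0_iff divide_simps)
        thus ?thesis by simp
      next
        case (real c)
        \<comment> \<open>The weak-type hypothesis is pointwise: each r in the level set obeys l r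
          \<le> c. The level set thus sits in one interval starting at 0, and no covering argument
          is required.\<close>
        have "S \<subseteq> {0..c / l}"
        proof
          fix r assume r: "r \<in> S"
          hence "ennreal (l * r) \<le> ennreal A * \<Phi> l" unfolding \<Phi>_def using l by (intro weak) (auto simp: S_def)
          hence "l * r \<le> c" using real by simp
          thus "r \<in> {0..c / l}" using l r I0[of r] by (auto simp: S_def field_simps)
        qed
        hence "emeasure lborel S \<le> emeasure lborel {0..c / l}" by (intro emeasure_mono) auto
        also have "\<dots> = ennreal (1 / l) * ennreal c" using real l by (simp add: ennreal_mult'[symmetric])
        also have "\<dots> = ennreal (1 / l) * ennreal A * \<Phi> l" using real by (simp add: mult.assoc)
        also have "ennreal (1 / l) * ennreal A = ennreal (A / l)" using l A by (simp add: ennreal_mult'[symmetric])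
        finally show ?thesis .
      qed
      hence "ennreal (p * l powr (p - 1)) * emeasure lborel S \<le> ennreal (p * l powr (p - 1)) * (ennreal (A / l) * \<Phi> l)"
        by (rule mult_left_mono) simp
      also have "\<dots> = ennreal (p * l powr (p - 1) * (A / l)) * \<Phi> l"
        using l A p by (subst ennreal_mult) (auto simp: mult.assoc)
      also have "p * l powr (p - 1) * (A / l) = A * p * l powr (p - 2)"
      proof -
        have "l powr (p - 1) = l powr (p - 2) * l" using l powr_add[of l "p - 2" 1] by simp
        thus ?thesis using l by simp
      qed
      finally have "ennreal (p * l powr (p - 1)) * emeasure lborel S \<le> ennreal (A * p * l powr (p - 2)) * \<Phi> l" .
      moreover have "(\<integral>\<^sup>+r. ennreal (p * l powr (p - 1)) * (if 0 < l \<and> ennreal l < M r then 1 else 0) * indicator I r \<partial>lborel)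
         = (\<integral>\<^sup>+r. ennreal (p * l powr (p - 1)) * indicator S r \<partial>lborel)"
        by (intro nn_integral_cong) (auto simp: S_def indicator_def l)
      ultimately show ?thesis using l by (simp add: nn_integral_cmult)
    qed simp
  qed
  also have "\<dots> = (\<integral>\<^sup>+l. (\<integral>\<^sup>+s. ennreal (A * p * l powr (p - 2)) * indicator {0<..} l * (ennreal (G s) * indicator {s. l < B * G s} s) \<partial>lborel) \<partial>lborel)"
    unfolding \<Phi>_def by (subst nn_integral_cmult) (auto simp: indicator_def)
  also have "\<dots> = (\<integral>\<^sup>+s. (\<integral>\<^sup>+l. ennreal (A * p * l powr (p - 2)) * indicator {0<..} l * (ennreal (G s) * indicator {s. l < B * G s} s) \<partial>lborel) \<partial>lborel)"
    unfolding indicator_def by (rule lborel_pair.Fubini') measurable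
  \<comment> \<open>For fixed s the variable l runs up to B times \<open>G s\<close>, and the
    integral of l^(p-2) converges at 0 because p > 1.\<close>
  also have "\<dots> \<le> (\<integral>\<^sup>+s. ennreal (A * p * B powr (p - 1) / (p - 1)) * ennreal (G s powr p) \<partial>lborel)"
  proof (rule nn_integral_mono)
    fix s :: real
    have "(\<integral>\<^sup>+l. ennreal (A * p * l powr (p - 2)) * indicator {0<..} l * (ennreal (G s) * indicator {s. l < B * G s} s) \<partial>lborel)
      \<le> (\<integral>\<^sup>+l. ennreal (A * p * G s) * (ennreal (l powr (p - 2)) * indicator {0..B * G s} l) \<partial>lborel)"
      using A p G[of s] by (intro nn_integral_mono) (auto simp: indicator_def ennreal_mult'[symmetric] intro!: ennreal_leI)
    also have "\<dots> = ennreal (A * p * G s) * ennreal ((B * G s) powr (p - 2 + 1) / (p - 2 + 1))"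
      using p B G[of s] by (subst nn_integral_cmult) (auto simp: nn_integral_powr_from_0)
    also have "\<dots> = ennreal (A * p * G s * ((B * G s) powr (p - 1) / (p - 1)))"
      using A p G[of s] by (subst ennreal_mult) (auto simp: diff_add_eq)
    also have "A * p * G s * ((B * G s) powr (p - 1) / (p - 1)) = A * p * B powr (p - 1) / (p - 1) * G s powr p"
    proof (cases "G s = 0")
      case False
      hence "G s powr p = G s * G s powr (p - 1)" using G[of s] by (subst powr_mult_base) auto
      thus ?thesis using G[of s] B by (simp add: powr_mult)
    qed (use p in simp)
    also have "ennreal \<dots> = ennreal (A * p * B powr (p - 1) / (p - 1)) * ennreal (G s powr p)"
      using A p by (intro ennreal_mult') auto
    finally show "(\<integral>\<^sup>+l. ennreal (A * p * l powr (p - 2)) * indicator {0<..} l * (ennreal (G s) * indicator {s. l < B * G s} s) \<partial>lborel)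
       \<le> ennreal (A * p * B powr (p - 1) / (p - 1)) * ennreal (G s powr p)" .
  qed
  also have "\<dots> = ennreal (A * p * B powr (p - 1) / (p - 1)) * (\<integral>\<^sup>+s. ennreal (G s powr p) \<partial>lborel)"
    by (rule nn_integral_cmult) measurable
  finally show ?thesis .
qed

section \<open>Hardy's inequality\<close>

text \<open>Hoelder's inequality with an auxiliary weight: g s^(d-2) is split into (g s^((d-1)/p)
  L^\<theta>) and (s^(d-2-(d-1)/p) L^(-\<theta>)). The p'-th power of the second factor has the
  exponent d - 1 - p' of s. The choice \<theta> = 0 is the plain inequality.\<close>

lemma hardy_Hoelder:
  fixes g L :: "real \<Rightarrow> real"
  assumes [measurable]: "g \<in> borel_measurable borel" "L \<in> borel_measurable borel" "S \<in> sets borel"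
    and p: "1 < p" and p': "p' = p / (p - 1)" and d: "2 \<le> d"
    and g: "\<And>s. 0 \<le> g s" and S: "S \<subseteq> {0<..}" and L: "\<And>s. s \<in> S \<Longrightarrow> 0 < L s"
    and B: "0 < B" and H: "(\<integral>\<^sup>+s. ennreal (s powr (real d - 1 - p') * L s powr (- (\<theta> * p'))) * indicator S s \<partial>lborel) \<le> ennreal (B powr p')"
  shows "ennreal_powr (\<integral>\<^sup>+s. ennreal (g s * s ^ (d - 2)) * indicator S s \<partial>lborel) p \<le>
    ennreal (B powr p) * (\<integral>\<^sup>+s. ennreal (g s powr p * s ^ (d - 1) * L s powr (\<theta> * p)) * indicator S s \<partial>lborel)"
proof -
  have p'1: "1 < p'" using p by (simp add: p' field_simps)
  define F where "F = (\<lambda>s. ennreal (g s * s powr ((real d - 1) / p) * L s powr \<theta>) * indicator S s)"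
  define H where "H = (\<lambda>s. ennreal (s powr (real d - 2 - (real d - 1) / p) * L s powr (- \<theta>)) * indicator S s)"
  have [measurable]: "F \<in> borel_measurable borel" "H \<in> borel_measurable borel"
    unfolding F_def H_def by measurable
  have FH: "ennreal (g s * s ^ (d - 2)) * indicator S s = F s * H s" for s
  proof (cases "s \<in> S")
    case True
    hence s: "0 < s" "0 < L s" using S L by auto
    have "s ^ (d - 2) = s powr (real d - 2)" using s d by (simp add: powr_realpow[symmetric] of_nat_diff)
    also have "\<dots> = s powr ((real d - 1) / p) * s powr (real d - 2 - (real d - 1) / p)"
      by (simp flip: powr_add)
    finally have eq: "g s * s ^ (d - 2) = (g s * s powr ((real d - 1) / p) * L s powr \<theta>) *
       (s powr (real d - 2 - (real d - 1) / p) * L s powr (- \<theta>))"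
      using s by (simp add: powr_minus field_simps)
    have "ennreal (g s * s ^ (d - 2)) = ennreal (g s * s powr ((real d - 1) / p) * L s powr \<theta>) *
       ennreal (s powr (real d - 2 - (real d - 1) / p) * L s powr (- \<theta>))"
      unfolding eq using g[of s] by (intro ennreal_mult) auto
    thus ?thesis using True unfolding F_def H_def by simp
  qed (simp add: F_def)
  have Fp: "ennreal_powr (F s) p = ennreal (g s powr p * s ^ (d - 1) * L s powr (\<theta> * p)) * indicator S s" for s
  proof (cases "s \<in> S")
    case True
    hence s: "0 < s" "0 < L s" using S L by auto
    have "s ^ (d - 1) = s powr (real d - 1)" using s d by (simp add: powr_realpow[symmetric] of_nat_diff)
    thus ?thesis using True s g[of s] p by (simp add: F_def powr_mult powr_powr)
  qed (simp add: F_def)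
  have Hp: "ennreal_powr (H s) p' = ennreal (s powr (real d - 1 - p') * L s powr (- (\<theta> * p'))) * indicator S s" for s
  proof (cases "s \<in> S")
    case True
    hence s: "0 < s" "0 < L s" using S L by auto
    have "(real d - 2 - (real d - 1) / p) * p' = real d - 1 - p'"
      using p by (simp add: p' field_simps)
    thus ?thesis using True s by (simp add: H_def powr_mult powr_powr)
  qed (simp add: H_def)
  have "ennreal_powr (\<integral>\<^sup>+s. F s * H s \<partial>lborel) p \<le> ennreal (B powr p) * (\<integral>\<^sup>+s. ennreal_powr (F s) p \<partial>lborel)"
    by (rule nn_integral_Hoelder_powr[OF _ _ p p' B]) (use H in \<open>simp_all add: Hp\<close>)
  thus ?thesis by (simp add: FH Fp)
qed

lemma ennreal_powr_le_imp:
  assumes "ennreal_powr x p \<le> ennreal (B powr p)" "0 < p" "0 \<le> B"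
  shows "x \<le> ennreal B"
proof -
  have "ennreal_powr (ennreal_powr x p) (1 / p) \<le> ennreal_powr (ennreal (B powr p)) (1 / p)"
    using assms by (intro ennreal_powr_mono) auto
  thus ?thesis using assms by (simp add: ennreal_powr_powr powr_powr)
qed

lemma hardy_Hoelder_one:
  fixes g :: "real \<Rightarrow> real"
  assumes [measurable]: "g \<in> borel_measurable borel" "S \<in> sets borel"
    and p: "1 < p" and p': "p' = p / (p - 1)" and d: "2 \<le> d"
    and g: "\<And>s. 0 \<le> g s" and S: "S \<subseteq> {0<..}"
    and N: "(\<integral>\<^sup>+s. ennreal (g s powr p * s ^ (d - 1)) * indicator {0<..} s \<partial>lborel) \<le> 1"
    and B: "0 < B" and H: "(\<integral>\<^sup>+s. ennreal (s powr (real d - 1 - p')) * indicator S s \<partial>lborel) \<le> ennreal (B powr p')"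
  shows "(\<integral>\<^sup>+s. ennreal (g s * s ^ (d - 2)) * indicator S s \<partial>lborel) \<le> ennreal B"
proof -
  have "ennreal_powr (\<integral>\<^sup>+s. ennreal (g s * s ^ (d - 2)) * indicator S s \<partial>lborel) p \<le>
    ennreal (B powr p) * (\<integral>\<^sup>+s. ennreal (g s powr p * s ^ (d - 1) * 1 powr (0 * p)) * indicator S s \<partial>lborel)"
  proof (rule hardy_Hoelder[where L = "\<lambda>_. 1" and \<theta> = 0, OF _ _ _ p p' d g S _ B])
    show "(\<integral>\<^sup>+s. ennreal (s powr (real d - 1 - p') * 1 powr (- (0 * p'))) * indicator S s \<partial>lborel) \<le> ennreal (B powr p')"
      using H by simp
  qed auto
  also have "\<dots> \<le> ennreal (B powr p) * 1"
  proof (intro mult_left_mono order_trans[OF _ N] nn_integral_mono)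
    show "ennreal (g s powr p * s ^ (d - 1) * 1 powr (0 * p)) * indicator S s
      \<le> ennreal (g s powr p * s ^ (d - 1)) * indicator {0<..} s" for s
      using S by (auto simp: indicator_def)
  qed simp
  finally have "ennreal_powr (\<integral>\<^sup>+s. ennreal (g s * s ^ (d - 2)) * indicator S s \<partial>lborel) p \<le> ennreal (B powr p)"
    by simp
  thus ?thesis by (rule ennreal_powr_le_imp) (use p B in auto)
qed

text \<open>Hardy's inequality, where \<open>- L\<close> is an antiderivative of the \<open>p'\<close>-th power of the dual
  weight. The bound on the sublevel sets of \<open>D\<close> is Muckenhoupt's condition.\<close>

locale hardy_weight =
  fixes L :: "real \<Rightarrow> real" and p p' q C :: real and d :: nat and D :: "real \<Rightarrow> real" and I :: "real set"
  assumes p: "1 < p" and p': "p' = p / (p - 1)" and q: "p \<le> q" and d: "2 \<le> d"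
    and L_measurable [measurable]: "L \<in> borel_measurable borel"
    and D_measurable [measurable]: "D \<in> borel_measurable borel"
    and I_measurable [measurable]: "I \<in> sets borel"
    and L_deriv: "\<And>s. 0 < s \<Longrightarrow> s \<le> 6 \<Longrightarrow> (L has_real_derivative - (s powr (real d - 1 - p'))) (at s)"
    and L_pos: "\<And>s. 0 < s \<Longrightarrow> s \<le> 6 \<Longrightarrow> 0 < L s"
    and C: "0 \<le> C"
    and level: "\<And>x. 0 < x \<Longrightarrow> x \<le> 6 \<Longrightarrow> emeasure lborel {r \<in> I. D r < x} \<le> ennreal (C * L x powr (- (q / p')))"
    and D_pos: "AE r in lborel. r \<in> I \<longrightarrow> 0 < D r"
begin

lemma p'_gt_1: "1 < p'"
  using p by (simp add: p' field_simps)

lemma L_powr_deriv: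
  assumes "0 < s" "s \<le> 6"
  shows "((\<lambda>s. L s powr a) has_real_derivative - (a * L s powr (a - 1) * s powr (real d - 1 - p'))) (at s)"
proof -
  have "((\<lambda>s. L s powr a) has_real_derivative (a * L s powr (a - 1) * - (s powr (real d - 1 - p')))) (at s)"
    using DERIV_fun_powr[OF L_deriv[OF assms] L_pos[OF assms], of a] by simp
  thus ?thesis by simp
qed

text \<open>The weight is minus the derivative of L, so the integral is explicit, and a < 1 makes
  the term at the upper end favourable. Used with a = 0 and a = 1/2.\<close>

lemma integral_L_powr:
  assumes D: "0 < D0" "D0 < 6" and a: "a < 1"
  shows "(\<integral>\<^sup>+s. ennreal (s powr (real d - 1 - p') * L s powr (- a)) * indicator {D0<..<6} s \<partial>lborel)
     \<le> ennreal (L D0 powr (1 - a) / (1 - a))"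
proof -
  have der: "((\<lambda>s. - (L s powr (1 - a) / (1 - a))) has_real_derivative s powr (real d - 1 - p') * L s powr (- a)) (at s)"
    if "0 < s" "s \<le> 6" for s
  proof -
    have "((\<lambda>s. - (L s powr (1 - a) / (1 - a))) has_real_derivative
        - (- ((1 - a) * L s powr (1 - a - 1) * s powr (real d - 1 - p')) / (1 - a))) (at s)"
      by (rule DERIV_minus[OF DERIV_cdivide[OF L_powr_deriv[OF that]]])
    thus ?thesis using a by (simp add: mult.commute)
  qed
  have "(\<integral>\<^sup>+s. ennreal (s powr (real d - 1 - p') * L s powr (- a)) * indicator {D0<..<6} s \<partial>lborel)
     \<le> (\<integral>\<^sup>+s. ennreal (s powr (real d - 1 - p') * L s powr (- a)) * indicator {D0..6} s \<partial>lborel)"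
    by (intro nn_integral_mono) (auto simp: indicator_def)
  also have "\<dots> = ennreal (- (L 6 powr (1 - a) / (1 - a)) - - (L D0 powr (1 - a) / (1 - a)))"
    using D by (intro nn_integral_FTC_Icc der) auto
  also have "\<dots> \<le> ennreal (L D0 powr (1 - a) / (1 - a))" using a by (intro ennreal_leI) simp
  finally show ?thesis .
qed

text \<open>Write L(D r)^m as L(s)^m plus the integral of the derivative between D r and s. After
  exchanging the integrals only the measures of the sets D < x remain; the level bound turns the
  integrand into the derivative of a multiple of L^(m - q/p'), and m < q/p' makes this multiple
  positive.\<close>

lemma integral_L_D_powr:
  assumes s: "0 < s" "s \<le> 6" and m: "0 < m" "m < q / p'"
  shows "(\<integral>\<^sup>+r. ennreal (L (D r) powr m) * indicator {r \<in> I. 0 < D r \<and> D r < s} r \<partial>lborel)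
    \<le> ennreal (C * (1 + m / (q / p' - m)) * L s powr (m - q / p'))"
proof -
  define Q where "Q = q / p'"
  define k where "k = (\<lambda>x. m * L x powr (m - 1) * x powr (real d - 1 - p'))"
  have [measurable]: "k \<in> borel_measurable borel" unfolding k_def by measurable
  have k0: "0 \<le> k x" for x using m by (simp add: k_def)
  have mQ: "m < Q" using m by (simp add: Q_def)
  have "(\<integral>\<^sup>+r. ennreal (L (D r) powr m) * indicator {r \<in> I. 0 < D r \<and> D r < s} r \<partial>lborel)
    \<le> (\<integral>\<^sup>+r. ennreal (L s powr m) * indicator {r \<in> I. D r < s} r +
         (\<integral>\<^sup>+x. ennreal (k x) * indicator {0<..s} x * (if r \<in> I \<and> D r < x then 1 else 0) \<partial>lborel) \<partial>lborel)"
  proof (rule nn_integral_mono)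
    fix r
    show "ennreal (L (D r) powr m) * indicator {r \<in> I. 0 < D r \<and> D r < s} r \<le> ennreal (L s powr m) * indicator {r \<in> I. D r < s} r +
         (\<integral>\<^sup>+x. ennreal (k x) * indicator {0<..s} x * (if r \<in> I \<and> D r < x then 1 else 0) \<partial>lborel)"
    proof (cases "r \<in> I \<and> 0 < D r \<and> D r < s")
      case r: True
      have der: "((\<lambda>x. - (L x powr m)) has_real_derivative k x) (at x)" if "0 < x" "x \<le> 6" for x
        using DERIV_minus[OF L_powr_deriv[OF that]] by (simp add: k_def)
      have "ennreal (L (D r) powr m) \<le> ennreal (L s powr m + (- (L s powr m) - - (L (D r) powr m)))" by simp
      also have "\<dots> = ennreal (L s powr m) + ennreal (- (L s powr m) - - (L (D r) powr m))"
      proof (rule ennreal_plus)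
        have "- (L (D r) powr m) \<le> - (L s powr m)"
          using r s by (intro deriv_nonneg_imp_mono[where g = "\<lambda>x. - (L x powr m)" and g' = k]) (auto intro!: der k0)
        thus "0 \<le> - (L s powr m) - - (L (D r) powr m)" by simp
      qed simp
      also have "ennreal (- (L s powr m) - - (L (D r) powr m)) = (\<integral>\<^sup>+x. ennreal (k x) * indicator {D r..s} x \<partial>lborel)"
        using r s by (intro nn_integral_FTC_Icc[symmetric] der k0) auto
      also have "\<dots> = (\<integral>\<^sup>+x. ennreal (k x) * indicator {0<..s} x * (if r \<in> I \<and> D r < x then 1 else 0) \<partial>lborel)"
        using r by (intro nn_integral_cong_AE AE_I[of _ _ "{D r}"]) (auto simp: indicator_def)
      finally show ?thesis using r by simp
    qed simp
  qed
  also have "\<dots> = ennreal (L s powr m) * emeasure lborel {r \<in> I. D r < s} +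
     (\<integral>\<^sup>+r. (\<integral>\<^sup>+x. ennreal (k x) * indicator {0<..s} x * (if r \<in> I \<and> D r < x then 1 else 0) \<partial>lborel) \<partial>lborel)"
    by (subst nn_integral_add) (auto simp: nn_integral_cmult)
  also have "(\<integral>\<^sup>+r. (\<integral>\<^sup>+x. ennreal (k x) * indicator {0<..s} x * (if r \<in> I \<and> D r < x then 1 else 0) \<partial>lborel) \<partial>lborel)
    = (\<integral>\<^sup>+x. (\<integral>\<^sup>+r. ennreal (k x) * indicator {0<..s} x * (if r \<in> I \<and> D r < x then 1 else 0) \<partial>lborel) \<partial>lborel)"
    by (rule lborel_pair.Fubini') measurable
  also have "\<dots> = (\<integral>\<^sup>+x. ennreal (k x) * indicator {0<..s} x * emeasure lborel {r \<in> I. D r < x} \<partial>lborel)"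
  proof (rule nn_integral_cong)
    fix x
    have "(\<integral>\<^sup>+r. ennreal (k x) * indicator {0<..s} x * (if r \<in> I \<and> D r < x then 1 else 0) \<partial>lborel)
      = (\<integral>\<^sup>+r. ennreal (k x) * indicator {0<..s} x * indicator {r \<in> I. D r < x} r \<partial>lborel)"
      by (intro nn_integral_cong) (simp add: indicator_def)
    thus "(\<integral>\<^sup>+r. ennreal (k x) * indicator {0<..s} x * (if r \<in> I \<and> D r < x then 1 else 0) \<partial>lborel)
      = ennreal (k x) * indicator {0<..s} x * emeasure lborel {r \<in> I. D r < x}"
      by (simp add: nn_integral_cmult)
  qed
  also have "\<dots> \<le> (\<integral>\<^sup>+x. ennreal C * (ennreal (m * L x powr (m - Q - 1) * x powr (real d - 1 - p')) * indicator {0<..s} x) \<partial>lborel)"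
  proof (rule nn_integral_mono)
    fix x
    show "ennreal (k x) * indicator {0<..s} x * emeasure lborel {r \<in> I. D r < x} \<le>
      ennreal C * (ennreal (m * L x powr (m - Q - 1) * x powr (real d - 1 - p')) * indicator {0<..s} x)"
    proof (cases "x \<in> {0<..s}")
      case True
      hence x: "0 < x" "x \<le> 6" using s by auto
      have "L x powr (m - Q - 1) = L x powr (m - 1) * L x powr (- Q)"
        using powr_add[of "L x" "m - 1" "- Q"] by (simp add: algebra_simps)
      hence eq: "C * (m * L x powr (m - Q - 1) * x powr (real d - 1 - p')) = k x * (C * L x powr (- Q))"
        by (simp add: k_def)
      have "ennreal (k x) * emeasure lborel {r \<in> I. D r < x} \<le> ennreal (k x) * ennreal (C * L x powr (- Q))"
        using level[OF x] by (intro mult_left_mono) (auto simp: Q_def)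
      also have "\<dots> = ennreal (C * (m * L x powr (m - Q - 1) * x powr (real d - 1 - p')))"
        unfolding eq using k0 C by (intro ennreal_mult[symmetric]) auto
      also have "\<dots> = ennreal C * ennreal (m * L x powr (m - Q - 1) * x powr (real d - 1 - p'))"
        using C by (rule ennreal_mult')
      finally show ?thesis using True by simp
    qed simp
  qed
  also have "\<dots> = ennreal C * (\<integral>\<^sup>+x. ennreal (m * L x powr (m - Q - 1) * x powr (real d - 1 - p')) * indicator {0<..s} x \<partial>lborel)"
    by (rule nn_integral_cmult) measurable
  also have "\<dots> \<le> ennreal C * ennreal (m / (Q - m) * L s powr (m - Q))"
  proof (intro mult_left_mono nn_integral_FTC_from_0_le)
    fix x assume x: "0 < x" "x \<le> s"
    hence x6: "x \<le> 6" using s by simp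
    have "((\<lambda>x. m / (Q - m) * L x powr (m - Q)) has_real_derivative
        m / (Q - m) * (- ((m - Q) * L x powr (m - Q - 1) * x powr (real d - 1 - p')))) (at x)"
      by (rule DERIV_cmult[OF L_powr_deriv[OF x(1) x6]])
    also have "m / (Q - m) * (- ((m - Q) * L x powr (m - Q - 1) * x powr (real d - 1 - p')))
      = m * L x powr (m - Q - 1) * x powr (real d - 1 - p')"
    proof -
      have "m / (Q - m) * (- ((m - Q) * a)) = m * a" for a using mQ by (simp add: field_simps)
      thus ?thesis by (simp only: mult.assoc)
    qed
    finally show "((\<lambda>x. m / (Q - m) * L x powr (m - Q)) has_real_derivative m * L x powr (m - Q - 1) * x powr (real d - 1 - p')) (at x)" .
  qed (use m mQ in auto)
  also have "ennreal (L s powr m) * emeasure lborel {r \<in> I. D r < s} \<le> ennreal (L s powr m) * ennreal (C * L s powr (- Q))"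
    using level[OF s] by (intro mult_left_mono) (auto simp: Q_def)
  also have "\<dots> = ennreal (C * L s powr (m - Q))"
    using C by (subst ennreal_mult[symmetric]) (auto simp: powr_diff powr_minus field_simps)
  also have "\<dots> + ennreal C * ennreal (m / (Q - m) * L s powr (m - Q)) = ennreal (C * (1 + m / (Q - m)) * L s powr (m - Q))"
    using C m mQ by (simp add: ennreal_mult'[symmetric] ennreal_plus[symmetric] algebra_simps del: ennreal_plus)
  finally show ?thesis by (simp add: Q_def add_left_mono add_right_mono)
qed

text \<open>With T the inner integral, T^q = T^p T^(q-p). The power q - p is estimated by plain
  Hoelder, which gives a power of L(D r). The power p is estimated with an auxiliary weight, so that
  an integral in s survives; Fubini then exchanges r and s, and the integral over r is controlled by
  the sublevel sets of D.\<close>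

theorem hardy_inequality:
  "\<exists>K\<ge>0. \<forall>g. g \<in> borel_measurable borel \<longrightarrow> (\<forall>s. 0 \<le> g s) \<longrightarrow>
     (\<integral>\<^sup>+s. ennreal (g s powr p * s ^ (d - 1)) * indicator {0<..} s \<partial>lborel) \<le> 1 \<longrightarrow>
     (\<integral>\<^sup>+r. ennreal_powr (\<integral>\<^sup>+s. ennreal (g s * s ^ (d - 2)) * indicator {D r<..<6} s \<partial>lborel) q * indicator I r \<partial>lborel) \<le> ennreal K"
proof -
  \<comment> \<open>This is \<theta> p for \<theta> = 1 / (2 p'), the middle of the interval of
    exponents for which the weighted Hoelder integral converges and m below stays positive. The
    constant 2 in the result is 1 / (1 - \<theta> p').\<close>
  define b where "b = (p - 1) / 2"
  define m where "m = q / p' - b"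
  define c where "c = C * (1 + m / (q / p' - m))"
  have pp': "p / p' = p - 1" using p by (simp add: p' field_simps)
  have "p / p' \<le> q / p'" using q p'_gt_1 by (simp add: divide_right_mono)
  hence "p - 1 \<le> q / p'" by (simp add: pp')
  moreover have "b < p - 1" using p by (simp add: b_def)
  ultimately have "b < q / p'" by (rule less_le_trans[rotated])
  hence m0: "0 < m" by (simp add: m_def)
  have mb: "m < q / p'" "m - q / p' = - b" "0 < q / p' - m" using p by (auto simp: m_def b_def)
  have c0: "0 \<le> c" unfolding c_def using C m0 mb by simp
  show ?thesis
  proof (intro exI[of _ "2 powr (p - 1) * c"] conjI allI impI)
    show "0 \<le> 2 powr (p - 1) * c" using c0 by simp
    fix g :: "real \<Rightarrow> real"
    assume g[measurable]: "g \<in> borel_measurable borel" and g0: "\<forall>s. 0 \<le> g s"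
      and N: "(\<integral>\<^sup>+s. ennreal (g s powr p * s ^ (d - 1)) * indicator {0<..} s \<partial>lborel) \<le> 1"
    define T where "T = (\<lambda>r. \<integral>\<^sup>+s. ennreal (g s * s ^ (d - 2)) * indicator {D r<..<6} s \<partial>lborel)"
    define w where "w = (\<lambda>s. g s powr p * s ^ (d - 1) * L s powr b)"
    have [measurable]: "w \<in> borel_measurable borel" unfolding w_def by measurable
    have pointwise: "ennreal_powr (T r) q \<le> (\<integral>\<^sup>+s. ennreal (2 powr (p - 1)) * (ennreal (L (D r) powr m) *
        (if D r < s then 1 else 0) * (ennreal (w s) * indicator {0<..<6} s)) \<partial>lborel)" if r: "0 < D r" for r
    proof (cases "D r < 6")
      case True
      define y where "y = L (D r)"
      have y: "0 < y" using r True L_pos by (simp add: y_def)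
      have T1: "T r \<le> ennreal (y powr (1 / p'))"
        unfolding T_def
      proof (rule hardy_Hoelder_one[OF g _ p p' d _ _ N])
        have "(\<integral>\<^sup>+s. ennreal (s powr (real d - 1 - p')) * indicator {D r<..<6} s \<partial>lborel)
           = (\<integral>\<^sup>+s. ennreal (s powr (real d - 1 - p') * L s powr (- 0)) * indicator {D r<..<6} s \<partial>lborel)"
        proof (rule nn_integral_cong)
          fix s show "ennreal (s powr (real d - 1 - p')) * indicator {D r<..<6} s =
            ennreal (s powr (real d - 1 - p') * L s powr (- 0)) * indicator {D r<..<6} s"
            using L_pos[of s] r by (cases "s \<in> {D r<..<6}") (auto simp: less_imp_le)
        qed
        also have "\<dots> \<le> ennreal (L (D r) powr (1 - 0) / (1 - 0))"
          using r True by (intro integral_L_powr) auto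
        finally show "(\<integral>\<^sup>+s. ennreal (s powr (real d - 1 - p')) * indicator {D r<..<6} s \<partial>lborel) \<le> ennreal ((y powr (1 / p')) powr p')"
          using p'_gt_1 y by (simp add: y_def powr_powr)
      qed (use g0 y r in auto)
      have T2: "ennreal_powr (T r) p \<le> ennreal (2 powr (p - 1) * y powr b) * (\<integral>\<^sup>+s. ennreal (w s) * indicator {D r<..<6} s \<partial>lborel)"
      proof -
        define B where "B = (2 * y powr (1 / 2)) powr (1 / p')"
        have "ennreal_powr (T r) p \<le> ennreal (B powr p) *
          (\<integral>\<^sup>+s. ennreal (g s powr p * s ^ (d - 1) * L s powr (1 / (2 * p') * p)) * indicator {D r<..<6} s \<partial>lborel)"
          unfolding T_def
        proof (rule hardy_Hoelder[OF g L_measurable _ p p' d])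
          have "(\<integral>\<^sup>+s. ennreal (s powr (real d - 1 - p') * L s powr (- (1 / 2))) * indicator {D r<..<6} s \<partial>lborel)
            \<le> ennreal (L (D r) powr (1 - 1 / 2) / (1 - 1 / 2))"
            using r True by (intro integral_L_powr) auto
          thus "(\<integral>\<^sup>+s. ennreal (s powr (real d - 1 - p') * L s powr (- (1 / (2 * p') * p'))) * indicator {D r<..<6} s \<partial>lborel)
            \<le> ennreal (B powr p')"
            using p'_gt_1 y by (simp add: B_def powr_powr y_def mult.commute)
        qed (use g0 y r L_pos in \<open>auto simp: B_def\<close>)
        moreover have "1 / (2 * p') * p = (p / p') / 2" by simp
        hence "1 / (2 * p') * p = b" unfolding pp' b_def .
        moreover have "B powr p = 2 powr (p - 1) * y powr b"
        proof -
          have "B powr p = (2 * y powr (1 / 2)) powr (p / p')" by (simp add: B_def powr_powr)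
          also have "\<dots> = 2 powr (p - 1) * y powr b" unfolding pp' using y by (simp add: powr_mult powr_powr b_def)
          finally show ?thesis .
        qed
        ultimately show ?thesis by (simp add: w_def)
      qed
      have "(q - p) / p' = q / p' - (p - 1)" by (simp add: diff_divide_distrib pp')
      hence "b + (q - p) / p' = m" unfolding m_def b_def by (simp add: diff_divide_distrib)
      hence ym: "y powr b * y powr ((q - p) / p') = y powr m" by (simp flip: powr_add)
      have "ennreal_powr (T r) q = ennreal_powr (T r) p * ennreal_powr (T r) (q - p)"
        using ennreal_powr_add[of p "q - p" "T r"] p q by simp
      also have "\<dots> \<le> (ennreal (2 powr (p - 1) * y powr b) * (\<integral>\<^sup>+s. ennreal (w s) * indicator {D r<..<6} s \<partial>lborel)) *
        ennreal_powr (ennreal (y powr (1 / p'))) (q - p)"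
        using T1 T2 q by (intro mult_mono ennreal_powr_mono) auto
      also have "\<dots> = ennreal (2 powr (p - 1) * (y powr b * y powr ((q - p) / p'))) * (\<integral>\<^sup>+s. ennreal (w s) * indicator {D r<..<6} s \<partial>lborel)"
        using y by (simp add: powr_powr ennreal_mult mult_ac)
      also have "\<dots> = ennreal (2 powr (p - 1) * y powr m) * (\<integral>\<^sup>+s. ennreal (w s) * indicator {D r<..<6} s \<partial>lborel)"
        unfolding ym ..
      also have "\<dots> = (\<integral>\<^sup>+s. ennreal (2 powr (p - 1) * y powr m) * (ennreal (w s) * indicator {D r<..<6} s) \<partial>lborel)"
        by (rule nn_integral_cmult[symmetric]) measurable
      also have "\<dots> = (\<integral>\<^sup>+s. ennreal (2 powr (p - 1)) * (ennreal (L (D r) powr m) *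
        (if D r < s then 1 else 0) * (ennreal (w s) * indicator {0<..<6} s)) \<partial>lborel)"
        using r by (intro nn_integral_cong) (auto simp: indicator_def ennreal_mult y_def mult_ac)
      finally show ?thesis .
    next
      case False
      hence "T r = 0" by (simp add: T_def)
      thus ?thesis by simp
    qed
    have "(\<integral>\<^sup>+r. ennreal_powr (T r) q * indicator I r \<partial>lborel) \<le>
      (\<integral>\<^sup>+r. (\<integral>\<^sup>+s. ennreal (2 powr (p - 1)) * (ennreal (w s) * indicator {0<..<6} s) *
        (ennreal (L (D r) powr m) * (if r \<in> I \<and> 0 < D r \<and> D r < s then 1 else 0)) \<partial>lborel) \<partial>lborel)"
    proof (rule nn_integral_mono_AE)
      show "AE r in lborel. ennreal_powr (T r) q * indicator I r \<le>
       (\<integral>\<^sup>+s. ennreal (2 powr (p - 1)) * (ennreal (w s) * indicator {0<..<6} s) *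
        (ennreal (L (D r) powr m) * (if r \<in> I \<and> 0 < D r \<and> D r < s then 1 else 0)) \<partial>lborel)"
        using D_pos
      proof eventually_elim
        case (elim r)
        show ?case
        proof (cases "r \<in> I")
          case True
          with elim have Dr: "0 < D r" by simp
          note pointwise[OF Dr]
          also have "(\<integral>\<^sup>+s. ennreal (2 powr (p - 1)) * (ennreal (L (D r) powr m) *
            (if D r < s then 1 else 0) * (ennreal (w s) * indicator {0<..<6} s)) \<partial>lborel) =
            (\<integral>\<^sup>+s. ennreal (2 powr (p - 1)) * (ennreal (w s) * indicator {0<..<6} s) *
            (ennreal (L (D r) powr m) * (if r \<in> I \<and> 0 < D r \<and> D r < s then 1 else 0)) \<partial>lborel)"
            using True Dr by (intro nn_integral_cong) (simp add: mult_ac)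
          finally show ?thesis using True by simp
        qed simp
      qed
    qed
    also have "\<dots> = (\<integral>\<^sup>+s. (\<integral>\<^sup>+r. ennreal (2 powr (p - 1)) * (ennreal (w s) * indicator {0<..<6} s) *
        (ennreal (L (D r) powr m) * (if r \<in> I \<and> 0 < D r \<and> D r < s then 1 else 0)) \<partial>lborel) \<partial>lborel)"
      by (rule lborel_pair.Fubini') measurable
    also have "\<dots> \<le> (\<integral>\<^sup>+s. ennreal (2 powr (p - 1) * c) * (ennreal (g s powr p * s ^ (d - 1)) * indicator {0<..} s) \<partial>lborel)"
    proof (rule nn_integral_mono)
      fix s
      show "(\<integral>\<^sup>+r. ennreal (2 powr (p - 1)) * (ennreal (w s) * indicator {0<..<6} s) *
        (ennreal (L (D r) powr m) * (if r \<in> I \<and> 0 < D r \<and> D r < s then 1 else 0)) \<partial>lborel)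
        \<le> ennreal (2 powr (p - 1) * c) * (ennreal (g s powr p * s ^ (d - 1)) * indicator {0<..} s)"
      proof (cases "s \<in> {0<..<6}")
        case True
        hence s: "0 < s" "s \<le> 6" by auto
        have "(\<integral>\<^sup>+r. ennreal (2 powr (p - 1)) * (ennreal (w s) * indicator {0<..<6} s) *
          (ennreal (L (D r) powr m) * (if r \<in> I \<and> 0 < D r \<and> D r < s then 1 else 0)) \<partial>lborel)
          = ennreal (2 powr (p - 1)) * ennreal (w s) * (\<integral>\<^sup>+r. ennreal (L (D r) powr m) * (if r \<in> I \<and> 0 < D r \<and> D r < s then 1 else 0) \<partial>lborel)"
          using True by (subst nn_integral_cmult) auto
        also have "(\<integral>\<^sup>+r. ennreal (L (D r) powr m) * (if r \<in> I \<and> 0 < D r \<and> D r < s then 1 else 0) \<partial>lborel)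
          = (\<integral>\<^sup>+r. ennreal (L (D r) powr m) * indicator {r \<in> I. 0 < D r \<and> D r < s} r \<partial>lborel)"
          by (intro nn_integral_cong) (simp add: indicator_def)
        also have "\<dots> \<le> ennreal (c * L s powr (- b))"
          using integral_L_D_powr[OF s m0 mb(1)] unfolding c_def mb(2) .
        also have "ennreal (2 powr (p - 1)) * ennreal (w s) * ennreal (c * L s powr (- b)) =
          ennreal (2 powr (p - 1) * w s * (c * L s powr (- b)))"
          using c0 s g0 by (simp add: ennreal_mult[symmetric] w_def)
        \<comment> \<open>The factor \<open>L s powr b\<close> inside w meets
          \<open>L s powr (- b)\<close> from the integral over r, so the auxiliary weight
          disappears.\<close>
        also have "2 powr (p - 1) * w s * (c * L s powr (- b)) = 2 powr (p - 1) * c * (g s powr p * s ^ (d - 1))"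
          using L_pos[OF s] by (simp add: w_def powr_minus)
        also have "ennreal (2 powr (p - 1) * c * (g s powr p * s ^ (d - 1))) = ennreal (2 powr (p - 1) * c) * ennreal (g s powr p * s ^ (d - 1))"
          using c0 by (intro ennreal_mult') auto
        finally show ?thesis using s by (simp add: mult_left_mono)
      qed simp
    qed
    also have "\<dots> = ennreal (2 powr (p - 1) * c) * (\<integral>\<^sup>+s. ennreal (g s powr p * s ^ (d - 1)) * indicator {0<..} s \<partial>lborel)"
      by (rule nn_integral_cmult) measurable
    also have "\<dots> \<le> ennreal (2 powr (p - 1) * c) * 1" using N by (rule mult_left_mono) simp
    finally show "(\<integral>\<^sup>+r. ennreal_powr (\<integral>\<^sup>+s. ennreal (g s * s ^ (d - 2)) * indicator {D r<..<6} s \<partial>lborel) q * indicator I r \<partial>lborel)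
      \<le> ennreal (2 powr (p - 1) * c)" by (simp add: T_def)
  qed
qed

end

section \<open>Bounds for the three ranges of the radius\<close>

text \<open>The radial form of the unit ball of L^p, up to the area of the sphere. Estimates are
  proved for such profiles first; homogeneity is restored by
  \<open>ennreal_scaling_bound\<close>.\<close>

definition unit_profile :: "nat \<Rightarrow> real \<Rightarrow> (real \<Rightarrow> real) \<Rightarrow> bool" where
  "unit_profile d p g \<longleftrightarrow> g \<in> borel_measurable borel \<and> (\<forall>s. 0 \<le> g s) \<and>
     (\<integral>\<^sup>+s. ennreal (g s powr p * s ^ (d - 1)) * indicator {0<..} s \<partial>lborel) \<le> 1"

text \<open>The support of the kernel is t plus or minus r. It is widened by half of r on each side
  so that t may be moved to a nearby rational number, which keeps the supremum countable and hence
  Borel. The factor 2 / r dominates 1/r + 1/t.\<close>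

definition near_majorant :: "(real \<Rightarrow> real) \<Rightarrow> real \<Rightarrow> ennreal" where
  "near_majorant g r = (SUP t\<in>\<rat> \<inter> {1..2}. ennreal (2 / r) *
     (\<integral>\<^sup>+s. ennreal (g s) * indicator {t - 3/2 * r<..<t + 3/2 * r} s \<partial>lborel))"

text \<open>D will be the distance to E. The upper limit 6 is the largest r + t for r \<le> 4 and t
  \<le> 2, and the constant is that of \<open>radial_kernel_le_power\<close>.\<close>

definition mid_majorant :: "nat \<Rightarrow> (real \<Rightarrow> real) \<Rightarrow> (real \<Rightarrow> real) \<Rightarrow> real \<Rightarrow> ennreal" where
  "mid_majorant d D g r = ennreal (2 * 6 ^ (d - 3)) *
     (\<integral>\<^sup>+s. ennreal (g s * s ^ (d - 2)) * indicator {D r<..<6} s \<partial>lborel)"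

text \<open>For r \<ge> 4 the kernel is at most 1/r + 1/t \<le> 2, and its support lies within
  distance 2 of r.\<close>

definition far_majorant :: "(real \<Rightarrow> real) \<Rightarrow> real \<Rightarrow> ennreal" where
  "far_majorant g r = 2 * (\<integral>\<^sup>+s. ennreal (g s) * indicator {r - 2<..<r + 2} s \<partial>lborel)"

lemma pred_interval_measurable:
  fixes a b :: "real \<Rightarrow> real"
  assumes [measurable]: "a \<in> borel_measurable borel" "b \<in> borel_measurable borel"
  shows "Measurable.pred (borel \<Otimes>\<^sub>M borel) (\<lambda>x. snd x \<in> {a (fst x)<..<b (fst x)})"
  unfolding greaterThanLessThan_iff by measurable

lemma nn_integral_interval_measurable:
  fixes a b g :: "real \<Rightarrow> real"
  assumes [measurable]: "a \<in> borel_measurable borel" "b \<in> borel_measurable borel" "g \<in> borel_measurable borel"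
  shows "(\<lambda>r. \<integral>\<^sup>+s. ennreal (g s) * indicator {a r<..<b r} s \<partial>lborel) \<in> borel_measurable borel"
proof -
  note pred_interval_measurable[OF assms(1,2), measurable]
  show ?thesis by measurable
qed

lemma majorants_measurable:
  assumes [measurable]: "g \<in> borel_measurable borel" "D \<in> borel_measurable borel"
  shows near_majorant_measurable: "near_majorant g \<in> borel_measurable borel"
    and mid_majorant_measurable: "mid_majorant d D g \<in> borel_measurable borel"
    and far_majorant_measurable: "far_majorant g \<in> borel_measurable borel"
proof -
  have [measurable]: "(\<lambda>r. \<integral>\<^sup>+s. ennreal (g s) * indicator {t - 3/2 * r<..<t + 3/2 * r} s \<partial>lborel) \<in> borel_measurable borel" for t
    by (rule nn_integral_interval_measurable) measurable
  have [measurable]: "(\<lambda>r. \<integral>\<^sup>+s. ennreal (g s * s ^ (d - 2)) * indicator {D r<..<6} s \<partial>lborel) \<in> borel_measurable borel"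
    by (rule nn_integral_interval_measurable) measurable
  have [measurable]: "(\<lambda>r. \<integral>\<^sup>+s. ennreal (g s) * indicator {r - 2<..<r + 2} s \<partial>lborel) \<in> borel_measurable borel"
    by (rule nn_integral_interval_measurable) measurable
  have "countable (\<rat> \<inter> {1..2::real})" by (intro countable_Int1 countable_rat)
  thus "near_majorant g \<in> borel_measurable borel"
    unfolding near_majorant_def[abs_def] by (intro borel_measurable_SUP) measurable
  show "mid_majorant d D g \<in> borel_measurable borel" unfolding mid_majorant_def[abs_def] by measurable
  show "far_majorant g \<in> borel_measurable borel" unfolding far_majorant_def[abs_def] by measurable
qed

context
  fixes d :: nat and p q :: real
  assumes d: "2 \<le> d" and pq: "p \<le> q"
begin

lemma far_majorant_Jensen:
  assumes p: "1 \<le> p" and [measurable]: "g \<in> borel_measurable borel" and g: "\<And>s. 0 \<le> g s"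
  shows "ennreal_powr (\<integral>\<^sup>+s. ennreal (g s) * indicator {r - 2<..<r + 2::real} s \<partial>lborel) p
    \<le> ennreal (4 powr (p - 1)) * (\<integral>\<^sup>+s. ennreal (g s powr p) * indicator {r - 2<..<r + 2} s \<partial>lborel)"
proof (cases "p = 1")
  case True
  thus ?thesis using g by simp
next
  case False
  with p have p1: "1 < p" by simp
  define p' where "p' = p / (p - 1)"
  have p'1: "1 < p'" using p1 by (simp add: p'_def field_simps)
  have pp': "p / p' = p - 1" using p1 by (simp add: p'_def field_simps)
  define J where "J = {r - 2<..<r + 2}"
  have [measurable]: "J \<in> sets borel" by (simp add: J_def)
  have i: "ennreal_powr (indicator J s) p' = indicator J s" for s by (auto simp: indicator_def)
  have "ennreal_powr (\<integral>\<^sup>+s. (ennreal (g s) * indicator J s) * indicator J s \<partial>lborel) p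
    \<le> ennreal ((4 powr (1 / p')) powr p) * (\<integral>\<^sup>+s. ennreal_powr (ennreal (g s) * indicator J s) p \<partial>lborel)"
  proof (rule nn_integral_Hoelder_powr[OF _ _ p1 p'_def])
    show "(\<integral>\<^sup>+s. ennreal_powr (indicator J s) p' \<partial>lborel) \<le> ennreal ((4 powr (1 / p')) powr p')"
      unfolding i using p'1 by (simp add: J_def powr_powr)
  qed auto
  moreover have "(ennreal (g s) * indicator J s) * indicator J s = ennreal (g s) * indicator J s" for s
    by (simp add: indicator_def)
  moreover have "ennreal_powr (ennreal (g s) * indicator J s) p = ennreal (g s powr p) * indicator J s" for s
    using g by (simp add: indicator_def)
  ultimately show ?thesis using pp' by (simp add: J_def powr_powr)
qed

text \<open>Jensen and the normalization give a uniform bound for the local integral Y, so Y^q \<le>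
  c^(q-p) Y^p; this is where p \<le> q enters. The p-th power is then integrated by Fubini.\<close>

lemma far_majorant_bound:
  assumes p: "1 \<le> p"
  shows "\<exists>K\<ge>0. \<forall>g. unit_profile d p g \<longrightarrow>
     (\<integral>\<^sup>+r. ennreal_powr (far_majorant g r) q * ennreal (r ^ (d - 1)) * indicator {4..} r \<partial>lborel) \<le> ennreal K"
proof -
  define c where "c = 4 powr ((p - 1) / p)"
  define K where "K = 2 powr q * 4 powr (p - 1) * c powr (q - p) * 2 ^ (d - 1) * 4"
  have c: "0 < c" by (simp add: c_def)
  have "\<forall>g. unit_profile d p g \<longrightarrow>
     (\<integral>\<^sup>+r. ennreal_powr (far_majorant g r) q * ennreal (r ^ (d - 1)) * indicator {4..} r \<partial>lborel) \<le> ennreal K"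
  proof (intro allI impI)
    fix g assume "unit_profile d p g"
    hence [measurable]: "g \<in> borel_measurable borel" and g: "\<And>s. 0 \<le> g s"
      and N: "(\<integral>\<^sup>+s. ennreal (g s powr p * s ^ (d - 1)) * indicator {0<..} s \<partial>lborel) \<le> 1"
      by (auto simp: unit_profile_def)
    define Y where "Y = (\<lambda>r::real. \<integral>\<^sup>+s. ennreal (g s) * indicator {r - 2<..<r + 2} s \<partial>lborel)"
    define Z where "Z = (\<lambda>r::real. \<integral>\<^sup>+s. ennreal (g s powr p) * indicator {r - 2<..<r + 2} s \<partial>lborel)"
    define k where "k = 2 powr q * 4 powr (p - 1) * c powr (q - p)"
    have J: "ennreal_powr (Y r) p \<le> ennreal (4 powr (p - 1)) * Z r" for r
      unfolding Y_def Z_def by (rule far_majorant_Jensen[OF p _ g]) measurable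
    have bound: "ennreal_powr (far_majorant g r) q \<le> ennreal k * Z r" if r: "4 \<le> r" for r
    proof -
      have "Z r \<le> (\<integral>\<^sup>+s. ennreal (g s powr p * s ^ (d - 1)) * indicator {0<..} s \<partial>lborel)"
        unfolding Z_def
      proof (rule nn_integral_mono)
        fix s
        have "g s powr p * 1 \<le> g s powr p * s ^ (d - 1)" if "r - 2 < s"
          using that r by (intro mult_left_mono one_le_power) auto
        thus "ennreal (g s powr p) * indicator {r - 2<..<r + 2} s \<le> ennreal (g s powr p * s ^ (d - 1)) * indicator {0<..} s"
          using r by (auto simp: indicator_def intro!: ennreal_leI)
      qed
      hence "Z r \<le> 1" using N by (rule order_trans)
      hence "ennreal (4 powr (p - 1)) * Z r \<le> ennreal (4 powr (p - 1)) * 1" by (rule mult_left_mono) simp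
      moreover have "4 powr (p - 1) = c powr p" using p by (simp add: c_def powr_powr)
      ultimately have "ennreal_powr (Y r) p \<le> ennreal (c powr p)" using J[of r] by simp
      hence Yc: "Y r \<le> ennreal c" by (rule ennreal_powr_le_imp) (use p c in auto)
      have "ennreal_powr (far_majorant g r) q = ennreal_powr (ennreal 2) q * ennreal_powr (Y r) q"
        using p pq by (simp add: far_majorant_def Y_def ennreal_powr_mult del: ennreal_powr_ennreal)
      also have "\<dots> = ennreal (2 powr q) * (ennreal_powr (Y r) p * ennreal_powr (Y r) (q - p))"
        using ennreal_powr_add[of p "q - p" "Y r"] ennreal_powr_ennreal[of 2 q] p pq by simp
      also have "\<dots> \<le> ennreal (2 powr q) * ((ennreal (4 powr (p - 1)) * Z r) * ennreal_powr (ennreal c) (q - p))"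
        using pq by (intro mult_left_mono mult_mono J ennreal_powr_mono Yc) auto
      also have "\<dots> = ennreal k * Z r"
        using c by (simp add: k_def ennreal_mult mult_ac)
      finally show ?thesis .
    qed
    have "(\<integral>\<^sup>+r. ennreal_powr (far_majorant g r) q * ennreal (r ^ (d - 1)) * indicator {4..} r \<partial>lborel)
      \<le> (\<integral>\<^sup>+r. (\<integral>\<^sup>+s. ennreal (k * 2 ^ (d - 1)) * (ennreal (g s powr p * s ^ (d - 1)) * indicator {0<..} s) *
             (if s - 2 < r \<and> r < s + 2 then 1 else 0) \<partial>lborel) \<partial>lborel)"
    proof (rule nn_integral_mono)
      fix r :: real
      show "ennreal_powr (far_majorant g r) q * ennreal (r ^ (d - 1)) * indicator {4..} r \<le>
        (\<integral>\<^sup>+s. ennreal (k * 2 ^ (d - 1)) * (ennreal (g s powr p * s ^ (d - 1)) * indicator {0<..} s) *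
             (if s - 2 < r \<and> r < s + 2 then 1 else 0) \<partial>lborel)"
      proof (cases "4 \<le> r")
        case True
        have "ennreal_powr (far_majorant g r) q * ennreal (r ^ (d - 1)) * indicator {4..} r \<le> ennreal k * Z r * ennreal (r ^ (d - 1))"
          using bound[OF True] True by (simp add: mult_right_mono)
        also have "\<dots> = (\<integral>\<^sup>+s. ennreal (k * r ^ (d - 1)) * (ennreal (g s powr p) * indicator {r - 2<..<r + 2} s) \<partial>lborel)"
          using True by (subst nn_integral_cmult) (auto simp: Z_def k_def ennreal_mult mult_ac)
        also have "\<dots> \<le> (\<integral>\<^sup>+s. ennreal (k * 2 ^ (d - 1)) * (ennreal (g s powr p * s ^ (d - 1)) * indicator {0<..} s) *
             (if s - 2 < r \<and> r < s + 2 then 1 else 0) \<partial>lborel)"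
        proof (rule nn_integral_mono)
          fix s
          have "k * r ^ (d - 1) * g s powr p \<le> k * 2 ^ (d - 1) * (g s powr p * s ^ (d - 1))" if s: "r - 2 < s"
          proof -
            \<comment> \<open>From r \<ge> 4 and s > r - 2 it follows that r < 2 s, so the weights
              at r and s are comparable.\<close>
            have "r ^ (d - 1) \<le> (2 * s) ^ (d - 1)" using s True by (intro power_mono) auto
            hence "(k * g s powr p) * r ^ (d - 1) \<le> (k * g s powr p) * (2 * s) ^ (d - 1)"
              by (intro mult_left_mono) (auto simp: k_def)
            thus ?thesis by (simp add: power_mult_distrib mult_ac)
          qed
          thus "ennreal (k * r ^ (d - 1)) * (ennreal (g s powr p) * indicator {r - 2<..<r + 2} s) \<le>
             ennreal (k * 2 ^ (d - 1)) * (ennreal (g s powr p * s ^ (d - 1)) * indicator {0<..} s) *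
             (if s - 2 < r \<and> r < s + 2 then 1 else 0)"
            using True by (auto simp: indicator_def k_def ennreal_mult''[symmetric] intro!: ennreal_leI)
        qed
        finally show ?thesis .
      qed simp
    qed
    also have "\<dots> = (\<integral>\<^sup>+s. (\<integral>\<^sup>+r. ennreal (k * 2 ^ (d - 1)) * (ennreal (g s powr p * s ^ (d - 1)) * indicator {0<..} s) *
             (if s - 2 < r \<and> r < s + 2 then 1 else 0) \<partial>lborel) \<partial>lborel)"
      by (rule lborel_pair.Fubini') measurable
    also have "\<dots> = (\<integral>\<^sup>+s. ennreal (k * 2 ^ (d - 1)) * 4 * (ennreal (g s powr p * s ^ (d - 1)) * indicator {0<..} s) \<partial>lborel)"
    proof (rule nn_integral_cong)
      fix s :: real
      have "(\<integral>\<^sup>+r. ennreal (k * 2 ^ (d - 1)) * (ennreal (g s powr p * s ^ (d - 1)) * indicator {0<..} s) *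
             (if s - 2 < r \<and> r < s + 2 then 1 else 0) \<partial>lborel)
        = ennreal (k * 2 ^ (d - 1)) * (ennreal (g s powr p * s ^ (d - 1)) * indicator {0<..} s) *
          (\<integral>\<^sup>+r. indicator {s - 2<..<s + 2} r \<partial>lborel)"
        by (subst nn_integral_cmult[symmetric]) (auto intro!: nn_integral_cong simp: indicator_def)
      also have "(\<integral>\<^sup>+r. indicator {s - 2<..<s + 2} r \<partial>lborel) = ennreal 4" by simp
      finally show "(\<integral>\<^sup>+r. ennreal (k * 2 ^ (d - 1)) * (ennreal (g s powr p * s ^ (d - 1)) * indicator {0<..} s) *
             (if s - 2 < r \<and> r < s + 2 then 1 else 0) \<partial>lborel) =
        ennreal (k * 2 ^ (d - 1)) * 4 * (ennreal (g s powr p * s ^ (d - 1)) * indicator {0<..} s)"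
        by (simp add: mult_ac)
    qed
    also have "\<dots> = ennreal (k * 2 ^ (d - 1)) * 4 * (\<integral>\<^sup>+s. ennreal (g s powr p * s ^ (d - 1)) * indicator {0<..} s \<partial>lborel)"
      by (rule nn_integral_cmult) measurable
    also have "\<dots> \<le> ennreal (k * 2 ^ (d - 1)) * 4 * 1" using N by (rule mult_left_mono) simp
    also have "\<dots> = ennreal K"
    proof -
      have "ennreal K = ennreal (k * 2 ^ (d - 1)) * ennreal 4" unfolding K_def k_def by (rule ennreal_mult'') simp
      thus ?thesis by simp
    qed
    finally show "(\<integral>\<^sup>+r. ennreal_powr (far_majorant g r) q * ennreal (r ^ (d - 1)) * indicator {4..} r \<partial>lborel) \<le> ennreal K" .
  qed
  moreover have "0 \<le> K" by (simp add: K_def)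
  ultimately show ?thesis by blast
qed

lemma mid_majorant_bound:
  assumes p: "1 \<le> p" and [measurable]: "D \<in> borel_measurable borel"
    and hardy: "\<exists>K\<ge>0. \<forall>g. unit_profile d p g \<longrightarrow>
      (\<integral>\<^sup>+r. ennreal_powr (\<integral>\<^sup>+s. ennreal (g s * s ^ (d - 2)) * indicator {D r<..<6} s \<partial>lborel) q * indicator {1/2..4} r \<partial>lborel) \<le> ennreal K"
  shows "\<exists>K\<ge>0. \<forall>g. unit_profile d p g \<longrightarrow>
     (\<integral>\<^sup>+r. ennreal_powr (mid_majorant d D g r) q * ennreal (r ^ (d - 1)) * indicator {1/2..<4} r \<partial>lborel) \<le> ennreal K"
proof -
  from hardy obtain K where K: "0 \<le> K" and KH: "\<And>g. unit_profile d p g \<Longrightarrow>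
      (\<integral>\<^sup>+r. ennreal_powr (\<integral>\<^sup>+s. ennreal (g s * s ^ (d - 2)) * indicator {D r<..<6} s \<partial>lborel) q * indicator {1/2..4} r \<partial>lborel) \<le> ennreal K"
    by blast
  define c where "c = (2 * 6 ^ (d - 3)) powr q * 4 ^ (d - 1)"
  have c: "0 \<le> c" by (simp add: c_def)
  have "(\<integral>\<^sup>+r. ennreal_powr (mid_majorant d D g r) q * ennreal (r ^ (d - 1)) * indicator {1/2..<4} r \<partial>lborel) \<le> ennreal (c * K)"
    if g: "unit_profile d p g" for g
  proof -
    have [measurable]: "g \<in> borel_measurable borel" using g by (simp add: unit_profile_def)
    define T where "T = (\<lambda>r. \<integral>\<^sup>+s. ennreal (g s * s ^ (d - 2)) * indicator {D r<..<6} s \<partial>lborel)"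
    have [measurable]: "T \<in> borel_measurable borel"
      unfolding T_def by (rule nn_integral_interval_measurable) measurable
    have "(\<integral>\<^sup>+r. ennreal_powr (mid_majorant d D g r) q * ennreal (r ^ (d - 1)) * indicator {1/2..<4} r \<partial>lborel)
      \<le> (\<integral>\<^sup>+r. ennreal c * (ennreal_powr (T r) q * indicator {1/2..4} r) \<partial>lborel)"
    proof (rule nn_integral_mono)
      fix r :: real
      show "ennreal_powr (mid_majorant d D g r) q * ennreal (r ^ (d - 1)) * indicator {1/2..<4} r
        \<le> ennreal c * (ennreal_powr (T r) q * indicator {1/2..4} r)"
      proof (cases "r \<in> {1/2..<4}")
        case True
        have "ennreal (r ^ (d - 1)) \<le> ennreal (4 ^ (d - 1))" using True by (intro ennreal_leI power_mono) auto
        hence "ennreal_powr (T r) q * ennreal ((2 * 6 ^ (d - 3)) powr q) * ennreal (r ^ (d - 1))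
          \<le> ennreal_powr (T r) q * ennreal ((2 * 6 ^ (d - 3)) powr q) * ennreal (4 ^ (d - 1))"
          by (rule mult_left_mono) simp
        moreover have "ennreal_powr (mid_majorant d D g r) q = ennreal ((2 * 6 ^ (d - 3)) powr q) * ennreal_powr (T r) q"
          using p pq by (simp add: mid_majorant_def T_def ennreal_powr_mult)
        moreover have "ennreal c = ennreal ((2 * 6 ^ (d - 3)) powr q) * ennreal (4 ^ (d - 1))"
          unfolding c_def by (rule ennreal_mult) auto
        ultimately show ?thesis using True by (simp add: mult_ac)
      qed simp
    qed
    also have "\<dots> = ennreal c * (\<integral>\<^sup>+r. ennreal_powr (T r) q * indicator {1/2..4} r \<partial>lborel)"
      by (rule nn_integral_cmult) measurable
    also have "\<dots> \<le> ennreal c * ennreal K" using KH[OF g] unfolding T_def by (rule mult_left_mono) simp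
    also have "\<dots> = ennreal (c * K)" using c by (simp add: ennreal_mult')
    finally show ?thesis .
  qed
  thus ?thesis using c K by (intro exI[of _ "c * K"]) auto
qed

text \<open>Two bounds are multiplied. The Marcinkiewicz argument gives a strong L^p bound in r
  without weight, and Hoelder on a window of length 3 r gives the size r^(-1/p). Using the latter
  for the power q - p leaves r^(d - 1 - (q-p)/p), bounded near 0 because q \<le> d p. The endpoint q
  = d p is thereby included.\<close>

lemma near_majorant_bound_p_gt_1:
  assumes p: "1 < p" and q: "q \<le> d * p"
  shows "\<exists>K\<ge>0. \<forall>g. unit_profile d p g \<longrightarrow>
     (\<integral>\<^sup>+r. ennreal_powr (near_majorant g r) q * ennreal (r ^ (d - 1)) * indicator {0<..<1/2} r \<partial>lborel) \<le> ennreal K"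
proof -
  define p' where "p' = p / (p - 1)"
  have p'1: "1 < p'" using p by (simp add: p'_def field_simps)
  have pp': "1 / p' = 1 - 1 / p" using p by (simp add: p'_def field_simps)
  \<comment> \<open>All windows lie in (1/4, 3), where every power of s is comparable to 1; the
    absolute value covers both signs of the exponent.\<close>
  define a where "a = 4 powr \<bar>real d - 1 - p'\<bar>"
  define C where "C = 2 * 4 ^ (d - 2) * (3 * a) powr (1 / p')"
  define k where "k = 4 * p * 12 powr (p - 1) / (p - 1) * 4 ^ (d - 1)"
  have a0: "0 < a" by (simp add: a_def)
  have C0: "0 < C" using a0 by (simp add: C_def)
  have k0: "0 \<le> k" using p by (simp add: k_def)
  have "(\<integral>\<^sup>+r. ennreal_powr (near_majorant g r) q * ennreal (r ^ (d - 1)) * indicator {0<..<1/2} r \<partial>lborel) \<le> ennreal (C powr (q - p) * k)"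
    if ug: "unit_profile d p g" for g
  proof -
    from ug have [measurable]: "g \<in> borel_measurable borel" and g: "\<And>s. 0 \<le> g s"
      and N: "(\<integral>\<^sup>+s. ennreal (g s powr p * s ^ (d - 1)) * indicator {0<..} s \<partial>lborel) \<le> 1"
      by (auto simp: unit_profile_def)
    have [measurable]: "near_majorant g \<in> borel_measurable borel" by (rule near_majorant_measurable) measurable
    define G where "G = (\<lambda>s. g s * indicator {1/4<..<3} s)"
    have G[measurable]: "G \<in> borel_measurable borel" and G0: "\<And>s. 0 \<le> G s" using g by (auto simp: G_def)
    define J where "J = (\<lambda>t r::real. {t - 3/2 * r<..<t + 3/2 * r})"
    have [measurable]: "J t r \<in> sets borel" for t r by (simp add: J_def)
    have J: "1/4 < s" "s < 3" if "s \<in> J t r" "r < 1/2" "1 \<le> t" "t \<le> 2" for s t r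
      using that by (auto simp: J_def)
    have gG: "(\<integral>\<^sup>+s. ennreal (g s) * indicator {t - 3/2 * r<..<t + 3/2 * r} s \<partial>lborel) = (\<integral>\<^sup>+s. ennreal (G s) * indicator (J t r) s \<partial>lborel)"
      if "r < 1/2" "1 \<le> t" "t \<le> 2" for t r
    proof (rule nn_integral_cong)
      fix s
      show "ennreal (g s) * indicator {t - 3/2 * r<..<t + 3/2 * r} s = ennreal (G s) * indicator (J t r) s"
        using J[of s t r] that by (cases "s \<in> J t r") (simp_all add: G_def J_def indicator_def)
    qed
    have size: "near_majorant g r \<le> ennreal (C * r powr (- (1 / p)))" if r: "0 < r" "r < 1/2" for r
      unfolding near_majorant_def
    proof (rule SUP_least)
      fix t :: real assume "t \<in> \<rat> \<inter> {1..2}"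
      hence t: "1 \<le> t" "t \<le> 2" by auto
      define B where "B = (3 * a * r) powr (1 / p')"
      have B0: "0 < B" using a0 r by (simp add: B_def)
      have "(\<integral>\<^sup>+s. ennreal (s powr (real d - 1 - p')) * indicator (J t r) s \<partial>lborel) \<le> (\<integral>\<^sup>+s. ennreal a * indicator (J t r) s \<partial>lborel)"
      proof (rule nn_integral_mono)
        fix s
        have "s powr (real d - 1 - p') \<le> a" if s: "s \<in> J t r"
        proof (cases "1 \<le> s")
          case True
          have "s powr (real d - 1 - p') \<le> s powr \<bar>real d - 1 - p'\<bar>" using True by (intro powr_mono) auto
          also have "\<dots> \<le> 4 powr \<bar>real d - 1 - p'\<bar>" using J[OF s r(2) t] by (intro powr_mono2) auto
          finally show ?thesis by (simp add: a_def)
        next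
          case False
          have s4: "1/4 < s" using J[OF s r(2) t] by simp
          have "s powr (real d - 1 - p') \<le> s powr (- \<bar>real d - 1 - p'\<bar>)" using False s4 by (intro powr_mono') auto
          also have "\<dots> \<le> (1/4) powr (- \<bar>real d - 1 - p'\<bar>)" using s4 by (intro powr_mono2') auto
          also have "\<dots> = a" by (simp add: a_def powr_minus powr_divide)
          finally show ?thesis .
        qed
        thus "ennreal (s powr (real d - 1 - p')) * indicator (J t r) s \<le> ennreal a * indicator (J t r) s"
          by (auto simp: indicator_def intro: ennreal_leI)
      qed
      also have "\<dots> = ennreal a * ennreal (3 * r)" using r by (simp add: nn_integral_cmult J_def)
      also have "\<dots> = ennreal (B powr p')"
        using r a0 p'1 by (simp add: B_def powr_powr ennreal_mult'[symmetric] mult_ac)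
      finally have "(\<integral>\<^sup>+s. ennreal (g s * s ^ (d - 2)) * indicator (J t r) s \<partial>lborel) \<le> ennreal B"
        using J[OF _ r(2) t] by (intro hardy_Hoelder_one[OF _ _ p p'_def d g _ N B0]) (auto intro: less_trans[of 0 "1/4"])
      hence b1: "ennreal (2 / r * 4 ^ (d - 2)) * (\<integral>\<^sup>+s. ennreal (g s * s ^ (d - 2)) * indicator (J t r) s \<partial>lborel)
        \<le> ennreal (2 / r * 4 ^ (d - 2)) * ennreal B" by (rule mult_left_mono) simp
      have b2: "ennreal (2 / r * 4 ^ (d - 2)) * ennreal B = ennreal (C * r powr (- (1 / p)))"
      proof -
        have "2 / r * 4 ^ (d - 2) * B = C * (r powr (1 / p') / r)"
          using r a0 by (simp add: B_def C_def powr_mult field_simps)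
        also have "r powr (1 / p') / r = r powr (- (1 / p))"
          using r unfolding pp' by (simp add: powr_diff powr_minus field_simps)
        finally show ?thesis using r B0 by (simp add: ennreal_mult'[symmetric])
      qed
      have "ennreal (2 / r) * (\<integral>\<^sup>+s. ennreal (g s) * indicator {t - 3/2 * r<..<t + 3/2 * r} s \<partial>lborel)
         \<le> ennreal (2 / r * 4 ^ (d - 2)) * (\<integral>\<^sup>+s. ennreal (g s * s ^ (d - 2)) * indicator (J t r) s \<partial>lborel)"
      proof -
        have "(\<integral>\<^sup>+s. ennreal (g s) * indicator (J t r) s \<partial>lborel) \<le> (\<integral>\<^sup>+s. ennreal (4 ^ (d - 2)) * (ennreal (g s * s ^ (d - 2)) * indicator (J t r) s) \<partial>lborel)"
        proof (rule nn_integral_mono)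
          fix s
          have "g s \<le> 4 ^ (d - 2) * (g s * s ^ (d - 2))" if "s \<in> J t r"
          proof -
            have "1 \<le> (4 * s) ^ (d - 2)" using J[OF that r(2) t] by (intro one_le_power) auto
            hence "g s * 1 \<le> g s * (4 * s) ^ (d - 2)" using g[of s] by (intro mult_left_mono) auto
            thus ?thesis by (simp add: power_mult_distrib mult_ac)
          qed
          thus "ennreal (g s) * indicator (J t r) s \<le> ennreal (4 ^ (d - 2)) * (ennreal (g s * s ^ (d - 2)) * indicator (J t r) s)"
            by (auto simp: indicator_def ennreal_mult'[symmetric] intro: ennreal_leI)
        qed
        also have "\<dots> = ennreal (4 ^ (d - 2)) * (\<integral>\<^sup>+s. ennreal (g s * s ^ (d - 2)) * indicator (J t r) s \<partial>lborel)"
          by (rule nn_integral_cmult) measurable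
        finally have "ennreal (2 / r) * (\<integral>\<^sup>+s. ennreal (g s) * indicator (J t r) s \<partial>lborel) \<le>
          ennreal (2 / r) * (ennreal (4 ^ (d - 2)) * (\<integral>\<^sup>+s. ennreal (g s * s ^ (d - 2)) * indicator (J t r) s \<partial>lborel))"
          by (rule mult_left_mono) simp
        also have "\<dots> = ennreal (2 / r * 4 ^ (d - 2)) * (\<integral>\<^sup>+s. ennreal (g s * s ^ (d - 2)) * indicator (J t r) s \<partial>lborel)"
          using r by (subst ennreal_mult) (auto simp: mult.assoc)
        finally show ?thesis by (simp add: J_def)
      qed
      from order_trans[OF this b1[unfolded b2]] show "ennreal (2 / r) * (\<integral>\<^sup>+s. ennreal (g s) * indicator {t - 3/2 * r<..<t + 3/2 * r} s \<partial>lborel)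
         \<le> ennreal (C * r powr (- (1 / p)))" .
    qed
    \<comment> \<open>The part of G below l / 12 contributes at most (2/r) (l/12) (3r) = l/2 to the
      average over a window. It is absorbed on the left, and the other half gives the constant
      4.\<close>
    have weak: "ennreal (l * r) \<le> ennreal 4 * (\<integral>\<^sup>+s. ennreal (G s) * indicator {s. l < 12 * G s} s \<partial>lborel)"
      if r: "r \<in> {0<..<1/2}" and l: "0 < l" "ennreal l < near_majorant g r" for r l
    proof -
      define \<Phi> where "\<Phi> = (\<integral>\<^sup>+s. ennreal (G s) * indicator {s. l < 12 * G s} s \<partial>lborel)"
      from l(2) obtain t :: real where t: "1 \<le> t" "t \<le> 2"
        and less: "ennreal l < ennreal (2 / r) * (\<integral>\<^sup>+s. ennreal (g s) * indicator {t - 3/2 * r<..<t + 3/2 * r} s \<partial>lborel)"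
        unfolding near_majorant_def less_SUP_iff by auto
      have "(\<integral>\<^sup>+s. ennreal (G s) * indicator (J t r) s \<partial>lborel)
        \<le> (\<integral>\<^sup>+s. ennreal (G s) * indicator {s. l < 12 * G s} s + ennreal (l / 12) * indicator (J t r) s \<partial>lborel)"
        by (intro nn_integral_mono) (auto simp: indicator_def not_less intro: ennreal_leI)
      also have "\<dots> = \<Phi> + (\<integral>\<^sup>+s. ennreal (l / 12) * indicator (J t r) s \<partial>lborel)"
        unfolding \<Phi>_def by (rule nn_integral_add) measurable
      also have "(\<integral>\<^sup>+s. ennreal (l / 12) * indicator (J t r) s \<partial>lborel) = ennreal (l / 12) * ennreal (3 * r)"
        using r by (simp add: nn_integral_cmult J_def)
      also have "\<dots> = ennreal (l * r / 4)" using l r by (simp add: ennreal_mult'[symmetric])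
      finally have le: "(\<integral>\<^sup>+s. ennreal (G s) * indicator (J t r) s \<partial>lborel) \<le> \<Phi> + ennreal (l * r / 4)" .
      have "ennreal (2 / r) * (\<integral>\<^sup>+s. ennreal (g s) * indicator {t - 3/2 * r<..<t + 3/2 * r} s \<partial>lborel)
        \<le> ennreal (2 / r) * (\<Phi> + ennreal (l * r / 4))"
        using le r t by (subst gG) (auto intro: mult_left_mono)
      with less have less: "ennreal l < ennreal (2 / r) * (\<Phi> + ennreal (l * r / 4))" by (rule less_le_trans)
      show ?thesis
      proof (cases \<Phi>)
        case (real c)
        have "ennreal l < ennreal (2 / r * (c + l * r / 4))"
          using less real l r by (simp add: ennreal_plus[symmetric] ennreal_mult'[symmetric] del: ennreal_plus)
        hence "l < 2 / r * (c + l * r / 4)" using l by (simp add: ennreal_less_iff)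
        hence "l * r \<le> 4 * c" using r by (simp add: field_simps)
        hence "ennreal (l * r) \<le> ennreal 4 * ennreal c" using real by (simp add: ennreal_mult'[symmetric] ennreal_leI del: ennreal_numeral)
        thus ?thesis using real by (simp add: \<Phi>_def)
      next
        case top
        thus ?thesis by (simp add: \<Phi>_def ennreal_mult_top)
      qed
    qed
    have GP: "(\<integral>\<^sup>+s. ennreal (G s powr p) \<partial>lborel) \<le> ennreal (4 ^ (d - 1))"
    proof -
      have "(\<integral>\<^sup>+s. ennreal (G s powr p) \<partial>lborel) \<le> (\<integral>\<^sup>+s. ennreal (4 ^ (d - 1)) * (ennreal (g s powr p * s ^ (d - 1)) * indicator {0<..} s) \<partial>lborel)"
      proof (rule nn_integral_mono)
        fix s :: real
        have "g s powr p \<le> 4 ^ (d - 1) * (g s powr p * s ^ (d - 1))" if "1/4 < s"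
        proof -
          have "1 \<le> (4 * s) ^ (d - 1)" using that by (intro one_le_power) auto
          hence "g s powr p * 1 \<le> g s powr p * (4 * s) ^ (d - 1)" by (intro mult_left_mono) auto
          thus ?thesis by (simp add: power_mult_distrib mult_ac)
        qed
        thus "ennreal (G s powr p) \<le> ennreal (4 ^ (d - 1)) * (ennreal (g s powr p * s ^ (d - 1)) * indicator {0<..} s)"
          using p by (auto simp: G_def indicator_def ennreal_mult'[symmetric] intro!: ennreal_leI)
      qed
      also have "\<dots> = ennreal (4 ^ (d - 1)) * (\<integral>\<^sup>+s. ennreal (g s powr p * s ^ (d - 1)) * indicator {0<..} s \<partial>lborel)"
        by (rule nn_integral_cmult) measurable
      also have "\<dots> \<le> ennreal (4 ^ (d - 1)) * 1" using N by (rule mult_left_mono) simp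
      finally show ?thesis by simp
    qed
    have "(\<integral>\<^sup>+r. ennreal_powr (near_majorant g r) p * indicator {0<..<1/2} r \<partial>lborel)
      \<le> ennreal (4 * p * 12 powr (p - 1) / (p - 1)) * (\<integral>\<^sup>+s. ennreal (G s powr p) \<partial>lborel)"
      by (rule nn_integral_weak_type_powr_le[OF _ G _ G0 p _ _ _ weak]) auto
    also have "\<dots> \<le> ennreal (4 * p * 12 powr (p - 1) / (p - 1)) * ennreal (4 ^ (d - 1))"
      using GP by (rule mult_left_mono) simp
    also have "\<dots> = ennreal k" unfolding k_def using p by (intro ennreal_mult[symmetric]) auto
    finally have strong: "(\<integral>\<^sup>+r. ennreal_powr (near_majorant g r) p * indicator {0<..<1/2} r \<partial>lborel) \<le> ennreal k" .
    have "(\<integral>\<^sup>+r. ennreal_powr (near_majorant g r) q * ennreal (r ^ (d - 1)) * indicator {0<..<1/2} r \<partial>lborel)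
      \<le> (\<integral>\<^sup>+r. ennreal (C powr (q - p)) * (ennreal_powr (near_majorant g r) p * indicator {0<..<1/2} r) \<partial>lborel)"
    proof (rule nn_integral_mono)
      fix r :: real
      show "ennreal_powr (near_majorant g r) q * ennreal (r ^ (d - 1)) * indicator {0<..<1/2} r \<le>
        ennreal (C powr (q - p)) * (ennreal_powr (near_majorant g r) p * indicator {0<..<1/2} r)"
      proof (cases "r \<in> {0<..<1/2}")
        case True
        hence r: "0 < r" "r < 1/2" by auto
        have "ennreal_powr (near_majorant g r) (q - p) \<le> ennreal_powr (ennreal (C * r powr (- (1 / p)))) (q - p)"
          using pq by (intro ennreal_powr_mono size r) auto
        also have "\<dots> = ennreal (C powr (q - p) * r powr (- ((q - p) / p)))"
          using C0 r by (simp add: powr_mult powr_powr)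
        finally have "ennreal_powr (near_majorant g r) (q - p) * ennreal (r ^ (d - 1))
           \<le> ennreal (C powr (q - p) * r powr (- ((q - p) / p))) * ennreal (r ^ (d - 1))" by (rule mult_right_mono) simp
        also have "\<dots> = ennreal (C powr (q - p) * (r powr (- ((q - p) / p)) * r powr (real d - 1)))"
          using r d by (simp add: ennreal_mult'[symmetric] powr_realpow[symmetric] of_nat_diff mult.assoc)
        also have "\<dots> \<le> ennreal (C powr (q - p) * 1)"
        proof (intro ennreal_leI mult_left_mono)
          have "q / p \<le> real d" using q p by (simp add: field_simps)
          hence e: "0 \<le> - ((q - p) / p) + (real d - 1)" using p by (simp add: diff_divide_distrib)
          have "r powr (- ((q - p) / p)) * r powr (real d - 1) = r powr (- ((q - p) / p) + (real d - 1))"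
            by (simp only: powr_add)
          also have "\<dots> \<le> 1 powr (- ((q - p) / p) + (real d - 1))" using r e by (intro powr_mono2) auto
          finally show "r powr (- ((q - p) / p)) * r powr (real d - 1) \<le> 1" by simp
        qed simp
        finally have "ennreal_powr (near_majorant g r) p * (ennreal_powr (near_majorant g r) (q - p) * ennreal (r ^ (d - 1)))
          \<le> ennreal_powr (near_majorant g r) p * ennreal (C powr (q - p) * 1)" by (rule mult_left_mono) simp
        moreover have "ennreal_powr (near_majorant g r) q = ennreal_powr (near_majorant g r) p * ennreal_powr (near_majorant g r) (q - p)"
          using ennreal_powr_add[of p "q - p" "near_majorant g r"] p pq by simp
        ultimately show ?thesis using True by (simp add: mult_ac)
      qed simp
    qed
    also have "\<dots> = ennreal (C powr (q - p)) * (\<integral>\<^sup>+r. ennreal_powr (near_majorant g r) p * indicator {0<..<1/2} r \<partial>lborel)"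
      by (rule nn_integral_cmult) measurable
    also have "\<dots> \<le> ennreal (C powr (q - p)) * ennreal k" using strong by (rule mult_left_mono) simp
    also have "\<dots> = ennreal (C powr (q - p) * k)" by (simp add: ennreal_mult')
    finally show ?thesis .
  qed
  thus ?thesis using k0 by (intro exI[of _ "C powr (q - p) * k"]) auto
qed

end

text \<open>For p = 1 the step from weak to strong type is lost, but only q = 1 occurs. The trivial
  bound by a multiple of 1 / r suffices, as the weight r^(d-1) compensates it.\<close>

lemma near_majorant_bound_p_eq_1:
  assumes d: "2 \<le> d"
  shows "\<exists>K\<ge>0. \<forall>g. unit_profile d 1 g \<longrightarrow>
     (\<integral>\<^sup>+r. ennreal_powr (near_majorant g r) 1 * ennreal (r ^ (d - 1)) * indicator {0<..<1/2} r \<partial>lborel) \<le> ennreal K"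
proof -
  have "(\<integral>\<^sup>+r. ennreal_powr (near_majorant g r) 1 * ennreal (r ^ (d - 1)) * indicator {0<..<1/2} r \<partial>lborel) \<le> ennreal (2 * 4 ^ (d - 1))"
    if ug: "unit_profile d 1 g" for g
  proof -
    from ug have [measurable]: "g \<in> borel_measurable borel" and g: "\<And>s. 0 \<le> g s"
      and N: "(\<integral>\<^sup>+s. ennreal (g s powr 1 * s ^ (d - 1)) * indicator {0<..} s \<partial>lborel) \<le> 1"
      by (auto simp: unit_profile_def)
    have size: "near_majorant g r \<le> ennreal (2 / r) * ennreal (4 ^ (d - 1))" if r: "0 < r" "r < 1/2" for r
      unfolding near_majorant_def
    proof (intro SUP_least mult_left_mono)
      fix t :: real assume "t \<in> \<rat> \<inter> {1..2}"
      hence t: "1 \<le> t" "t \<le> 2" by auto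
      have "(\<integral>\<^sup>+s. ennreal (g s) * indicator {t - 3/2 * r<..<t + 3/2 * r} s \<partial>lborel)
        \<le> (\<integral>\<^sup>+s. ennreal (4 ^ (d - 1)) * (ennreal (g s powr 1 * s ^ (d - 1)) * indicator {0<..} s) \<partial>lborel)"
      proof (rule nn_integral_mono)
        fix s :: real
        have "g s \<le> 4 ^ (d - 1) * (g s * s ^ (d - 1))" if "1/4 < s"
        proof -
          have "1 \<le> (4 * s) ^ (d - 1)" using that by (intro one_le_power) auto
          hence "g s * 1 \<le> g s * (4 * s) ^ (d - 1)" using g[of s] by (intro mult_left_mono) auto
          thus ?thesis by (simp add: power_mult_distrib mult_ac)
        qed
        thus "ennreal (g s) * indicator {t - 3/2 * r<..<t + 3/2 * r} s \<le> ennreal (4 ^ (d - 1)) * (ennreal (g s powr 1 * s ^ (d - 1)) * indicator {0<..} s)"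
          using r t g[of s] by (auto simp: indicator_def ennreal_mult'[symmetric] intro!: ennreal_leI)
      qed
      also have "\<dots> = ennreal (4 ^ (d - 1)) * (\<integral>\<^sup>+s. ennreal (g s powr 1 * s ^ (d - 1)) * indicator {0<..} s \<partial>lborel)"
        by (rule nn_integral_cmult) measurable
      also have "\<dots> \<le> ennreal (4 ^ (d - 1)) * 1" using N by (rule mult_left_mono) simp
      finally show "(\<integral>\<^sup>+s. ennreal (g s) * indicator {t - 3/2 * r<..<t + 3/2 * r} s \<partial>lborel) \<le> ennreal (4 ^ (d - 1))" by simp
    qed simp
    have "(\<integral>\<^sup>+r. ennreal_powr (near_majorant g r) 1 * ennreal (r ^ (d - 1)) * indicator {0<..<1/2} r \<partial>lborel)
       \<le> (\<integral>\<^sup>+r. ennreal (2 * 4 ^ (d - 1)) * indicator {0..1} r \<partial>(lborel :: real measure))"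
    proof (rule nn_integral_mono)
      fix r :: real
      show "ennreal_powr (near_majorant g r) 1 * ennreal (r ^ (d - 1)) * indicator {0<..<1/2} r \<le> ennreal (2 * 4 ^ (d - 1)) * indicator {0..1} r"
      proof (cases "r \<in> {0<..<1/2}")
        case True
        hence r: "0 < r" "r < 1/2" by auto
        have rr: "2 / r * 4 ^ (d - 1) * r ^ (d - 1) \<le> 2 * 4 ^ (d - 1)"
        proof -
          have "r ^ (d - 1) = r * r ^ (d - 2)" using d by (metis Suc_diff_le diff_Suc_Suc numeral_2_eq_2 power_Suc One_nat_def)
          moreover have "r ^ (d - 2) \<le> 1" using r by (intro power_le_one) auto
          ultimately show ?thesis using r by (simp add: mult_left_le)
        qed
        have "near_majorant g r * ennreal (r ^ (d - 1)) \<le> ennreal (2 / r) * ennreal (4 ^ (d - 1)) * ennreal (r ^ (d - 1))"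
          using size[OF r] by (rule mult_right_mono) simp
        also have "\<dots> = ennreal (2 / r * 4 ^ (d - 1) * r ^ (d - 1))" using r by (simp add: ennreal_mult'[symmetric])
        also have "\<dots> \<le> ennreal (2 * 4 ^ (d - 1))" using rr by (rule ennreal_leI)
        finally show ?thesis using r by simp
      qed simp
    qed
    also have "\<dots> = ennreal (2 * 4 ^ (d - 1))" by (simp add: nn_integral_cmult)
    finally show ?thesis .
  qed
  thus ?thesis by (intro exI[of _ "2 * 4 ^ (d - 1)"]) auto
qed

section \<open>Covering numbers\<close>

definition covers :: "real set \<Rightarrow> real \<Rightarrow> real set \<Rightarrow> bool" where
  "covers E \<delta> A \<longleftrightarrow> finite A \<and> E \<subseteq> (\<Union>a\<in>A. {a..a + \<delta>})"

lemma covering_number_le: "covers E \<delta> A \<Longrightarrow> covering_number E \<delta> \<le> card A"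
  unfolding covering_number_def covers_def by (rule Least_le) auto

text \<open>The cells of the grid of mesh \<delta> that meet E. They show that finite covers exist
  and, being disjoint when taken half open, bound the volume of a neighbourhood of E from
  below.\<close>

lemma grid_covers:
  fixes E :: "real set"
  assumes E: "E \<subseteq> {1..2}" and \<delta>: "0 < \<delta>"
  defines "K \<equiv> {k::int. \<exists>e\<in>E. \<lfloor>e / \<delta>\<rfloor> = k}"
  shows "finite K" and "covers E \<delta> ((\<lambda>k. of_int k * \<delta>) ` K)"
proof -
  have "K \<subseteq> {0..\<lfloor>2 / \<delta>\<rfloor>}"
  proof
    fix k assume "k \<in> K"
    then obtain e where e: "e \<in> E" "\<lfloor>e / \<delta>\<rfloor> = k" by (auto simp: K_def)
    have "0 \<le> e / \<delta>" "e / \<delta> \<le> 2 / \<delta>" using e E \<delta> by (auto simp: divide_right_mono)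
    thus "k \<in> {0..\<lfloor>2 / \<delta>\<rfloor>}" using e(2) by (auto intro: floor_mono)
  qed
  thus fin: "finite K" by (rule finite_subset) simp
  show "covers E \<delta> ((\<lambda>k. of_int k * \<delta>) ` K)"
    unfolding covers_def
  proof (intro conjI subsetI)
    fix e assume e: "e \<in> E"
    define k where "k = \<lfloor>e / \<delta>\<rfloor>"
    have "of_int k \<le> e / \<delta>" "e / \<delta> < of_int k + 1" unfolding k_def by linarith+
    hence "of_int k * \<delta> \<le> e" "e \<le> of_int k * \<delta> + \<delta>" using \<delta> by (auto simp: field_simps)
    moreover have "k \<in> K" using e by (auto simp: K_def k_def)
    ultimately show "e \<in> (\<Union>a\<in>(\<lambda>k. of_int k * \<delta>) ` K. {a..a + \<delta>})" by auto
  qed (use fin in simp)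
qed

locale dilation_set =
  fixes E :: "real set"
  assumes E_ne: "E \<noteq> {}" and E_sub: "E \<subseteq> {1..2}"
begin

abbreviation N :: "real \<Rightarrow> nat" where "N \<equiv> covering_number E"

lemma covering_number_attained:
  assumes "0 < \<delta>"
  obtains A where "covers E \<delta> A" "card A = N \<delta>"
proof -
  let ?P = "\<lambda>n. \<exists>A. finite A \<and> card A = n \<and> E \<subseteq> (\<Union>a\<in>A. {a..a + \<delta>})"
  have "\<exists>n. ?P n" using grid_covers(2)[OF E_sub assms] unfolding covers_def by blast
  hence "?P (N \<delta>)" unfolding covering_number_def by (rule LeastI_ex)
  thus ?thesis using that unfolding covers_def by blast
qed

lemma covering_number_pos: assumes "0 < \<delta>" shows "1 \<le> N \<delta>"
proof -
  obtain A where A: "covers E \<delta> A" "card A = N \<delta>" by (rule covering_number_attained[OF assms])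
  have "A \<noteq> {}" using A(1) E_ne by (auto simp: covers_def)
  thus ?thesis using A by (metis One_nat_def Suc_leI card_gt_0_iff covers_def)
qed

lemma infdist_less_imp: assumes "infdist r E < x" obtains e where "e \<in> E" "\<bar>r - e\<bar> < x"
proof -
  have "(INF e\<in>E. dist r e) < x" using assms E_ne by (simp add: infdist_def)
  then obtain e where "e \<in> E" "dist r e < x"
    using E_ne by (subst (asm) cINF_less_iff) (auto intro: bdd_belowI[of _ 0])
  thus ?thesis using that by (auto simp: dist_real_def)
qed

lemma infdist_measurable [measurable]: "(\<lambda>r. infdist r E) \<in> borel_measurable borel"
  by (intro borel_measurable_continuous_onI continuous_intros)

text \<open>Each interval of an optimal cover grows by x at both ends, which gives length 3
  x.\<close>

lemma emeasure_infdist_less: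
  assumes x: "0 < x"
  shows "emeasure lborel {r. infdist r E < x} \<le> ennreal (3 * x * N x)"
proof -
  obtain A where A: "covers E x A" "card A = N x" by (rule covering_number_attained[OF x])
  have "{r. infdist r E < x} \<subseteq> (\<Union>a\<in>A. {a - x..a + 2 * x})"
  proof
    fix r assume "r \<in> {r. infdist r E < x}"
    then obtain e where e: "e \<in> E" "\<bar>r - e\<bar> < x" using infdist_less_imp by auto
    then obtain a where a: "a \<in> A" "a \<le> e" "e \<le> a + x" using A(1) by (fastforce simp: covers_def)
    thus "r \<in> (\<Union>a\<in>A. {a - x..a + 2 * x})" using e(2) by (intro UN_I[of a]) auto
  qed
  hence "emeasure lborel {r. infdist r E < x} \<le> emeasure lborel (\<Union>a\<in>A. {a - x..a + 2 * x})"
    using A(1) by (intro emeasure_mono) (auto simp: covers_def intro!: sets.finite_UN)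
  also have "\<dots> \<le> (\<Sum>a\<in>A. emeasure lborel {a - x..a + 2 * x})"
    using A(1) by (intro emeasure_subadditive_finite) (auto simp: covers_def)
  also have "\<dots> = (\<Sum>a\<in>A. ennreal (3 * x))" using x by simp
  also have "\<dots> = ennreal (3 * x * N x)"
    using x A(2) by (simp add: ennreal_of_nat_eq_real_of_nat ennreal_mult'[symmetric] mult.commute)
  finally show ?thesis .
qed

text \<open>The half-open grid cells meeting E are disjoint, have length x and stay within x of E;
  since the closed cells cover E, there are at least N x of them.\<close>

lemma emeasure_infdist_le:
  assumes x: "0 < x"
  shows "ennreal (x * N x) \<le> emeasure lborel {r. infdist r E \<le> x}"
proof -
  define K where "K = {k::int. \<exists>e\<in>E. \<lfloor>e / x\<rfloor> = k}"
  have K: "finite K" "covers E x ((\<lambda>k. of_int k * x) ` K)"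
    using grid_covers[OF E_sub x] unfolding K_def by auto
  define J where "J = (\<lambda>k::int. {of_int k * x..<of_int k * x + x})"
  have Jk: "\<lfloor>r / x\<rfloor> = k" if "r \<in> J k" for r k
    using that x by (intro floor_unique) (auto simp: J_def field_simps)
  have "N x \<le> card ((\<lambda>k. of_int k * x) ` K)" by (rule covering_number_le[OF K(2)])
  also have "\<dots> \<le> card K" using K(1) by (rule card_image_le)
  finally have "ennreal (x * N x) \<le> ennreal (x * card K)" using x by (intro ennreal_leI) auto
  also have "\<dots> = (\<Sum>k\<in>K. emeasure lborel (J k))"
    using x by (simp add: J_def ennreal_of_nat_eq_real_of_nat ennreal_mult'[symmetric] mult.commute)
  also have "\<dots> = emeasure lborel (\<Union>k\<in>K. J k)"
  proof (rule sum_emeasure)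
    show "disjoint_family_on J K" unfolding disjoint_family_on_def using Jk by blast
  qed (use K(1) in \<open>auto simp: J_def\<close>)
  also have "\<dots> \<le> emeasure lborel {r. infdist r E \<le> x}"
  proof (rule emeasure_mono)
    show "(\<Union>k\<in>K. J k) \<subseteq> {r. infdist r E \<le> x}"
    proof
      fix r assume "r \<in> (\<Union>k\<in>K. J k)"
      then obtain k e where k: "r \<in> J k" "e \<in> E" "\<lfloor>e / x\<rfloor> = k" by (auto simp: K_def)
      have "of_int k \<le> e / x" "e / x < of_int k + 1" using k(3) by linarith+
      hence "of_int k * x \<le> e" "e < of_int k * x + x" using x by (auto simp: field_simps)
      hence "dist r e \<le> x" using k(1) by (auto simp: J_def dist_real_def)
      thus "r \<in> {r. infdist r E \<le> x}" using infdist_le2[OF k(2)] by auto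
    qed
  qed measurable
  finally show ?thesis .
qed

text \<open>The trivial covering bound, read off from volumes: a neighbourhood of E of radius at
  most 1 lies in [0, 3].\<close>

lemma covering_number_le_inverse:
  assumes \<delta>: "0 < \<delta>" "\<delta> \<le> 1"
  shows "\<delta> * N \<delta> \<le> 3"
proof -
  have "ennreal (\<delta> * N \<delta>) \<le> emeasure lborel {r. infdist r E \<le> \<delta>}"
    by (rule emeasure_infdist_le[OF \<delta>(1)])
  also have "\<dots> \<le> emeasure lborel {0..3::real}"
  proof (rule emeasure_mono)
    show "{r. infdist r E \<le> \<delta>} \<subseteq> {0..3}"
    proof
      fix r assume r: "r \<in> {r. infdist r E \<le> \<delta>}"
      show "r \<in> {0..3}"
      proof (rule ccontr)
        assume "r \<notin> {0..3}"
        hence *: "\<delta> + (if r < 0 then - r else r - 3) \<le> dist r e" if "e \<in> E" for e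
          using that E_sub \<delta> by (force simp: dist_real_def)
        have "\<delta> + (if r < 0 then - r else r - 3) \<le> infdist r E"
          using E_ne * by (auto simp: infdist_def intro!: cINF_greatest)
        thus False using r \<open>r \<notin> {0..3}\<close> by (auto split: if_splits)
      qed
    qed
  qed simp
  finally show ?thesis by (simp add: ennreal_le_iff del: ennreal_numeral flip: ennreal_numeral)
qed

text \<open>The exceptional set is the closure of E, contained in neighbourhoods of measure at most
  3 x N(x). It has to be null for the singular Hardy weights and for measurability of the maximal
  function.\<close>

lemma AE_infdist_pos:
  assumes lim: "((\<lambda>x. x * N x) \<longlongrightarrow> 0) (at_right 0)"
  shows "AE r in lborel. 0 < infdist r E"
proof -
  have "emeasure lborel {r. infdist r E = 0} \<le> ennreal (3 * 0)"
  proof (rule tendsto_lowerbound)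
    show "((\<lambda>x. ennreal (3 * (x * N x))) \<longlongrightarrow> ennreal (3 * 0)) (at_right 0)"
      by (intro tendsto_intros lim)
    show "\<forall>\<^sub>F x in at_right 0. emeasure lborel {r. infdist r E = 0} \<le> ennreal (3 * (x * N x))"
    proof (rule eventually_at_rightI[of 0 1])
      fix x :: real assume "x \<in> {0<..<1}"
      hence x: "0 < x" by simp
      have "emeasure lborel {r. infdist r E = 0} \<le> emeasure lborel {r. infdist r E < x}"
        using x by (intro emeasure_mono) auto
      also have "\<dots> \<le> ennreal (3 * x * N x)" by (rule emeasure_infdist_less[OF x])
      finally show "emeasure lborel {r. infdist r E = 0} \<le> ennreal (3 * (x * N x))" by (simp add: mult.assoc)
    qed simp
  qed simp
  hence "{r. infdist r E = 0} \<in> null_sets lborel" by (intro null_setsI) auto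
  hence "AE r in lborel. r \<notin> {r. infdist r E = 0}" by (rule AE_not_in)
  thus ?thesis by eventually_elim (use infdist_nonneg in \<open>auto simp: less_le\<close>)
qed

section \<open>Hardy bounds in the subcritical, supercritical and critical ranges and for p =
  1\<close>

definition hardy_bounded :: "nat \<Rightarrow> real \<Rightarrow> real \<Rightarrow> bool" where
  "hardy_bounded d p q \<longleftrightarrow> (\<exists>K\<ge>0. \<forall>g. unit_profile d p g \<longrightarrow>
      (\<integral>\<^sup>+r. ennreal_powr (\<integral>\<^sup>+s. ennreal (g s * s ^ (d - 2)) * indicator {infdist r E<..<6} s \<partial>lborel) q *
        indicator {1/2..4} r \<partial>lborel) \<le> ennreal K)"

lemma hardy_boundedI:
  assumes "hardy_weight L p p' q C d (\<lambda>r. infdist r E) {1/2..4}"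
  shows "hardy_bounded d p q"
  using hardy_weight.hardy_inequality[OF assms] unfolding hardy_bounded_def unit_profile_def by auto

text \<open>Below the critical value of 1/p the conjugate exponent is smaller than d, so the dual
  weight is integrable at 0.\<close>

lemma (in -) integrable_dual_weight:
  assumes p: "1 < p" and p': "p' = p / (p - 1)" and d: "2 \<le> d" and sub: "1 / p < (real d - 1) / real d"
  shows "0 < real d - p'"
    and "(\<integral>\<^sup>+s. ennreal (s powr (real d - 1 - p')) * indicator {0..6} s \<partial>lborel) = ennreal (6 powr (real d - p') / (real d - p'))"
proof -
  have "real d < (real d - 1) * p" using sub p d by (simp add: field_simps)
  thus dp: "0 < real d - p'" using p by (simp add: p' field_simps)
  show "(\<integral>\<^sup>+s. ennreal (s powr (real d - 1 - p')) * indicator {0..6} s \<partial>lborel) = ennreal (6 powr (real d - p') / (real d - p'))"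
    using nn_integral_powr_from_0[of "real d - 1 - p'" 6] dp by (simp add: algebra_simps)
qed

text \<open>Hoelder up to s = 0 bounds the inner integral uniformly in r, so nothing about the size
  of E enters. The factor 7/2 is the length of the range of r.\<close>

lemma hardy_bounded_subcritical:
  assumes p: "1 < p" and q: "p \<le> q" and d: "2 \<le> d" and sub: "1 / p < (real d - 1) / real d"
  shows "hardy_bounded d p q"
proof -
  define p' where "p' = p / (p - 1)"
  have p'1: "1 < p'" using p by (simp add: p'_def field_simps)
  note dp = integrable_dual_weight[OF p p'_def d sub]
  define B where "B = (6 powr (real d - p') / (real d - p')) powr (1 / p')"
  have B0: "0 < B" using dp by (simp add: B_def)
  have "(\<integral>\<^sup>+r. ennreal_powr (\<integral>\<^sup>+s. ennreal (g s * s ^ (d - 2)) * indicator {infdist r E<..<6} s \<partial>lborel) q *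
        indicator {1/2..4} r \<partial>lborel) \<le> ennreal (B powr q * (7/2))" if g: "unit_profile d p g" for g
  proof -
    have T: "(\<integral>\<^sup>+s. ennreal (g s * s ^ (d - 2)) * indicator {infdist r E<..<6} s \<partial>lborel) \<le> ennreal B" for r
    proof (rule hardy_Hoelder_one[OF _ _ p p'_def d _ _ _ B0])
      have "(\<integral>\<^sup>+s. ennreal (s powr (real d - 1 - p')) * indicator {infdist r E<..<6} s \<partial>lborel)
         \<le> (\<integral>\<^sup>+s. ennreal (s powr (real d - 1 - p')) * indicator {0..6} s \<partial>lborel)"
        using infdist_nonneg[of r E] by (intro nn_integral_mono) (auto simp: indicator_def)
      also have "\<dots> = ennreal (B powr p')" unfolding dp(2) using dp(1) p'1 by (simp add: B_def powr_powr)
      finally show "(\<integral>\<^sup>+s. ennreal (s powr (real d - 1 - p')) * indicator {infdist r E<..<6} s \<partial>lborel) \<le> ennreal (B powr p')" .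
      show "{infdist r E<..<6} \<subseteq> {0<..}" using infdist_nonneg[of r E] by auto
    qed (use g in \<open>auto simp: unit_profile_def\<close>)
    have "(\<integral>\<^sup>+r. ennreal_powr (\<integral>\<^sup>+s. ennreal (g s * s ^ (d - 2)) * indicator {infdist r E<..<6} s \<partial>lborel) q *
        indicator {1/2..4} r \<partial>lborel) \<le> (\<integral>\<^sup>+r. ennreal (B powr q) * indicator {1/2..4::real} r \<partial>lborel)"
    proof (intro nn_integral_mono mult_right_mono)
      fix r
      show "ennreal_powr (\<integral>\<^sup>+s. ennreal (g s * s ^ (d - 2)) * indicator {infdist r E<..<6} s \<partial>lborel) q \<le> ennreal (B powr q)"
        using ennreal_powr_mono[OF T, of q] p q B0 by simp
    qed simp
    also have "\<dots> = ennreal (B powr q) * ennreal (7/2)" by (simp add: nn_integral_cmult)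
    also have "\<dots> = ennreal (B powr q * (7/2))" by (rule ennreal_mult'[symmetric]) simp
    finally show ?thesis .
  qed
  thus ?thesis unfolding hardy_bounded_def by (intro exI[of _ "B powr q * (7/2)"]) auto
qed

lemma emeasure_level_bounded: "emeasure lborel {r \<in> {1/2..4}. infdist r E < x} \<le> ennreal 4"
proof -
  have "emeasure lborel {r \<in> {1/2..4}. infdist r E < x} \<le> emeasure lborel {0..4::real}"
    by (intro emeasure_mono) auto
  thus ?thesis by simp
qed

lemma emeasure_level_le:
  assumes "0 < x" shows "emeasure lborel {r \<in> {1/2..4}. infdist r E < x} \<le> ennreal (3 * (x * N x))"
proof -
  have "emeasure lborel {r \<in> {1/2..4}. infdist r E < x} \<le> emeasure lborel {r. infdist r E < x}"
    by (intro emeasure_mono) auto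
  thus ?thesis using emeasure_infdist_less[OF assms] by (simp add: mult.assoc)
qed

text \<open>Now p' > d, and with k = p' - d the antiderivative is L(x) = x^(-k) / k. Then L^(-q/p')
  is a multiple of x^(k q/p'), and k q/p' = q (1 - d + d/p): Muckenhoupt's condition follows from
  the covering bound.\<close>

lemma hardy_bounded_supercritical:
  assumes p: "1 < p" and q: "p \<le> q" and d: "2 \<le> d" and super: "(real d - 1) / real d < 1 / p"
    and C: "0 \<le> C" and cov: "\<And>x. 0 < x \<Longrightarrow> x < 1 \<Longrightarrow> x * N x \<le> C * x powr (q * (1 - real d + real d / p))"
  shows "hardy_bounded d p q" and "((\<lambda>x. x * N x) \<longlongrightarrow> 0) (at_right 0)"
proof -
  define p' where "p' = p / (p - 1)"
  have p'1: "1 < p'" using p by (simp add: p'_def field_simps)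
  define k where "k = p' - real d"
  have "(real d - 1) * p < real d" using super p d by (simp add: field_simps)
  hence k: "0 < k" using p by (simp add: k_def p'_def field_simps)
  define a where "a = q * (1 - real d + real d / p)"
  have ak: "a = k * (q / p')" using p by (simp add: a_def k_def p'_def field_simps)
  have a0: "0 < a" unfolding ak using k p q p'1 by simp
  show lim: "((\<lambda>x. x * N x) \<longlongrightarrow> 0) (at_right 0)"
  proof (rule tendsto_sandwich[OF _ _ tendsto_const])
    show "\<forall>\<^sub>F x in at_right 0. 0 \<le> x * N x"
      by (rule eventually_at_rightI[of 0 1]) auto
    show "\<forall>\<^sub>F x in at_right 0. x * N x \<le> C * x powr a"
      unfolding a_def by (rule eventually_at_rightI[of 0 1]) (use cov in auto)
    show "((\<lambda>x. C * x powr a) \<longlongrightarrow> 0) (at_right 0)"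
      using a0 by real_asymp
  qed
  define L where "L = (\<lambda>x. x powr (- k) / k)"
  \<comment> \<open>The summand 3 C serves x < 1, through the covering bound; the 4 serves x \<ge>
    1, where the measure of the whole range of r is enough. The denominator undoes the normalization
    of L.\<close>
  define C' where "C' = (4 + 3 * C) / k powr (q / p')"
  have C'0: "0 \<le> C'" using C by (simp add: C'_def)
  have "hardy_weight L p p' q C' d (\<lambda>r. infdist r E) {1/2..4}"
  proof
    show "(L has_real_derivative - (s powr (real d - 1 - p'))) (at s)" if "0 < s" for s
    proof -
      have "(L has_real_derivative (- k * s powr (- k - 1)) / k) (at s)"
        unfolding L_def using that by (auto intro!: derivative_eq_intros)
      also have "(- k * s powr (- k - 1)) / k = - (s powr (- k - 1))" using k by simp
      also have "- k - 1 = real d - 1 - p'" by (simp add: k_def)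
      finally show ?thesis .
    qed
    show "0 < L s" if "0 < s" for s using that k by (simp add: L_def)
    show "emeasure lborel {r \<in> {1/2..4}. infdist r E < x} \<le> ennreal (C' * L x powr (- (q / p')))" if x: "0 < x" for x
    proof -
      have eq: "C' * L x powr (- (q / p')) = (4 + 3 * C) * x powr a"
      proof -
        have "L x powr (- (q / p')) = x powr a * k powr (q / p')"
        proof -
          have "L x powr (- (q / p')) = (x powr (- k)) powr (- (q / p')) / k powr (- (q / p'))"
            using k by (simp add: L_def powr_divide)
          also have "(x powr (- k)) powr (- (q / p')) = x powr a" unfolding powr_powr ak by simp
          also have "x powr a / k powr (- (q / p')) = x powr a * k powr (q / p')"
            using k by (simp add: powr_minus_divide)
          finally show ?thesis .
        qed
        thus ?thesis using k by (simp add: C'_def)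
      qed
      show ?thesis
      proof (cases "x < 1")
        case True
        have "3 * (x * N x) \<le> 3 * (C * x powr a)" using cov[OF x True] by (simp add: a_def)
        also have "\<dots> \<le> (4 + 3 * C) * x powr a" by (simp add: algebra_simps)
        finally show ?thesis unfolding eq using emeasure_level_le[OF x] by (meson ennreal_leI order_trans)
      next
        case False
        hence "1 \<le> x powr a" using a0 by (intro ge_one_powr_ge_zero) auto
        hence "4 * 1 \<le> (4 + 3 * C) * x powr a" using C by (intro mult_mono) auto
        thus ?thesis unfolding eq by (intro order_trans[OF emeasure_level_bounded ennreal_leI]) simp
      qed
    qed
    show "AE r in lborel. r \<in> {1/2..4} \<longrightarrow> 0 < infdist r E"
      using AE_infdist_pos[OF lim] by eventually_elim simp
  qed (use p q d p'_def C'0 in \<open>auto simp: L_def\<close>)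
  thus "hardy_bounded d p q" by (rule hardy_boundedI)
qed

text \<open>Here p' = d, the dual weight is 1 / s and L is logarithmic; this is the source of the
  exponent q / d of the logarithm.\<close>

lemma hardy_bounded_critical:
  assumes p: "1 < p" and q: "p \<le> q" and d: "2 \<le> d" and crit: "1 / p = (real d - 1) / real d"
    and C: "0 \<le> C" and cov: "\<And>x. 0 < x \<Longrightarrow> x < 1 \<Longrightarrow> x * ln (1 / x) powr (q / d) * N x \<le> C"
  shows "hardy_bounded d p q" and "((\<lambda>x. x * N x) \<longlongrightarrow> 0) (at_right 0)"
proof -
  define p' where "p' = p / (p - 1)"
  have "(real d - 1) * p = real d" using crit p d by (simp add: field_simps)
  hence p'd: "p' = real d" using p by (simp add: p'_def field_simps)
  define Q where "Q = q / real d"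
  have Q0: "0 < Q" using p q d by (simp add: Q_def)
  have cov': "x * N x \<le> C * ln (1 / x) powr (- Q)" if x: "0 < x" "x < 1" for x
  proof -
    have "0 < ln (1 / x)" using x by simp
    thus ?thesis using cov[OF x] by (simp add: Q_def powr_minus field_simps)
  qed
  show lim: "((\<lambda>x. x * N x) \<longlongrightarrow> 0) (at_right 0)"
  proof (rule tendsto_sandwich[OF _ _ tendsto_const])
    show "\<forall>\<^sub>F x in at_right 0. 0 \<le> x * N x"
      by (rule eventually_at_rightI[of 0 1]) auto
    show "\<forall>\<^sub>F x in at_right 0. x * N x \<le> C * ln (1 / x) powr (- Q)"
      by (rule eventually_at_rightI[of 0 1]) (use cov' in auto)
    have "LIM x at_right (0::real). ln (1 / x) :> at_top"
      by real_asymp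
    hence "((\<lambda>x. ln (1 / x) powr (- Q)) \<longlongrightarrow> 0) (at_right (0::real))"
      using Q0 by (intro tendsto_neg_powr) auto
    hence "((\<lambda>x. C * ln (1 / x) powr (- Q)) \<longlongrightarrow> C * 0) (at_right (0::real))"
      by (intro tendsto_mult tendsto_const)
    thus "((\<lambda>x. C * ln (1 / x) powr (- Q)) \<longlongrightarrow> 0) (at_right (0::real))" by simp
  qed
  \<comment> \<open>The constant of integration keeps L at least 1 on all of (0, 6].\<close>
  define L where "L = (\<lambda>x::real. 1 + ln 6 - ln x)"
  define c where "c = 2 + ln (6::real)"
  have ln6: "0 < ln (6::real)" by simp
  have c0: "0 < c" unfolding c_def using ln6 by linarith
  define C' where "C' = (4 + 3 * C) * c powr Q"
  have C'0: "0 \<le> C'" using C by (simp add: C'_def)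
  have Lpos: "0 < L s" if "0 < s" "s \<le> 6" for s
  proof -
    have "ln s \<le> ln 6" using that by (subst ln_le_cancel_iff) auto
    thus ?thesis by (simp add: L_def)
  qed
  have "hardy_weight L p p' q C' d (\<lambda>r. infdist r E) {1/2..4}"
  proof
    show "(L has_real_derivative - (s powr (real d - 1 - p'))) (at s)" if "0 < s" for s
    proof -
      have "(L has_real_derivative - (1 / s)) (at s)"
        unfolding L_def using that by (auto intro!: derivative_eq_intros)
      thus ?thesis using that by (simp add: p'd powr_minus_divide)
    qed
    show "0 < L s" if "0 < s" "s \<le> 6" for s using that by (rule Lpos)
    show "emeasure lborel {r \<in> {1/2..4}. infdist r E < x} \<le> ennreal (C' * L x powr (- (q / p')))" if x: "0 < x" "x \<le> 6" for x
    proof -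
      have eq: "C' * L x powr (- (q / p')) = (4 + 3 * C) * (c / L x) powr Q"
      proof -
        have "(c / L x) powr Q = c powr Q * L x powr (- Q)"
          using Lpos[OF x] c0 by (simp add: powr_divide powr_minus_divide)
        moreover have "q / p' = Q" by (simp add: Q_def p'd)
        ultimately show ?thesis by (simp add: C'_def)
      qed
      show ?thesis
      \<comment> \<open>Below 1/e the logarithm of 1/x is at least 1 and absorbs the constants, so L
        is at most c times it. Above, L itself is at most c and the trivial bound on the measure
        suffices.\<close>
      proof (cases "x < exp (- 1)")
        case True
        hence x1: "x < 1" using exp_le_one_iff[of "-1"] by linarith
        have l1: "1 \<le> ln (1 / x)"
        proof -
          have "ln x < ln (exp (- 1))" using True x by (subst ln_less_cancel_iff) auto
          thus ?thesis using x by (simp add: ln_div)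
        qed
        have "L x = 1 + ln 6 + ln (1 / x)" using x by (simp add: L_def ln_div)
        also have "\<dots> \<le> (1 + ln 6) * ln (1 / x) + ln (1 / x)"
          using l1 ln6 mult_left_mono[OF l1, of "1 + ln 6"] by simp
        also have "\<dots> = c * ln (1 / x)" by (simp add: c_def algebra_simps)
        finally have "inverse (ln (1 / x)) \<le> c / L x" using l1 Lpos[OF x] by (simp add: field_simps)
        hence "inverse (ln (1 / x)) powr Q \<le> (c / L x) powr Q" using Q0 l1 by (intro powr_mono2) auto
        moreover have "inverse (ln (1 / x)) powr Q = ln (1 / x) powr (- Q)" using l1 by (simp add: powr_minus inverse_powr)
        ultimately have "3 * (C * ln (1 / x) powr (- Q)) \<le> 3 * (C * (c / L x) powr Q)" using C by (simp add: mult_left_mono)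
        also have "\<dots> \<le> (4 + 3 * C) * (c / L x) powr Q" by (simp add: algebra_simps)
        finally have "3 * (x * N x) \<le> (4 + 3 * C) * (c / L x) powr Q" using cov'[OF x(1) x1] by linarith
        thus ?thesis unfolding eq using emeasure_level_le[OF x(1)] by (meson ennreal_leI order_trans)
      next
        case False
        have "ln (exp (- 1)) \<le> ln x" using False x by (subst ln_le_cancel_iff) auto
        hence "L x \<le> c" by (simp add: L_def c_def)
        hence "1 \<le> (c / L x) powr Q" using Q0 Lpos[OF x] by (intro ge_one_powr_ge_zero) auto
        hence "4 * 1 \<le> (4 + 3 * C) * (c / L x) powr Q" using C by (intro mult_mono) auto
        thus ?thesis unfolding eq by (intro order_trans[OF emeasure_level_bounded ennreal_leI]) simp
      qed
    qed
    show "AE r in lborel. r \<in> {1/2..4} \<longrightarrow> 0 < infdist r E"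
      using AE_infdist_pos[OF lim] by eventually_elim simp
  qed (use p q d p'_def C'0 in \<open>auto simp: L_def\<close>)
  thus "hardy_bounded d p q" by (rule hardy_boundedI)
qed

text \<open>For p = q = 1 Fubini alone is enough: the set of r with distance less than s has measure
  at most K s, which raises s^(d-2) to s^(d-1).\<close>

lemma hardy_bounded_1:
  assumes d: "2 \<le> d" and C: "0 \<le> C" and cov: "\<And>x. 0 < x \<Longrightarrow> x < 1 \<Longrightarrow> x * N x \<le> C * x"
  shows "hardy_bounded d 1 1" and "((\<lambda>x. x * N x) \<longlongrightarrow> 0) (at_right 0)"
proof -
  show "((\<lambda>x. x * N x) \<longlongrightarrow> 0) (at_right 0)"
  proof (rule tendsto_sandwich[OF _ _ tendsto_const])
    show "\<forall>\<^sub>F x in at_right 0. 0 \<le> x * N x"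
      by (rule eventually_at_rightI[of 0 1]) auto
    show "\<forall>\<^sub>F x in at_right 0. x * N x \<le> C * x"
      by (rule eventually_at_rightI[of 0 1]) (use cov in auto)
    show "((\<lambda>x. C * x) \<longlongrightarrow> 0) (at_right 0)" by real_asymp
  qed
  define K where "K = 4 + 3 * C"
  have level: "emeasure lborel {r \<in> {1/2..4}. infdist r E < s} \<le> ennreal (K * s)" if s: "0 < s" for s
  proof (cases "s < 1")
    case True
    have "3 * (s * N s) \<le> 3 * (C * s)" using cov[OF s True] by simp
    also have "\<dots> \<le> K * s" using s by (simp add: K_def algebra_simps)
    finally show ?thesis using emeasure_level_le[OF s] by (meson ennreal_leI order_trans)
  next
    case False
    hence "4 * 1 \<le> K * s" using C by (intro mult_mono) (auto simp: K_def)
    thus ?thesis by (intro order_trans[OF emeasure_level_bounded ennreal_leI]) simp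
  qed
  have "(\<integral>\<^sup>+r. ennreal_powr (\<integral>\<^sup>+s. ennreal (g s * s ^ (d - 2)) * indicator {infdist r E<..<6} s \<partial>lborel) 1 *
        indicator {1/2..4} r \<partial>lborel) \<le> ennreal K" if ug: "unit_profile d 1 g" for g
  proof -
    from ug have [measurable]: "g \<in> borel_measurable borel" and g: "\<And>s. 0 \<le> g s"
      and N: "(\<integral>\<^sup>+s. ennreal (g s powr 1 * s ^ (d - 1)) * indicator {0<..} s \<partial>lborel) \<le> 1"
      by (auto simp: unit_profile_def)
    have "(\<integral>\<^sup>+r. ennreal_powr (\<integral>\<^sup>+s. ennreal (g s * s ^ (d - 2)) * indicator {infdist r E<..<6} s \<partial>lborel) 1 *
        indicator {1/2..4} r \<partial>lborel)
      \<le> (\<integral>\<^sup>+r. (\<integral>\<^sup>+s. ennreal (g s * s ^ (d - 2)) * indicator {0<..} s * (if r \<in> {1/2..4} \<and> infdist r E < s then 1 else 0) \<partial>lborel) \<partial>lborel)"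
    proof (rule nn_integral_mono)
      fix r :: real
      show "ennreal_powr (\<integral>\<^sup>+s. ennreal (g s * s ^ (d - 2)) * indicator {infdist r E<..<6} s \<partial>lborel) 1 * indicator {1/2..4} r
        \<le> (\<integral>\<^sup>+s. ennreal (g s * s ^ (d - 2)) * indicator {0<..} s * (if r \<in> {1/2..4} \<and> infdist r E < s then 1 else 0) \<partial>lborel)"
      proof (cases "r \<in> {1/2..4}")
        case True
        thus ?thesis using infdist_nonneg[of r E]
          by (auto intro!: nn_integral_mono simp: indicator_def)
      qed simp
    qed
    also have "\<dots> = (\<integral>\<^sup>+s. (\<integral>\<^sup>+r. ennreal (g s * s ^ (d - 2)) * indicator {0<..} s * (if r \<in> {1/2..4} \<and> infdist r E < s then 1 else 0) \<partial>lborel) \<partial>lborel)"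
      by (rule lborel_pair.Fubini') measurable
    also have "\<dots> \<le> (\<integral>\<^sup>+s. ennreal K * (ennreal (g s powr 1 * s ^ (d - 1)) * indicator {0<..} s) \<partial>lborel)"
    proof (rule nn_integral_mono)
      fix s :: real
      show "(\<integral>\<^sup>+r. ennreal (g s * s ^ (d - 2)) * indicator {0<..} s * (if r \<in> {1/2..4} \<and> infdist r E < s then 1 else 0) \<partial>lborel)
        \<le> ennreal K * (ennreal (g s powr 1 * s ^ (d - 1)) * indicator {0<..} s)"
      proof (cases "0 < s")
        case s: True
        have "(\<integral>\<^sup>+r. ennreal (g s * s ^ (d - 2)) * indicator {0<..} s * (if r \<in> {1/2..4} \<and> infdist r E < s then 1 else 0) \<partial>lborel)
          = (\<integral>\<^sup>+r. ennreal (g s * s ^ (d - 2)) * indicator {r \<in> {1/2..4}. infdist r E < s} r \<partial>lborel)"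
          using s by (intro nn_integral_cong) (simp add: indicator_def)
        also have "\<dots> = ennreal (g s * s ^ (d - 2)) * emeasure lborel {r \<in> {1/2..4}. infdist r E < s}"
          by (simp add: nn_integral_cmult)
        also have "\<dots> \<le> ennreal (g s * s ^ (d - 2)) * ennreal (K * s)"
          using level[OF s] by (rule mult_left_mono) simp
        also have "\<dots> = ennreal K * ennreal (g s powr 1 * s ^ (d - 1))"
        proof -
          have "s ^ (d - 1) = s * s ^ (d - 2)" using d by (metis Suc_diff_le diff_Suc_Suc numeral_2_eq_2 power_Suc One_nat_def)
          hence m1: "g s * s ^ (d - 2) * (K * s) = K * (g s powr 1 * s ^ (d - 1))" using g[of s] by simp
          have m2: "ennreal (g s * s ^ (d - 2) * (K * s)) = ennreal (g s * s ^ (d - 2)) * ennreal (K * s)"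
            using g[of s] s C by (intro ennreal_mult) (auto simp: K_def)
          have m3: "ennreal (K * (g s powr 1 * s ^ (d - 1))) = ennreal K * ennreal (g s powr 1 * s ^ (d - 1))"
            using C by (intro ennreal_mult') (simp add: K_def)
          show ?thesis unfolding m2[symmetric] m3[symmetric] m1 ..
        qed
        finally show ?thesis using s by simp
      qed simp
    qed
    also have "\<dots> = ennreal K * (\<integral>\<^sup>+s. ennreal (g s powr 1 * s ^ (d - 1)) * indicator {0<..} s \<partial>lborel)"
      by (rule nn_integral_cmult) measurable
    also have "\<dots> \<le> ennreal K * 1" using N by (rule mult_left_mono) simp
    finally show ?thesis by simp
  qed
  thus "hardy_bounded d 1 1" unfolding hardy_bounded_def using C by (intro exI[of _ K]) (auto simp: K_def)
qed

end

section \<open>Sufficient conditions\<close>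

text \<open>On a sphere where f is not absolutely integrable both sides are infinite, by the
  convention in \<open>maximal_fun\<close>.\<close>

lemma maximal_fun_le_nn_integral:
  fixes f :: "'a::euclidean_space \<Rightarrow> complex"
  assumes [measurable]: "f \<in> borel_measurable borel"
  shows "maximal_fun E f x \<le> (SUP t\<in>E. \<integral>\<^sup>+y. ennreal (norm (f (x + t *\<^sub>R y))) \<partial>sphere_measure)"
  unfolding maximal_fun_def
proof (rule SUP_mono)
  fix t assume t: "t \<in> E"
  have m: "(\<lambda>y. f (x + t *\<^sub>R y)) \<in> borel_measurable sphere_measure" by measurable
  have "(if integrable sphere_measure (\<lambda>y. f (x + t *\<^sub>R y)) then ennreal (norm (sphere_avg t f x)) else \<infinity>)
    \<le> (\<integral>\<^sup>+y. ennreal (norm (f (x + t *\<^sub>R y))) \<partial>sphere_measure)"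
  proof (cases "integrable sphere_measure (\<lambda>y. f (x + t *\<^sub>R y))")
    case True
    thus ?thesis unfolding sphere_avg_def by (simp add: integral_norm_bound_ennreal)
  next
    case False
    hence "(\<integral>\<^sup>+y. ennreal (norm (f (x + t *\<^sub>R y))) \<partial>sphere_measure) = \<infinity>"
      using m unfolding integrable_iff_bounded by (simp add: less_top[symmetric])
    thus ?thesis by simp
  qed
  thus "\<exists>t'\<in>E. (if integrable sphere_measure (\<lambda>y. f (x + t *\<^sub>R y)) then ennreal (norm (sphere_avg t f x)) else \<infinity>)
    \<le> (\<integral>\<^sup>+y. ennreal (norm (f (x + t' *\<^sub>R y))) \<partial>sphere_measure)"
    using t by blast
qed

definition majorant :: "nat \<Rightarrow> real set \<Rightarrow> (real \<Rightarrow> real) \<Rightarrow> real \<Rightarrow> ennreal" where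
  "majorant d E g r = (if r < 1/2 then near_majorant g r
     else if r < 4 then mid_majorant d (\<lambda>r. infdist r E) g r else far_majorant g r)"

lemma kernel_integral_le_majorant:
  fixes g :: "real \<Rightarrow> real"
  assumes [measurable]: "g \<in> borel_measurable borel" and g: "\<And>s. 0 \<le> g s"
    and E: "E \<subseteq> {1..2}" "t \<in> E" and r: "0 < r" and d: "3 \<le> d"
  shows "(\<integral>\<^sup>+s. ennreal (g s) * (ennreal (radial_kernel d r t s) * indicator {\<bar>r - t\<bar><..<r + t} s) \<partial>lborel) \<le> majorant d E g r"
proof -
  have t: "1 \<le> t" "t \<le> 2" using E by auto
  define J where "J = {\<bar>r - t\<bar><..<r + t}"
  have s0: "0 < s" if "s \<in> J" for s using that abs_ge_zero[of "r - t"] unfolding J_def by auto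
  have kb: "radial_kernel d r t s \<le> 1 / r + 1 / t" "0 \<le> radial_kernel d r t s" if "s \<in> J" for s
  proof -
    have "radial_kernel d r t s \<le> s / (r * t)"
      using that r t by (intro radial_kernel_bounds) (auto simp: J_def)
    also have "\<dots> \<le> (r + t) / (r * t)" using that r t by (intro divide_right_mono) (auto simp: J_def)
    also have "\<dots> = 1 / r + 1 / t" using r t by (simp add: field_simps)
    finally show "radial_kernel d r t s \<le> 1 / r + 1 / t" .
    show "0 \<le> radial_kernel d r t s" using that r t by (intro radial_kernel_bounds) (auto simp: J_def)
  qed
  consider "r < 1/2" | "1/2 \<le> r" "r < 4" | "4 \<le> r" by linarith
  thus ?thesis
  proof cases
    case 1
    \<comment> \<open>A rational u within r/2 of t; the window of half-width 3r/2 about u contains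
      the support of the kernel, which has half-width r about t.\<close>
    obtain u where u: "u \<in> \<rat>" "max 1 (t - r/2) < u" "u < min 2 (t + r/2)"
      using Rats_dense_in_real[of "max 1 (t - r/2)" "min 2 (t + r/2)"] t r 1 by auto
    have tr: "1 / r + 1 / t \<le> 2 / r" using 1 t r by (simp add: field_simps)
    have "(\<integral>\<^sup>+s. ennreal (g s) * (ennreal (radial_kernel d r t s) * indicator J s) \<partial>lborel)
      \<le> (\<integral>\<^sup>+s. ennreal (2 / r) * (ennreal (g s) * indicator {u - 3/2 * r<..<u + 3/2 * r} s) \<partial>lborel)"
    proof (rule nn_integral_mono)
      fix s
      show "ennreal (g s) * (ennreal (radial_kernel d r t s) * indicator J s) \<le>
        ennreal (2 / r) * (ennreal (g s) * indicator {u - 3/2 * r<..<u + 3/2 * r} s)"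
      proof (cases "s \<in> J")
        case True
        have "s \<in> {u - 3/2 * r<..<u + 3/2 * r}" using True u 1 t by (auto simp: J_def)
        moreover have "ennreal (g s) * ennreal (radial_kernel d r t s) \<le> ennreal (g s) * ennreal (2 / r)"
          using kb(1)[OF True] tr by (intro mult_left_mono ennreal_leI) auto
        ultimately show ?thesis using True by (simp add: mult.commute)
      qed simp
    qed
    also have "\<dots> = ennreal (2 / r) * (\<integral>\<^sup>+s. ennreal (g s) * indicator {u - 3/2 * r<..<u + 3/2 * r} s \<partial>lborel)"
      by (rule nn_integral_cmult) measurable
    also have "\<dots> \<le> near_majorant g r"
      unfolding near_majorant_def using u by (intro SUP_upper) auto
    finally show ?thesis using 1 by (simp add: majorant_def J_def)
  next
    case 2
    have "(\<integral>\<^sup>+s. ennreal (g s) * (ennreal (radial_kernel d r t s) * indicator J s) \<partial>lborel)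
      \<le> (\<integral>\<^sup>+s. ennreal (2 * 6 ^ (d - 3)) * (ennreal (g s * s ^ (d - 2)) * indicator {infdist r E<..<6} s) \<partial>lborel)"
    proof (rule nn_integral_mono)
      fix s
      show "ennreal (g s) * (ennreal (radial_kernel d r t s) * indicator J s) \<le>
        ennreal (2 * 6 ^ (d - 3)) * (ennreal (g s * s ^ (d - 2)) * indicator {infdist r E<..<6} s)"
      proof (cases "s \<in> J")
        case True
        have "infdist r E \<le> \<bar>r - t\<bar>" using infdist_le[OF E(2), of r] by (simp add: dist_real_def)
        hence "s \<in> {infdist r E<..<6}" using True 2 t by (auto simp: J_def)
        moreover have "g s * radial_kernel d r t s \<le> g s * (2 * 6 ^ (d - 3) * s ^ (d - 2))"
          using True 2 t d g by (intro mult_left_mono radial_kernel_le_power) (auto simp: J_def)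
        hence "ennreal (g s) * ennreal (radial_kernel d r t s) \<le> ennreal (2 * 6 ^ (d - 3)) * ennreal (g s * s ^ (d - 2))"
          using g[of s] s0[OF True] by (simp add: ennreal_mult'[symmetric] ennreal_leI mult_ac)
        ultimately show ?thesis using True by simp
      qed simp
    qed
    also have "\<dots> = mid_majorant d (\<lambda>r. infdist r E) g r"
      unfolding mid_majorant_def by (rule nn_integral_cmult) measurable
    finally show ?thesis using 2 by (simp add: majorant_def J_def)
  next
    case 3
    have "(\<integral>\<^sup>+s. ennreal (g s) * (ennreal (radial_kernel d r t s) * indicator J s) \<partial>lborel)
      \<le> (\<integral>\<^sup>+s. 2 * (ennreal (g s) * indicator {r - 2<..<r + 2} s) \<partial>lborel)"
    proof (rule nn_integral_mono)
      fix s
      show "ennreal (g s) * (ennreal (radial_kernel d r t s) * indicator J s) \<le> 2 * (ennreal (g s) * indicator {r - 2<..<r + 2} s)"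
      proof (cases "s \<in> J")
        case True
        have "s \<in> {r - 2<..<r + 2}" using True 3 t by (auto simp: J_def)
        moreover have "1 / r \<le> 1" "1 / t \<le> 1" using 3 t by auto
        hence "1 / r + 1 / t \<le> 2" by linarith
        hence "ennreal (g s) * ennreal (radial_kernel d r t s) \<le> ennreal (g s) * ennreal 2"
          using kb(1)[OF True] by (intro mult_left_mono ennreal_leI) auto
        ultimately show ?thesis using True by (simp add: mult.commute)
      qed simp
    qed
    also have "\<dots> = far_majorant g r"
      unfolding far_majorant_def by (rule nn_integral_cmult) measurable
    finally show ?thesis using 3 by (simp add: majorant_def J_def)
  qed
qed

lemma maximal_fun_le_majorant:
  fixes f :: "'a::euclidean_space \<Rightarrow> complex"
  assumes [measurable]: "f \<in> borel_measurable borel" "g \<in> borel_measurable borel"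
    and g: "\<And>s. 0 \<le> g s" and fg: "\<And>x. norm (f x) = g (norm x)"
    and E: "E \<subseteq> {1..2}" and d: "3 \<le> DIM('a)" and x: "x \<noteq> 0"
  shows "maximal_fun E f x \<le> ennreal (sphere_const DIM('a)) * majorant DIM('a) E g (norm x)"
proof (rule order_trans[OF maximal_fun_le_nn_integral[OF assms(1)]], rule SUP_least)
  fix t assume t: "t \<in> E"
  have t0: "0 < t" using t E by auto
  have "(\<integral>\<^sup>+y. ennreal (norm (f (x + t *\<^sub>R y))) \<partial>sphere_measure) = ennreal (sphere_const DIM('a)) *
    (\<integral>\<^sup>+s. ennreal (g s) * (ennreal (radial_kernel DIM('a) (norm x) t s) * indicator {\<bar>norm x - t\<bar><..<norm x + t} s) \<partial>lborel)"
    unfolding fg by (rule nn_integral_sphere_radial[OF _ x t0 d]) measurable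
  also have "\<dots> \<le> ennreal (sphere_const DIM('a)) * majorant DIM('a) E g (norm x)"
    using x by (intro mult_left_mono kernel_integral_le_majorant[OF _ g E t _ d]) auto
  finally show "(\<integral>\<^sup>+y. ennreal (norm (f (x + t *\<^sub>R y))) \<partial>sphere_measure) \<le> \<dots>" .
qed

lemma majorant_measurable:
  assumes [measurable]: "g \<in> borel_measurable borel"
  shows "majorant d E g \<in> borel_measurable borel"
proof -
  have "(\<lambda>r. infdist r E) \<in> borel_measurable borel"
    by (intro borel_measurable_continuous_onI continuous_intros)
  note majorants_measurable[OF assms this, measurable]
  show ?thesis unfolding majorant_def[abs_def] by measurable
qed

lemma majorant_cmult:
  assumes [measurable]: "g \<in> borel_measurable borel" and g: "\<And>s. 0 \<le> g s" and c: "0 \<le> c"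
  shows "majorant d E (\<lambda>s. c * g s) r = ennreal c * majorant d E g r"
proof -
  have 1: "(\<integral>\<^sup>+s. ennreal (c * g s) * indicator A s \<partial>lborel) = ennreal c * (\<integral>\<^sup>+s. ennreal (g s) * indicator A s \<partial>lborel)"
    if [measurable]: "A \<in> sets borel" for A
    using c by (subst nn_integral_cmult[symmetric]) (auto simp: ennreal_mult' mult.assoc)
  have 2: "(\<integral>\<^sup>+s. ennreal (c * g s * s ^ (d - 2)) * indicator A s \<partial>lborel) = ennreal c * (\<integral>\<^sup>+s. ennreal (g s * s ^ (d - 2)) * indicator A s \<partial>lborel)"
    if [measurable]: "A \<in> sets borel" for A
    using c by (subst nn_integral_cmult[symmetric]) (auto simp: ennreal_mult' mult.assoc)
  have "near_majorant (\<lambda>s. c * g s) r = ennreal c * near_majorant g r"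
    unfolding near_majorant_def SUP_mult_left_ennreal by (subst 1) (auto simp: mult_ac)
  moreover have "mid_majorant d D (\<lambda>s. c * g s) r = ennreal c * mid_majorant d D g r" for D
    unfolding mid_majorant_def by (subst 2) (auto simp: mult_ac)
  moreover have "far_majorant (\<lambda>s. c * g s) r = ennreal c * far_majorant g r"
    unfolding far_majorant_def by (subst 1) (auto simp: mult_ac)
  ultimately show ?thesis by (simp add: majorant_def)
qed

context dilation_set
begin

lemma majorant_bound:
  fixes p q :: real and d :: nat
  assumes d: "2 \<le> d" and p: "1 \<le> p" and pq: "p \<le> q" and q: "q \<le> d * p" and p1: "p = 1 \<Longrightarrow> q = 1"
    and hardy: "hardy_bounded d p q"
  shows "\<exists>K\<ge>0. \<forall>g. unit_profile d p g \<longrightarrow>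
     (\<integral>\<^sup>+r. ennreal_powr (majorant d E g r) q * ennreal (r ^ (d - 1)) * indicator {0<..} r \<partial>lborel) \<le> ennreal K"
proof -
  have "\<exists>K\<ge>0. \<forall>g. unit_profile d p g \<longrightarrow>
     (\<integral>\<^sup>+r. ennreal_powr (near_majorant g r) q * ennreal (r ^ (d - 1)) * indicator {0<..<1/2} r \<partial>lborel) \<le> ennreal K"
  proof (cases "p = 1")
    case True
    thus ?thesis using near_majorant_bound_p_eq_1[OF d] p1 by simp
  next
    case False
    thus ?thesis using near_majorant_bound_p_gt_1[OF d pq _ q] p by simp
  qed
  then obtain K1 where K1: "K1 \<ge> 0" "\<And>g. unit_profile d p g \<Longrightarrow>
     (\<integral>\<^sup>+r. ennreal_powr (near_majorant g r) q * ennreal (r ^ (d - 1)) * indicator {0<..<1/2} r \<partial>lborel) \<le> ennreal K1" by blast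
  obtain K2 where K2: "K2 \<ge> 0" "\<And>g. unit_profile d p g \<Longrightarrow>
     (\<integral>\<^sup>+r. ennreal_powr (mid_majorant d (\<lambda>r. infdist r E) g r) q * ennreal (r ^ (d - 1)) * indicator {1/2..<4} r \<partial>lborel) \<le> ennreal K2"
    using mid_majorant_bound[OF d pq p infdist_measurable hardy[unfolded hardy_bounded_def]] by blast
  obtain K3 where K3: "K3 \<ge> 0" "\<And>g. unit_profile d p g \<Longrightarrow>
     (\<integral>\<^sup>+r. ennreal_powr (far_majorant g r) q * ennreal (r ^ (d - 1)) * indicator {4..} r \<partial>lborel) \<le> ennreal K3"
    using far_majorant_bound[OF d pq p] by blast
  show ?thesis
  proof (intro exI[of _ "K1 + K2 + K3"] conjI allI impI)
    show "0 \<le> K1 + K2 + K3" using K1 K2 K3 by simp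
    fix g assume ug: "unit_profile d p g"
    hence [measurable]: "g \<in> borel_measurable borel" by (simp add: unit_profile_def)
    note majorants_measurable[OF this infdist_measurable, measurable]
    have "(\<integral>\<^sup>+r. ennreal_powr (majorant d E g r) q * ennreal (r ^ (d - 1)) * indicator {0<..} r \<partial>lborel)
      = (\<integral>\<^sup>+r. ennreal_powr (near_majorant g r) q * ennreal (r ^ (d - 1)) * indicator {0<..<1/2} r
       + ennreal_powr (mid_majorant d (\<lambda>r. infdist r E) g r) q * ennreal (r ^ (d - 1)) * indicator {1/2..<4} r
       + ennreal_powr (far_majorant g r) q * ennreal (r ^ (d - 1)) * indicator {4..} r \<partial>lborel)"
      by (intro nn_integral_cong) (auto simp: majorant_def indicator_def)
    also have "\<dots> = (\<integral>\<^sup>+r. ennreal_powr (near_majorant g r) q * ennreal (r ^ (d - 1)) * indicator {0<..<1/2} r \<partial>lborel)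
       + (\<integral>\<^sup>+r. ennreal_powr (mid_majorant d (\<lambda>r. infdist r E) g r) q * ennreal (r ^ (d - 1)) * indicator {1/2..<4} r \<partial>lborel)
       + (\<integral>\<^sup>+r. ennreal_powr (far_majorant g r) q * ennreal (r ^ (d - 1)) * indicator {4..} r \<partial>lborel)"
      by (simp add: nn_integral_add)
    also have "\<dots> \<le> ennreal K1 + ennreal K2 + ennreal K3"
      using K1 K2 K3 ug by (intro add_mono) auto
    finally show "(\<integral>\<^sup>+r. ennreal_powr (majorant d E g r) q * ennreal (r ^ (d - 1)) * indicator {0<..} r \<partial>lborel) \<le> ennreal (K1 + K2 + K3)"
      using K1 K2 K3 by (simp add: ennreal_plus[symmetric] del: ennreal_plus)
  qed
qed

end

section \<open>From radial integrals to norms on the whole space\<close>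

lemma Lp_norm_real:
  assumes "g \<in> borel_measurable lebesgue" and "1 \<le> p"
  shows "Lp_norm (ennreal p) g = ennreal_powr (\<integral>\<^sup>+x. ennreal_powr (g x) p \<partial>lborel) (1 / p)"
  using assms by (simp add: Lp_norm_def nn_integral_completion)

lemma borel_imp_lebesgue_measurable:
  "f \<in> borel_measurable borel \<Longrightarrow> f \<in> borel_measurable lebesgue"
  by (metis measurable_completion measurable_lborel2)

lemma Lp_norm_radial:
  fixes f :: "'a::euclidean_space \<Rightarrow> complex"
  assumes [measurable]: "f \<in> borel_measurable borel" "g \<in> borel_measurable borel"
    and g: "\<And>s. 0 \<le> g s" and fg: "\<And>x. norm (f x) = g (norm x)" and p: "1 \<le> p"
  shows "Lp_norm (ennreal p) (\<lambda>x. ennreal (norm (f x))) = ennreal ((DIM('a) * unit_ball_vol DIM('a)) powr (1 / p)) *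
     ennreal_powr (\<integral>\<^sup>+s. ennreal (g s powr p * s ^ (DIM('a) - 1)) * indicator {0<..} s \<partial>lborel) (1 / p)"
proof -
  have "(\<lambda>x. ennreal (norm (f x))) \<in> borel_measurable lebesgue"
    by (rule borel_imp_lebesgue_measurable) measurable
  hence "Lp_norm (ennreal p) (\<lambda>x. ennreal (norm (f x))) = ennreal_powr (\<integral>\<^sup>+x. ennreal_powr (ennreal (norm (f x))) p \<partial>lborel) (1 / p)"
    by (rule Lp_norm_real[OF _ p])
  also have "(\<integral>\<^sup>+x. ennreal_powr (ennreal (norm (f x))) p \<partial>lborel) = (\<integral>\<^sup>+x. ennreal (g (norm (x::'a)) powr p) \<partial>lborel)"
    using g by (simp add: fg)
  also have "\<dots> = ennreal (DIM('a) * unit_ball_vol DIM('a)) * (\<integral>\<^sup>+s. ennreal (g s powr p) * ennreal (s ^ (DIM('a) - 1)) * indicator {0<..} s \<partial>lborel)"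
    by (rule nn_integral_norm) measurable
  also have "(\<integral>\<^sup>+s. ennreal (g s powr p) * ennreal (s ^ (DIM('a) - 1)) * indicator {0<..} s \<partial>lborel)
    = (\<integral>\<^sup>+s. ennreal (g s powr p * s ^ (DIM('a) - 1)) * indicator {0<..} s \<partial>lborel)"
    by (simp add: ennreal_mult')
  finally show ?thesis using p by (simp add: ennreal_powr_mult)
qed

text \<open>The given f0 is arbitrary on negative arguments and may fail to be measurable there;
  restricting f to a line through the origin gives a Borel profile.\<close>

lemma radial_profile:
  fixes f :: "'a::euclidean_space \<Rightarrow> complex"
  assumes [measurable]: "f \<in> borel_measurable borel" and rad: "\<And>x. f x = f0 (norm x)"
  obtains F :: "real \<Rightarrow> complex" where "F \<in> borel_measurable borel" "\<And>x. f x = F (norm x)"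
proof -
  obtain b :: 'a where b: "b \<in> Basis" using nonempty_Basis by blast
  show ?thesis
  proof (rule that[of "\<lambda>s. f (s *\<^sub>R b)"])
    show "(\<lambda>s. f (s *\<^sub>R b)) \<in> borel_measurable borel" by measurable
    show "f x = f (norm x *\<^sub>R b)" for x using b by (simp add: rad[of x] rad[of "norm x *\<^sub>R b"])
  qed
qed

text \<open>Recovers the homogeneous inequality from the normalized one. If P > 0 the scaling with
  c^p P = 1 is used; if P = 0 all scalings are allowed, and c tending to infinity forces V =
  0.\<close>

lemma ennreal_scaling_bound:
  fixes V P :: ennreal
  assumes p: "1 \<le> p" and q: "1 \<le> q" and K: "0 \<le> K" and P: "P < \<infinity>"
    and scale: "\<And>c. 0 < c \<Longrightarrow> ennreal (c powr p) * P \<le> 1 \<Longrightarrow> ennreal (c powr q) * V \<le> ennreal K"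
  shows "V \<le> ennreal K * ennreal_powr P (q / p)"
proof -
  obtain P' where P': "P = ennreal P'" "0 \<le> P'" using P by (cases P) auto
  have V: "V \<le> ennreal (K / c powr q)" if "0 < c" "c powr p * P' \<le> 1" for c
  proof -
    have "ennreal (c powr q) * V \<le> ennreal K"
      using that P' by (intro scale) (auto simp: ennreal_mult'[symmetric])
    hence "ennreal (1 / c powr q) * (ennreal (c powr q) * V) \<le> ennreal (1 / c powr q) * ennreal K"
      by (rule mult_left_mono) simp
    thus ?thesis using that K by (simp add: mult.assoc[symmetric] ennreal_mult'[symmetric])
  qed
  show ?thesis
  proof (cases "P' = 0")
    case True
    have "V \<le> ennreal (K * 0)"
    proof (rule tendsto_lowerbound)
      have "((\<lambda>c. inverse (c powr q)) \<longlongrightarrow> 0) at_top" using q by real_asymp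
      thus "((\<lambda>c. ennreal (K * inverse (c powr q))) \<longlongrightarrow> ennreal (K * 0)) at_top"
        by (intro tendsto_intros)
      show "\<forall>\<^sub>F c in at_top. V \<le> ennreal (K * inverse (c powr q))"
        using eventually_gt_at_top[of 0] by eventually_elim (use V True in \<open>auto simp: divide_inverse\<close>)
    qed simp
    thus ?thesis by simp
  next
    case False
    hence P0: "0 < P'" using P' by simp
    have "(P' powr (- (1 / p))) powr p = P' powr (- 1)" using p unfolding powr_powr by simp
    hence "V \<le> ennreal (K / (P' powr (- (1 / p))) powr q)"
      using P0 by (intro V) (auto simp: powr_minus)
    also have "(P' powr (- (1 / p))) powr q = P' powr (- (q / p))" unfolding powr_powr by simp
    also have "K / P' powr (- (q / p)) = K * P' powr (q / p)"
      using P0 by (simp add: powr_minus_divide)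
    finally show ?thesis using P' K by (simp add: ennreal_mult')
  qed
qed

text \<open>Measurability is a separate hypothesis because \<open>Lp_norm\<close> is infinite off
  the measurable functions, whatever majorant is available. It is supplied later for each range of
  exponents.\<close>

lemma (in dilation_set) maximal_bounded_finite_exponents:
  fixes p q :: real
  assumes d: "3 \<le> DIM('a::euclidean_space)" and p: "1 \<le> p" and pq: "p \<le> q" and q: "q \<le> DIM('a) * p" and p1: "p = 1 \<Longrightarrow> q = 1"
    and hardy: "hardy_bounded DIM('a) p q"
    and meas: "\<And>f. f \<in> (radial_Lp (ennreal p) :: ('a \<Rightarrow> complex) set) \<Longrightarrow> maximal_fun E f \<in> borel_measurable lebesgue"
  shows "maximal_bounded TYPE('a) E (ennreal p) (ennreal q)"
proof -
  let ?d = "DIM('a)"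
  define \<kappa> where "\<kappa> = sphere_const ?d"
  define \<omega> where "\<omega> = ?d * unit_ball_vol ?d"
  have \<kappa>: "0 < \<kappa>" using d by (simp add: \<kappa>_def sphere_const_pos)
  have \<omega>: "0 < \<omega>" by (simp add: \<omega>_def)
  have d2: "2 \<le> ?d" using d by simp
  obtain K where K: "0 \<le> K" "\<And>g. unit_profile ?d p g \<Longrightarrow>
     (\<integral>\<^sup>+r. ennreal_powr (majorant ?d E g r) q * ennreal (r ^ (?d - 1)) * indicator {0<..} r \<partial>lborel) \<le> ennreal K"
    using majorant_bound[OF d2 p pq q p1 hardy] by blast
  define C where "C = (\<kappa> powr q * \<omega> * K) powr (1 / q) / \<omega> powr (1 / p)"
  show ?thesis unfolding maximal_bounded_def
  proof (intro exI[of _ C] ballI)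
    fix f :: "'a \<Rightarrow> complex" assume f: "f \<in> radial_Lp (ennreal p)"
    from f have fm[measurable]: "f \<in> borel_measurable borel" by (simp add: radial_Lp_def)
    from f obtain f0 where f0: "\<And>x. f x = f0 (norm x)" by (auto simp: radial_Lp_def)
    obtain F where Fm[measurable]: "F \<in> borel_measurable borel" and F: "\<And>x. f x = F (norm x)"
      using radial_profile[OF fm f0] by blast
    define g where "g = (\<lambda>s. norm (F s))"
    have [measurable]: "g \<in> borel_measurable borel" unfolding g_def by measurable
    have g: "0 \<le> g s" for s by (simp add: g_def)
    have fg: "norm (f x) = g (norm x)" for x by (simp add: g_def F)
    define P where "P = (\<integral>\<^sup>+s. ennreal (g s powr p * s ^ (?d - 1)) * indicator {0<..} s \<partial>lborel)"
    define V where "V = (\<integral>\<^sup>+r. ennreal_powr (majorant ?d E g r) q * ennreal (r ^ (?d - 1)) * indicator {0<..} r \<partial>lborel)"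
    have A: "Lp_norm (ennreal p) (\<lambda>x. ennreal (norm (f x))) = ennreal (\<omega> powr (1 / p)) * ennreal_powr P (1 / p)"
      unfolding P_def \<omega>_def by (rule Lp_norm_radial[where f = f and g = g, OF _ _ g fg p]) measurable
    have "Lp_norm (ennreal p) (\<lambda>x. ennreal (norm (f x))) < \<infinity>" using f by (simp add: radial_Lp_def)
    hence P: "P < \<infinity>" unfolding A using \<omega> by (cases P) (auto simp: ennreal_mult_top)
    note majorant_measurable[of g, measurable]
    have "V \<le> ennreal K * ennreal_powr P (q / p)"
    proof (rule ennreal_scaling_bound[OF p _ K(1) P])
      fix c :: real assume c: "0 < c" "ennreal (c powr p) * P \<le> 1"
      have "(\<integral>\<^sup>+s. ennreal ((c * g s) powr p * s ^ (?d - 1)) * indicator {0<..} s \<partial>lborel) = ennreal (c powr p) * P"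
        unfolding P_def using c g
        by (subst nn_integral_cmult[symmetric]) (auto simp: powr_mult ennreal_mult' mult.assoc)
      hence "unit_profile ?d p (\<lambda>s. c * g s)" using c g by (simp add: unit_profile_def)
      hence "(\<integral>\<^sup>+r. ennreal_powr (majorant ?d E (\<lambda>s. c * g s) r) q * ennreal (r ^ (?d - 1)) * indicator {0<..} r \<partial>lborel) \<le> ennreal K"
        by (rule K(2))
      also have "(\<integral>\<^sup>+r. ennreal_powr (majorant ?d E (\<lambda>s. c * g s) r) q * ennreal (r ^ (?d - 1)) * indicator {0<..} r \<partial>lborel)
        = ennreal (c powr q) * V"
        unfolding V_def using c g p pq
        by (subst nn_integral_cmult[symmetric]) (auto simp: majorant_cmult ennreal_powr_mult mult.assoc)
      finally show "ennreal (c powr q) * V \<le> ennreal K" .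
    qed (use p pq in simp)
    have "(\<integral>\<^sup>+x. ennreal_powr (maximal_fun E f x) q \<partial>lborel) \<le> (\<integral>\<^sup>+x. ennreal_powr (ennreal \<kappa> * majorant ?d E g (norm (x::'a))) q \<partial>lborel)"
    proof (rule nn_integral_mono_AE)
      have "AE x in lborel. x \<noteq> (0::'a)" by (rule AE_lborel_singleton)
      thus "AE x in lborel. ennreal_powr (maximal_fun E f x) q \<le> ennreal_powr (ennreal \<kappa> * majorant ?d E g (norm (x::'a))) q"
      proof eventually_elim
        case (elim x)
        thus ?case unfolding \<kappa>_def using p pq
          by (intro ennreal_powr_mono maximal_fun_le_majorant[where f = f and g = g, OF _ _ g fg E_sub d]) auto
      qed
    qed
    also have "\<dots> = ennreal \<omega> * (\<integral>\<^sup>+r. ennreal_powr (ennreal \<kappa> * majorant ?d E g r) q * ennreal (r ^ (?d - 1)) * indicator {0<..} r \<partial>lborel)"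
      unfolding \<omega>_def by (rule nn_integral_norm) measurable
    also have "(\<integral>\<^sup>+r. ennreal_powr (ennreal \<kappa> * majorant ?d E g r) q * ennreal (r ^ (?d - 1)) * indicator {0<..} r \<partial>lborel) = ennreal (\<kappa> powr q) * V"
      unfolding V_def using \<kappa> p pq by (subst nn_integral_cmult[symmetric]) (auto simp: ennreal_powr_mult mult.assoc)
    also have "ennreal \<omega> * (ennreal (\<kappa> powr q) * V) \<le> ennreal \<omega> * (ennreal (\<kappa> powr q) * (ennreal K * ennreal_powr P (q / p)))"
      using \<open>V \<le> _\<close> by (intro mult_left_mono) auto
    also have "\<dots> = ennreal (\<kappa> powr q * \<omega> * K) * ennreal_powr P (q / p)"
      using \<omega> K by (simp add: ennreal_mult mult_ac)
    finally have "ennreal_powr (\<integral>\<^sup>+x. ennreal_powr (maximal_fun E f x) q \<partial>lborel) (1 / q) \<le> ennreal_powr (ennreal (\<kappa> powr q * \<omega> * K) * ennreal_powr P (q / p)) (1 / q)"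
      using p pq by (intro ennreal_powr_mono) auto
    also have "\<dots> = ennreal ((\<kappa> powr q * \<omega> * K) powr (1 / q)) * ennreal_powr P (1 / p)"
      using p pq \<omega> K by (simp add: ennreal_powr_mult ennreal_powr_powr)
    also have "(\<kappa> powr q * \<omega> * K) powr (1 / q) = C * \<omega> powr (1 / p)" using \<omega> by (simp add: C_def)
    also have "ennreal (C * \<omega> powr (1 / p)) * ennreal_powr P (1 / p) = ennreal C * Lp_norm (ennreal p) (\<lambda>x. ennreal (norm (f x)))"
      unfolding A by (simp add: ennreal_mult'' mult.assoc)
    finally show "Lp_norm (ennreal q) (maximal_fun E f) \<le> ennreal C * Lp_norm (ennreal p) (\<lambda>x. ennreal (norm (f x)))"
      using Lp_norm_real[OF meas[OF f], of q] p pq by simp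
  qed
qed

section \<open>Measurability of the maximal function\<close>

text \<open>The density of the distance to the origin of a uniform point on the sphere of radius t
  about a point at distance r.\<close>

definition radial_density :: "nat \<Rightarrow> real \<Rightarrow> real \<Rightarrow> real \<Rightarrow> real" where
  "radial_density d r t s = sphere_const d * radial_kernel d r t s * indicator {\<bar>r - t\<bar><..<r + t} s"

lemma radial_density_measurable [measurable]: "radial_density d r t \<in> borel_measurable borel"
  unfolding radial_density_def[abs_def] by measurable

lemma radial_density_nonneg: "0 < r \<Longrightarrow> 0 < t \<Longrightarrow> 2 \<le> d \<Longrightarrow> 0 \<le> radial_density d r t s"
  using sphere_const_pos[of d] radial_kernel_bounds(1)[of r t s d]
  by (auto simp: radial_density_def indicator_def)

lemma ennreal_radial_density:
  "0 < r \<Longrightarrow> 0 < t \<Longrightarrow> 2 \<le> d \<Longrightarrow> ennreal (radial_density d r t s) =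
    ennreal (sphere_const d) * (ennreal (radial_kernel d r t s) * indicator {\<bar>r - t\<bar><..<r + t} s)"
  using sphere_const_pos[of d] by (auto simp: radial_density_def indicator_def ennreal_mult')

lemma distr_sphere_measure_norm:
  fixes x :: "'a::euclidean_space"
  assumes x: "x \<noteq> 0" and t: "0 < t" and d: "3 \<le> DIM('a)"
  shows "distr sphere_measure borel (\<lambda>y. norm (x + t *\<^sub>R y)) = density lborel (\<lambda>s. ennreal (radial_density DIM('a) (norm x) t s))"
proof (rule measure_eqI)
  fix A assume "A \<in> sets (distr (sphere_measure :: 'a measure) borel (\<lambda>y. norm (x + t *\<^sub>R y)))"
  hence A[measurable]: "A \<in> sets borel" by simp
  have d2: "2 \<le> DIM('a)" using d by simp
  have nx: "0 < norm x" using x by simp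
  have "emeasure (distr sphere_measure borel (\<lambda>y. norm (x + t *\<^sub>R y))) A
     = (\<integral>\<^sup>+s. indicator A s \<partial>distr sphere_measure borel (\<lambda>y. norm (x + t *\<^sub>R y)))"
    by simp
  also have "\<dots> = (\<integral>\<^sup>+y. indicator A (norm (x + t *\<^sub>R y)) \<partial>sphere_measure)"
    by (rule nn_integral_distr) measurable
  also have "\<dots> = ennreal (sphere_const DIM('a)) *
    (\<integral>\<^sup>+s. indicator A s * (ennreal (radial_kernel DIM('a) (norm x) t s) * indicator {\<bar>norm x - t\<bar><..<norm x + t} s) \<partial>lborel)"
    by (rule nn_integral_sphere_radial[OF _ x t d]) measurable
  also have "\<dots> = (\<integral>\<^sup>+s. ennreal (radial_density DIM('a) (norm x) t s) * indicator A s \<partial>lborel)"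
    by (subst nn_integral_cmult[symmetric])
       (auto simp: ennreal_radial_density[OF nx t d2] mult_ac)
  also have "\<dots> = emeasure (density lborel (\<lambda>s. ennreal (radial_density DIM('a) (norm x) t s))) A"
    by (subst emeasure_density) auto
  finally show "emeasure (distr sphere_measure borel (\<lambda>y. norm (x + t *\<^sub>R y))) A
    = emeasure (density lborel (\<lambda>s. ennreal (radial_density DIM('a) (norm x) t s))) A" .
qed simp

text \<open>The complex-valued counterpart of the formula for nonnegative functions, needed because
  continuity in r concerns the averages themselves and not their majorants.\<close>

lemma sphere_avg_radial:
  fixes f :: "'a::euclidean_space \<Rightarrow> complex" and F :: "real \<Rightarrow> complex"
  assumes F[measurable]: "F \<in> borel_measurable borel" and fF: "\<And>x. f x = F (norm x)"
    and x: "x \<noteq> 0" and t: "0 < t" and d: "3 \<le> DIM('a)"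
  shows "integrable sphere_measure (\<lambda>y. f (x + t *\<^sub>R y)) \<longleftrightarrow> integrable lborel (\<lambda>s. radial_density DIM('a) (norm x) t s *\<^sub>R F s)"
    and "sphere_avg t f x = (\<integral>s. radial_density DIM('a) (norm x) t s *\<^sub>R F s \<partial>lborel)"
proof -
  have nn: "0 \<le> radial_density DIM('a) (norm x) t s" for s
    using x t d by (intro radial_density_nonneg) auto
  have m: "(\<lambda>y. norm (x + t *\<^sub>R y)) \<in> sphere_measure \<rightarrow>\<^sub>M borel" by measurable
  have "integrable sphere_measure (\<lambda>y. f (x + t *\<^sub>R y)) \<longleftrightarrow> integrable (distr sphere_measure borel (\<lambda>y. norm (x + t *\<^sub>R y))) F"
    unfolding fF by (rule integrable_distr_eq[symmetric, OF m]) simp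
  also have "\<dots> \<longleftrightarrow> integrable lborel (\<lambda>s. radial_density DIM('a) (norm x) t s *\<^sub>R F s)"
    unfolding distr_sphere_measure_norm[OF x t d] by (rule integrable_density) (auto simp: nn)
  finally show "integrable sphere_measure (\<lambda>y. f (x + t *\<^sub>R y)) \<longleftrightarrow> integrable lborel (\<lambda>s. radial_density DIM('a) (norm x) t s *\<^sub>R F s)" .
  have "sphere_avg t f x = integral\<^sup>L (distr sphere_measure borel (\<lambda>y. norm (x + t *\<^sub>R y))) F"
    unfolding sphere_avg_def fF by (rule integral_distr[symmetric, OF m]) simp
  also have "\<dots> = (\<integral>s. radial_density DIM('a) (norm x) t s *\<^sub>R F s \<partial>lborel)"
    unfolding distr_sphere_measure_norm[OF x t d] by (rule integral_density) (auto simp: nn)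
  finally show "sphere_avg t f x = (\<integral>s. radial_density DIM('a) (norm x) t s *\<^sub>R F s \<partial>lborel)" .
qed

lemma eventually_nhds_open_Collect:
  "open {u. P u} \<Longrightarrow> P r \<Longrightarrow> \<forall>\<^sub>F u in nhds r. P u"
  using eventually_nhds_in_open[of "{u. P u}" r] by simp

lemma radial_density_tendsto:
  assumes r: "0 < r" and t: "0 < t" and s: "s \<noteq> \<bar>r - t\<bar>" "s \<noteq> r + t"
  shows "((\<lambda>r. radial_density d r t s) \<longlongrightarrow> radial_density d r t s) (nhds r)"
proof -
  have "isCont (\<lambda>r. radial_kernel d r t s) r"
    unfolding radial_kernel_def using r t by (intro continuous_intros) auto
  hence cont: "((\<lambda>r. radial_kernel d r t s) \<longlongrightarrow> radial_kernel d r t s) (nhds r)"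
    using tendsto_at_iff_tendsto_nhds[of "\<lambda>r. radial_kernel d r t s" r] by (simp add: isCont_def)
  have ind: "\<forall>\<^sub>F u in nhds r. (indicator {\<bar>u - t\<bar><..<u + t} s :: real) = indicator {\<bar>r - t\<bar><..<r + t} s"
  proof -
    consider "\<bar>r - t\<bar> < s" "s < r + t" | "s < \<bar>r - t\<bar>" | "r + t < s" using s by linarith
    thus ?thesis
    proof cases
      case 1
      have "\<forall>\<^sub>F u in nhds r. \<bar>u - t\<bar> < s" "\<forall>\<^sub>F u in nhds r. s < u + t"
        using 1 by (auto intro!: eventually_nhds_open_Collect open_Collect_less continuous_intros)
      thus ?thesis by eventually_elim (use 1 in \<open>auto simp: indicator_def\<close>)
    next
      case 2
      have "\<forall>\<^sub>F u in nhds r. s < \<bar>u - t\<bar>"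
        using 2 by (auto intro!: eventually_nhds_open_Collect open_Collect_less continuous_intros)
      thus ?thesis by eventually_elim (use 2 in \<open>auto simp: indicator_def\<close>)
    next
      case 3
      have "\<forall>\<^sub>F u in nhds r. u + t < s"
        using 3 by (auto intro!: eventually_nhds_open_Collect open_Collect_less continuous_intros)
      thus ?thesis by eventually_elim (use 3 in \<open>auto simp: indicator_def\<close>)
    qed
  qed
  have "((\<lambda>u. sphere_const d * radial_kernel d u t s * indicator {\<bar>r - t\<bar><..<r + t} s) \<longlongrightarrow> radial_density d r t s) (nhds r)"
    unfolding radial_density_def
    by (intro tendsto_intros cont)
  thus ?thesis
    by (rule Lim_transform_eventually) (use ind in \<open>eventually_elim, simp add: radial_density_def\<close>)
qed

text \<open>Dominated convergence along sequences. The density converges except at the two ends of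
  its support, which form a null set of s.\<close>

lemma radial_average_isCont:
  fixes F :: "real \<Rightarrow> complex" and w :: "real \<Rightarrow> real"
  assumes F[measurable]: "F \<in> borel_measurable borel" and r: "0 < r" and t: "0 < t" and d: "2 \<le> d"
    and w: "integrable lborel (\<lambda>s. w s * norm (F s))"
    and dom: "\<forall>\<^sub>F u in nhds r. \<forall>s. radial_density d u t s \<le> w s"
  shows "integrable lborel (\<lambda>s. radial_density d r t s *\<^sub>R F s)"
    and "isCont (\<lambda>u. \<integral>s. radial_density d u t s *\<^sub>R F s \<partial>lborel) r"
proof -
  have ev: "\<forall>\<^sub>F u in nhds r. 0 < u \<and> (\<forall>s. radial_density d u t s \<le> w s)"
    using dom r by (auto intro: eventually_conj order_tendstoD(1)[OF filterlim_ident])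
  have bound: "norm (radial_density d u t s *\<^sub>R F s) \<le> w s * norm (F s)"
    if "0 < u \<and> (\<forall>s. radial_density d u t s \<le> w s)" for u s
    using that radial_density_nonneg[of u t d s] t d by (simp add: mult_right_mono)
  show "integrable lborel (\<lambda>s. radial_density d r t s *\<^sub>R F s)"
  proof (rule Bochner_Integration.integrable_bound[OF w])
    show "AE s in lborel. norm (radial_density d r t s *\<^sub>R F s) \<le> norm (w s * norm (F s))"
      by (intro AE_I2 order_trans[OF bound[OF eventually_nhds_x_imp_x[OF ev]]]) simp
  qed measurable
  show "isCont (\<lambda>u. \<integral>s. radial_density d u t s *\<^sub>R F s \<partial>lborel) r"
    unfolding continuous_at_sequentially
  proof (intro allI impI)
    fix u assume u: "u \<longlonglongrightarrow> r"
    from eventually_compose_filterlim[OF ev u] obtain M where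
      M: "\<And>n. M \<le> n \<Longrightarrow> 0 < u n \<and> (\<forall>s. radial_density d (u n) t s \<le> w s)"
      by (auto simp: eventually_sequentially)
    \<comment> \<open>The domination by w holds only near r, so the sequence is shifted by M to have
      it from the first term on.\<close>
    have "(\<lambda>n. \<integral>s. radial_density d (u (n + M)) t s *\<^sub>R F s \<partial>lborel) \<longlonglongrightarrow> (\<integral>s. radial_density d r t s *\<^sub>R F s \<partial>lborel)"
    proof (rule integral_dominated_convergence[OF _ _ w])
      have "AE s in lborel. s \<notin> {\<bar>r - t\<bar>, r + t}"
        by (intro AE_not_in countable_imp_null_set_lborel) auto
      thus "AE s in lborel. (\<lambda>n. radial_density d (u (n + M)) t s *\<^sub>R F s) \<longlonglongrightarrow> radial_density d r t s *\<^sub>R F s"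
      proof eventually_elim
        case (elim s)
        have "(\<lambda>n. u (n + M)) \<longlonglongrightarrow> r" using u by (rule LIMSEQ_ignore_initial_segment)
        hence "(\<lambda>n. radial_density d (u (n + M)) t s) \<longlonglongrightarrow> radial_density d r t s"
          using radial_density_tendsto[OF r t] elim by (auto intro: filterlim_compose[rotated])
        thus ?case by (intro tendsto_intros)
      qed
      show "AE s in lborel. norm (radial_density d (u (n + M)) t s *\<^sub>R F s) \<le> w s * norm (F s)" for n
        using bound[OF M[of "n + M"]] by (intro AE_I2) auto
    qed measurable
    thus "((\<lambda>u. \<integral>s. radial_density d u t s *\<^sub>R F s \<partial>lborel) \<circ> u) \<longlonglongrightarrow> (\<integral>s. radial_density d r t s *\<^sub>R F s \<partial>lborel)"
      unfolding o_def by (rule LIMSEQ_offset)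
  qed
qed

text \<open>Nothing is required near 0: only spheres through the origin see that part of the
  profile.\<close>

definition locally_integrable_profile :: "(real \<Rightarrow> complex) \<Rightarrow> bool" where
  "locally_integrable_profile F \<longleftrightarrow> (\<forall>\<eta> R. 0 < \<eta> \<longrightarrow> (\<integral>\<^sup>+s. ennreal (norm (F s)) * indicator {\<eta>..R} s \<partial>lborel) < \<infinity>)"

text \<open>If r \<noteq> t, the spheres for nearby radii stay at a positive distance \<eta> from
  the origin, and local integrability suffices. If r = t, they may pass through the origin; then the
  kernel bound by s^(d-2) and the second alternative give the dominating function.\<close>

lemma radial_average_continuous:
  fixes F :: "real \<Rightarrow> complex"
  assumes F[measurable]: "F \<in> borel_measurable borel" and loc: "locally_integrable_profile F"
    and r: "0 < r" and t: "1 \<le> t" "t \<le> 2" and d: "3 \<le> d"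
    and or: "r \<noteq> t \<or> (\<integral>\<^sup>+s. ennreal (norm (F s) * s ^ (d - 2)) * indicator {0..6} s \<partial>lborel) < \<infinity>"
  shows "integrable lborel (\<lambda>s. radial_density d r t s *\<^sub>R F s)"
    and "isCont (\<lambda>u. \<integral>s. radial_density d u t s *\<^sub>R F s \<partial>lborel) r"
proof -
  have t0: "0 < t" and d2: "2 \<le> d" using t d by auto
  have \<kappa>: "0 < sphere_const d" using d2 by (rule sphere_const_pos)
  have "\<exists>w. integrable lborel (\<lambda>s. w s * norm (F s)) \<and> (\<forall>\<^sub>F u in nhds r. \<forall>s. radial_density d u t s \<le> w s)"
  proof (cases "r = t")
    case False
    define \<eta> where "\<eta> = \<bar>r - t\<bar> / 2"
    define c where "c = sphere_const d * (2 / r + 1)"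
    have \<eta>: "0 < \<eta>" using False by (simp add: \<eta>_def)
    have c: "0 \<le> c" using \<kappa> r by (simp add: c_def)
    have 1: "integrable lborel (\<lambda>s. c * indicator {\<eta>..2 * r + t} s * norm (F s))"
    proof (rule integrableI_bounded)
      have "(\<integral>\<^sup>+s. ennreal (norm (c * indicator {\<eta>..2 * r + t} s * norm (F s))) \<partial>lborel)
        = (\<integral>\<^sup>+s. ennreal c * (ennreal (norm (F s)) * indicator {\<eta>..2 * r + t} s) \<partial>lborel)"
        using c by (intro nn_integral_cong) (auto simp: indicator_def ennreal_mult')
      also have "\<dots> = ennreal c * (\<integral>\<^sup>+s. ennreal (norm (F s)) * indicator {\<eta>..2 * r + t} s \<partial>lborel)"
        by (rule nn_integral_cmult) measurable
      also have "\<dots> < \<infinity>" using loc \<eta> unfolding locally_integrable_profile_def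
        by (auto simp: ennreal_mult_less_top)
      finally show "(\<integral>\<^sup>+s. ennreal (norm (c * indicator {\<eta>..2 * r + t} s * norm (F s))) \<partial>lborel) < \<infinity>" .
    qed measurable
    have "\<forall>\<^sub>F u in nhds r. \<eta> < \<bar>u - t\<bar>"
      using False by (intro eventually_nhds_open_Collect open_Collect_less continuous_intros) (simp add: \<eta>_def)
    moreover have "\<forall>\<^sub>F u in nhds r. r / 2 < u" "\<forall>\<^sub>F u in nhds r. u < 2 * r"
      using r by (auto intro!: eventually_nhds_open_Collect open_Collect_less continuous_intros)
    ultimately have 2: "\<forall>\<^sub>F u in nhds r. \<forall>s. radial_density d u t s \<le> c * indicator {\<eta>..2 * r + t} s"
    proof eventually_elim
      case (elim u)
      have u0: "0 < u" using elim r by simp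
      show ?case
      proof
        fix s
        show "radial_density d u t s \<le> c * indicator {\<eta>..2 * r + t} s"
        proof (cases "s \<in> {\<bar>u - t\<bar><..<u + t}")
          case True
          have "radial_kernel d u t s \<le> s / (u * t)" using True u0 t0 by (intro radial_kernel_bounds) auto
          also have "\<dots> \<le> (u + t) / (u * t)" using True u0 t0 by (intro divide_right_mono) auto
          also have "\<dots> = 1 / u + 1 / t" using u0 t0 by (simp add: field_simps)
          also have "\<dots> \<le> 2 / r + 1"
          proof (rule add_mono)
            show "1 / u \<le> 2 / r" using elim r u0 by (simp add: field_simps)
            show "1 / t \<le> 1" using t by simp
          qed
          finally have "sphere_const d * radial_kernel d u t s \<le> c" using \<kappa> by (simp add: c_def)
          thus ?thesis using True elim by (simp add: radial_density_def indicator_def)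
        next
          case False
          thus ?thesis using c by (simp add: radial_density_def)
        qed
      qed
    qed
    from 1 2 show ?thesis by (intro exI[of _ "\<lambda>s. c * indicator {\<eta>..2 * r + t} s"] conjI)
  next
    case True
    define c where "c = sphere_const d * (2 * 6 ^ (d - 3))"
    have c: "0 \<le> c" using \<kappa> by (simp add: c_def)
    have fin: "(\<integral>\<^sup>+s. ennreal (norm (F s) * s ^ (d - 2)) * indicator {0..6} s \<partial>lborel) < \<infinity>" using or True by simp
    have 1: "integrable lborel (\<lambda>s. c * s ^ (d - 2) * indicator {0..6} s * norm (F s))"
    proof (rule integrableI_bounded)
      have "(\<integral>\<^sup>+s. ennreal (norm (c * s ^ (d - 2) * indicator {0..6} s * norm (F s))) \<partial>lborel)
        = (\<integral>\<^sup>+s. ennreal c * (ennreal (norm (F s) * s ^ (d - 2)) * indicator {0..6} s) \<partial>lborel)"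
        using c by (intro nn_integral_cong) (auto simp: indicator_def ennreal_mult'[symmetric] abs_mult mult_ac)
      also have "\<dots> = ennreal c * (\<integral>\<^sup>+s. ennreal (norm (F s) * s ^ (d - 2)) * indicator {0..6} s \<partial>lborel)"
        by (rule nn_integral_cmult) measurable
      also have "\<dots> < \<infinity>" using fin by (auto simp: ennreal_mult_less_top)
      finally show "(\<integral>\<^sup>+s. ennreal (norm (c * s ^ (d - 2) * indicator {0..6} s * norm (F s))) \<partial>lborel) < \<infinity>" .
    qed measurable
    have "\<forall>\<^sub>F u in nhds r. 1/2 < u" "\<forall>\<^sub>F u in nhds r. u < 4"
      using True t by (auto intro!: eventually_nhds_open_Collect open_Collect_less continuous_intros)
    hence 2: "\<forall>\<^sub>F u in nhds r. \<forall>s. radial_density d u t s \<le> c * s ^ (d - 2) * indicator {0..6} s"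
    proof eventually_elim
      case (elim u)
      show ?case
      proof
        fix s
        show "radial_density d u t s \<le> c * s ^ (d - 2) * indicator {0..6} s"
        proof (cases "s \<in> {\<bar>u - t\<bar><..<u + t}")
          case True
          have s: "0 \<le> s" "s \<le> 6" using True abs_ge_zero[of "u - t"] elim t by auto
          have "radial_kernel d u t s \<le> 2 * 6 ^ (d - 3) * s ^ (d - 2)"
            using True elim t d by (intro radial_kernel_le_power) auto
          hence "sphere_const d * radial_kernel d u t s \<le> c * s ^ (d - 2)" using \<kappa> by (simp add: c_def mult.assoc)
          thus ?thesis using True s by (simp add: radial_density_def indicator_def)
        next
          case False
          thus ?thesis using c by (simp add: radial_density_def) (simp add: indicator_def)
        qed
      qed
    qed
    from 1 2 show ?thesis by (intro exI[of _ "\<lambda>s. c * s ^ (d - 2) * indicator {0..6} s"] conjI)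
  qed
  then obtain w where w: "integrable lborel (\<lambda>s. w s * norm (F s))"
    "\<forall>\<^sub>F u in nhds r. \<forall>s. radial_density d u t s \<le> w s" by blast
  show "integrable lborel (\<lambda>s. radial_density d r t s *\<^sub>R F s)"
    and "isCont (\<lambda>u. \<integral>s. radial_density d u t s *\<^sub>R F s \<partial>lborel) r"
    using radial_average_isCont[OF F r t0 d2 w] by auto
qed

lemma AE_lborel_norm_iff:
  assumes [measurable]: "Measurable.pred borel P"
  shows "(AE x in lborel. P (norm (x::'a::euclidean_space))) \<longleftrightarrow> (AE r in lborel. 0 < r \<longrightarrow> P r)"
proof -
  define h where "h = (\<lambda>r::real. if P r then 0 else 1 :: ennreal)"
  have [measurable]: "h \<in> borel_measurable borel" unfolding h_def by measurable
  have "(AE x in lborel. P (norm (x::'a))) \<longleftrightarrow> (\<integral>\<^sup>+x. h (norm (x::'a)) \<partial>lborel) = 0"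
    by (subst nn_integral_0_iff_AE) (auto simp: h_def)
  also have "\<dots> \<longleftrightarrow> (\<integral>\<^sup>+r. h r * ennreal (r ^ (DIM('a) - 1)) * indicator {0<..} r \<partial>lborel) = 0"
  proof -
    have "0 < real DIM('a) * unit_ball_vol DIM('a)" by simp
    hence "ennreal (real DIM('a) * unit_ball_vol DIM('a)) \<noteq> 0" by (simp only: ennreal_eq_0_iff not_le)
    thus ?thesis by (subst nn_integral_norm) auto
  qed
  also have "\<dots> \<longleftrightarrow> (AE r in lborel. h r * ennreal (r ^ (DIM('a) - 1)) * indicator {0<..} r = 0)"
    by (subst nn_integral_0_iff_AE) auto
  also have "\<dots> \<longleftrightarrow> (AE r in lborel. 0 < r \<longrightarrow> P r)"
  proof (intro AE_cong)
    fix r :: real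
    show "h r * ennreal (r ^ (DIM('a) - 1)) * indicator {0<..} r = 0 \<longleftrightarrow> (0 < r \<longrightarrow> P r)"
      using zero_less_power[of r "DIM('a) - 1"]
      by (cases "0 < r") (auto simp: h_def ennreal_eq_0_iff not_le)
  qed
  finally show ?thesis .
qed

lemma borel_measurable_lebesgue_AE_eq:
  fixes f g :: "'a::euclidean_space \<Rightarrow> ennreal"
  assumes [measurable]: "f \<in> borel_measurable borel" and eq: "AE x in lborel. f x = g x"
  shows "g \<in> borel_measurable lebesgue"
proof (rule borel_measurableI_greater)
  fix a
  have "{x \<in> space lebesgue. a < f x} \<in> sets borel" by simp
  hence A: "{x. a < f x} \<in> sets lebesgue" by simp
  have "AE x in lborel. \<not> (a < g x \<longleftrightarrow> \<not> a < f x)" using eq by eventually_elim simp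
  hence B: "Measurable.pred lebesgue (\<lambda>x. (a < g x) = (\<not> a < f x))" by (rule sets_completion_AE)
  \<comment> \<open>Q is the null set on which the two superlevel sets disagree; the superlevel set
    of g is the symmetric difference of that of f with Q, measurable by completeness.\<close>
  define Q where "Q = {x. (a < g x) = (\<not> a < f x)}"
  have "Q \<in> sets lebesgue" using B by (simp add: Q_def pred_def)
  moreover have "{x. a < g x} = ({x. a < f x} - Q) \<union> (Q - {x. a < f x})" by (auto simp: Q_def)
  ultimately have "{x. a < g x} \<in> sets lebesgue" using A by (metis sets.Diff sets.Un)
  thus "{x \<in> space lebesgue. a < g x} \<in> sets lebesgue" by simp
qed

text \<open>E may be uncountable and irregular, so the supremum cannot be treated as a countable
  one. On an open set V of radii every average is continuous, hence each superlevel set of the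
  supremum is a union of open sets. Radii outside V are negligible.\<close>

lemma maximal_fun_radial_measurable:
  fixes f :: "'a::euclidean_space \<Rightarrow> complex" and F :: "real \<Rightarrow> complex"
  assumes F[measurable]: "F \<in> borel_measurable borel" and fF: "\<And>x. f x = F (norm x)"
    and loc: "locally_integrable_profile F" and E: "E \<subseteq> {1..2}" "E \<noteq> {}" and d: "3 \<le> DIM('a)"
    and or: "(AE r in lborel. 0 < infdist r E) \<or>
      (\<integral>\<^sup>+s. ennreal (norm (F s) * s ^ (DIM('a) - 2)) * indicator {0..6} s \<partial>lborel) < \<infinity>"
  shows "maximal_fun E f \<in> borel_measurable lebesgue"
proof -
  define fin where "fin \<longleftrightarrow> (\<integral>\<^sup>+s. ennreal (norm (F s) * s ^ (DIM('a) - 2)) * indicator {0..6} s \<partial>lborel) < \<infinity>"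
  \<comment> \<open>If the profile is not integrable against s^(d-2), the closure of E is removed,
    so that r = t cannot occur; by assumption it is then a null set.\<close>
  define V where "V = {r. 0 < r \<and> (fin \<or> 0 < infdist r E)}"
  define \<Phi> where "\<Phi> = (\<lambda>t u. \<integral>s. radial_density DIM('a) u t s *\<^sub>R F s \<partial>lborel)"
  define W where "W = (\<lambda>r. if r \<in> V then SUP t\<in>E. ennreal (norm (\<Phi> t r)) else 0)"
  have "open {r::real. 0 < infdist r E}" "open {r::real. 0 < r}"
    by (intro open_Collect_less continuous_intros)+
  hence V: "open V" unfolding V_def by (cases fin) (auto intro: open_Collect_conj)
  have avg: "integrable lborel (\<lambda>s. radial_density DIM('a) r t s *\<^sub>R F s)" "isCont (\<Phi> t) r" if "t \<in> E" "r \<in> V" for t r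
  proof -
    have "r \<noteq> t \<or> fin" using that by (auto simp: V_def)
    thus "integrable lborel (\<lambda>s. radial_density DIM('a) r t s *\<^sub>R F s)" "isCont (\<Phi> t) r"
      using radial_average_continuous[OF F loc, of r t "DIM('a)"] that E d unfolding \<Phi>_def fin_def
      by (auto simp: V_def)
  qed
  have [measurable]: "W \<in> borel_measurable borel"
  proof (rule borel_measurableI_greater)
    fix a
    have "open (\<Union>t\<in>E. {r \<in> V. a < ennreal (norm (\<Phi> t r))})"
    proof (intro open_UN ballI)
      fix t assume "t \<in> E"
      hence "continuous_on V (\<lambda>r. ennreal (norm (\<Phi> t r)))"
        using avg(2) by (intro continuous_on_ennreal continuous_intros continuous_at_imp_continuous_on) auto
      hence "open (V \<inter> (\<lambda>r. ennreal (norm (\<Phi> t r))) -` {a<..})"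
        using V by (rule continuous_open_preimage) simp
      moreover have "V \<inter> (\<lambda>r. ennreal (norm (\<Phi> t r))) -` {a<..} = {r \<in> V. a < ennreal (norm (\<Phi> t r))}" by auto
      ultimately show "open {r \<in> V. a < ennreal (norm (\<Phi> t r))}" by simp
    qed
    moreover have "{r \<in> space borel. a < W r} = (\<Union>t\<in>E. {r \<in> V. a < ennreal (norm (\<Phi> t r))})"
      by (auto simp: W_def less_SUP_iff split: if_splits)
    ultimately show "{r \<in> space borel. a < W r} \<in> sets borel" by simp
  qed
  have "AE x in lborel. W (norm (x::'a)) = maximal_fun E f x"
  proof -
    have V'[measurable]: "Measurable.pred borel (\<lambda>r. r \<in> V)" using V by (simp add: pred_def)
    have "AE r in lborel. 0 < r \<longrightarrow> r \<in> V"
    proof (cases fin)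
      case True
      thus ?thesis by (simp add: V_def)
    next
      case False
      hence "AE r in lborel. 0 < infdist r E" using or by (simp add: fin_def)
      thus ?thesis by eventually_elim (simp add: V_def)
    qed
    hence "AE x in lborel. norm (x::'a) \<in> V" by (subst AE_lborel_norm_iff) auto
    thus ?thesis
    proof eventually_elim
      case (elim x)
      hence x: "x \<noteq> 0" by (auto simp: V_def)
      have "(if integrable sphere_measure (\<lambda>y. f (x + t *\<^sub>R y)) then ennreal (norm (sphere_avg t f x)) else \<infinity>)
          = ennreal (norm (\<Phi> t (norm x)))" if t: "t \<in> E" for t
      proof -
        have t0: "0 < t" using t E by auto
        have "integrable sphere_measure (\<lambda>y. f (x + t *\<^sub>R y))"
          using sphere_avg_radial(1)[OF F fF x t0 d] avg(1)[OF t elim] by simp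
        moreover have "sphere_avg t f x = \<Phi> t (norm x)"
          unfolding \<Phi>_def by (rule sphere_avg_radial(2)[OF F fF x t0 d])
        ultimately show ?thesis by simp
      qed
      thus ?case using elim by (simp add: W_def maximal_fun_def cong: SUP_cong)
    qed
  qed
  thus ?thesis by (rule borel_measurable_lebesgue_AE_eq[rotated]) measurable
qed

lemma locally_integrable_profile_powr:
  assumes [measurable]: "F \<in> borel_measurable borel" and p: "1 \<le> p"
    and fin: "(\<integral>\<^sup>+s. ennreal (norm (F s) powr p * s ^ n) * indicator {0<..} s \<partial>lborel) < \<infinity>"
  shows "locally_integrable_profile F"
  unfolding locally_integrable_profile_def
proof (intro allI impI)
  fix \<eta> R :: real assume \<eta>: "0 < \<eta>"
  have "(\<integral>\<^sup>+s. ennreal (norm (F s)) * indicator {\<eta>..R} s \<partial>lborel)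
    \<le> (\<integral>\<^sup>+s. indicator {\<eta>..R} s + ennreal (1 / \<eta> ^ n) * (ennreal (norm (F s) powr p * s ^ n) * indicator {0<..} s) \<partial>lborel)"
  proof (rule nn_integral_mono)
    fix s
    show "ennreal (norm (F s)) * indicator {\<eta>..R} s \<le> indicator {\<eta>..R} s + ennreal (1 / \<eta> ^ n) * (ennreal (norm (F s) powr p * s ^ n) * indicator {0<..} s)"
    proof (cases "s \<in> {\<eta>..R}")
      case True
      have "norm (F s) \<le> 1 + norm (F s) powr p"
      proof (cases "norm (F s) \<le> 1")
        case True
        thus ?thesis by (intro order_trans[OF True]) simp
      next
        case False
        thus ?thesis using powr_mono[of 1 p "norm (F s)"] p by simp
      qed
      also have "norm (F s) powr p * 1 \<le> norm (F s) powr p * ((s / \<eta>) ^ n)"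
        using True \<eta> by (intro mult_left_mono one_le_power) auto
      hence "1 + norm (F s) powr p \<le> 1 + 1 / \<eta> ^ n * (norm (F s) powr p * s ^ n)"
        by (simp add: power_divide)
      finally have "ennreal (norm (F s)) \<le> ennreal (1 + 1 / \<eta> ^ n * (norm (F s) powr p * s ^ n))" by (rule ennreal_leI)
      also have "\<dots> = 1 + ennreal (1 / \<eta> ^ n) * ennreal (norm (F s) powr p * s ^ n)"
        using True \<eta> by (subst ennreal_plus) (auto simp: ennreal_mult'[symmetric])
      finally show ?thesis using True \<eta> by simp
    qed simp
  qed
  also have "\<dots> = emeasure lborel {\<eta>..R} + ennreal (1 / \<eta> ^ n) * (\<integral>\<^sup>+s. ennreal (norm (F s) powr p * s ^ n) * indicator {0<..} s \<partial>lborel)"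
    by (subst nn_integral_add) (auto simp: nn_integral_cmult)
  also have "\<dots> < \<infinity>" using fin by (cases "\<eta> \<le> R") (auto simp: ennreal_mult_less_top)
  finally show "(\<integral>\<^sup>+s. ennreal (norm (F s)) * indicator {\<eta>..R} s \<partial>lborel) < \<infinity>" .
qed

lemma radial_Lp_profile:
  fixes f :: "'a::euclidean_space \<Rightarrow> complex"
  assumes f: "f \<in> radial_Lp (ennreal p)" and p: "1 \<le> p"
  obtains F :: "real \<Rightarrow> complex" where "F \<in> borel_measurable borel" "\<And>x. f x = F (norm x)"
    "(\<integral>\<^sup>+s. ennreal (norm (F s) powr p * s ^ (DIM('a) - 1)) * indicator {0<..} s \<partial>lborel) < \<infinity>"
proof -
  from f have fm: "f \<in> borel_measurable borel" by (simp add: radial_Lp_def)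
  from f obtain f0 where f0: "\<And>x. f x = f0 (norm x)" by (auto simp: radial_Lp_def)
  obtain F where F: "F \<in> borel_measurable borel" "\<And>x. f x = F (norm x)"
    using radial_profile[OF fm f0] by blast
  have "(\<lambda>s. norm (F s)) \<in> borel_measurable borel" using F(1) by measurable
  note L = Lp_norm_radial[where f = f and g = "\<lambda>s. norm (F s)", OF fm this _ _ p]
  let ?P = "\<integral>\<^sup>+s. ennreal (norm (F s) powr p * s ^ (DIM('a) - 1)) * indicator {0<..} s \<partial>lborel"
  have "Lp_norm (ennreal p) (\<lambda>x. ennreal (norm (f x))) < \<infinity>" using f by (simp add: radial_Lp_def)
  hence "ennreal ((DIM('a) * unit_ball_vol DIM('a)) powr (1 / p)) * ennreal_powr ?P (1 / p) < \<infinity>"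
    using L F(2) by simp
  moreover have "unit_ball_vol (real DIM('a)) \<noteq> 0" using unit_ball_vol_pos[of "real DIM('a)"] of_nat_0_le_iff[of "DIM('a)"] by linarith
  ultimately have "?P < \<infinity>" by (cases ?P) (auto simp: ennreal_mult_top)
  thus ?thesis using that F by blast
qed

section \<open>Measurability in each range of exponents, and the pair of infinite exponents\<close>

context dilation_set
begin

lemma maximal_fun_measurable_null:
  fixes f :: "'a::euclidean_space \<Rightarrow> complex"
  assumes f: "f \<in> radial_Lp (ennreal p)" and p: "1 \<le> p" and d: "3 \<le> DIM('a)"
    and null: "((\<lambda>x. x * N x) \<longlongrightarrow> 0) (at_right 0)"
  shows "maximal_fun E f \<in> borel_measurable lebesgue"
proof -
  obtain F :: "real \<Rightarrow> complex" where F: "F \<in> borel_measurable borel" "\<And>x. f x = F (norm x)"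
    "(\<integral>\<^sup>+s. ennreal (norm (F s) powr p * s ^ (DIM('a) - 1)) * indicator {0<..} s \<partial>lborel) < \<infinity>"
    using radial_Lp_profile[OF f p] by blast
  show ?thesis
    using AE_infdist_pos[OF null]
    by (intro maximal_fun_radial_measurable[OF F(1,2) locally_integrable_profile_powr[OF F(1) p F(3)] E_sub E_ne d]) simp
qed

text \<open>Here the closure of E may have positive measure. Instead, the integrable dual weight and
  Hoelder make the profile integrable against s^(d-2) down to the origin.\<close>

lemma maximal_fun_measurable_subcritical:
  fixes f :: "'a::euclidean_space \<Rightarrow> complex"
  assumes f: "f \<in> radial_Lp (ennreal p)" and p: "1 < p" and d: "3 \<le> DIM('a)"
    and sub: "1 / p < (real DIM('a) - 1) / real DIM('a)"
  shows "maximal_fun E f \<in> borel_measurable lebesgue"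
proof -
  let ?d = "DIM('a)"
  have p1: "1 \<le> p" and d2: "2 \<le> ?d" using p d by auto
  obtain F :: "real \<Rightarrow> complex" where F[measurable]: "F \<in> borel_measurable borel" and fF: "\<And>x. f x = F (norm x)" and
    fin: "(\<integral>\<^sup>+s. ennreal (norm (F s) powr p * s ^ (?d - 1)) * indicator {0<..} s \<partial>lborel) < \<infinity>"
    using radial_Lp_profile[OF f p1] by blast
  define p' where "p' = p / (p - 1)"
  have p'1: "1 < p'" using p by (simp add: p'_def field_simps)
  note dp = integrable_dual_weight[OF p p'_def d2 sub]
  define B where "B = (6 powr (real ?d - p') / (real ?d - p')) powr (1 / p')"
  have B0: "0 < B" using dp by (simp add: B_def)
  have "ennreal_powr (\<integral>\<^sup>+s. ennreal (norm (F s) * s ^ (?d - 2)) * indicator {0<..6} s \<partial>lborel) p \<le>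
    ennreal (B powr p) * (\<integral>\<^sup>+s. ennreal (norm (F s) powr p * s ^ (?d - 1) * 1 powr (0 * p)) * indicator {0<..6} s \<partial>lborel)"
  proof (rule hardy_Hoelder[where L = "\<lambda>_. 1" and \<theta> = 0, OF _ _ _ p p'_def d2 _ _ _ B0])
    have "(\<integral>\<^sup>+s. ennreal (s powr (real ?d - 1 - p') * 1 powr (- (0 * p'))) * indicator {0<..6} s \<partial>lborel)
      \<le> (\<integral>\<^sup>+s. ennreal (s powr (real ?d - 1 - p')) * indicator {0..6} s \<partial>lborel)"
      by (intro nn_integral_mono) (auto simp: indicator_def)
    also have "\<dots> = ennreal (B powr p')" unfolding dp(2) using dp(1) p'1 by (simp add: B_def powr_powr)
    finally show "(\<integral>\<^sup>+s. ennreal (s powr (real ?d - 1 - p') * 1 powr (- (0 * p'))) * indicator {0<..6} s \<partial>lborel) \<le> ennreal (B powr p')" .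
  qed auto
  also have "(\<integral>\<^sup>+s. ennreal (norm (F s) powr p * s ^ (?d - 1) * 1 powr (0 * p)) * indicator {0<..6} s \<partial>lborel)
    \<le> (\<integral>\<^sup>+s. ennreal (norm (F s) powr p * s ^ (?d - 1)) * indicator {0<..} s \<partial>lborel)"
    by (intro nn_integral_mono) (auto simp: indicator_def)
  finally have "ennreal_powr (\<integral>\<^sup>+s. ennreal (norm (F s) * s ^ (?d - 2)) * indicator {0<..6} s \<partial>lborel) p < \<infinity>"
    using fin by (auto simp: mult_left_mono ennreal_mult_less_top intro: le_less_trans)
  hence "(\<integral>\<^sup>+s. ennreal (norm (F s) * s ^ (?d - 2)) * indicator {0<..6} s \<partial>lborel) < \<infinity>"
    by (cases "\<integral>\<^sup>+s. ennreal (norm (F s) * s ^ (?d - 2)) * indicator {0<..6} s \<partial>lborel") auto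
  also have "(\<integral>\<^sup>+s. ennreal (norm (F s) * s ^ (?d - 2)) * indicator {0<..6} s \<partial>lborel)
    = (\<integral>\<^sup>+s. ennreal (norm (F s) * s ^ (?d - 2)) * indicator {0..6} s \<partial>lborel)"
    by (intro nn_integral_cong_AE AE_I[of _ _ "{0}"]) (auto simp: indicator_def)
  finally show ?thesis
    by (intro maximal_fun_radial_measurable[OF F fF locally_integrable_profile_powr[OF F p1 fin] E_sub E_ne d]) simp
qed

text \<open>This is the origin of the exponent square, the only admissible point with a = 0. The
  bound holds with constant 1, because each average is taken against a probability measure.\<close>

lemma maximal_bounded_infinity:
  assumes d: "3 \<le> DIM('a::euclidean_space)"
  shows "maximal_bounded TYPE('a) E \<infinity> \<infinity>"
  unfolding maximal_bounded_def
proof (intro exI[of _ 1] ballI)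
  fix f :: "'a \<Rightarrow> complex" assume f: "f \<in> radial_Lp \<infinity>"
  from f have fm[measurable]: "f \<in> borel_measurable borel" by (simp add: radial_Lp_def)
  from f obtain f0 where f0: "\<And>x. f x = f0 (norm x)" by (auto simp: radial_Lp_def)
  obtain F where F[measurable]: "F \<in> borel_measurable borel" and fF: "\<And>x. f x = F (norm x)"
    using radial_profile[OF fm f0] by blast
  have fl: "(\<lambda>x. ennreal (norm (f x))) \<in> borel_measurable lebesgue"
    by (rule borel_imp_lebesgue_measurable) measurable
  define A where "A = Lp_norm \<infinity> (\<lambda>x. ennreal (norm (f x)))"
  have A: "A = esssup lebesgue (\<lambda>x. ennreal (norm (f x)))" using fl by (simp add: A_def Lp_norm_def)
  have Afin: "A < \<infinity>" using f by (simp add: A_def radial_Lp_def)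
  have "AE x in lebesgue. ennreal (norm (f x)) \<le> A" unfolding A by (rule esssup_AE)
  hence "AE x in lborel. ennreal (norm (F (norm (x::'a)))) \<le> A" by (simp add: fF AE_completion_iff)
  \<comment> \<open>The essential bound is transferred to the profile. A sphere not centred at 0
    then ignores the exceptional radii, since the distance to the origin has a density on
    it.\<close>
  hence FA: "AE s in lborel. 0 < s \<longrightarrow> ennreal (norm (F s)) \<le> A"
    by (subst (asm) AE_lborel_norm_iff) auto
  have FI: "(\<integral>\<^sup>+s. ennreal (norm (F s)) * indicator S s \<partial>lborel) < \<infinity>"
    if S[measurable]: "S \<in> sets borel" and "S \<subseteq> {0<..}" and "emeasure lborel S < \<infinity>" for S
  proof -
    have "(\<integral>\<^sup>+s. ennreal (norm (F s)) * indicator S s \<partial>lborel) \<le> (\<integral>\<^sup>+s. A * indicator S s \<partial>lborel)"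
      using FA by (intro nn_integral_mono_AE, eventually_elim) (use that in \<open>auto simp: indicator_def\<close>)
    also have "\<dots> = A * emeasure lborel S" by (simp add: nn_integral_cmult)
    also have "\<dots> < \<infinity>" using that Afin by (simp add: ennreal_mult_less_top)
    finally show ?thesis .
  qed
  have loc: "locally_integrable_profile F"
    unfolding locally_integrable_profile_def
  proof (intro allI impI)
    fix \<eta> R :: real assume "0 < \<eta>"
    thus "(\<integral>\<^sup>+s. ennreal (norm (F s)) * indicator {\<eta>..R} s \<partial>lborel) < \<infinity>"
      by (intro FI) (auto simp: emeasure_lborel_Icc_eq)
  qed
  have "(\<integral>\<^sup>+s. ennreal (norm (F s) * s ^ (DIM('a) - 2)) * indicator {0..6} s \<partial>lborel)
     \<le> (\<integral>\<^sup>+s. ennreal (6 ^ (DIM('a) - 2)) * (ennreal (norm (F s)) * indicator {0<..6} s) \<partial>lborel)"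
  proof (rule nn_integral_mono_AE)
    have "AE s in lborel. s \<noteq> (0::real)" by (rule AE_lborel_singleton)
    thus "AE s in lborel. ennreal (norm (F s) * s ^ (DIM('a) - 2)) * indicator {0..6} s
      \<le> ennreal (6 ^ (DIM('a) - 2)) * (ennreal (norm (F s)) * indicator {0<..6} s)"
    proof eventually_elim
      case (elim s)
      show ?case
      proof (cases "s \<in> {0..6}")
        case True
        have "norm (F s) * s ^ (DIM('a) - 2) \<le> norm (F s) * 6 ^ (DIM('a) - 2)"
          using True by (intro mult_left_mono power_mono) auto
        thus ?thesis using True elim by (auto simp: ennreal_mult'[symmetric] mult.commute intro!: ennreal_leI)
      qed simp
    qed
  qed
  also have "\<dots> = ennreal (6 ^ (DIM('a) - 2)) * (\<integral>\<^sup>+s. ennreal (norm (F s)) * indicator {0<..6} s \<partial>lborel)"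
    by (rule nn_integral_cmult) measurable
  also have "\<dots> < \<infinity>"
  proof -
    have "(\<integral>\<^sup>+s. ennreal (norm (F s)) * indicator {0<..6} s \<partial>lborel) < \<infinity>" by (rule FI) auto
    thus ?thesis by (simp add: ennreal_mult_less_top)
  qed
  finally have meas: "maximal_fun E f \<in> borel_measurable lebesgue"
    by (intro maximal_fun_radial_measurable[OF F fF loc E_sub E_ne d]) simp
  have "maximal_fun E f x \<le> A" if x: "x \<noteq> 0" for x
  proof (rule order_trans[OF maximal_fun_le_nn_integral[OF fm]], rule SUP_least)
    fix t assume "t \<in> E"
    hence t: "0 < t" using E_sub by auto
    interpret S: prob_space "sphere_measure :: 'a measure" by (rule prob_space_sphere_measure)
    have m: "(\<lambda>s. ennreal (norm (F s))) \<in> borel_measurable borel" "(\<lambda>_::real. A) \<in> borel_measurable borel" by auto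
    have "(\<integral>\<^sup>+y. ennreal (norm (f (x + t *\<^sub>R y))) \<partial>sphere_measure) = ennreal (sphere_const DIM('a)) *
      (\<integral>\<^sup>+s. ennreal (norm (F s)) * (ennreal (radial_kernel DIM('a) (norm x) t s) * indicator {\<bar>norm x - t\<bar><..<norm x + t} s) \<partial>lborel)"
      unfolding fF by (rule nn_integral_sphere_radial[OF m(1) x t d])
    also have "\<dots> \<le> ennreal (sphere_const DIM('a)) *
      (\<integral>\<^sup>+s. A * (ennreal (radial_kernel DIM('a) (norm x) t s) * indicator {\<bar>norm x - t\<bar><..<norm x + t} s) \<partial>lborel)"
    proof (intro mult_left_mono nn_integral_mono_AE)
      show "AE s in lborel. ennreal (norm (F s)) * (ennreal (radial_kernel DIM('a) (norm x) t s) * indicator {\<bar>norm x - t\<bar><..<norm x + t} s)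
        \<le> A * (ennreal (radial_kernel DIM('a) (norm x) t s) * indicator {\<bar>norm x - t\<bar><..<norm x + t} s)"
        using FA
      proof eventually_elim
        case (elim s)
        show ?case
        proof (cases "s \<in> {\<bar>norm x - t\<bar><..<norm x + t}")
          case True
          hence "0 < s" using abs_ge_zero[of "norm x - t"] by auto
          thus ?thesis using elim by (intro mult_right_mono) auto
        qed simp
      qed
    qed simp
    \<comment> \<open>The radial formula read backwards for a constant profile, so the kernel need
      not be integrated explicitly.\<close>
    also have "\<dots> = (\<integral>\<^sup>+y. A \<partial>(sphere_measure :: 'a measure))"
      by (rule nn_integral_sphere_radial[OF m(2) x t d, symmetric])
    also have "\<dots> = A" using S.emeasure_space_1 by simp
    finally show "(\<integral>\<^sup>+y. ennreal (norm (f (x + t *\<^sub>R y))) \<partial>sphere_measure) \<le> A" .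
  qed
  hence "AE x in lebesgue. maximal_fun E f x \<le> A"
    by (intro AE_completion AE_I[of _ _ "{0}"]) auto
  hence "esssup lebesgue (maximal_fun E f) \<le> A" by (rule esssup_I[OF meas])
  thus "Lp_norm \<infinity> (maximal_fun E f) \<le> ennreal 1 * Lp_norm \<infinity> (\<lambda>x. ennreal (norm (f x)))"
    using meas by (simp add: Lp_norm_def A[symmetric] fl)
qed

end

section \<open>Necessary conditions\<close>

lemma exponent_cases:
  fixes p :: ennreal
  assumes "1 \<le> p"
  obtains "p = \<infinity>" "enn2real (inverse p) = 0"
  | p' where "1 \<le> p'" "p = ennreal p'" "enn2real (inverse p) = 1 / p'"
proof (cases p)
  case (real p')
  hence "1 \<le> p'" using assms by (simp add: ennreal_1[symmetric] del: ennreal_1)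
  thus ?thesis using real that(2)[of p'] by (simp add: inverse_ennreal inverse_eq_divide)
qed (use that(1) in simp)

text \<open>Chebyshev's inequality for finite and infinite exponents at once. For non-measurable g
  the right side is infinite, so lower bounds need no measurability.\<close>

lemma Lp_norm_ge:
  fixes g :: "'a::euclidean_space \<Rightarrow> ennreal"
  assumes q: "1 \<le> q" and S[measurable]: "S \<in> sets borel" and pos: "0 < emeasure lborel S" and fin: "emeasure lborel S < \<infinity>"
    and h: "0 \<le> h" and ge: "\<And>x. x \<in> S \<Longrightarrow> ennreal h \<le> g x"
  shows "ennreal (h * measure lborel S powr enn2real (inverse q)) \<le> Lp_norm q g"
proof (cases "g \<in> borel_measurable lebesgue")
  case False
  thus ?thesis by (simp add: Lp_norm_def)
next
  case g: True
  define v where "v = measure lborel S"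
  have e: "emeasure lborel S = ennreal v"
    unfolding v_def using fin by (intro emeasure_eq_ennreal_measure) simp
  hence v: "0 < v" "emeasure lborel S = ennreal v" using pos by simp_all
  show ?thesis using q
  proof (cases rule: exponent_cases)
    case 1
    have "ennreal h \<le> esssup lebesgue g"
    proof (rule ccontr)
      assume "\<not> ennreal h \<le> esssup lebesgue g"
      moreover have "AE x in lborel. g x \<le> esssup lebesgue g" using esssup_AE[of g lebesgue] by (simp add: AE_completion_iff)
      ultimately have "AE x in lborel. x \<notin> S" by (auto elim!: eventually_mono dest: ge)
      hence "emeasure lborel S = 0" by (subst (asm) AE_iff_null_sets[symmetric]) (auto simp: null_sets_def)
      thus False using pos by simp
    qed
    thus ?thesis using 1 g v by (simp add: Lp_norm_def v_def[symmetric])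
  next
    case (2 q')
    have "ennreal (h powr q' * v) = (\<integral>\<^sup>+x. ennreal (h powr q') * indicator S x \<partial>lborel)"
      using v h by (simp add: nn_integral_cmult ennreal_mult')
    also have "\<dots> \<le> (\<integral>\<^sup>+x. ennreal_powr (g x) q' \<partial>lborel)"
    proof (rule nn_integral_mono)
      fix x
      show "ennreal (h powr q') * indicator S x \<le> ennreal_powr (g x) q'"
        using ennreal_powr_mono[OF ge[of x], of q'] h 2 by (auto simp: indicator_def)
    qed
    finally have "ennreal_powr (ennreal (h powr q' * v)) (1 / q') \<le> ennreal_powr (\<integral>\<^sup>+x. ennreal_powr (g x) q' \<partial>lborel) (1 / q')"
      using 2 by (intro ennreal_powr_mono) auto
    also have "ennreal_powr (ennreal (h powr q' * v)) (1 / q') = ennreal (h * v powr (1 / q'))"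
      using v h 2 by (simp add: powr_mult powr_powr)
    finally show ?thesis using 2 Lp_norm_real[OF g, of q'] by (simp add: v_def)
  qed
qed

lemma Lp_norm_indicator_le:
  fixes A :: "'a::euclidean_space set"
  assumes p: "1 \<le> p" and A[measurable]: "A \<in> sets borel" and pos: "0 < v" and v: "emeasure lborel A \<le> ennreal v"
  shows "Lp_norm p (\<lambda>x. ennreal (norm (complex_of_real (indicator A x)))) \<le> ennreal (v powr enn2real (inverse p))"
proof -
  have m: "(\<lambda>x. ennreal (norm (complex_of_real (indicator A x)))) \<in> borel_measurable lebesgue"
    by (rule borel_imp_lebesgue_measurable) measurable
  show ?thesis using p
  proof (cases rule: exponent_cases)
    case 1
    have "esssup lebesgue (\<lambda>x. ennreal (norm (complex_of_real (indicator A x)))) \<le> 1"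
      by (rule esssup_I[OF m]) (auto simp: indicator_def)
    thus ?thesis using 1 m pos by (simp add: Lp_norm_def)
  next
    case (2 p')
    have "(\<integral>\<^sup>+x. ennreal_powr (ennreal (norm (complex_of_real (indicator A x)))) p' \<partial>lborel) = (\<integral>\<^sup>+x. indicator A x \<partial>lborel)"
      by (intro nn_integral_cong) (simp add: indicator_def)
    hence "Lp_norm p (\<lambda>x. ennreal (norm (complex_of_real (indicator A x)))) = ennreal_powr (emeasure lborel A) (1 / p')"
      using 2 Lp_norm_real[OF m, of p'] by simp
    also have "\<dots> \<le> ennreal_powr (ennreal v) (1 / p')" using v 2 by (intro ennreal_powr_mono) auto
    finally show ?thesis using 2 pos by simp
  qed
qed

lemma maximal_fun_ge:
  fixes u :: "'a::euclidean_space \<Rightarrow> real"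
  assumes [measurable]: "u \<in> borel_measurable borel" and u: "\<And>x. 0 \<le> u x" and t: "t \<in> E"
  shows "(\<integral>\<^sup>+y. ennreal (u (x + t *\<^sub>R y)) \<partial>sphere_measure) \<le> maximal_fun E (\<lambda>x. complex_of_real (u x)) x"
  unfolding maximal_fun_def
proof (rule SUP_upper2[OF t])
  show "(\<integral>\<^sup>+y. ennreal (u (x + t *\<^sub>R y)) \<partial>sphere_measure) \<le>
    (if integrable sphere_measure (\<lambda>y. complex_of_real (u (x + t *\<^sub>R y))) then ennreal (norm (sphere_avg t (\<lambda>x. complex_of_real (u x)) x)) else \<infinity>)"
  proof (cases "integrable sphere_measure (\<lambda>y. complex_of_real (u (x + t *\<^sub>R y)))")
    case True
    hence i: "integrable sphere_measure (\<lambda>y. u (x + t *\<^sub>R y))"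
      using integrable_Re[OF True] by simp
    have "norm (sphere_avg t (\<lambda>x. complex_of_real (u x)) x) = (\<integral>y. u (x + t *\<^sub>R y) \<partial>sphere_measure)"
      unfolding sphere_avg_def using u by (simp add: integral_nonneg_AE)
    thus ?thesis using True nn_integral_eq_integral[OF i] u by simp
  qed simp
qed

context dilation_set
begin

text \<open>The common form of the tests with indicators: A' describes the radial test set, v bounds
  its volume from above, w bounds the volume of a set where the maximal function is at least h from
  below. The constant depends on none of these, so they may vary with a scale.\<close>

lemma indicator_test:
  assumes bounded: "maximal_bounded TYPE('a::euclidean_space) E p q" and p: "1 \<le> p" and q: "1 \<le> q"
  shows "\<exists>C>0. \<forall>(A'::real set) (S::'a set) v w h. A' \<in> sets borel \<longrightarrow> S \<in> sets borel \<longrightarrow> 0 < v \<longrightarrow> 0 < w \<longrightarrow> 0 \<le> h \<longrightarrow>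
     emeasure lborel {x::'a. norm x \<in> A'} \<le> ennreal v \<longrightarrow> ennreal w \<le> emeasure lborel S \<longrightarrow> emeasure lborel S < \<infinity> \<longrightarrow>
     (\<forall>x\<in>S. \<exists>t\<in>E. ennreal h \<le> (\<integral>\<^sup>+y. indicator A' (norm (x + t *\<^sub>R y)) \<partial>sphere_measure)) \<longrightarrow>
     h * w powr enn2real (inverse q) \<le> C * v powr enn2real (inverse p)"
proof -
  from bounded obtain C where C: "\<And>f. f \<in> (radial_Lp p :: ('a \<Rightarrow> complex) set) \<Longrightarrow>
     Lp_norm q (maximal_fun E f) \<le> ennreal C * Lp_norm p (\<lambda>x. ennreal (norm (f x)))"
    unfolding maximal_bounded_def by blast
  show ?thesis
  proof (intro exI[of _ "max C 1"] conjI allI impI)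
    fix A' :: "real set" and S :: "'a set" and v w h :: real
    assume A'[measurable]: "A' \<in> sets borel" and S[measurable]: "S \<in> sets borel" and vwh: "0 < v" "0 < w" "0 \<le> h"
      and v: "emeasure lborel {x::'a. norm x \<in> A'} \<le> ennreal v" and w: "ennreal w \<le> emeasure lborel S" "emeasure lborel S < \<infinity>"
      and ge: "\<forall>x\<in>S. \<exists>t\<in>E. ennreal h \<le> (\<integral>\<^sup>+y. indicator A' (norm (x + t *\<^sub>R y)) \<partial>sphere_measure)"
    define A where "A = {x::'a. norm x \<in> A'}"
    have A[measurable]: "A \<in> sets borel" unfolding A_def by measurable
    define f where "f = (\<lambda>x::'a. complex_of_real (indicator A x))"
    have norm_le: "Lp_norm p (\<lambda>x. ennreal (norm (f x))) \<le> ennreal (v powr enn2real (inverse p))"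
      unfolding f_def by (rule Lp_norm_indicator_le[OF p A vwh(1)]) (use v in \<open>simp add: A_def\<close>)
    have "f \<in> radial_Lp p"
      unfolding radial_Lp_def
    proof (intro CollectI conjI exI[of _ "\<lambda>s. complex_of_real (indicator A' s)"] allI)
      show "f \<in> borel_measurable borel" unfolding f_def by measurable
      show "f x = complex_of_real (indicator A' (norm x))" for x by (simp add: f_def A_def indicator_def)
      show "Lp_norm p (\<lambda>x. ennreal (norm (f x))) < \<infinity>" using norm_le by (auto intro: le_less_trans)
    qed
    from C[OF this] have "Lp_norm q (maximal_fun E f) \<le> ennreal C * Lp_norm p (\<lambda>x. ennreal (norm (f x)))" .
    also have "\<dots> \<le> ennreal (max C 1) * ennreal (v powr enn2real (inverse p))"
      using norm_le by (intro mult_mono ennreal_leI) auto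
    finally have upper: "Lp_norm q (maximal_fun E f) \<le> ennreal (max C 1 * v powr enn2real (inverse p))"
      by (simp add: ennreal_mult')
    have "ennreal (h * measure lborel S powr enn2real (inverse q)) \<le> Lp_norm q (maximal_fun E f)"
    proof (rule Lp_norm_ge[OF q S _ w(2) vwh(3)])
      show "0 < emeasure lborel S" using w(1) vwh(2) by (auto intro: less_le_trans[rotated])
      fix x assume "x \<in> S"
      then obtain t where t: "t \<in> E" "ennreal h \<le> (\<integral>\<^sup>+y. indicator A' (norm (x + t *\<^sub>R y)) \<partial>sphere_measure)" using ge by blast
      note t(2)
      also have "(\<integral>\<^sup>+y. indicator A' (norm (x + t *\<^sub>R y)) \<partial>sphere_measure) = (\<integral>\<^sup>+y. ennreal (indicator A (x + t *\<^sub>R y)) \<partial>sphere_measure)"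
        by (intro nn_integral_cong) (simp add: A_def indicator_def)
      also have "\<dots> \<le> maximal_fun E f x" unfolding f_def by (rule maximal_fun_ge[OF _ _ t(1)]) auto
      finally show "ennreal h \<le> maximal_fun E f x" .
    qed
    also note upper
    finally have "h * measure lborel S powr enn2real (inverse q) \<le> max C 1 * v powr enn2real (inverse p)"
      using vwh by (subst (asm) ennreal_le_iff) auto
    moreover have "w \<le> measure lborel S" using w vwh by (simp add: emeasure_eq_ennreal_measure)
    hence "h * w powr enn2real (inverse q) \<le> h * measure lborel S powr enn2real (inverse q)"
      using vwh by (intro mult_left_mono powr_mono2) auto
    ultimately show "h * w powr enn2real (inverse q) \<le> max C 1 * v powr enn2real (inverse p)" by linarith
  qed simp
qed

lemma (in -) sphere_average_eq_1:
  fixes x :: "'a::euclidean_space"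
  assumes "\<And>y. norm y = 1 \<Longrightarrow> norm (x + t *\<^sub>R y) \<in> A'"
  shows "ennreal 1 \<le> (\<integral>\<^sup>+y. indicator A' (norm (x + t *\<^sub>R y)) \<partial>(sphere_measure :: 'a measure))"
proof -
  interpret S: prob_space "sphere_measure :: 'a measure" by (rule prob_space_sphere_measure)
  have "(\<integral>\<^sup>+y. indicator A' (norm (x + t *\<^sub>R y)) \<partial>(sphere_measure :: 'a measure)) = (\<integral>\<^sup>+y. 1 \<partial>(sphere_measure :: 'a measure))"
  proof (rule nn_integral_cong_AE)
    show "AE y in sphere_measure. (indicator A' (norm (x + t *\<^sub>R y)) :: ennreal) = 1"
      using AE_sphere_measure_norm by eventually_elim (use assms in simp)
  qed
  thus ?thesis using S.emeasure_space_1 by simp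
qed

lemma (in -) powr_le_imp_exponent_le:
  fixes a b C :: real
  assumes "0 < C" and "\<And>R. R0 \<le> R \<Longrightarrow> R powr b \<le> C * R powr a"
  shows "b \<le> a"
proof (rule ccontr)
  assume "\<not> b \<le> a"
  hence ab: "0 < b - a" by simp
  have "\<forall>\<^sub>F R in at_top. R powr (b - a) \<le> C"
    using eventually_ge_at_top[of R0] eventually_gt_at_top[of 0]
  proof eventually_elim
    case (elim R)
    hence "R powr b \<le> C * R powr a" using assms(2) by simp
    thus ?case using elim by (simp add: powr_diff field_simps)
  qed
  moreover have "filterlim (\<lambda>R::real. R powr (b - a)) at_top at_top" using ab by real_asymp
  hence "\<forall>\<^sub>F R::real in at_top. C < R powr (b - a)" by (simp add: filterlim_at_top_dense)
  ultimately have "\<forall>\<^sub>F R::real in at_top. False" by eventually_elim simp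
  thus False by simp
qed

text \<open>Large balls: on the ball of radius R/2 the averages of the indicator of the ball of
  radius R are 1, because t \<le> 2 \<le> R/2. Letting R grow compares R^(d/q) with R^(d/p).\<close>

lemma necessary_diagonal:
  assumes bounded: "maximal_bounded TYPE('a::euclidean_space) E p q" and p: "1 \<le> p" and q: "1 \<le> q"
  shows "enn2real (inverse q) \<le> enn2real (inverse p)"
proof -
  let ?d = "DIM('a)" and ?a = "enn2real (inverse p)" and ?b = "enn2real (inverse q)"
  define \<omega> where "\<omega> = unit_ball_vol ?d"
  have \<omega>: "0 < \<omega>" by (simp add: \<omega>_def)
  from indicator_test[OF bounded p q] obtain C where C: "0 < C" and
    test: "\<And>(A'::real set) (S::'a set) v w h. A' \<in> sets borel \<Longrightarrow> S \<in> sets borel \<Longrightarrow> 0 < v \<Longrightarrow> 0 < w \<Longrightarrow> 0 \<le> h \<Longrightarrow>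
     emeasure lborel {x::'a. norm x \<in> A'} \<le> ennreal v \<Longrightarrow> ennreal w \<le> emeasure lborel S \<Longrightarrow> emeasure lborel S < \<infinity> \<Longrightarrow>
     (\<forall>x\<in>S. \<exists>t\<in>E. ennreal h \<le> (\<integral>\<^sup>+y. indicator A' (norm (x + t *\<^sub>R y)) \<partial>sphere_measure)) \<Longrightarrow>
     h * w powr ?b \<le> C * v powr ?a" by metis
  obtain t where t: "t \<in> E" using E_ne by blast
  have le: "R powr (?d * ?b) \<le> C * \<omega> powr ?a / (\<omega> powr ?b * (1/2) powr (?d * ?b)) * R powr (?d * ?a)" if R: "4 \<le> R" for R
  proof -
    have ball: "{x::'a. norm x \<in> {..R}} = cball 0 R" by (auto simp: dist_norm)
    have "1 * (\<omega> * (R / 2) ^ ?d) powr ?b \<le> C * (\<omega> * R ^ ?d) powr ?a"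
    proof (rule test[of "{..R}" "cball 0 (R / 2)"])
      show "emeasure lborel {x::'a. norm x \<in> {..R}} \<le> ennreal (\<omega> * R ^ ?d)"
        unfolding ball using R by (simp add: emeasure_cball \<omega>_def)
      show "ennreal (\<omega> * (R / 2) ^ ?d) \<le> emeasure lborel (cball (0::'a) (R / 2))"
        using R by (simp add: emeasure_cball \<omega>_def)
      show "emeasure lborel (cball (0::'a) (R / 2)) < \<infinity>" using R by (simp add: emeasure_cball)
      show "\<forall>x\<in>cball (0::'a) (R / 2). \<exists>t\<in>E. ennreal 1 \<le> (\<integral>\<^sup>+y. indicator {..R} (norm (x + t *\<^sub>R y)) \<partial>sphere_measure)"
      proof (intro ballI bexI[OF _ t] sphere_average_eq_1)
        fix x y :: 'a assume x: "x \<in> cball 0 (R / 2)" and y: "norm y = 1"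
        have "norm (x + t *\<^sub>R y) \<le> norm x + norm (t *\<^sub>R y)" by (rule norm_triangle_ineq)
        also have "\<dots> \<le> R / 2 + 2" using x y t E_sub by (intro add_mono) (auto simp: dist_norm)
        finally show "norm (x + t *\<^sub>R y) \<in> {..R}" using R by simp
      qed
    qed (use R \<omega> in auto)
    moreover have "(\<omega> * (R / 2) ^ ?d) powr ?b = \<omega> powr ?b * (1/2) powr (?d * ?b) * R powr (?d * ?b)"
    proof -
      have "(R / 2) ^ ?d = (1/2 * R) powr ?d" using R by (simp add: powr_realpow)
      thus ?thesis using R \<omega> by (simp add: powr_mult powr_powr powr_divide)
    qed
    moreover have "(\<omega> * R ^ ?d) powr ?a = \<omega> powr ?a * R powr (?d * ?a)"
    proof -
      have "R ^ ?d = R powr ?d" using R by (simp add: powr_realpow)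
      thus ?thesis using R \<omega> by (simp add: powr_mult powr_powr)
    qed
    ultimately show ?thesis using \<omega> by (simp add: field_simps)
  qed
  have "0 < C * \<omega> powr ?a / (\<omega> powr ?b * (1/2) powr (?d * ?b))" using C \<omega> by simp
  hence "?d * ?b \<le> ?d * ?a" using le by (rule powr_le_imp_exponent_le)
  thus ?thesis by simp
qed

lemma (in -) emeasure_radial_le:
  assumes A[measurable]: "A \<in> sets borel" and A2: "A \<subseteq> {..3}"
  shows "emeasure lborel {x::'a::euclidean_space. norm x \<in> A} \<le> ennreal (DIM('a) * unit_ball_vol DIM('a) * 3 ^ (DIM('a) - 1)) * emeasure lborel A"
proof -
  have "emeasure lborel {x::'a. norm x \<in> A} = (\<integral>\<^sup>+x. indicator {x::'a. norm x \<in> A} x \<partial>lborel)" by simp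
  also have "\<dots> = (\<integral>\<^sup>+x. indicator A (norm (x::'a)) \<partial>lborel)"
    by (intro nn_integral_cong) (simp add: indicator_def)
  also have "\<dots> = ennreal (DIM('a) * unit_ball_vol DIM('a)) * (\<integral>\<^sup>+r. indicator A r * ennreal (r ^ (DIM('a) - 1)) * indicator {0<..} r \<partial>lborel)"
    by (rule nn_integral_norm) measurable
  also have "\<dots> \<le> ennreal (DIM('a) * unit_ball_vol DIM('a)) * (\<integral>\<^sup>+r. ennreal (3 ^ (DIM('a) - 1)) * indicator A r \<partial>lborel)"
    using A2 by (intro mult_left_mono nn_integral_mono) (auto simp: indicator_def intro!: ennreal_leI power_mono)
  also have "\<dots> = ennreal (DIM('a) * unit_ball_vol DIM('a)) * (ennreal (3 ^ (DIM('a) - 1)) * emeasure lborel A)"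
    by (simp add: nn_integral_cmult)
  also have "\<dots> = ennreal (DIM('a) * unit_ball_vol DIM('a) * 3 ^ (DIM('a) - 1)) * emeasure lborel A"
    by (subst ennreal_mult) (auto simp: mult.assoc)
  finally show ?thesis .
qed

lemma (in -) emeasure_radial_ge:
  assumes A[measurable]: "A \<in> sets borel" and A2: "A \<subseteq> {1/2..}"
  shows "ennreal (DIM('a) * unit_ball_vol DIM('a) * (1/2) ^ (DIM('a) - 1)) * emeasure lborel A \<le> emeasure lborel {x::'a::euclidean_space. norm x \<in> A}"
proof -
  have "ennreal (DIM('a) * unit_ball_vol DIM('a) * (1/2) ^ (DIM('a) - 1)) * emeasure lborel A =
    ennreal (DIM('a) * unit_ball_vol DIM('a)) * (ennreal ((1/2) ^ (DIM('a) - 1)) * emeasure lborel A)"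
    by (subst ennreal_mult) (auto simp: mult.assoc)
  also have "ennreal ((1/2) ^ (DIM('a) - 1)) * emeasure lborel A = (\<integral>\<^sup>+r. ennreal ((1/2) ^ (DIM('a) - 1)) * indicator A r \<partial>lborel)"
    by (simp add: nn_integral_cmult)
  also have "ennreal (DIM('a) * unit_ball_vol DIM('a)) * (\<integral>\<^sup>+r. ennreal ((1/2) ^ (DIM('a) - 1)) * indicator A r \<partial>lborel)
    \<le> ennreal (DIM('a) * unit_ball_vol DIM('a)) * (\<integral>\<^sup>+r. indicator A r * ennreal (r ^ (DIM('a) - 1)) * indicator {0<..} r \<partial>lborel)"
  proof (intro mult_left_mono nn_integral_mono)
    fix r :: real
    show "ennreal ((1/2) ^ (DIM('a) - 1)) * indicator A r \<le> indicator A r * ennreal (r ^ (DIM('a) - 1)) * indicator {0<..} r"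
    proof (cases "r \<in> A")
      case True
      hence r: "1/2 \<le> r" using A2 by auto
      hence "ennreal ((1/2) ^ (DIM('a) - 1)) \<le> ennreal (r ^ (DIM('a) - 1))" by (intro ennreal_leI power_mono) auto
      thus ?thesis using True r by simp
    qed simp
  qed simp
  also have "\<dots> = (\<integral>\<^sup>+x. indicator A (norm (x::'a)) \<partial>lborel)"
    by (rule nn_integral_norm[symmetric]) measurable
  also have "\<dots> = (\<integral>\<^sup>+x. indicator {x::'a. norm x \<in> A} x \<partial>lborel)"
    by (intro nn_integral_cong) (simp add: indicator_def)
  also have "\<dots> = emeasure lborel {x::'a. norm x \<in> A}" by simp
  finally show ?thesis .
qed

text \<open>A shell of width 2 \<delta> about the sphere of radius t contains all spheres of radius
  t centred within \<delta> of the origin. This compares \<delta>^(d/q) with \<delta>^(1/p) as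
  \<delta> tends to 0.\<close>

lemma necessary_bottom:
  assumes bounded: "maximal_bounded TYPE('a::euclidean_space) E p q" and p: "1 \<le> p" and q: "1 \<le> q"
  shows "enn2real (inverse p) \<le> DIM('a) * enn2real (inverse q)"
proof -
  let ?d = "DIM('a)" and ?a = "enn2real (inverse p)" and ?b = "enn2real (inverse q)"
  define \<omega> where "\<omega> = unit_ball_vol ?d"
  have \<omega>: "0 < \<omega>" by (simp add: \<omega>_def)
  define c where "c = ?d * \<omega> * 3 ^ (?d - 1) * 2"
  have c: "0 < c" using \<omega> by (simp add: c_def)
  from indicator_test[OF bounded p q] obtain C where C: "0 < C" and
    test: "\<And>(A'::real set) (S::'a set) v w h. A' \<in> sets borel \<Longrightarrow> S \<in> sets borel \<Longrightarrow> 0 < v \<Longrightarrow> 0 < w \<Longrightarrow> 0 \<le> h \<Longrightarrow>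
     emeasure lborel {x::'a. norm x \<in> A'} \<le> ennreal v \<Longrightarrow> ennreal w \<le> emeasure lborel S \<Longrightarrow> emeasure lborel S < \<infinity> \<Longrightarrow>
     (\<forall>x\<in>S. \<exists>t\<in>E. ennreal h \<le> (\<integral>\<^sup>+y. indicator A' (norm (x + t *\<^sub>R y)) \<partial>sphere_measure)) \<Longrightarrow>
     h * w powr ?b \<le> C * v powr ?a" by metis
  obtain t where t: "t \<in> E" using E_ne by blast
  have t12: "1 \<le> t" "t \<le> 2" using t E_sub by auto
  have le: "R powr ?a \<le> C * c powr ?a / \<omega> powr ?b * R powr (?d * ?b)" if R: "4 \<le> R" for R
  proof -
    define \<delta> where "\<delta> = 1 / R"
    have \<delta>: "0 < \<delta>" "\<delta> \<le> 1" using R by (auto simp: \<delta>_def)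
    have "1 * (\<omega> * \<delta> ^ ?d) powr ?b \<le> C * (c * \<delta>) powr ?a"
    proof (rule test[of "{t - \<delta>..t + \<delta>}" "cball 0 \<delta>"])
      have "emeasure lborel {x::'a. norm x \<in> {t - \<delta>..t + \<delta>}} \<le> ennreal (?d * \<omega> * 3 ^ (?d - 1)) * emeasure lborel {t - \<delta>..t + \<delta>}"
        unfolding \<omega>_def using t12 \<delta> by (intro emeasure_radial_le) auto
      also have "\<dots> = ennreal (?d * \<omega> * 3 ^ (?d - 1)) * ennreal (2 * \<delta>)" using \<delta> by simp
      also have "\<dots> = ennreal (c * \<delta>)" using \<delta> \<omega> by (simp add: ennreal_mult'[symmetric] c_def)
      finally show "emeasure lborel {x::'a. norm x \<in> {t - \<delta>..t + \<delta>}} \<le> ennreal (c * \<delta>)" .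
      show "ennreal (\<omega> * \<delta> ^ ?d) \<le> emeasure lborel (cball (0::'a) \<delta>)"
        using \<delta> by (simp add: emeasure_cball \<omega>_def)
      show "emeasure lborel (cball (0::'a) \<delta>) < \<infinity>" using \<delta> by (simp add: emeasure_cball)
      show "\<forall>x\<in>cball (0::'a) \<delta>. \<exists>t'\<in>E. ennreal 1 \<le> (\<integral>\<^sup>+y. indicator {t - \<delta>..t + \<delta>} (norm (x + t' *\<^sub>R y)) \<partial>sphere_measure)"
      proof (intro ballI bexI[OF _ t] sphere_average_eq_1)
        fix x y :: 'a assume x: "x \<in> cball 0 \<delta>" and y: "norm y = 1"
        have ty: "norm (t *\<^sub>R y) = t" using y t12 by simp
        have "norm (x + t *\<^sub>R y) \<le> norm x + norm (t *\<^sub>R y)" by (rule norm_triangle_ineq)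
        moreover have "norm (t *\<^sub>R y) \<le> norm (x + t *\<^sub>R y) + norm x"
          using norm_triangle_ineq4[of "x + t *\<^sub>R y" x] by simp
        ultimately show "norm (x + t *\<^sub>R y) \<in> {t - \<delta>..t + \<delta>}" using x ty by (simp add: dist_norm)
      qed
    qed (use \<delta> \<omega> c in auto)
    moreover have "(\<omega> * \<delta> ^ ?d) powr ?b = \<omega> powr ?b / R powr (?d * ?b)"
    proof -
      have "\<delta> ^ ?d = \<delta> powr ?d" using \<delta> by (simp add: powr_realpow)
      hence "(\<omega> * \<delta> ^ ?d) powr ?b = \<omega> powr ?b * \<delta> powr (?d * ?b)" using \<delta> \<omega> by (simp add: powr_mult powr_powr)
      thus ?thesis using R by (simp add: \<delta>_def powr_divide)
    qed
    moreover have "(c * \<delta>) powr ?a = c powr ?a / R powr ?a"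
      using R c by (simp add: \<delta>_def powr_divide)
    moreover have "0 < R powr (?d * ?b)" "0 < R powr ?a" "0 < \<omega> powr ?b" using R \<omega> by auto
    ultimately show ?thesis by (simp add: field_simps)
  qed
  have "0 < C * c powr ?a / \<omega> powr ?b" using C \<omega> c by simp
  thus ?thesis using le by (rule powr_le_imp_exponent_le)
qed

text \<open>The distance to E need not be attained, so the bound \<delta>/4 is relaxed to a strict
  \<delta>/2 to find t. Then 2 |r - t| \<le> s for every s \<ge> \<delta>, as the lower kernel bound
  requires.\<close>

lemma near_dilation_kernel:
  assumes near: "infdist r E \<le> \<delta> / 4" and \<delta>: "0 < \<delta>" "\<delta> \<le> 1/2" and d: "3 \<le> d"
  obtains t where "t \<in> E" "1/2 \<le> r" "r \<le> 3" "1 \<le> t" "t \<le> 2"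
    "\<And>s. \<delta> \<le> s \<Longrightarrow> s \<le> 1/2 \<Longrightarrow> s ^ (d - 2) / (6 * 10 ^ (d - 3)) \<le> radial_kernel d r t s"
    "\<And>s. \<delta> \<le> s \<Longrightarrow> s \<le> 1/2 \<Longrightarrow> s \<in> {\<bar>r - t\<bar><..<r + t}"
proof -
  have "infdist r E < \<delta> / 2" using near \<delta> by linarith
  then obtain t where t: "t \<in> E" "\<bar>r - t\<bar> < \<delta> / 2" by (rule infdist_less_imp)
  have t12: "1 \<le> t" "t \<le> 2" using t E_sub by auto
  have r: "1/2 \<le> r" "r \<le> 3" using t(2) t12 \<delta> by linarith+
  note k = radial_kernel_ge_power[OF r t12 _ _ _ d]
  show ?thesis
  proof (rule that[OF t(1) r t12])
    fix s assume s: "\<delta> \<le> s" "s \<le> 1/2"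
    have "2 * \<bar>r - t\<bar> \<le> s" "0 < s" using t s \<delta> by auto
    from k[OF this s(2)] show "s ^ (d - 2) / (6 * 10 ^ (d - 3)) \<le> radial_kernel d r t s" "s \<in> {\<bar>r - t\<bar><..<r + t}" by auto
  qed
qed

lemma near_set_volume:
  fixes x :: real
  assumes x: "0 < x" "x \<le> 1/8"
  defines "S \<equiv> {y::'a::euclidean_space. norm y \<in> {r. infdist r E \<le> x}}"
  shows "S \<in> sets borel" and "ennreal (DIM('a) * unit_ball_vol DIM('a) * (1/2) ^ (DIM('a) - 1) * (x * N x)) \<le> emeasure lborel S"
    and "emeasure lborel S < \<infinity>"
proof -
  have near: "1/2 \<le> r \<and> r \<le> 3" if "infdist r E \<le> x" for r
  proof -
    have "infdist r E < 1/2" using that x by simp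
    then obtain t where "t \<in> E" "\<bar>r - t\<bar> < 1/2" by (rule infdist_less_imp)
    moreover have "1 \<le> t" "t \<le> 2" using \<open>t \<in> E\<close> E_sub by auto
    ultimately show ?thesis by linarith
  qed
  have [measurable]: "{r. infdist r E \<le> x} \<in> sets borel" by measurable
  have "Measurable.pred borel (\<lambda>y::'a. norm y \<in> {r. infdist r E \<le> x})" by measurable
  thus "S \<in> sets borel" by (simp add: S_def pred_def)
  have "ennreal (DIM('a) * unit_ball_vol DIM('a) * (1/2) ^ (DIM('a) - 1) * (x * N x)) =
    ennreal (DIM('a) * unit_ball_vol DIM('a) * (1/2) ^ (DIM('a) - 1)) * ennreal (x * N x)"
    by (rule ennreal_mult') auto
  also have "\<dots> \<le> ennreal (DIM('a) * unit_ball_vol DIM('a) * (1/2) ^ (DIM('a) - 1)) * emeasure lborel {r. infdist r E \<le> x}"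
    by (intro mult_left_mono emeasure_infdist_le x) simp
  also have "\<dots> \<le> emeasure lborel S"
    unfolding S_def using near by (intro emeasure_radial_ge) auto
  finally show "ennreal (DIM('a) * unit_ball_vol DIM('a) * (1/2) ^ (DIM('a) - 1) * (x * N x)) \<le> emeasure lborel S" .
  have "emeasure lborel S \<le> emeasure lborel (cball (0::'a) 3)"
    using near by (intro emeasure_mono) (auto simp: S_def dist_norm)
  also have "\<dots> < \<infinity>" by (simp add: emeasure_cball)
  finally show "emeasure lborel S < \<infinity>" .
qed

text \<open>Small balls: for |y| within x of E the sphere of a suitable radius in E meets a ball
  about the origin of radius comparable to x in a proportion at least a multiple of x^(d-1). Such y
  fill a volume at least a multiple of x N(x).\<close>

lemma necessary_power:
  assumes bounded: "maximal_bounded TYPE('a::euclidean_space) E p q" and p: "1 \<le> p" and q: "1 \<le> q" and d: "3 \<le> DIM('a)"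
  shows "\<exists>C>0. \<forall>x::real. 0 < x \<longrightarrow> x \<le> 1/16 \<longrightarrow>
    x powr (real DIM('a) - 1) * (x * N x) powr enn2real (inverse q) \<le> C * x powr (DIM('a) * enn2real (inverse p))"
proof -
  let ?d = "DIM('a)" and ?a = "enn2real (inverse p)" and ?b = "enn2real (inverse q)"
  define \<omega> where "\<omega> = unit_ball_vol ?d"
  have \<omega>: "0 < \<omega>" by (simp add: \<omega>_def)
  define \<kappa> where "\<kappa> = sphere_const ?d / (6 * 10 ^ (?d - 3))"
  have \<kappa>: "0 < \<kappa>" using sphere_const_pos[of ?d] d by (simp add: \<kappa>_def)
  define m where "m = ?d * \<omega> * (1/2) ^ (?d - 1)"
  have m: "0 < m" using \<omega> by (simp add: m_def)
  from indicator_test[OF bounded p q] obtain C where C: "0 < C" and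
    test: "\<And>(A'::real set) (S::'a set) v w h. A' \<in> sets borel \<Longrightarrow> S \<in> sets borel \<Longrightarrow> 0 < v \<Longrightarrow> 0 < w \<Longrightarrow> 0 \<le> h \<Longrightarrow>
     emeasure lborel {x::'a. norm x \<in> A'} \<le> ennreal v \<Longrightarrow> ennreal w \<le> emeasure lborel S \<Longrightarrow> emeasure lborel S < \<infinity> \<Longrightarrow>
     (\<forall>x\<in>S. \<exists>t\<in>E. ennreal h \<le> (\<integral>\<^sup>+y. indicator A' (norm (x + t *\<^sub>R y)) \<partial>sphere_measure)) \<Longrightarrow>
     h * w powr ?b \<le> C * v powr ?a" by metis
  define K where "K = C * (\<omega> * 8 ^ ?d) powr ?a / (\<kappa> * 4 ^ (?d - 1) * m powr ?b)"
  have "x powr (real ?d - 1) * (x * N x) powr ?b \<le> K * x powr (?d * ?a)" if x: "0 < x" "x \<le> 1/16" for x :: real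
  proof -
    \<comment> \<open>The factor 4 turns the neighbourhood of radius x into the hypothesis of
      \<open>near_dilation_kernel\<close>. The ball has radius 2 \<delta>, and only its outer half,
      \<delta> \<le> s \<le> 2 \<delta>, is used.\<close>
    define \<delta> where "\<delta> = 4 * x"
    have \<delta>: "0 < \<delta>" "\<delta> \<le> 1/4" using x by (auto simp: \<delta>_def)
    define S where "S = {y::'a. norm y \<in> {r. infdist r E \<le> x}}"
    have x8: "x \<le> 1/8" using x by simp
    note S = near_set_volume[OF x(1) x8, where 'a = 'a, folded S_def \<omega>_def]
    have ball: "{x::'a. norm x \<in> {..2 * \<delta>}} = cball 0 (2 * \<delta>)" by (auto simp: dist_norm)
    have N1: "1 \<le> N x" by (rule covering_number_pos[OF x(1)])
    have h: "\<kappa> * \<delta> ^ (?d - 1) * (m * (x * N x)) powr ?b \<le> C * (\<omega> * (2 * \<delta>) ^ ?d) powr ?a"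
    proof (rule test[of "{..2 * \<delta>}" S])
      show "emeasure lborel {x::'a. norm x \<in> {..2 * \<delta>}} \<le> ennreal (\<omega> * (2 * \<delta>) ^ ?d)"
        unfolding ball using \<delta> by (simp add: emeasure_cball \<omega>_def)
      show "ennreal (m * (x * N x)) \<le> emeasure lborel S" using S(2) by (simp add: m_def)
      show "\<forall>y\<in>S. \<exists>t\<in>E. ennreal (\<kappa> * \<delta> ^ (?d - 1)) \<le> (\<integral>\<^sup>+z. indicator {..2 * \<delta>} (norm (y + t *\<^sub>R z)) \<partial>sphere_measure)"
      proof
        fix y assume y: "y \<in> S"
        hence "infdist (norm y) E \<le> \<delta> / 4" by (simp add: S_def \<delta>_def)
        moreover have "\<delta> \<le> 1/2" using \<delta> by simp
        ultimately obtain t where t: "t \<in> E" "1/2 \<le> norm y" "norm y \<le> 3" "1 \<le> t" "t \<le> 2"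
          and k: "\<And>s. \<delta> \<le> s \<Longrightarrow> s \<le> 1/2 \<Longrightarrow> s ^ (?d - 2) / (6 * 10 ^ (?d - 3)) \<le> radial_kernel ?d (norm y) t s"
            "\<And>s. \<delta> \<le> s \<Longrightarrow> s \<le> 1/2 \<Longrightarrow> s \<in> {\<bar>norm y - t\<bar><..<norm y + t}"
          using near_dilation_kernel[of "norm y" \<delta> ?d] \<delta>(1) d by blast
        have y0: "y \<noteq> 0" using t by auto
        have t0: "0 < t" using t by simp
        have "ennreal (\<kappa> * \<delta> ^ (?d - 1)) = ennreal (sphere_const ?d) * (\<integral>\<^sup>+s. ennreal (\<delta> ^ (?d - 2) / (6 * 10 ^ (?d - 3))) * indicator {\<delta>..2 * \<delta>} s \<partial>lborel)"
        proof -
          have "\<delta> ^ (?d - 1) = \<delta> ^ (?d - 2) * \<delta>" using d by (metis Suc_1 Suc_diff_Suc Suc_le_lessD numeral_3_eq_3 power_Suc2 Suc_leD One_nat_def)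
          hence "\<kappa> * \<delta> ^ (?d - 1) = sphere_const ?d * (\<delta> ^ (?d - 2) / (6 * 10 ^ (?d - 3)) * \<delta>)"
            by (simp add: \<kappa>_def)
          moreover have "(\<integral>\<^sup>+s. ennreal (\<delta> ^ (?d - 2) / (6 * 10 ^ (?d - 3))) * indicator {\<delta>..2 * \<delta>} s \<partial>lborel)
            = ennreal (\<delta> ^ (?d - 2) / (6 * 10 ^ (?d - 3)) * \<delta>)"
            using \<delta> by (simp add: nn_integral_cmult ennreal_mult''[symmetric])
          moreover have "0 \<le> sphere_const ?d" using sphere_const_pos[of ?d] d by simp
          ultimately show ?thesis by (simp only: ennreal_mult')
        qed
        also have "\<dots> \<le> ennreal (sphere_const ?d) *
          (\<integral>\<^sup>+s. indicator {..2 * \<delta>} s * (ennreal (radial_kernel ?d (norm y) t s) * indicator {\<bar>norm y - t\<bar><..<norm y + t} s) \<partial>lborel)"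
        proof (intro mult_left_mono nn_integral_mono)
          fix s
          show "ennreal (\<delta> ^ (?d - 2) / (6 * 10 ^ (?d - 3))) * indicator {\<delta>..2 * \<delta>} s \<le>
            indicator {..2 * \<delta>} s * (ennreal (radial_kernel ?d (norm y) t s) * indicator {\<bar>norm y - t\<bar><..<norm y + t} s)"
          proof (cases "s \<in> {\<delta>..2 * \<delta>}")
            case True
            hence s: "\<delta> \<le> s" "s \<le> 1/2" using \<delta> by auto
            have "\<delta> ^ (?d - 2) / (6 * 10 ^ (?d - 3)) \<le> s ^ (?d - 2) / (6 * 10 ^ (?d - 3))"
              using s \<delta> by (intro divide_right_mono power_mono) auto
            also note k(1)[OF s]
            finally show ?thesis using True k(2)[OF s] by (simp add: ennreal_leI)
          qed simp
        qed simp
        also have "\<dots> = (\<integral>\<^sup>+z. indicator {..2 * \<delta>} (norm (y + t *\<^sub>R z)) \<partial>sphere_measure)"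
          by (rule nn_integral_sphere_radial[OF _ y0 t0 d, symmetric]) measurable
        finally show "\<exists>t\<in>E. ennreal (\<kappa> * \<delta> ^ (?d - 1)) \<le> (\<integral>\<^sup>+z. indicator {..2 * \<delta>} (norm (y + t *\<^sub>R z)) \<partial>sphere_measure)"
          using t(1) by blast
      qed
    qed (use S \<delta> \<omega> \<kappa> m x N1 in auto)
    have l: "\<kappa> * \<delta> ^ (?d - 1) * (m * (x * N x)) powr ?b = (\<kappa> * 4 ^ (?d - 1) * m powr ?b) * (x powr (real ?d - 1) * (x * N x) powr ?b)"
    proof -
      have "\<delta> ^ (?d - 1) = 4 ^ (?d - 1) * x powr (real ?d - 1)"
        using x d by (simp add: \<delta>_def power_mult_distrib powr_realpow[symmetric] of_nat_diff)
      moreover have "(m * (x * N x)) powr ?b = m powr ?b * (x * N x) powr ?b"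
        using m x by (simp add: powr_mult)
      ultimately show ?thesis by simp
    qed
    have r: "(\<omega> * (2 * \<delta>) ^ ?d) powr ?a = (\<omega> * 8 ^ ?d) powr ?a * x powr (?d * ?a)"
    proof -
      have "\<omega> * (2 * \<delta>) ^ ?d = (\<omega> * 8 ^ ?d) * x powr ?d"
        using x by (simp add: \<delta>_def power_mult_distrib powr_realpow)
      thus ?thesis using x \<omega> by (simp add: powr_mult powr_powr)
    qed
    have pos: "0 < \<kappa> * 4 ^ (?d - 1) * m powr ?b" using \<kappa> m by simp
    show ?thesis using h pos unfolding l r K_def by (simp add: field_simps)
  qed
  moreover have "0 < K" using C \<omega> \<kappa> m by (simp add: K_def)
  ultimately show ?thesis by blast
qed

lemma (in -) nn_integral_inverse_interval:
  assumes "0 < \<delta>" "\<delta> \<le> 1/2"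
  shows "(\<integral>\<^sup>+s. ennreal (1 / s) * indicator {\<delta>..1/2} s \<partial>lborel) = ennreal (ln (1 / (2 * \<delta>)))"
proof -
  have "(\<integral>\<^sup>+s. ennreal (1 / s) * indicator {\<delta>..1/2} s \<partial>lborel) = ennreal (ln (1/2) - ln \<delta>)"
    using assms by (intro nn_integral_FTC_Icc) (auto intro!: derivative_eq_intros)
  also have "ln (1/2) - ln \<delta> = ln (1 / (2 * \<delta>))" using assms by (simp add: ln_div ln_mult)
  finally show ?thesis .
qed

text \<open>The profile s^(1-d), cut off to [\<delta>, 1/2], is extremal for the critical Hardy
  operator: the integral of its p-th power against s^(d-1) and its integral against s^(d-2) are both
  that of ds/s, equal to l. Hence l (x N(x))^(1/q) is at most a multiple of l^(1/p), and dividing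
  leaves l^(1/d).\<close>

lemma necessary_log:
  assumes bounded: "maximal_bounded TYPE('a::euclidean_space) E p q" and p: "1 \<le> p" and q: "1 \<le> q" and d: "3 \<le> DIM('a)"
    and crit: "enn2real (inverse p) = (real DIM('a) - 1) / real DIM('a)"
  shows "\<exists>C>0. \<forall>x::real. 0 < x \<longrightarrow> x \<le> 1/16 \<longrightarrow>
    ln (1 / (8 * x)) powr (1 / DIM('a)) * (x * N x) powr enn2real (inverse q) \<le> C"
proof -
  let ?d = "DIM('a)" and ?b = "enn2real (inverse q)"
  \<comment> \<open>In this proof p' denotes the finite real value of p and not its conjugate
    exponent.\<close>
  from p have "\<exists>p'. 1 < p' \<and> p = ennreal p' \<and> 1 / p' = (real ?d - 1) / real ?d"
  proof (cases rule: exponent_cases)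
    case 1
    thus ?thesis using crit d by simp
  next
    case (2 p')
    have "(real ?d - 1) / real ?d < 1" by simp
    hence "1 / p' < 1" using 2 crit by simp
    hence "1 < p'" using 2 by simp
    thus ?thesis using 2 crit by auto
  qed
  then obtain p' where p': "1 < p'" "p = ennreal p'" "1 / p' = (real ?d - 1) / real ?d" by blast
  have dp: "(1 - real ?d) * p' = - real ?d" using p'(1,3) d by (simp add: field_simps)
  have p'1: "1 \<le> p'" using p' by simp
  define \<omega> where "\<omega> = unit_ball_vol ?d"
  have \<omega>: "0 < \<omega>" by (simp add: \<omega>_def)
  define \<kappa> where "\<kappa> = sphere_const ?d / (6 * 10 ^ (?d - 3))"
  have \<kappa>: "0 < \<kappa>" using sphere_const_pos[of ?d] d by (simp add: \<kappa>_def)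
  define m where "m = ?d * \<omega> * (1/2) ^ (?d - 1)"
  have m: "0 < m" using \<omega> by (simp add: m_def)
  from bounded obtain C where C: "\<And>f. f \<in> (radial_Lp p :: ('a \<Rightarrow> complex) set) \<Longrightarrow>
     Lp_norm q (maximal_fun E f) \<le> ennreal C * Lp_norm p (\<lambda>x. ennreal (norm (f x)))"
    unfolding maximal_bounded_def by blast
  define K where "K = max C 1 * (?d * \<omega>) powr (1 / p') / (\<kappa> * m powr ?b)"
  have "ln (1 / (8 * x)) powr (1 / ?d) * (x * N x) powr ?b \<le> K" if x: "0 < x" "x \<le> 1/16" for x :: real
  proof -
    define \<delta> where "\<delta> = 4 * x"
    have \<delta>: "0 < \<delta>" "\<delta> \<le> 1/4" using x by (auto simp: \<delta>_def)
    define l where "l = ln (1 / (2 * \<delta>))"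
    have l: "0 < l" using \<delta> by (simp add: l_def)
    define S where "S = {y::'a. norm y \<in> {r. infdist r E \<le> x}}"
    have x8: "x \<le> 1/8" using x by simp
    note S = near_set_volume[OF x(1) x8, where 'a = 'a, folded S_def \<omega>_def]
    have N1: "1 \<le> N x" by (rule covering_number_pos[OF x(1)])
    define g where "g = (\<lambda>s::real. s powr (1 - real ?d) * indicator {\<delta>..1/2} s)"
    have g[measurable]: "g \<in> borel_measurable borel" and g0: "0 \<le> g s" for s by (auto simp: g_def)
    define f where "f = (\<lambda>x::'a. complex_of_real (g (norm x)))"
    have fm[measurable]: "f \<in> borel_measurable borel" unfolding f_def by measurable
    have fg: "norm (f x) = g (norm x)" for x using g0 by (simp add: f_def)
    have "Lp_norm p (\<lambda>x. ennreal (norm (f x))) = ennreal ((?d * \<omega>) powr (1 / p')) *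
      ennreal_powr (\<integral>\<^sup>+s. ennreal (g s powr p' * s ^ (?d - 1)) * indicator {0<..} s \<partial>lborel) (1 / p')"
      unfolding p'(2) \<omega>_def by (rule Lp_norm_radial[OF fm g g0 fg p'1])
    also have "(\<integral>\<^sup>+s. ennreal (g s powr p' * s ^ (?d - 1)) * indicator {0<..} s \<partial>lborel) = (\<integral>\<^sup>+s. ennreal (1 / s) * indicator {\<delta>..1/2} s \<partial>lborel)"
    proof (rule nn_integral_cong)
      fix s
      show "ennreal (g s powr p' * s ^ (?d - 1)) * indicator {0<..} s = ennreal (1 / s) * indicator {\<delta>..1/2} s"
      proof (cases "s \<in> {\<delta>..1/2}")
        case True
        hence s: "0 < s" using \<delta> by auto
        have "g s powr p' * s ^ (?d - 1) = s powr (- real ?d) * s powr (real ?d - 1)"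
          using True s d by (simp add: g_def powr_powr dp powr_realpow[symmetric] of_nat_diff)
        also have "\<dots> = 1 / s" unfolding powr_add[symmetric] using s by (simp add: powr_minus_divide)
        finally show ?thesis using True s by simp
      qed (use p' in \<open>simp add: g_def\<close>)
    qed
    also have "\<dots> = ennreal l" unfolding l_def using \<delta> by (intro nn_integral_inverse_interval) auto
    finally have norm_f: "Lp_norm p (\<lambda>x. ennreal (norm (f x))) = ennreal ((?d * \<omega>) powr (1 / p') * l powr (1 / p'))"
      using l by (simp add: ennreal_mult')
    have "f \<in> radial_Lp p"
      unfolding radial_Lp_def
    proof (intro CollectI conjI exI[of _ "\<lambda>s. complex_of_real (g s)"] allI)
      show "Lp_norm p (\<lambda>x. ennreal (norm (f x))) < \<infinity>" unfolding norm_f by simp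
    qed (auto simp: f_def)
    from C[OF this] have "Lp_norm q (maximal_fun E f) \<le> ennreal C * ennreal ((?d * \<omega>) powr (1 / p') * l powr (1 / p'))" unfolding norm_f .
    also have "\<dots> \<le> ennreal (max C 1) * ennreal ((?d * \<omega>) powr (1 / p') * l powr (1 / p'))"
      by (intro mult_right_mono ennreal_leI) auto
    also have "\<dots> = ennreal (max C 1 * ((?d * \<omega>) powr (1 / p') * l powr (1 / p')))" by (rule ennreal_mult'[symmetric]) simp
    finally have upper: "Lp_norm q (maximal_fun E f) \<le> \<dots>" .
    have w: "0 < m * (x * N x)" using m x N1 by simp
    have "ennreal (\<kappa> * l * measure lborel S powr ?b) \<le> Lp_norm q (maximal_fun E f)"
    proof (rule Lp_norm_ge[OF q S(1) _ S(3)])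
      show "0 < emeasure lborel S" using S(2) w by (auto simp: m_def intro: less_le_trans[rotated])
      show "0 \<le> \<kappa> * l" using \<kappa> l by simp
      fix y assume y: "y \<in> S"
      hence "infdist (norm y) E \<le> \<delta> / 4" by (simp add: S_def \<delta>_def)
      moreover have "\<delta> \<le> 1/2" using \<delta> by simp
      ultimately obtain t where t: "t \<in> E" "1/2 \<le> norm y" "norm y \<le> 3" "1 \<le> t" "t \<le> 2"
        and k: "\<And>s. \<delta> \<le> s \<Longrightarrow> s \<le> 1/2 \<Longrightarrow> s ^ (?d - 2) / (6 * 10 ^ (?d - 3)) \<le> radial_kernel ?d (norm y) t s"
          "\<And>s. \<delta> \<le> s \<Longrightarrow> s \<le> 1/2 \<Longrightarrow> s \<in> {\<bar>norm y - t\<bar><..<norm y + t}"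
        using near_dilation_kernel[of "norm y" \<delta> ?d] \<delta>(1) d by blast
      have y0: "y \<noteq> 0" using t by auto
      have t0: "0 < t" using t by simp
      have "ennreal (\<kappa> * l) = ennreal (sphere_const ?d) * (ennreal (1 / (6 * 10 ^ (?d - 3))) * (\<integral>\<^sup>+s. ennreal (1 / s) * indicator {\<delta>..1/2} s \<partial>lborel))"
      proof -
        have "(\<integral>\<^sup>+s. ennreal (1 / s) * indicator {\<delta>..1/2} s \<partial>lborel) = ennreal l"
          unfolding l_def using \<delta> by (intro nn_integral_inverse_interval) auto
        moreover have "0 \<le> sphere_const ?d" using sphere_const_pos[of ?d] d by simp
        ultimately show ?thesis using l by (simp add: \<kappa>_def ennreal_mult'[symmetric])
      qed
      also have "ennreal (1 / (6 * 10 ^ (?d - 3))) * (\<integral>\<^sup>+s. ennreal (1 / s) * indicator {\<delta>..1/2} s \<partial>lborel)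
        = (\<integral>\<^sup>+s. ennreal (1 / (6 * 10 ^ (?d - 3))) * (ennreal (1 / s) * indicator {\<delta>..1/2} s) \<partial>lborel)"
        by (rule nn_integral_cmult[symmetric]) measurable
      also have "ennreal (sphere_const ?d) * \<dots> \<le> ennreal (sphere_const ?d) *
        (\<integral>\<^sup>+s. ennreal (g s) * (ennreal (radial_kernel ?d (norm y) t s) * indicator {\<bar>norm y - t\<bar><..<norm y + t} s) \<partial>lborel)"
      proof (intro mult_left_mono nn_integral_mono)
        fix s
        show "ennreal (1 / (6 * 10 ^ (?d - 3))) * (ennreal (1 / s) * indicator {\<delta>..1/2} s) \<le>
          ennreal (g s) * (ennreal (radial_kernel ?d (norm y) t s) * indicator {\<bar>norm y - t\<bar><..<norm y + t} s)"
        proof (cases "s \<in> {\<delta>..1/2}")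
          case True
          hence s: "\<delta> \<le> s" "s \<le> 1/2" "0 < s" using \<delta> by auto
          have "s powr (1 - real ?d) * s ^ (?d - 2) = s powr (1 - real ?d) * s powr (real ?d - 2)"
            using s d by (simp add: powr_realpow[symmetric] of_nat_diff)
          also have "\<dots> = 1 / s" unfolding powr_add[symmetric] using s by (simp add: powr_minus_divide)
          finally have "1 / (6 * 10 ^ (?d - 3)) * (1 / s) = g s * (s ^ (?d - 2) / (6 * 10 ^ (?d - 3)))"
            using True by (simp add: g_def)
          also have "\<dots> \<le> g s * radial_kernel ?d (norm y) t s"
            using k(1)[OF s(1,2)] g0 by (intro mult_left_mono)
          finally have "ennreal (1 / (6 * 10 ^ (?d - 3)) * (1 / s)) \<le> ennreal (g s * radial_kernel ?d (norm y) t s)" by (rule ennreal_leI)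
          thus ?thesis using True k(2)[OF s(1,2)] s g0[of s] by (simp add: ennreal_mult'[symmetric])
        qed simp
      qed simp
      also have "\<dots> = (\<integral>\<^sup>+z. ennreal (g (norm (y + t *\<^sub>R z))) \<partial>sphere_measure)"
        by (rule nn_integral_sphere_radial[OF _ y0 t0 d, symmetric]) measurable
      also have "\<dots> \<le> maximal_fun E f y" unfolding f_def by (rule maximal_fun_ge[OF _ g0 t(1)]) measurable
      finally show "ennreal (\<kappa> * l) \<le> maximal_fun E f y" .
    qed
    also note upper
    finally have "\<kappa> * l * measure lborel S powr ?b \<le> max C 1 * ((?d * \<omega>) powr (1 / p') * l powr (1 / p'))"
      by (subst (asm) ennreal_le_iff) auto
    moreover have "m * (x * N x) \<le> measure lborel S"
      using S(2,3) w by (simp add: emeasure_eq_ennreal_measure m_def)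
    hence "\<kappa> * l * (m * (x * N x)) powr ?b \<le> \<kappa> * l * measure lborel S powr ?b"
      using w \<kappa> l by (intro mult_left_mono powr_mono2) auto
    ultimately have "\<kappa> * l * (m * (x * N x)) powr ?b \<le> max C 1 * ((?d * \<omega>) powr (1 / p') * l powr (1 / p'))" by linarith
    hence le: "\<kappa> * l * (m * (x * N x)) powr ?b \<le> max C 1 * ((?d * \<omega>) powr (1 / p') * l powr (1 / p'))" .
    define A B where "A = l powr (1 / p')" and "B = l powr (1 / ?d)"
    have A: "0 < A" using l by (simp add: A_def)
    \<comment> \<open>At the critical exponent the conjugate of p is d, so dividing l by l^(1/p)
      leaves l^(1/d).\<close>
    have "1 / p' + 1 / ?d = 1" unfolding p'(3) using d by (simp add: field_simps)
    hence lAB: "l = A * B" using l by (simp add: A_def B_def flip: powr_add)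
    have mX: "(m * (x * N x)) powr ?b = m powr ?b * (x * N x) powr ?b" using m x by (simp add: powr_mult)
    have eq: "\<kappa> * l * (m * (x * N x)) powr ?b = A * ((\<kappa> * m powr ?b) * (B * (x * N x) powr ?b))"
      unfolding mX by (subst lAB) (simp add: mult_ac)
    have eqr: "max C 1 * ((?d * \<omega>) powr (1 / p') * A) = A * (max C 1 * (?d * \<omega>) powr (1 / p'))" by simp
    have "A * ((\<kappa> * m powr ?b) * (B * (x * N x) powr ?b)) \<le> A * (max C 1 * (?d * \<omega>) powr (1 / p'))"
      using le unfolding A_def[symmetric] eqr eq .
    hence "(\<kappa> * m powr ?b) * (B * (x * N x) powr ?b) \<le> max C 1 * (?d * \<omega>) powr (1 / p')"
      using A by (subst (asm) mult_le_cancel_left_pos) auto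
    moreover have "0 < \<kappa> * m powr ?b" using \<kappa> m by simp
    moreover have "l = ln (1 / (8 * x))" by (simp add: l_def \<delta>_def)
    ultimately show ?thesis unfolding K_def B_def by (simp add: field_simps)
  qed
  moreover have "0 < K" using \<omega> \<kappa> m by (simp add: K_def)
  ultimately show ?thesis by blast
qed

end

section \<open>The type set\<close>

context dilation_set
begin

definition log_covering_bound :: "real \<Rightarrow> bool" where
  "log_covering_bound Q \<longleftrightarrow> (\<exists>C. \<forall>x::real. 0 < x \<longrightarrow> x < 1 \<longrightarrow> x * ln (1 / x) powr Q * N x \<le> C)"

text \<open>Phrased for x N(x), the size of a neighbourhood of E. In terms of N it says N(x) \<le> C
  x^(\<gamma>-1), a bound of dimension 1 - \<gamma> without loss.\<close>

definition power_covering_bound :: "real \<Rightarrow> bool" where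
  "power_covering_bound \<gamma> \<longleftrightarrow> (\<exists>C. \<forall>x::real. 0 < x \<longrightarrow> x < 1 \<longrightarrow> x * N x \<le> C * x powr \<gamma>)"

lemma power_covering_boundE:
  assumes "power_covering_bound \<gamma>"
  obtains C where "0 < C" "\<And>x::real. 0 < x \<Longrightarrow> x < 1 \<Longrightarrow> x * N x \<le> C * x powr \<gamma>"
proof -
  from assms obtain C where C: "\<And>x::real. 0 < x \<Longrightarrow> x < 1 \<Longrightarrow> x * N x \<le> C * x powr \<gamma>"
    unfolding power_covering_bound_def by blast
  show ?thesis
  proof (rule that[of "max C 1"])
    fix x :: real assume x: "0 < x" "x < 1"
    have "C * x powr \<gamma> \<le> max C 1 * x powr \<gamma>" by (intro mult_right_mono) auto
    thus "x * N x \<le> max C 1 * x powr \<gamma>" using C[OF x] by linarith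
  qed simp
qed

text \<open>E is nonempty, so N \<ge> 1 and x N(x) cannot decay faster than x.\<close>

lemma power_covering_bound_exponent_le_1:
  assumes "power_covering_bound \<gamma>" shows "\<gamma> \<le> 1"
proof -
  obtain C where C: "0 < C" "\<And>x::real. 0 < x \<Longrightarrow> x < 1 \<Longrightarrow> x * N x \<le> C * x powr \<gamma>"
    by (rule power_covering_boundE[OF assms]) blast
  have "R powr \<gamma> \<le> C * R powr 1" if R: "2 \<le> R" for R
  proof -
    define x where "x = 1 / R"
    have x: "0 < x" "x < 1" using R by (auto simp: x_def)
    have "x * 1 \<le> x * N x" using covering_number_pos[OF x(1)] x by (intro mult_left_mono) auto
    also have "\<dots> \<le> C * x powr \<gamma>" by (rule C(2)[OF x])
    finally show ?thesis using R by (simp add: x_def powr_divide field_simps)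
  qed
  with C(1) show ?thesis by (rule powr_le_imp_exponent_le)
qed

text \<open>Here a = 1/p and b = 1/q, so that 1 / b / d is q / d and the last exponent is q (1 - d +
  d/p). If b = 0, the inequalities force a = 0 and the first alternative applies for d > 1; the
  quotients by b then never matter.\<close>

definition admissible :: "nat \<Rightarrow> real \<Rightarrow> real \<Rightarrow> bool" where
  "admissible d a b \<longleftrightarrow> 0 \<le> b \<and> a \<le> 1 \<and> b \<le> a \<and> a \<le> d * b \<and>
    (a < (real d - 1) / d \<or>
     a = (real d - 1) / d \<and> log_covering_bound (1 / b / d) \<or>
     (real d - 1) / d < a \<and> power_covering_bound ((1 - real d + d * a) / b))"

lemma admissible_imp_maximal_bounded:
  assumes d: "3 \<le> DIM('a::euclidean_space)" and ab: "admissible DIM('a) a b"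
  obtains p q where "1 \<le> p" "1 \<le> q" "a = enn2real (inverse p)" "b = enn2real (inverse q)" "maximal_bounded TYPE('a) E p q"
proof (cases "a = 0")
  case True
  hence "b = 0" using ab by (auto simp: admissible_def)
  thus ?thesis using that[of \<infinity> \<infinity>] True maximal_bounded_infinity[OF d] by simp
next
  case False
  let ?d = "DIM('a)"
  have d2: "2 \<le> ?d" using d by simp
  from ab have ab': "0 \<le> b" "a \<le> 1" "b \<le> a" "a \<le> ?d * b" by (auto simp: admissible_def)
  have a0: "0 < a" using ab' False by simp
  have b0: "0 < b" using ab' a0 d by (cases "b = 0") auto
  define p q where "p = 1 / a" and "q = 1 / b"
  have p: "1 \<le> p" and q0: "0 < q" and pq: "p \<le> q" and qp: "q \<le> ?d * p"
    using a0 b0 ab' by (auto simp: p_def q_def field_simps)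
  have q1: "1 \<le> q" using p pq by simp
  have inv: "a = enn2real (inverse (ennreal p))" "b = enn2real (inverse (ennreal q))"
    using a0 b0 by (simp_all add: p_def q_def inverse_ennreal)
  \<comment> \<open>For p = 1 the covering exponent is 1 / b = q, which cannot exceed 1 as N \<ge>
    1. This supplies the restriction under which the near and middle ranges were settled at p =
    1.\<close>
  have p1: "q = 1" if "p = 1"
  proof -
    have "a = 1" using that a0 by (simp add: p_def)
    hence "power_covering_bound (1 / b)" using ab by (auto simp: admissible_def field_simps)
    hence "1 / b \<le> 1" by (rule power_covering_bound_exponent_le_1)
    hence "q \<le> 1" by (simp add: q_def)
    thus ?thesis using q1 by simp
  qed
  have ap: "1 / p = a" by (simp add: p_def)
  have expo: "q * (1 - real ?d + real ?d / p) = (1 - real ?d + ?d * a) / b" by (simp add: p_def q_def)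
  have "hardy_bounded ?d p q \<and> (\<forall>f \<in> (radial_Lp (ennreal p) :: ('a \<Rightarrow> complex) set). maximal_fun E f \<in> borel_measurable lebesgue)"
  proof -
    consider "a < (real ?d - 1) / ?d" | "a = (real ?d - 1) / ?d" "log_covering_bound (1 / b / ?d)"
      | "(real ?d - 1) / ?d < a" "power_covering_bound ((1 - real ?d + ?d * a) / b)"
      using ab unfolding admissible_def by blast
    thus ?thesis
    proof cases
      case 1
      have "a < 1" using 1 by (rule less_le_trans) simp
      hence "1 < p" using a0 by (simp add: p_def)
      thus ?thesis using hardy_bounded_subcritical[of p q ?d] maximal_fun_measurable_subcritical[of _ p] pq d2 d 1 ap by auto
    next
      case 2
      have "a < 1" using 2(1) d by simp
      hence p1: "1 < p" using a0 by (simp add: p_def)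
      obtain C where C: "\<And>x::real. 0 < x \<Longrightarrow> x < 1 \<Longrightarrow> x * ln (1 / x) powr (1 / b / ?d) * N x \<le> C"
        using 2(2) unfolding log_covering_bound_def by blast
      have C': "x * ln (1 / x) powr (q / ?d) * N x \<le> max C 0" if "0 < x" "x < 1" for x :: real
        using C[OF that] by (simp add: q_def)
      note h = hardy_bounded_critical[OF p1 pq d2 _ _ C']
      show ?thesis using h 2(1) ap maximal_fun_measurable_null[OF _ p d] by simp
    next
      case 3
      obtain C where C: "0 < C" "\<And>x::real. 0 < x \<Longrightarrow> x < 1 \<Longrightarrow> x * N x \<le> C * x powr ((1 - real ?d + ?d * a) / b)"
        by (rule power_covering_boundE[OF 3(2)]) blast
      show ?thesis
      proof (cases "p = 1")
        case True
        hence "a = 1" "b = 1" using a0 b0 p1 by (auto simp: p_def q_def)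
        hence "x * N x \<le> C * x" if "0 < x" "x < 1" for x :: real using C(2)[OF that] that by simp
        thus ?thesis using hardy_bounded_1[OF d2, of C] C(1) True p1 maximal_fun_measurable_null[OF _ p d] by simp
      next
        case False
        hence p1: "1 < p" using p by simp
        have C': "x * N x \<le> C * x powr (q * (1 - real ?d + real ?d / p))" if "0 < x" "x < 1" for x :: real
          using C(2)[OF that] unfolding expo .
        note h = hardy_bounded_supercritical[OF p1 pq d2 _ _ C']
        show ?thesis using h 3(1) ap C(1) maximal_fun_measurable_null[OF _ p d] by simp
      qed
    qed
  qed
  hence "maximal_bounded TYPE('a) E (ennreal p) (ennreal q)"
    using maximal_bounded_finite_exponents[OF d p pq qp p1] by blast
  moreover have "1 \<le> ennreal p" "1 \<le> ennreal q" using p q1 by (simp_all add: ennreal_1[symmetric] del: ennreal_1)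
  ultimately show ?thesis using that inv by blast
qed

lemma maximal_bounded_imp_admissible:
  assumes d: "3 \<le> DIM('a::euclidean_space)" and bounded: "maximal_bounded TYPE('a) E p q" and p: "1 \<le> p" and q: "1 \<le> q"
  shows "admissible DIM('a) (enn2real (inverse p)) (enn2real (inverse q))"
proof -
  let ?d = "DIM('a)" and ?a = "enn2real (inverse p)" and ?b = "enn2real (inverse q)"
  have ba: "?b \<le> ?a" by (rule necessary_diagonal[OF bounded p q])
  have ab: "?a \<le> ?d * ?b" by (rule necessary_bottom[OF bounded p q])
  have b0: "0 \<le> ?b" by simp
  have a1: "?a \<le> 1" using p by (cases rule: exponent_cases) auto
  have small: "x * N x \<le> 3" if "0 < x" "x < 1" for x :: real using covering_number_le_inverse[of x] that by simp
  have xN: "0 < x * N x" if "0 < x" for x :: real using covering_number_pos[OF that] that by simp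
  consider "?a < (real ?d - 1) / ?d" | "?a = (real ?d - 1) / ?d" | "(real ?d - 1) / ?d < ?a" by linarith
  thus ?thesis
  proof cases
    case 1
    thus ?thesis using ba ab b0 a1 by (simp add: admissible_def)
  next
    case 2
    have "0 < ?a" unfolding 2 using d by simp
    hence "?b \<noteq> 0" using ab by auto
    hence b: "0 < ?b" using b0 by linarith
    define Q where "Q = 1 / ?b / ?d"
    have Q: "0 < Q" using b d by (simp add: Q_def)
    obtain C where C: "0 < C" "\<And>x::real. 0 < x \<Longrightarrow> x \<le> 1/16 \<Longrightarrow> ln (1 / (8 * x)) powr (1 / ?d) * (x * N x) powr ?b \<le> C"
      using necessary_log[OF bounded p q d 2] by blast
    have "log_covering_bound Q"
      unfolding log_covering_bound_def
    \<comment> \<open>The first summand serves x \<le> 1/64, where ln 8 is at most half of ln (1/x),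
      so that ln (1/x) \<le> 2 ln (1/(8x)). The second serves larger x, where x N(x) \<le> 3 and the
      logarithm is at most ln 64.\<close>
    proof (intro exI[of _ "2 powr Q * C powr (1 / ?b) + 3 * ln 64 powr Q"] allI impI)
      fix x :: real assume x: "0 < x" "x < 1"
      show "x * ln (1 / x) powr Q * N x \<le> 2 powr Q * C powr (1 / ?b) + 3 * ln 64 powr Q"
      proof (cases "x \<le> 1/64")
        case True
        have l8: "0 < ln (1 / (8 * x))" using x True by simp
        have "ln 64 \<le> ln (1 / x)" using x True by (subst ln_le_cancel_iff) (auto simp: field_simps)
        moreover have "ln (64::real) = 2 * ln 8" using ln_mult[of "8::real" 8] by simp
        moreover have "ln (1 / (8 * x)) = ln (1 / x) - ln 8" using x by (simp add: ln_div ln_mult)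
        ultimately have "ln (1 / x) \<le> 2 * ln (1 / (8 * x))" by simp
        moreover have "0 < ln (1 / x)" using x by simp
        ultimately have "ln (1 / x) powr Q \<le> (2 * ln (1 / (8 * x))) powr Q" using Q by (intro powr_mono2) auto
        also have "\<dots> = 2 powr Q * ln (1 / (8 * x)) powr Q" using l8 by (simp add: powr_mult)
        finally have le1: "ln (1 / x) powr Q * (x * N x) \<le> 2 powr Q * ln (1 / (8 * x)) powr Q * (x * N x)"
          using xN[OF x(1)] by (intro mult_right_mono) auto
        have "ln (1 / (8 * x)) powr Q * (x * N x) \<le> C powr (1 / ?b)"
        proof -
          have "(ln (1 / (8 * x)) powr (1 / ?d) * (x * N x) powr ?b) powr (1 / ?b) \<le> C powr (1 / ?b)"
            using C(2)[of x] x True b by (intro powr_mono2) auto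
          moreover have "(ln (1 / (8 * x)) powr (1 / ?d) * (x * N x) powr ?b) powr (1 / ?b) = ln (1 / (8 * x)) powr Q * (x * N x)"
          proof -
            have "1 / ?d * (1 / ?b) = Q" by (simp add: Q_def)
            thus ?thesis using xN[OF x(1)] x l8 b by (simp only: powr_mult powr_powr) simp
          qed
          ultimately show ?thesis by simp
        qed
        hence "2 powr Q * (ln (1 / (8 * x)) powr Q * (x * N x)) \<le> 2 powr Q * C powr (1 / ?b)" by (rule mult_left_mono) simp
        with le1 have "ln (1 / x) powr Q * (x * N x) \<le> 2 powr Q * C powr (1 / ?b)"
          unfolding mult.assoc by (rule order_trans)
        moreover have "0 \<le> 3 * ln (64::real) powr Q" by simp
        moreover have "x * ln (1 / x) powr Q * N x = ln (1 / x) powr Q * (x * N x)" by simp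
        ultimately show ?thesis by linarith
      next
        case False
        have "ln (1 / x) \<le> ln 64" using False x by (subst ln_le_cancel_iff) (auto simp: field_simps)
        hence "ln (1 / x) powr Q \<le> ln 64 powr Q" using Q x by (intro powr_mono2) auto
        hence "(x * N x) * ln (1 / x) powr Q \<le> 3 * ln 64 powr Q"
          using small[OF x] by (intro mult_mono) auto
        moreover have "0 \<le> 2 powr Q * C powr (1 / ?b)" by simp
        moreover have "x * ln (1 / x) powr Q * N x = (x * N x) * ln (1 / x) powr Q" by simp
        ultimately show ?thesis by linarith
      qed
    qed
    thus ?thesis using ba ab b0 a1 2 by (simp add: admissible_def Q_def)
  next
    case 3
    have "0 < ?a" using 3 d by (intro le_less_trans[OF _ 3]) simp
    hence "?b \<noteq> 0" using ab by auto
    hence b: "0 < ?b" using b0 by linarith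
    define \<gamma> where "\<gamma> = (1 - real ?d + ?d * ?a) / ?b"
    have "0 < 1 - real ?d + ?d * ?a" using 3 d by (simp add: field_simps)
    hence \<gamma>: "0 < \<gamma>" using b by (simp add: \<gamma>_def)
    obtain C where C: "0 < C" "\<And>x::real. 0 < x \<Longrightarrow> x \<le> 1/16 \<Longrightarrow> x powr (real ?d - 1) * (x * N x) powr ?b \<le> C * x powr (?d * ?a)"
      using necessary_power[OF bounded p q d] by blast
    have "power_covering_bound \<gamma>"
      unfolding power_covering_bound_def
    \<comment> \<open>The first summand is the test inequality for x \<le> 1/16. For larger x one
      has (16 x)^\<gamma> \<ge> 1, and x N(x) \<le> 3 gives the second.\<close>
    proof (intro exI[of _ "C powr (1 / ?b) + 3 * 16 powr \<gamma>"] allI impI)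
      fix x :: real assume x: "0 < x" "x < 1"
      show "x * N x \<le> (C powr (1 / ?b) + 3 * 16 powr \<gamma>) * x powr \<gamma>"
      proof (cases "x \<le> 1/16")
        case True
        have "(x * N x) powr ?b \<le> C * x powr (1 - real ?d + ?d * ?a)"
        proof -
          have "x powr (1 - real ?d) * (x powr (real ?d - 1) * (x * N x) powr ?b) \<le> x powr (1 - real ?d) * (C * x powr (?d * ?a))"
            using C(2)[OF x(1) True] by (rule mult_left_mono) simp
          moreover have "x powr (1 - real ?d) * (x powr (real ?d - 1) * y) = y" for y
            using x by (simp add: mult.assoc[symmetric] powr_add[symmetric])
          ultimately show ?thesis by (simp add: powr_add mult_ac)
        qed
        hence "((x * N x) powr ?b) powr (1 / ?b) \<le> (C * x powr (1 - real ?d + ?d * ?a)) powr (1 / ?b)"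
          using b by (intro powr_mono2) auto
        moreover have "((x * N x) powr ?b) powr (1 / ?b) = x * N x" using xN[OF x(1)] b by (simp add: powr_powr)
        moreover have "(C * x powr (1 - real ?d + ?d * ?a)) powr (1 / ?b) = C powr (1 / ?b) * x powr \<gamma>"
          using C(1) x by (simp add: powr_mult powr_powr \<gamma>_def)
        ultimately have "x * N x \<le> C powr (1 / ?b) * x powr \<gamma>" by simp
        also have "\<dots> \<le> (C powr (1 / ?b) + 3 * 16 powr \<gamma>) * x powr \<gamma>" by (simp add: distrib_right)
        finally show ?thesis .
      next
        case False
        have "1 \<le> (16 * x) powr \<gamma>" using False \<gamma> by (intro ge_one_powr_ge_zero) auto
        hence "x * N x \<le> 3 * (16 * x) powr \<gamma>" using small[OF x] by linarith
        also have "\<dots> = 3 * 16 powr \<gamma> * x powr \<gamma>" using x by (simp add: powr_mult)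
        also have "\<dots> \<le> (C powr (1 / ?b) + 3 * 16 powr \<gamma>) * x powr \<gamma>" by (simp add: distrib_right)
        finally show ?thesis .
      qed
    qed
    thus ?thesis using ba ab b0 a1 3 by (simp add: admissible_def \<gamma>_def)
  qed
qed

lemma radial_type_set_iff:
  assumes d: "3 \<le> DIM('a::euclidean_space)"
  shows "(a, b) \<in> radial_type_set TYPE('a) E \<longleftrightarrow> admissible DIM('a) a b"
proof
  assume "(a, b) \<in> radial_type_set TYPE('a) E"
  thus "admissible DIM('a) a b" using maximal_bounded_imp_admissible[OF d] by (auto simp: radial_type_set_def)
next
  assume "admissible DIM('a) a b"
  then obtain p q where "1 \<le> p" "1 \<le> q" "a = enn2real (inverse p)" "b = enn2real (inverse q)" "maximal_bounded TYPE('a) E p q"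
    by (rule admissible_imp_maximal_bounded[OF d])
  thus "(a, b) \<in> radial_type_set TYPE('a) E" unfolding radial_type_set_def by blast
qed

section \<open>Covering bounds in terms of the upper Minkowski dimension\<close>

abbreviation \<beta> :: real where "\<beta> \<equiv> upper_minkowski_dim E"

definition dim_quotient :: "real \<Rightarrow> real" where
  "dim_quotient \<delta> = ln (real (N \<delta>)) / ln (1 / \<delta>)"

lemma dim_quotient_nonneg: "0 < \<delta> \<Longrightarrow> \<delta> < 1 \<Longrightarrow> 0 \<le> dim_quotient \<delta>"
  using covering_number_pos[of \<delta>] by (auto simp: dim_quotient_def intro!: divide_nonneg_pos)

lemma dim_quotient_le:
  assumes \<delta>: "0 < \<delta>" "\<delta> < 1" and C: "0 < C" and le: "N \<delta> \<le> C * \<delta> powr (- \<gamma>)"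
  shows "dim_quotient \<delta> \<le> \<gamma> + ln C / ln (1 / \<delta>)"
proof -
  have l: "0 < ln (1 / \<delta>)" using \<delta> by simp
  have "ln (real (N \<delta>)) \<le> ln (C * \<delta> powr (- \<gamma>))"
    using le covering_number_pos[OF \<delta>(1)] C \<delta> by (subst ln_le_cancel_iff) auto
  also have "\<dots> = ln C + \<gamma> * ln (1 / \<delta>)" using C \<delta> by (simp add: ln_mult ln_powr ln_div)
  finally show ?thesis using l by (simp add: dim_quotient_def field_simps)
qed

lemma Limsup_dim_quotient_le:
  assumes C: "0 < C" and le: "\<And>\<delta>. 0 < \<delta> \<Longrightarrow> \<delta> < 1 \<Longrightarrow> N \<delta> \<le> C * \<delta> powr (- \<gamma>)"
  shows "Limsup (at_right 0) (\<lambda>\<delta>. ereal (dim_quotient \<delta>)) \<le> ereal \<gamma>"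
proof -
  have "Limsup (at_right 0) (\<lambda>\<delta>. ereal (dim_quotient \<delta>)) \<le> Limsup (at_right 0) (\<lambda>\<delta>. ereal (\<gamma> + ln C / ln (1 / \<delta>)))"
    by (intro Limsup_mono eventually_at_rightI[of 0 1]) (use dim_quotient_le[OF _ _ C le] in auto)
  also have "\<dots> = ereal \<gamma>"
  proof (rule lim_imp_Limsup)
    have "((\<lambda>\<delta>. \<gamma> + ln C / ln (1 / \<delta>)) \<longlongrightarrow> \<gamma>) (at_right 0)" by real_asymp
    thus "((\<lambda>\<delta>. ereal (\<gamma> + ln C / ln (1 / \<delta>))) \<longlongrightarrow> ereal \<gamma>) (at_right 0)" by simp
  qed simp
  finally show ?thesis .
qed

text \<open>From 1 \<le> N(\<delta>) \<le> 3 / \<delta> the upper limit lies in [0, 1], so the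
  conversion to a real number returns it and not a default value.\<close>

lemma Limsup_dim_quotient:
  "Limsup (at_right 0) (\<lambda>\<delta>. ereal (dim_quotient \<delta>)) = ereal \<beta>" and dim_nonneg: "0 \<le> \<beta>" and dim_le_1: "\<beta> \<le> 1"
proof -
  let ?L = "Limsup (at_right 0) (\<lambda>\<delta>. ereal (dim_quotient \<delta>))"
  have "\<forall>\<^sub>F \<delta> in at_right 0. 0 \<le> ereal (dim_quotient \<delta>)"
    by (rule eventually_at_rightI[of 0 1]) (auto intro: dim_quotient_nonneg)
  hence ge: "0 \<le> ?L" by (intro le_Limsup) auto
  have "N \<delta> \<le> 3 * \<delta> powr (- 1)" if "0 < \<delta>" "\<delta> < 1" for \<delta>
    using covering_number_le_inverse[of \<delta>] that by (simp add: powr_minus_divide field_simps)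
  hence le: "?L \<le> ereal 1" by (intro Limsup_dim_quotient_le[of 3]) auto
  have \<beta>: "\<beta> = real_of_ereal ?L" by (simp add: upper_minkowski_dim_def dim_quotient_def)
  from ge le show "?L = ereal \<beta>" "0 \<le> \<beta>" "\<beta> \<le> 1" unfolding \<beta> by (cases ?L; simp)+
qed

lemma dim_le_if_power_covering_bound:
  assumes "power_covering_bound \<gamma>" shows "\<beta> \<le> 1 - \<gamma>"
proof -
  obtain C where C: "0 < C" "\<And>x::real. 0 < x \<Longrightarrow> x < 1 \<Longrightarrow> x * N x \<le> C * x powr \<gamma>"
    by (rule power_covering_boundE[OF assms]) blast
  have "N x \<le> C * x powr (- (1 - \<gamma>))" if "0 < x" "x < 1" for x :: real
    using C(2)[OF that] that by (simp add: powr_diff powr_minus field_simps)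
  from Limsup_dim_quotient_le[OF C(1) this] show ?thesis by (simp add: Limsup_dim_quotient)
qed

text \<open>With a strict inequality the dimension controls the covering numbers for all small x
  without a constant. The borderline \<gamma> = 1 - \<beta> is not decided by the dimension.\<close>

lemma power_covering_bound_if_dim_less:
  assumes "\<beta> < 1 - \<gamma>" shows "power_covering_bound \<gamma>"
proof -
  have "Limsup (at_right 0) (\<lambda>\<delta>. ereal (dim_quotient \<delta>)) < ereal (1 - \<gamma>)" using assms by (simp add: Limsup_dim_quotient)
  hence "\<forall>\<^sub>F \<delta> in at_right 0. ereal (dim_quotient \<delta>) < ereal (1 - \<gamma>)" by (rule Limsup_lessD)
  then obtain c where c: "0 < c" "\<And>\<delta>. 0 < \<delta> \<Longrightarrow> \<delta> < c \<Longrightarrow> dim_quotient \<delta> < 1 - \<gamma>"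
    by (auto simp: eventually_at_right_field)
  define c' where "c' = min c 1"
  have c': "0 < c'" "c' \<le> c" "c' \<le> 1" using c by (auto simp: c'_def)
  show ?thesis
    unfolding power_covering_bound_def
  \<comment> \<open>The 1 serves x < c'. Otherwise x N(x) \<le> 3, and either (x / c')^\<gamma>
    \<ge> 1 for \<gamma> \<ge> 0, or x^\<gamma> \<ge> 1 for \<gamma> < 0; the maximum merges both
    cases.\<close>
  proof (intro exI[of _ "1 + 3 * (1 / c') powr max 0 \<gamma>"] allI impI)
    fix x :: real assume x: "0 < x" "x < 1"
    have p: "0 < x powr \<gamma>" using x by simp
    show "x * N x \<le> (1 + 3 * (1 / c') powr max 0 \<gamma>) * x powr \<gamma>"
    proof (cases "x < c'")
      case True
      have l: "0 < ln (1 / x)" using x by simp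
      have "dim_quotient x < 1 - \<gamma>" using c(2) x True c' by simp
      hence "ln (real (N x)) \<le> (1 - \<gamma>) * ln (1 / x)" using l by (simp add: dim_quotient_def field_simps)
      also have "\<dots> = ln ((1 / x) powr (1 - \<gamma>))" using x by (simp add: ln_powr)
      finally have "N x \<le> (1 / x) powr (1 - \<gamma>)"
        using covering_number_pos[OF x(1)] x by (subst (asm) ln_le_cancel_iff) auto
      hence "x * N x \<le> x * (1 / x) powr (1 - \<gamma>)" using x by (intro mult_left_mono) auto
      also have "\<dots> = x powr \<gamma>" using x by (simp add: powr_divide powr_diff)
      finally show ?thesis using p by (simp add: distrib_right add_increasing2)
    next
      case False
      have "1 \<le> (1 / c') powr max 0 \<gamma> * x powr \<gamma>"
      proof (cases "0 \<le> \<gamma>")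
        case True
        have "1 \<le> (1 / c' * x) powr \<gamma>" using True False c' by (intro ge_one_powr_ge_zero) (auto simp: field_simps)
        also have "(1 / c' * x) powr \<gamma> = (1 / c') powr \<gamma> * x powr \<gamma>" by (rule powr_mult)
        finally show ?thesis using True by (simp only: max_absorb2)
      next
        case g: False
        have "1 powr \<gamma> \<le> x powr \<gamma>" using g x by (intro powr_mono2') auto
        thus ?thesis using g c' by simp
      qed
      moreover have "x * N x \<le> 3" using covering_number_le_inverse[of x] x by simp
      ultimately have "x * N x \<le> x powr \<gamma> + 3 * ((1 / c') powr max 0 \<gamma> * x powr \<gamma>)" using p by linarith
      thus ?thesis by (simp add: distrib_right)
    qed
  qed
qed

text \<open>Room in the dimension yields a genuine power of x, with \<gamma> half of 1 - \<beta>,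
  and a logarithm loses to any power: ln y \<le> y^e / e with e Q = \<gamma>.\<close>

lemma log_covering_bound_if_dim_less:
  assumes "\<beta> < 1" and Q: "0 < Q" shows "log_covering_bound Q"
proof -
  define \<gamma> where "\<gamma> = (1 - \<beta>) / 2"
  have \<gamma>: "0 < \<gamma>" "\<beta> < 1 - \<gamma>" using assms by (simp_all add: \<gamma>_def field_simps)
  obtain C where C: "0 < C" "\<And>x::real. 0 < x \<Longrightarrow> x < 1 \<Longrightarrow> x * N x \<le> C * x powr \<gamma>"
    by (rule power_covering_boundE[OF power_covering_bound_if_dim_less[OF \<gamma>(2)]]) blast
  define e where "e = \<gamma> / Q"
  have e: "0 < e" using \<gamma> Q by (simp add: e_def)
  show ?thesis unfolding log_covering_bound_def
  proof (intro exI[of _ "C * (1 / e) powr Q"] allI impI)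
    fix x :: real assume x: "0 < x" "x < 1"
    have l: "0 < ln (1 / x)" using x by simp
    have "e * ln (1 / x) = ln ((1 / x) powr e)" using x by (simp add: ln_powr)
    also have "\<dots> \<le> (1 / x) powr e" using x ln_le_minus_one[of "(1 / x) powr e"] by simp
    finally have "ln (1 / x) \<le> 1 / e * (1 / x) powr e" using e by (simp add: field_simps)
    hence "ln (1 / x) powr Q \<le> (1 / e * (1 / x) powr e) powr Q" using l Q by (intro powr_mono2) auto
    also have "\<dots> = (1 / e) powr Q * (1 / x) powr \<gamma>" using Q by (simp only: powr_mult powr_powr) (simp add: e_def)
    finally have "x * N x * ln (1 / x) powr Q \<le> (C * x powr \<gamma>) * ((1 / e) powr Q * (1 / x) powr \<gamma>)"
      using C(2)[OF x] C(1) by (intro mult_mono[of "x * N x"]) auto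
    also have "\<dots> = C * (1 / e) powr Q" using x by (simp add: powr_divide)
    finally show "x * ln (1 / x) powr Q * N x \<le> C * (1 / e) powr Q" by (simp add: mult_ac)
  qed
qed

end

text \<open>The three inequalities are the sides: b \<le> a joins the origin to P2, a \<le> d b
  joins it to P3, and the last one is the side from P2 to P3.\<close>

lemma type_triangle_iff:
  assumes d: "2 \<le> d" and \<beta>: "0 \<le> \<beta>" "\<beta> \<le> 1"
  shows "(a, b) \<in> type_triangle d \<beta> \<longleftrightarrow> b \<le> a \<and> a \<le> d * b \<and> 1 - real d + d * a \<le> (1 - \<beta>) * b"
    and "(a, b) \<in> closed_segment (vertex_P2 d \<beta>) (vertex_P3_rad d \<beta>) \<longleftrightarrow> b \<le> a \<and> a \<le> d * b \<and> 1 - real d + d * a = (1 - \<beta>) * b"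
proof -
  define n where "n = real d"
  have n: "2 \<le> n" using d by (simp add: n_def)
  define A B where "A = (n - 1) / (n - 1 + \<beta>)" and "B = (n - 1) / (n\<^sup>2 - 1 + \<beta>)"
  have nn: "4 \<le> n\<^sup>2" using power_mono[of 2 n 2] n by simp
  have DA: "0 < n - 1 + \<beta>" and DB: "0 < n\<^sup>2 - 1 + \<beta>" using n nn \<beta> by auto
  have AB: "0 < A" "0 < B" using n DA DB by (auto simp: A_def B_def)
  have P2: "vertex_P2 d \<beta> = (A, A)" and P3: "vertex_P3_rad d \<beta> = (n * B, B)"
    by (auto simp: vertex_P2_def vertex_P3_rad_def A_def B_def n_def)
  have lineA: "1 - n + n * A = (1 - \<beta>) * A" using DA by (simp add: A_def field_simps)
  have lineB: "1 - n + n * (n * B) = (1 - \<beta>) * B" using DB by (simp add: B_def field_simps power2_eq_square)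
  have vw: "(n * b - a) / ((n - 1) * A) + (a - b) / ((n - 1) * B) = ((1 - \<beta>) * b * (- 1) + n * a) / (n - 1)"
  proof -
    have "(n * b - a) / ((n - 1) * A) = (n * b - a) * (n - 1 + \<beta>) / (n - 1)\<^sup>2"
      using n DA by (simp add: A_def power2_eq_square)
    moreover have "(a - b) / ((n - 1) * B) = (a - b) * (n\<^sup>2 - 1 + \<beta>) / (n - 1)\<^sup>2"
      using n DB by (simp add: B_def power2_eq_square)
    ultimately have "(n * b - a) / ((n - 1) * A) + (a - b) / ((n - 1) * B)
       = ((n * b - a) * (n - 1 + \<beta>) + (a - b) * (n\<^sup>2 - 1 + \<beta>)) / (n - 1)\<^sup>2"
      by (simp add: add_divide_distrib)
    also have "(n * b - a) * (n - 1 + \<beta>) + (a - b) * (n\<^sup>2 - 1 + \<beta>) = (n - 1) * ((1 - \<beta>) * b * (- 1) + n * a)"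
      by (simp add: power2_eq_square algebra_simps)
    finally show ?thesis using n by (simp add: power2_eq_square)
  qed
  \<comment> \<open>The barycentric coordinates with respect to P2 and P3; the origin receives the
    weight 1 - v - w.\<close>
  define v w where "v = (n * b - a) / ((n - 1) * A)" and "w = (a - b) / ((n - 1) * B)"
  have coords: "v * A + w * (n * B) = a" "v * A + w * B = b"
  proof -
    have "v * A = (n * b - a) / (n - 1)" "w * B = (a - b) / (n - 1)" using AB by (auto simp: v_def w_def)
    hence "v * A + n * (w * B) = ((n - 1) * a) / (n - 1)" "v * A + w * B = ((n - 1) * b) / (n - 1)"
      by (simp_all add: add_divide_distrib[symmetric] algebra_simps)
    thus "v * A + w * (n * B) = a" "v * A + w * B = b" using n by (auto simp: mult_ac)
  qed
  have nn0: "v \<ge> 0 \<and> w \<ge> 0" if "b \<le> a" "a \<le> n * b" using that n AB by (auto simp: v_def w_def)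
  \<comment> \<open>The condition v + w \<le> 1 is the third inequality divided by n - 1, and
    equality of both sides there is v + w = 1.\<close>
  have sum: "v + w = 1 + (1 - n + n * a - (1 - \<beta>) * b) / (n - 1)"
    using vw n by (simp add: v_def w_def field_simps)
  show "(a, b) \<in> type_triangle d \<beta> \<longleftrightarrow> b \<le> a \<and> a \<le> d * b \<and> 1 - real d + d * a \<le> (1 - \<beta>) * b"
    unfolding n_def[symmetric]
  proof
    assume "(a, b) \<in> type_triangle d \<beta>"
    then obtain u v w where uvw: "0 \<le> u" "0 \<le> v" "0 \<le> w" "u + v + w = 1" "a = v * A + w * (n * B)" "b = v * A + w * B"
      unfolding type_triangle_def P2 P3 convex_hull_3 by auto
    have "w * B \<le> w * (n * B)" "v * A \<le> v * (n * A)" using uvw n AB by (auto intro!: mult_left_mono)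
    \<comment> \<open>The defect of the third inequality is affine, vanishes at P2 and P3 and equals
      1 - n < 0 at the origin, so only the weight u remains.\<close>
    moreover have "1 - n + n * a - (1 - \<beta>) * b = u * (1 - n) + v * (1 - n + n * A - (1 - \<beta>) * A) + w * (1 - n + n * (n * B) - (1 - \<beta>) * B)"
    proof -
      have u: "u = 1 - v - w" using uvw by simp
      show ?thesis unfolding uvw(5,6) u by (simp add: algebra_simps)
    qed
    hence "1 - n + n * a - (1 - \<beta>) * b = u * (1 - n)" by (simp add: lineA lineB)
    moreover have "u * (1 - n) \<le> 0" using uvw n by (intro mult_nonneg_nonpos) auto
    ultimately show "b \<le> a \<and> a \<le> n * b \<and> 1 - n + n * a \<le> (1 - \<beta>) * b"
      unfolding uvw(5,6) by (simp add: algebra_simps)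
  next
    assume ab: "b \<le> a \<and> a \<le> n * b \<and> 1 - n + n * a \<le> (1 - \<beta>) * b"
    have "(1 - n + n * a - (1 - \<beta>) * b) / (n - 1) \<le> 0" using ab n by (intro divide_nonpos_pos) auto
    hence "v + w \<le> 1" using sum by simp
    hence "0 \<le> v \<and> 0 \<le> w \<and> 0 \<le> 1 - v - w" using nn0 ab by simp
    thus "(a, b) \<in> type_triangle d \<beta>"
      unfolding type_triangle_def P2 P3 convex_hull_3
      by (intro CollectI exI[of _ "1 - v - w"] exI[of _ v] exI[of _ w]) (use coords in auto)
  qed
  show "(a, b) \<in> closed_segment (vertex_P2 d \<beta>) (vertex_P3_rad d \<beta>) \<longleftrightarrow> b \<le> a \<and> a \<le> d * b \<and> 1 - real d + d * a = (1 - \<beta>) * b"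
    unfolding n_def[symmetric]
  proof
    assume "(a, b) \<in> closed_segment (vertex_P2 d \<beta>) (vertex_P3_rad d \<beta>)"
    then obtain w where w: "0 \<le> w" "w \<le> 1" "a = (1 - w) * A + w * (n * B)" "b = (1 - w) * A + w * B"
      unfolding P2 P3 closed_segment_def by auto
    have "w * B \<le> w * (n * B)" "(1 - w) * A \<le> (1 - w) * (n * A)" using w n AB by (auto intro!: mult_left_mono)
    moreover have "1 - n + n * a - (1 - \<beta>) * b = (1 - w) * (1 - n + n * A - (1 - \<beta>) * A) + w * (1 - n + n * (n * B) - (1 - \<beta>) * B)"
      unfolding w(3,4) by (simp add: algebra_simps)
    hence "1 - n + n * a - (1 - \<beta>) * b = 0" by (simp add: lineA lineB)
    ultimately show "b \<le> a \<and> a \<le> n * b \<and> 1 - n + n * a = (1 - \<beta>) * b"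
      unfolding w(3,4) by (simp add: algebra_simps)
  next
    assume ab: "b \<le> a \<and> a \<le> n * b \<and> 1 - n + n * a = (1 - \<beta>) * b"
    hence v: "v = 1 - w" using sum by simp
    hence "0 \<le> w \<and> w \<le> 1" using nn0 ab by simp
    thus "(a, b) \<in> closed_segment (vertex_P2 d \<beta>) (vertex_P3_rad d \<beta>)"
      unfolding P2 P3 closed_segment_def using coords v by auto
  qed
qed

lemma SUP_ennreal_less_top_iff:
  fixes f :: "real \<Rightarrow> real"
  assumes "\<And>x. x \<in> S \<Longrightarrow> 0 \<le> f x" and S: "S \<noteq> {}"
  shows "(SUP x\<in>S. ennreal (f x)) < \<infinity> \<longleftrightarrow> (\<exists>C. \<forall>x\<in>S. f x \<le> C)"
proof
  assume "(SUP x\<in>S. ennreal (f x)) < \<infinity>"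
  then obtain C where C: "(SUP x\<in>S. ennreal (f x)) = ennreal C" "0 \<le> C"
    by (cases "SUP x\<in>S. ennreal (f x)") auto
  have "f x \<le> C" if "x \<in> S" for x
    using SUP_upper[OF that, of "\<lambda>x. ennreal (f x)"] C by simp
  thus "\<exists>C. \<forall>x\<in>S. f x \<le> C" by blast
next
  assume "\<exists>C. \<forall>x\<in>S. f x \<le> C"
  then obtain C where "\<forall>x\<in>S. f x \<le> C" by blast
  hence "(SUP x\<in>S. ennreal (f x)) \<le> ennreal C" by (intro SUP_least ennreal_leI) auto
  thus "(SUP x\<in>S. ennreal (f x)) < \<infinity>" by (auto intro: le_less_trans)
qed

section \<open>Position in the triangle and membership in the type set\<close>

context dilation_set
begin

lemma SUP_power_covering:
  "(SUP \<delta>\<in>{0<..<1}. ennreal (\<delta> powr \<beta> * real (N \<delta>))) < \<infinity> \<longleftrightarrow> power_covering_bound (1 - \<beta>)"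
proof -
  have "(SUP \<delta>\<in>{0<..<1}. ennreal (\<delta> powr \<beta> * real (N \<delta>))) < \<infinity> \<longleftrightarrow> (\<exists>C. \<forall>\<delta>\<in>{0<..<1}. \<delta> powr \<beta> * real (N \<delta>) \<le> C)"
    by (rule SUP_ennreal_less_top_iff) (auto intro: dense)
  also have "\<dots> \<longleftrightarrow> power_covering_bound (1 - \<beta>)"
  proof -
    have "\<delta> powr \<beta> * real (N \<delta>) \<le> C \<longleftrightarrow> \<delta> * N \<delta> \<le> C * \<delta> powr (1 - \<beta>)" if "0 < \<delta>" for \<delta> C
      using that by (simp add: powr_diff field_simps)
    thus ?thesis unfolding power_covering_bound_def by (intro ex_cong1) auto
  qed
  finally show ?thesis .
qed

lemma SUP_log_covering:
  "(SUP \<delta>\<in>{0<..<1}. ennreal (\<delta> * ln (1 / \<delta>) powr Q * real (N \<delta>))) < \<infinity> \<longleftrightarrow> log_covering_bound Q"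
proof -
  have "(SUP \<delta>\<in>{0<..<1}. ennreal (\<delta> * ln (1 / \<delta>) powr Q * real (N \<delta>))) < \<infinity> \<longleftrightarrow> (\<exists>C. \<forall>\<delta>\<in>{0<..<1}. \<delta> * ln (1 / \<delta>) powr Q * real (N \<delta>) \<le> C)"
    by (rule SUP_ennreal_less_top_iff) (auto intro: dense)
  also have "\<dots> \<longleftrightarrow> log_covering_bound Q"
    unfolding log_covering_bound_def by (intro ex_cong1) auto
  finally show ?thesis .
qed

text \<open>Up to the critical value of a the left side of the last inequality is nonpositive.
  Beyond it, the covering bound limits the dimension, and multiplying by b gives the side of the
  triangle.\<close>

lemma radial_type_set_subset_triangle:
  fixes a b :: real
  assumes d: "3 \<le> DIM('a::euclidean_space)" and ab: "(a, b) \<in> radial_type_set TYPE('a) E"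
  shows "b \<le> a \<and> a \<le> DIM('a) * b \<and> 1 - real DIM('a) + DIM('a) * a \<le> (1 - \<beta>) * b"
proof -
  let ?d = "DIM('a)"
  from ab have adm: "admissible ?d a b" by (simp add: radial_type_set_iff[OF d])
  hence ab': "0 \<le> b" "a \<le> 1" "b \<le> a" "a \<le> ?d * b" by (auto simp: admissible_def)
  have "1 - real ?d + ?d * a \<le> (1 - \<beta>) * b"
  proof (cases "(real ?d - 1) / ?d < a")
    case True
    hence pos: "0 < 1 - real ?d + ?d * a" using d by (simp add: field_simps)
    have "0 \<le> (real ?d - 1) / ?d" using d by simp
    hence "0 < a" using True by (rule le_less_trans)
    hence b: "0 < b" using ab' by (cases "b = 0") auto
    have "power_covering_bound ((1 - real ?d + ?d * a) / b)" using adm True by (auto simp: admissible_def)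
    hence "\<beta> \<le> 1 - (1 - real ?d + ?d * a) / b" by (rule dim_le_if_power_covering_bound)
    thus ?thesis using b by (simp add: field_simps)
  next
    case False
    hence "1 - real ?d + ?d * a \<le> 0" using d by (simp add: field_simps)
    also have "0 \<le> (1 - \<beta>) * b" using dim_le_1 ab' by simp
    finally show ?thesis .
  qed
  thus ?thesis using ab' by simp
qed

lemma in_radial_type_set_iff:
  fixes a b :: real
  assumes d: "3 \<le> DIM('a::euclidean_space)" and ab: "b \<le> a" "a \<le> DIM('a) * b"
    and line: "1 - real DIM('a) + DIM('a) * a \<le> (1 - \<beta>) * b"
  shows "(a, b) \<in> radial_type_set TYPE('a) E \<longleftrightarrow> a < (real DIM('a) - 1) / DIM('a) \<or>
     a = (real DIM('a) - 1) / DIM('a) \<and> log_covering_bound (1 / b / DIM('a)) \<or>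
     (real DIM('a) - 1) / DIM('a) < a \<and> power_covering_bound ((1 - real DIM('a) + DIM('a) * a) / b)"
proof -
  let ?d = "real DIM('a)"
  have d1: "1 < ?d" using d by simp
  have b: "0 \<le> b"
  proof -
    have "b \<le> ?d * b" using ab by simp
    hence "0 \<le> (?d - 1) * b" by (simp add: algebra_simps)
    thus ?thesis using d1 by (simp add: zero_le_mult_iff)
  qed
  have "(1 - \<beta>) * b \<le> 1 * a" using ab b dim_nonneg dim_le_1 by (intro mult_mono) auto
  hence "(?d - 1) * a \<le> (?d - 1) * 1" using line by (simp add: algebra_simps)
  hence "a \<le> 1" using d1 by simp
  thus ?thesis using ab b by (simp add: radial_type_set_iff[OF d] admissible_def)
qed

text \<open>Off the side between P2 and P3 the required covering exponent is strictly below 1 -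
  \<beta>, so the dimension provides the bound; at the critical a strictness forces \<beta> < 1,
  which controls the logarithm.\<close>

lemma strict_in_radial_type_set:
  fixes a b :: real
  assumes d: "3 \<le> DIM('a::euclidean_space)" and ab: "b \<le> a" "a \<le> DIM('a) * b"
    and line: "1 - real DIM('a) + DIM('a) * a < (1 - \<beta>) * b"
  shows "(a, b) \<in> radial_type_set TYPE('a) E"
proof -
  let ?d = "real DIM('a)"
  have d1: "1 < ?d" using d by simp
  have "b \<le> ?d * b" using ab by simp
  hence "0 \<le> (?d - 1) * b" by (simp add: algebra_simps)
  hence b: "0 \<le> b" using d1 by (simp add: zero_le_mult_iff)
  consider "a < (?d - 1) / ?d" | "a = (?d - 1) / ?d" | "(?d - 1) / ?d < a" by linarith
  thus ?thesis
  proof cases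
    case 1
    thus ?thesis using in_radial_type_set_iff[OF d ab] line by simp
  next
    case 2
    hence "1 - ?d + ?d * a = 0" using d1 by simp
    hence "0 < (1 - \<beta>) * b" using line by simp
    hence "0 < b" "\<beta> < 1" using b dim_le_1 by (auto simp: zero_less_mult_iff)
    hence "log_covering_bound (1 / b / ?d)" using d1 by (intro log_covering_bound_if_dim_less) auto
    thus ?thesis using in_radial_type_set_iff[OF d ab] line 2 by simp
  next
    case 3
    have "0 < (?d - 1) / ?d" using d1 by simp
    hence "0 < a" using 3 by (rule less_trans)
    hence b0: "0 < b" using ab b by (cases "b = 0") auto
    have "\<beta> < 1 - (1 - ?d + ?d * a) / b" using line b0 by (simp add: field_simps)
    hence "power_covering_bound ((1 - ?d + ?d * a) / b)" by (rule power_covering_bound_if_dim_less)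
    thus ?thesis using in_radial_type_set_iff[OF d ab] line 3 by simp
  qed
qed

text \<open>On this side the required exponent is 1 - \<beta> at every point, so the segment belongs
  to the type set as a whole or not at all. As \<beta> < 1, it lies entirely beyond the critical
  value of a.\<close>

lemma on_line_in_radial_type_set_iff:
  fixes a b :: real
  assumes d: "3 \<le> DIM('a::euclidean_space)" and ab: "b \<le> a" "a \<le> DIM('a) * b"
    and line: "1 - real DIM('a) + DIM('a) * a = (1 - \<beta>) * b" and \<beta>: "\<beta> < 1"
  shows "(a, b) \<in> radial_type_set TYPE('a) E \<longleftrightarrow> power_covering_bound (1 - \<beta>)"
proof -
  let ?d = "real DIM('a)"
  have d1: "1 < ?d" using d by simp
  have "b \<le> ?d * b" using ab by simp
  hence "0 \<le> (?d - 1) * b" by (simp add: algebra_simps)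
  hence b: "0 \<le> b" using d1 by (simp add: zero_le_mult_iff)
  have "b \<noteq> 0" using ab line d1 by auto
  hence b0: "0 < b" using b by simp
  hence "0 < 1 - ?d + ?d * a" unfolding line using \<beta> by simp
  hence "(?d - 1) / ?d < a" using d1 by (simp add: field_simps)
  moreover have "(1 - ?d + ?d * a) / b = 1 - \<beta>" unfolding line using b0 by simp
  ultimately show ?thesis using in_radial_type_set_iff[OF d ab] line by simp
qed

lemma closure_radial_type_set:
  assumes d: "3 \<le> DIM('a::euclidean_space)"
  shows "closure (radial_type_set TYPE('a) E) = type_triangle DIM('a) \<beta>"
proof
  have d2: "2 \<le> DIM('a)" using d by simp
  note tri = type_triangle_iff(1)[OF d2 dim_nonneg dim_le_1]
  show "closure (radial_type_set TYPE('a) E) \<subseteq> type_triangle DIM('a) \<beta>"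
  proof (rule closure_minimal)
    show "radial_type_set TYPE('a) E \<subseteq> type_triangle DIM('a) \<beta>"
      using radial_type_set_subset_triangle[OF d] tri by auto
    show "closed (type_triangle DIM('a) \<beta>)"
      unfolding type_triangle_def by (intro compact_imp_closed finite_imp_compact_convex_hull) simp
  qed
  show "type_triangle DIM('a) \<beta> \<subseteq> closure (radial_type_set TYPE('a) E)"
  proof
    fix z assume "z \<in> type_triangle DIM('a) \<beta>"
    moreover obtain a b where z: "z = (a, b)" by force
    ultimately have ab: "b \<le> a" "a \<le> DIM('a) * b" "1 - real DIM('a) + DIM('a) * a \<le> (1 - \<beta>) * b"
      using tri by auto
    \<comment> \<open>Shrinking towards the origin keeps the two homogeneous inequalities and makes
      the third strict, since its constant term 1 - d is negative and is not scaled.\<close>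
    have "(l * a, l * b) \<in> radial_type_set TYPE('a) E" if l: "0 < l" "l < 1" for l
    proof (rule strict_in_radial_type_set[OF d])
      show "l * b \<le> l * a" using ab l by simp
      show "l * a \<le> real DIM('a) * (l * b)" using mult_left_mono[OF ab(2), of l] l by (simp add: mult_ac)
      have "l * (1 - real DIM('a) + DIM('a) * a) \<le> l * ((1 - \<beta>) * b)" using ab(3) l by (intro mult_left_mono) auto
      moreover have "1 * (1 - real DIM('a)) < l * (1 - real DIM('a))"
        using l d by (intro mult_strict_right_mono_neg) auto
      ultimately show "1 - real DIM('a) + real DIM('a) * (l * a) < (1 - \<beta>) * (l * b)" by (simp add: algebra_simps)
    qed
    note scaled = this
    have "(real n / (real n + 1) * a, real n / (real n + 1) * b) \<in> radial_type_set TYPE('a) E" if "0 < n" for n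
      using that by (intro scaled) auto
    hence "\<forall>\<^sub>F n in sequentially. (real n / (real n + 1) * a, real n / (real n + 1) * b) \<in> closure (radial_type_set TYPE('a) E)"
      using closure_subset by (intro eventually_mono[OF eventually_gt_at_top[of 0]]) blast
    moreover have "(\<lambda>n. (real n / (real n + 1) * a, real n / (real n + 1) * b)) \<longlonglongrightarrow> (1 * a, 1 * b)"
    proof -
      have "(\<lambda>n. real n / (real n + 1)) \<longlonglongrightarrow> 1" by real_asymp
      thus ?thesis by (intro tendsto_intros)
    qed
    ultimately show "z \<in> closure (radial_type_set TYPE('a) E)"
      unfolding z using closed_closure by (intro Lim_in_closed_set[where F = sequentially]) auto
  qed
qed

end

theorem theorem1p1:
  fixes E :: "real set" and d :: nat and \<beta> :: real
  assumes "d = DIM('a::euclidean_space)" and "3 \<le> d"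
    and "E \<noteq> {}" and "E \<subseteq> {1..2}"
    and "\<beta> = upper_minkowski_dim E"
  shows "closure (radial_type_set TYPE('a) E) = type_triangle d \<beta>
    \<and> (\<beta> < 1 \<and>
         (SUP \<delta>\<in>{0<..<1}. ennreal (\<delta> powr \<beta> * real (covering_number E \<delta>))) < \<infinity> \<longrightarrow>
         radial_type_set TYPE('a) E = type_triangle d \<beta>)
    \<and> (\<beta> < 1 \<and>
         (SUP \<delta>\<in>{0<..<1}. ennreal (\<delta> powr \<beta> * real (covering_number E \<delta>))) = \<infinity> \<longrightarrow>
         radial_type_set TYPE('a) E =
           type_triangle d \<beta> - closed_segment (vertex_P2 d \<beta>) (vertex_P3_rad d \<beta>))
    \<and> (\<beta> = 1 \<longrightarrow>
         radial_type_set TYPE('a) E =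
           {(a, b) \<in> type_triangle d 1.
              a < (real d - 1) / real d \<or>
              (SUP \<delta>\<in>{0<..<1}.
                 ennreal (\<delta> * ln (1 / \<delta>) powr ((1 / b) / real d) * real (covering_number E \<delta>))) < \<infinity>})"
proof -
  interpret dilation_set E by standard (use assms in auto)
  have d: "3 \<le> DIM('a)" and d2: "2 \<le> DIM('a)" and dd: "d = DIM('a)" using assms by auto
  note tri = type_triangle_iff[OF d2 dim_nonneg dim_le_1]
  let ?T = "radial_type_set TYPE('a) E"
  \<comment> \<open>One description covers both cases with \<beta> < 1: only points of the segment
    depend on the covering hypothesis.\<close>
  have T_iff: "(a, b) \<in> ?T \<longleftrightarrow> (a, b) \<in> type_triangle d \<beta> \<and>
     ((a, b) \<in> closed_segment (vertex_P2 d \<beta>) (vertex_P3_rad d \<beta>) \<longrightarrow> power_covering_bound (1 - \<beta>))"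
    if "\<beta> < 1" for a b
  proof (cases "(a, b) \<in> type_triangle d \<beta>")
    case True
    hence ab: "b \<le> a" "a \<le> DIM('a) * b" "1 - real DIM('a) + DIM('a) * a \<le> (1 - \<beta>) * b"
      using tri(1) assms by auto
    show ?thesis
    proof (cases "1 - real DIM('a) + DIM('a) * a = (1 - \<beta>) * b")
      case eq: True
      thus ?thesis using on_line_in_radial_type_set_iff[OF d ab(1,2)] that True ab tri(2) assms by auto
    next
      case False
      thus ?thesis using strict_in_radial_type_set[OF d ab(1,2)] True ab tri(2) assms by auto
    qed
  next
    case False
    thus ?thesis using radial_type_set_subset_triangle[OF d, of a b] tri(1) assms by auto
  qed
  have SUP_iff: "(SUP \<delta>\<in>{0<..<1}. ennreal (\<delta> powr \<beta> * real (N \<delta>))) < \<infinity> \<longleftrightarrow> power_covering_bound (1 - \<beta>)"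
    using SUP_power_covering assms by simp
  show ?thesis
  proof (intro conjI impI; (elim conjE)?)
    show "closure ?T = type_triangle d \<beta>" using closure_radial_type_set[OF d] assms by simp
  next
    assume \<beta>: "\<beta> < 1" and "(SUP \<delta>\<in>{0<..<1}. ennreal (\<delta> powr \<beta> * real (N \<delta>))) < \<infinity>"
    thus "?T = type_triangle d \<beta>" using T_iff[OF \<beta>] SUP_iff by auto
  next
    assume \<beta>: "\<beta> < 1" and "(SUP \<delta>\<in>{0<..<1}. ennreal (\<delta> powr \<beta> * real (N \<delta>))) = \<infinity>"
    hence "\<not> power_covering_bound (1 - \<beta>)" using SUP_iff by (metis less_irrefl)
    thus "?T = type_triangle d \<beta> - closed_segment (vertex_P2 d \<beta>) (vertex_P3_rad d \<beta>)"
      using T_iff[OF \<beta>] by auto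
  next
    assume \<beta>: "\<beta> = 1"
    have "(a, b) \<in> ?T \<longleftrightarrow> (a, b) \<in> type_triangle d 1 \<and>
      (a < (real d - 1) / real d \<or> log_covering_bound ((1 / b) / real d))" for a b
    proof (cases "(a, b) \<in> type_triangle d 1")
      case True
      hence ab: "b \<le> a" "a \<le> DIM('a) * b" "1 - real DIM('a) + DIM('a) * a \<le> (1 - \<beta>) * b"
        using tri(1) assms \<beta> by auto
      \<comment> \<open>For \<beta> = 1 the third side is the vertical line at the critical a, so
        the supercritical alternative does not occur and only the logarithmic condition is left on
        that side.\<close>
      have "\<not> (real d - 1) / real d < a" using ab(3) \<beta> d by (simp add: dd field_simps)
      thus ?thesis using in_radial_type_set_iff[OF d ab(1,2)] ab(3) assms True by auto
    next
      case False
      thus ?thesis using radial_type_set_subset_triangle[OF d, of a b] tri(1) assms \<beta> by auto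
    qed
    thus "?T = {(a, b) \<in> type_triangle d 1. a < (real d - 1) / real d \<or>
      (SUP \<delta>\<in>{0<..<1}. ennreal (\<delta> * ln (1 / \<delta>) powr ((1 / b) / real d) * real (N \<delta>))) < \<infinity>}"
      unfolding SUP_log_covering by auto
  qed
qed

end
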